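(* For every saturated algebraically closed field $K$ of characteristic $0$ there exist a function $E:K\to K^\times$ and a field automorphism $\sigma$ of $K$ of order two with $\sigma\circ E=E\circ\sigma$, such that $K_E$ satisfies (E), (LOG), (STD), (SP) and (CCP), and $E$ is continuous with respect to the topology induced by $\sigma$.
   Context: The topology induced by $\sigma$: $R=K^\sigma$ is a real closed field with its order topology; choosing $i\in K$ with $i^2=-1$, $K=R\oplus iR$ is identified with $R^2$ and given the product topology, $K^\times$ the subspace topology. Notation: $\mathbb{G}=\mathbb{G}_a\times\mathbb{G}_m$; $\langle\bar z;\bar w\rangle=((z_1,w_1),\dots,(z_n,w_n))$; integer matrices $M=(m_{ij})$ act by $M\cdot\langle\bar z;\bar w\rangle=\langle(\sum_jm_{ij}z_j)_i;(\prod_jw_j^{m_{ij}})_i\rangle$, $M\cdot V$ being the Zariski closure of the image. An irreducible $V\subseteq\mathbb{G}^n$ is rotund if $\dim M\cdot V\geq\mathrm{rank}\,M$ for all $M\in\mathcal{M}_{n,n}(\mathbb{Z})$; absolutely free if for every nonzero $M\in\mathcal{M}_{1,n}(\mathbb{Z})$ both projections of $M\cdot V$ to $\mathbb{G}_a,\mathbb{G}_m$ have dimension $1$; depth $=\dim V-n$. $V$ is $E$-defined over finite $\bar c$ if defined over the field generated by $\bar c\cup E(\bar c)$; a generic solution over $\bar c$ is $\bar z$ with $\langle\bar z;E(\bar z)\rangle\in V$ of transcendence degree $\dim V$ over $\mathbb{Q}(\bar cE(\bar c))$. Axioms: (E) $E:(K,+)\to(K^\times,\cdot)$ is a homomorphism;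 (LOG) $E$ is surjective; (STD) $\ker E=\omega\mathbb{Z}$ for some $\omega\in K^\times$; (SP) for $\mathbb{Q}$-linearly independent $z_1,\dots,z_n$, $\mathrm{tr.deg.}_\mathbb{Q}(z_1,\dots,z_n,E(z_1),\dots,E(z_n))\geq n$; (CCP) every absolutely free rotund $V\subseteq\mathbb{G}^n$ of depth $0$ $E$-defined over a finite $\bar c$ has at most countably many generic solutions over $\bar c$. *)

theory Defs
  imports "HOL-Analysis.Analysis" "HOL-Computational_Algebra.Polynomial" "HOL-Library.Countable_Set"
begin

definition alg_closed_field :: "'a::field itself \<Rightarrow> bool" where
  "alg_closed_field _ \<longleftrightarrow> (\<forall>p::'a poly. degree p > 0 \<longrightarrow> (\<exists>x. poly p x = 0))"

datatype 'a rterm = RVar nat | RParam 'a | RZero | ROne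
  | RAdd "'a rterm" "'a rterm" | RNeg "'a rterm" | RMul "'a rterm" "'a rterm"

datatype 'a rfml = REq "'a rterm" "'a rterm" | RNot "'a rfml" | RAnd "'a rfml" "'a rfml"
  | REx nat "'a rfml"

primrec teval :: "(nat \<Rightarrow> 'a::comm_ring_1) \<Rightarrow> 'a rterm \<Rightarrow> 'a" where
  "teval \<rho> (RVar n) = \<rho> n"
| "teval \<rho> (RParam a) = a"
| "teval \<rho> RZero = 0"
| "teval \<rho> ROne = 1"
| "teval \<rho> (RAdd s t) = teval \<rho> s + teval \<rho> t"
| "teval \<rho> (RNeg s) = - teval \<rho> s"
| "teval \<rho> (RMul s t) = teval \<rho> s * teval \<rho> t"

primrec fsat :: "(nat \<Rightarrow> 'a::comm_ring_1) \<Rightarrow> 'a rfml \<Rightarrow> bool" where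
  "fsat \<rho> (REq s t) \<longleftrightarrow> teval \<rho> s = teval \<rho> t"
| "fsat \<rho> (RNot \<phi>) \<longleftrightarrow> \<not> fsat \<rho> \<phi>"
| "fsat \<rho> (RAnd \<phi> \<psi>) \<longleftrightarrow> fsat \<rho> \<phi> \<and> fsat \<rho> \<psi>"
| "fsat \<rho> (REx n \<phi>) \<longleftrightarrow> (\<exists>x. fsat (\<rho>(n := x)) \<phi>)"

primrec tvars :: "'a rterm \<Rightarrow> nat set" where
  "tvars (RVar n) = {n}" | "tvars (RParam a) = {}" | "tvars RZero = {}" | "tvars ROne = {}"
| "tvars (RAdd s t) = tvars s \<union> tvars t" | "tvars (RNeg s) = tvars s"
| "tvars (RMul s t) = tvars s \<union> tvars t"

primrec tparams :: "'a rterm \<Rightarrow> 'a set" where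
  "tparams (RVar n) = {}" | "tparams (RParam a) = {a}" | "tparams RZero = {}" | "tparams ROne = {}"
| "tparams (RAdd s t) = tparams s \<union> tparams t" | "tparams (RNeg s) = tparams s"
| "tparams (RMul s t) = tparams s \<union> tparams t"

primrec ffree :: "'a rfml \<Rightarrow> nat set" where
  "ffree (REq s t) = tvars s \<union> tvars t" | "ffree (RNot \<phi>) = ffree \<phi>"
| "ffree (RAnd \<phi> \<psi>) = ffree \<phi> \<union> ffree \<psi>" | "ffree (REx n \<phi>) = ffree \<phi> - {n}"

primrec fparams :: "'a rfml \<Rightarrow> 'a set" where
  "fparams (REq s t) = tparams s \<union> tparams t" | "fparams (RNot \<phi>) = fparams \<phi>"
| "fparams (RAnd \<phi> \<psi>) = fparams \<phi> \<union> fparams \<psi>" | "fparams (REx n \<phi>) = fparams \<phi>"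

definition saturated :: "'a::comm_ring_1 itself \<Rightarrow> bool" where
  "saturated _ \<longleftrightarrow> (\<forall>(A::'a set) (\<Phi>::'a rfml set).
     (card_of A, card_of (UNIV::'a set)) \<in> ordLess \<longrightarrow>
     (\<forall>\<phi>\<in>\<Phi>. ffree \<phi> \<subseteq> {0} \<and> fparams \<phi> \<subseteq> A) \<longrightarrow>
     (\<forall>\<Phi>0. finite \<Phi>0 \<and> \<Phi>0 \<subseteq> \<Phi> \<longrightarrow> (\<exists>x. \<forall>\<phi>\<in>\<Phi>0. fsat (\<lambda>_. x) \<phi>)) \<longrightarrow>
     (\<exists>x. \<forall>\<phi>\<in>\<Phi>. fsat (\<lambda>_. x) \<phi>))"

definition is_subfield :: "'a::field set \<Rightarrow> bool" where
  "is_subfield S \<longleftrightarrow> 0 \<in> S \<and> 1 \<in> S \<and> (\<forall>x\<in>S. \<forall>y\<in>S. x + y \<in> S \<and> x - y \<in> S \<and> x * y \<in> S)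
     \<and> (\<forall>x\<in>S. inverse x \<in> S)"

definition gen_field :: "'a::field set \<Rightarrow> 'a set" where
  "gen_field A = \<Inter>{S. is_subfield S \<and> A \<subseteq> S}"

text \<open>A polynomial in the variables X_0,...,X_(m-1) with coefficients in F, represented
  by its coefficient function on exponent vectors.\<close>
definition is_mpoly :: "'a::field set \<Rightarrow> nat \<Rightarrow> ((nat \<Rightarrow> nat) \<Rightarrow> 'a) \<Rightarrow> bool" where
  "is_mpoly F m c \<longleftrightarrow> finite {\<alpha>. c \<alpha> \<noteq> 0} \<and> (\<forall>\<alpha>. c \<alpha> \<in> F)
     \<and> (\<forall>\<alpha>. c \<alpha> \<noteq> 0 \<longrightarrow> (\<forall>i\<ge>m. \<alpha> i = 0))"

definition mpeval :: "nat \<Rightarrow> ((nat \<Rightarrow> nat) \<Rightarrow> 'a::field) \<Rightarrow> (nat \<Rightarrow> 'a) \<Rightarrow> 'a" where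
  "mpeval m c p = (\<Sum>\<alpha>\<in>{\<alpha>. c \<alpha> \<noteq> 0}. c \<alpha> * (\<Prod>i<m. p i ^ \<alpha> i))"

definition alg_indep :: "'a::field set \<Rightarrow> 'a list \<Rightarrow> bool" where
  "alg_indep F bs \<longleftrightarrow> (\<forall>c. is_mpoly F (length bs) c \<and> mpeval (length bs) c (\<lambda>i. bs ! i) = 0
      \<longrightarrow> (\<forall>\<alpha>. c \<alpha> = 0))"

definition trdeg :: "'a::field set \<Rightarrow> 'a list \<Rightarrow> nat" where
  "trdeg F xs = Max {n. \<exists>bs. set bs \<subseteq> set xs \<and> length bs = n \<and> alg_indep F bs}"

section \<open>Zariski geometry on G^n = G_a^n x G_m^n\<close>

text \<open>Points of affine m-space are functions nat => K vanishing from m on.\<close>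
definition aff :: "nat \<Rightarrow> (nat \<Rightarrow> 'a::field) set" where
  "aff m = {p. \<forall>j\<ge>m. p j = 0}"

definition zset :: "nat \<Rightarrow> ((nat \<Rightarrow> nat) \<Rightarrow> 'a::field) set \<Rightarrow> (nat \<Rightarrow> 'a) set" where
  "zset m S = {p \<in> aff m. \<forall>c\<in>S. mpeval m c p = 0}"

text \<open>G^n inside affine 2n-space: coordinates 0..n-1 are z, n..2n-1 are w (nonzero).\<close>
definition Gn :: "nat \<Rightarrow> (nat \<Rightarrow> 'a::field) set" where
  "Gn n = {p \<in> aff (2*n). \<forall>i<n. p (n + i) \<noteq> 0}"

definition zclosed_over :: "'a::field set \<Rightarrow> nat \<Rightarrow> (nat \<Rightarrow> 'a) set \<Rightarrow> (nat \<Rightarrow> 'a) set \<Rightarrow> bool" where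
  "zclosed_over F m U X \<longleftrightarrow> (\<exists>S. (\<forall>c\<in>S. is_mpoly F m c) \<and> X = U \<inter> zset m S)"

abbreviation zclosed :: "nat \<Rightarrow> (nat \<Rightarrow> 'a::field) set \<Rightarrow> (nat \<Rightarrow> 'a) set \<Rightarrow> bool" where
  "zclosed \<equiv> zclosed_over UNIV"

definition zcl :: "nat \<Rightarrow> (nat \<Rightarrow> 'a::field) set \<Rightarrow> (nat \<Rightarrow> 'a) set \<Rightarrow> (nat \<Rightarrow> 'a) set" where
  "zcl m U X = \<Inter>{Y. zclosed m U Y \<and> X \<subseteq> Y}"

definition zirred :: "nat \<Rightarrow> (nat \<Rightarrow> 'a::field) set \<Rightarrow> (nat \<Rightarrow> 'a) set \<Rightarrow> bool" where
  "zirred m U X \<longleftrightarrow> zclosed m U X \<and> X \<noteq> {} \<and>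
     (\<forall>Y1 Y2. zclosed m U Y1 \<and> zclosed m U Y2 \<and> X = Y1 \<union> Y2 \<longrightarrow> X = Y1 \<or> X = Y2)"

definition zdim :: "nat \<Rightarrow> (nat \<Rightarrow> 'a::field) set \<Rightarrow> (nat \<Rightarrow> 'a) set \<Rightarrow> nat" where
  "zdim m U X = Sup {k. \<exists>Y. (\<forall>j\<le>k. zirred m U (Y j)) \<and> (\<forall>j<k. Y j \<subset> Y (Suc j)) \<and> Y k \<subseteq> X}"

definition mact :: "nat \<Rightarrow> nat \<Rightarrow> (nat \<Rightarrow> nat \<Rightarrow> int) \<Rightarrow> (nat \<Rightarrow> 'a::field) \<Rightarrow> (nat \<Rightarrow> 'a)" where
  "mact k n M p = (\<lambda>i. if i < k then (\<Sum>j<n. of_int (M i j) * p j)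
      else if i < 2*k then (\<Prod>j<n. p (n + j) powi M (i - k) j) else 0)"

definition mimg :: "nat \<Rightarrow> nat \<Rightarrow> (nat \<Rightarrow> nat \<Rightarrow> int) \<Rightarrow> (nat \<Rightarrow> 'a::field) set \<Rightarrow> (nat \<Rightarrow> 'a) set" where
  "mimg k n M V = zcl (2*k) (Gn k) (mact k n M ` V)"

definition qrank :: "nat \<Rightarrow> nat \<Rightarrow> (nat \<Rightarrow> nat \<Rightarrow> int) \<Rightarrow> nat" where
  "qrank k n M = Max {r. \<exists>rows::nat list. length rows = r \<and> set rows \<subseteq> {..<k} \<and>
      (\<forall>q::nat \<Rightarrow> rat. (\<forall>j<n. (\<Sum>l<r. q l * of_int (M (rows ! l) j)) = 0) \<longrightarrow> (\<forall>l<r. q l = 0))}"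

definition irred_subvar :: "nat \<Rightarrow> (nat \<Rightarrow> 'a::field) set \<Rightarrow> bool" where
  "irred_subvar n V \<longleftrightarrow> zirred (2*n) (Gn n) V"

definition rotund :: "nat \<Rightarrow> (nat \<Rightarrow> 'a::field) set \<Rightarrow> bool" where
  "rotund n V \<longleftrightarrow> (\<forall>M. zdim (2*n) (Gn n) (mimg n n M V) \<ge> qrank n n M)"

definition proj_a :: "(nat \<Rightarrow> 'a::field) \<Rightarrow> (nat \<Rightarrow> 'a)" where
  "proj_a q = (\<lambda>j. if j = 0 then q 0 else 0)"

definition proj_m :: "(nat \<Rightarrow> 'a::field) \<Rightarrow> (nat \<Rightarrow> 'a)" where
  "proj_m q = (\<lambda>j. if j = 0 then q 1 else 0)"

definition Ga1 :: "(nat \<Rightarrow> 'a::field) set" where "Ga1 = aff 1"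
definition Gm1 :: "(nat \<Rightarrow> 'a::field) set" where "Gm1 = {p \<in> aff 1. p 0 \<noteq> 0}"

definition abs_free :: "nat \<Rightarrow> (nat \<Rightarrow> 'a::field) set \<Rightarrow> bool" where
  "abs_free n V \<longleftrightarrow> (\<forall>M. (\<exists>j<n. M 0 j \<noteq> 0) \<longrightarrow>
     zdim 1 Ga1 (zcl 1 Ga1 (proj_a ` mimg 1 n M V)) = 1 \<and>
     zdim 1 Gm1 (zcl 1 Gm1 (proj_m ` mimg 1 n M V)) = 1)"

definition depth0 :: "nat \<Rightarrow> (nat \<Rightarrow> 'a::field) set \<Rightarrow> bool" where
  "depth0 n V \<longleftrightarrow> zdim (2*n) (Gn n) V = n"

definition param_field :: "('a::field \<Rightarrow> 'a) \<Rightarrow> 'a list \<Rightarrow> 'a set" where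
  "param_field E cs = gen_field (set cs \<union> E ` set cs)"

definition E_defined :: "('a::field \<Rightarrow> 'a) \<Rightarrow> nat \<Rightarrow> (nat \<Rightarrow> 'a) set \<Rightarrow> 'a list \<Rightarrow> bool" where
  "E_defined E n V cs \<longleftrightarrow> zclosed_over (param_field E cs) (2*n) (Gn n) V"

definition graph_pt :: "('a::field \<Rightarrow> 'a) \<Rightarrow> nat \<Rightarrow> (nat \<Rightarrow> 'a) \<Rightarrow> (nat \<Rightarrow> 'a)" where
  "graph_pt E n z = (\<lambda>j. if j < n then z j else if j < 2*n then E (z (j - n)) else 0)"

definition generic_solutions :: "('a::field \<Rightarrow> 'a) \<Rightarrow> nat \<Rightarrow> (nat \<Rightarrow> 'a) set \<Rightarrow> 'a list \<Rightarrow> (nat \<Rightarrow> 'a) set" where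
  "generic_solutions E n V cs = {z \<in> aff n. graph_pt E n z \<in> V \<and>
     trdeg (param_field E cs) (map z [0..<n] @ map (E \<circ> z) [0..<n]) = zdim (2*n) (Gn n) V}"

definition ax_E :: "('a::field \<Rightarrow> 'a) \<Rightarrow> bool" where
  "ax_E E \<longleftrightarrow> (\<forall>x. E x \<noteq> 0) \<and> (\<forall>x y. E (x + y) = E x * E y)"

definition ax_LOG :: "('a::field \<Rightarrow> 'a) \<Rightarrow> bool" where
  "ax_LOG E \<longleftrightarrow> (\<forall>w. w \<noteq> 0 \<longrightarrow> (\<exists>z. E z = w))"

definition ax_STD :: "('a::field \<Rightarrow> 'a) \<Rightarrow> bool" where
  "ax_STD E \<longleftrightarrow> (\<exists>\<omega>. \<omega> \<noteq> 0 \<and> {z. E z = 1} = range (\<lambda>k::int. \<omega> * of_int k))"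

definition ax_SP :: "('a::field_char_0 \<Rightarrow> 'a) \<Rightarrow> bool" where
  "ax_SP E \<longleftrightarrow> (\<forall>zs::'a list.
     (\<forall>q::nat \<Rightarrow> rat. (\<Sum>i<length zs. of_rat (q i) * zs ! i) = 0 \<longrightarrow> (\<forall>i<length zs. q i = 0))
     \<longrightarrow> trdeg \<rat> (zs @ map E zs) \<ge> length zs)"

definition ax_CCP :: "('a::field \<Rightarrow> 'a) \<Rightarrow> bool" where
  "ax_CCP E \<longleftrightarrow> (\<forall>n V cs. irred_subvar n V \<and> abs_free n V \<and> rotund n V \<and> depth0 n V
     \<and> E_defined E n V cs \<longrightarrow> countable (generic_solutions E n V cs))"

definition field_aut :: "('a::field \<Rightarrow> 'a) \<Rightarrow> bool" where
  "field_aut \<sigma> \<longleftrightarrow> bij \<sigma> \<and> (\<forall>x y. \<sigma> (x + y) = \<sigma> x + \<sigma> y) \<and> (\<forall>x y. \<sigma> (x * y) = \<sigma> x * \<sigma> y)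
     \<and> \<sigma> 1 = 1"

definition fixed_field :: "('a::field \<Rightarrow> 'a) \<Rightarrow> 'a set" where
  "fixed_field \<sigma> = {x. \<sigma> x = x}"

text \<open>The ordering of the real closed field R = K^sigma: the positive elements are the
  nonzero squares.\<close>
definition rc_less :: "('a::field \<Rightarrow> 'a) \<Rightarrow> 'a \<Rightarrow> 'a \<Rightarrow> bool" where
  "rc_less \<sigma> x y \<longleftrightarrow> x \<noteq> y \<and> (\<exists>r\<in>fixed_field \<sigma>. y - x = r * r)"

definition imag_unit :: "'a::field" where
  "imag_unit = (SOME i. i * i = -1)"

text \<open>Open boxes (a1,a2) + i (b1,b2) with endpoints in R: a basis of the product
  topology on K = R + iR, identified with R^2.\<close>
definition sigma_boxes :: "('a::field \<Rightarrow> 'a) \<Rightarrow> 'a set set" where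
  "sigma_boxes \<sigma> = {{a + imag_unit * b | a b. a \<in> fixed_field \<sigma> \<and> b \<in> fixed_field \<sigma> \<and>
        rc_less \<sigma> a1 a \<and> rc_less \<sigma> a a2 \<and> rc_less \<sigma> b1 b \<and> rc_less \<sigma> b b2}
      | a1 a2 b1 b2. a1 \<in> fixed_field \<sigma> \<and> a2 \<in> fixed_field \<sigma> \<and> b1 \<in> fixed_field \<sigma> \<and> b2 \<in> fixed_field \<sigma>}"

definition sigma_topology :: "('a::field \<Rightarrow> 'a) \<Rightarrow> 'a topology" where
  "sigma_topology \<sigma> = topology_generated_by (sigma_boxes \<sigma>)"

end

theory Submission
  imports Defs "HOL-Analysis.Analysis" "HOL-Computational_Algebra.Fundamental_Theorem_Algebra"
begin

text \<open>Saturation provides a transcendence basis \<open>\<xi>\<close> of \<open>K\<close> of full cardinality. Send \<open>\<xi> i\<close> to a positive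
  infinitesimal of an ultrapower of the complex numbers that lies below all positive elements of the earlier levels;
  this embeds \<open>K\<close> so that complex conjugation induces the automorphism \<open>\<sigma>\<close>, with real part \<open>R\<close>.
  The exponential is the one of the ultrapower, composed with a linear map that carries a rational basis of \<open>R\<close>
  bijectively to rational bases of the logarithms of moduli and of the arguments of \<open>K\<close>. A Cantor-Bernstein
  argument chooses these bijections such that every basis element \<open>c\<close> either lies at an earlier level than
  the infinitesimal \<open>\<gamma>\<close> with \<open>E c = 1 + \<gamma>\<close> (respectively \<open>E c = (1 + \<i> \<gamma>) / (1 - \<i> \<gamma>)\<close>), or is the inverse
  (respectively \<open>\<i>\<close> times the inverse) of an infinitesimal of a level later than \<open>E c\<close>. So one of \<open>c\<close>, \<open>E c\<close> is always
  a new transcendental, which yields (SP) and (CCP). The basis of \<open>R\<close> is adapted to the convex subgroups of the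
  levels; as \<open>E\<close> maps small basis elements to \<open>1\<close> plus something even smaller, it is continuous at \<open>0\<close>.\<close>

section \<open>Algebraic dependence in a field\<close>

text \<open>The exponential of the ultrapower need not map the image of \<open>K\<close> to itself,
  and its kernel consists of all hyperinteger multiples of one element. Both defects vanish when it
  is preceded by rational-linear bijections from \<open>R\<close> onto exactly those real
  logarithms, respectively those finite arguments, whose exponentials lie in the image; surjectivity
  comes along. Such a bijection may be prescribed freely on a basis, which leaves room for freeness,
  but continuity demands that small elements get small logarithms. Only large basis elements may
  therefore take logarithms whose size is not controlled, and this is why inverses of infinitesimals
  are put into the basis of \<open>R\<close>. The full cardinality of the transcendence basis serves
  to give every element private levels above its own. For (CCP) one more transcendental is needed
  than (SP) counts: over a countable subfield closed under exponentials and logarithms, both members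
  of the pair at the lowest new level are new. Generic points exist over countable fields of
  definition as long as \<open>K\<close> is uncountable, and for countable \<open>K\<close> nothing
  has to be shown.\<close>

definition is_subring :: "'a::comm_ring_1 set \<Rightarrow> bool" where
  "is_subring S \<longleftrightarrow> 0 \<in> S \<and> 1 \<in> S \<and> (\<forall>x\<in>S. \<forall>y\<in>S. x + y \<in> S \<and> x - y \<in> S \<and> x * y \<in> S)"

lemma subfield_subring: "is_subfield S \<Longrightarrow> is_subring S"
  by (auto simp: is_subfield_def is_subring_def)

lemma
  assumes "is_subring S"
  shows subring_0: "0 \<in> S" and subring_1: "1 \<in> S"
    and subring_add: "x \<in> S \<Longrightarrow> y \<in> S \<Longrightarrow> x + y \<in> S"
    and subring_diff: "x \<in> S \<Longrightarrow> y \<in> S \<Longrightarrow> x - y \<in> S"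
    and subring_mult: "x \<in> S \<Longrightarrow> y \<in> S \<Longrightarrow> x * y \<in> S"
  using assms by (auto simp: is_subring_def)

lemma subring_uminus: "is_subring S \<Longrightarrow> x \<in> S \<Longrightarrow> - x \<in> S"
  using subring_diff[of S 0 x] subring_0 by auto

lemma subring_power: "is_subring S \<Longrightarrow> x \<in> S \<Longrightarrow> x ^ n \<in> S"
  by (induction n) (auto intro: subring_1 subring_mult)

lemma subring_sum: "is_subring S \<Longrightarrow> (\<And>i. i \<in> I \<Longrightarrow> f i \<in> S) \<Longrightarrow> sum f I \<in> S"
  by (induction I rule: infinite_finite_induct) (auto intro: subring_0 subring_add)

lemma subring_prod: "is_subring S \<Longrightarrow> (\<And>i. i \<in> I \<Longrightarrow> f i \<in> S) \<Longrightarrow> prod f I \<in> S"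
  by (induction I rule: infinite_finite_induct) (auto intro: subring_1 subring_mult)

lemma subring_of_nat: "is_subring S \<Longrightarrow> of_nat n \<in> S"
  by (induction n) (auto intro: subring_1 subring_add subring_0)

lemma subring_of_int: "is_subring S \<Longrightarrow> of_int n \<in> S"
  by (cases n) (auto intro: subring_of_nat subring_uminus subring_diff subring_1)

lemmas subring_closed = subring_0 subring_1 subring_add subring_diff subring_mult subring_uminus
  subring_power subring_sum subring_prod subring_of_nat subring_of_int

lemma subfield_inverse: "is_subfield S \<Longrightarrow> x \<in> S \<Longrightarrow> inverse x \<in> S"
  by (auto simp: is_subfield_def)

lemma subfield_divide: "is_subfield S \<Longrightarrow> x \<in> S \<Longrightarrow> y \<in> S \<Longrightarrow> x / y \<in> S"
  unfolding divide_inverse using subfield_inverse subfield_subring subring_mult by blast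

lemma subfield_powi: "is_subfield S \<Longrightarrow> x \<in> S \<Longrightarrow> x powi k \<in> S"
  by (auto simp: power_int_def intro!: subring_power subfield_subring subfield_inverse)

lemma subfield_of_rat: "is_subfield S \<Longrightarrow> of_rat q \<in> (S :: 'a::field_char_0 set)"
  by (cases q) (auto simp: of_rat_rat intro!: subfield_divide subring_of_int subfield_subring)

lemma subfield_Rats: "is_subfield (\<rat> :: 'a::field_char_0 set)"
  by (auto simp: is_subfield_def)

lemma subfield_UNIV: "is_subfield UNIV"
  by (auto simp: is_subfield_def)

lemma subfield_gen_field: "is_subfield (gen_field A)"
  unfolding gen_field_def is_subfield_def by auto

lemma gen_field_superset: "A \<subseteq> gen_field A"
  unfolding gen_field_def by auto

lemma gen_field_least: "is_subfield S \<Longrightarrow> A \<subseteq> S \<Longrightarrow> gen_field A \<subseteq> S"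
  unfolding gen_field_def by auto

lemma gen_field_mono: "A \<subseteq> B \<Longrightarrow> gen_field A \<subseteq> gen_field B"
  using gen_field_least[OF subfield_gen_field] gen_field_superset by (meson order_trans)

lemma subfield_Union_directed:
  assumes "\<S> \<noteq> {}" and "\<And>S. S \<in> \<S> \<Longrightarrow> is_subfield S"
    and "\<And>S T. S \<in> \<S> \<Longrightarrow> T \<in> \<S> \<Longrightarrow> \<exists>U\<in>\<S>. S \<subseteq> U \<and> T \<subseteq> U"
  shows "is_subfield (\<Union>\<S>)"
proof -
  have pair: "\<exists>U\<in>\<S>. x \<in> U \<and> y \<in> U" if "x \<in> \<Union>\<S>" "y \<in> \<Union>\<S>" for x y
  proof -
    obtain S T where "S \<in> \<S>" "T \<in> \<S>" "x \<in> S" "y \<in> T" using \<open>x \<in> \<Union>\<S>\<close> \<open>y \<in> \<Union>\<S>\<close> by blast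
    then show ?thesis using assms(3)[of S T] by blast
  qed
  obtain S0 where S0: "S0 \<in> \<S>" using assms(1) by blast
  have "x + y \<in> \<Union>\<S> \<and> x - y \<in> \<Union>\<S> \<and> x * y \<in> \<Union>\<S>" if xy: "x \<in> \<Union>\<S>" "y \<in> \<Union>\<S>" for x y
  proof -
    obtain U where "U \<in> \<S>" "x \<in> U" "y \<in> U" using pair[OF xy] by blast
    then show ?thesis using assms(2)[of U] unfolding is_subfield_def by blast
  qed
  moreover have "0 \<in> \<Union>\<S>" "1 \<in> \<Union>\<S>" using S0 assms(2)[OF S0] unfolding is_subfield_def by auto
  moreover have "inverse x \<in> \<Union>\<S>" if "x \<in> \<Union>\<S>" for x
    using that assms(2) unfolding is_subfield_def by blast
  ultimately show ?thesis unfolding is_subfield_def by blast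
qed

text \<open>The subfields generated by finite subsets of \<open>A\<close> form a directed family,
  and its union is a subfield containing \<open>A\<close>.\<close>

lemma gen_field_finitary:
  assumes "x \<in> gen_field A"
  shows "\<exists>F. finite F \<and> F \<subseteq> A \<and> x \<in> gen_field F"
proof -
  let ?S = "gen_field ` {F. finite F \<and> F \<subseteq> A}"
  have "is_subfield (\<Union>?S)"
  proof (rule subfield_Union_directed)
    fix S T assume "S \<in> ?S" "T \<in> ?S"
    then obtain F G where "finite F" "F \<subseteq> A" "finite G" "G \<subseteq> A" "S = gen_field F" "T = gen_field G"
      by blast
    then show "\<exists>U\<in>?S. S \<subseteq> U \<and> T \<subseteq> U"
      using gen_field_mono[of F "F \<union> G"] gen_field_mono[of G "F \<union> G"]
      by (intro bexI[of _ "gen_field (F \<union> G)"]) auto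
  qed (auto simp: subfield_gen_field)
  moreover have "A \<subseteq> \<Union>?S"
  proof
    fix a assume "a \<in> A"
    then show "a \<in> \<Union>?S" using gen_field_superset[of "{a}"] by (intro UnionI[of "gen_field {a}"]) auto
  qed
  ultimately have "gen_field A \<subseteq> \<Union>?S" by (rule gen_field_least)
  then show ?thesis using assms by blast
qed

section \<open>Polynomials over a subfield and division with remainder\<close>

definition coeffs_in :: "'a::zero set \<Rightarrow> 'a poly \<Rightarrow> bool" where
  "coeffs_in S p \<longleftrightarrow> (\<forall>i. coeff p i \<in> S)"

lemma coeffs_in_mono: "coeffs_in S p \<Longrightarrow> S \<subseteq> T \<Longrightarrow> coeffs_in T p"
  by (auto simp: coeffs_in_def)

lemma
  assumes "is_subring S"
  shows coeffs_in_0: "coeffs_in S 0" and coeffs_in_1: "coeffs_in S 1"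
    and coeffs_in_add: "coeffs_in S p \<Longrightarrow> coeffs_in S q \<Longrightarrow> coeffs_in S (p + q)"
    and coeffs_in_diff: "coeffs_in S p \<Longrightarrow> coeffs_in S q \<Longrightarrow> coeffs_in S (p - q)"
    and coeffs_in_mult: "coeffs_in S p \<Longrightarrow> coeffs_in S q \<Longrightarrow> coeffs_in S (p * q)"
    and coeffs_in_smult: "a \<in> S \<Longrightarrow> coeffs_in S p \<Longrightarrow> coeffs_in S (smult a p)"
    and coeffs_in_monom: "a \<in> S \<Longrightarrow> coeffs_in S (monom a n)"
    and coeffs_in_pCons: "a \<in> S \<Longrightarrow> coeffs_in S p \<Longrightarrow> coeffs_in S (pCons a p)"
    and coeffs_in_sum: "(\<And>i. i \<in> I \<Longrightarrow> coeffs_in S (f i)) \<Longrightarrow> coeffs_in S (sum f I)"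
  using assms
  by (auto simp: coeffs_in_def coeff_mult coeff_sum coeff_pCons subring_closed
      simp flip: monom_0 one_poly_eq_simps(1) split: nat.split intro!: subring_sum)

lemma coeffs_in_pConsD: "coeffs_in S (pCons a p) \<Longrightarrow> a \<in> S \<and> coeffs_in S p"
  unfolding coeffs_in_def by (metis coeff_pCons_0 coeff_pCons_Suc)

lemma poly_in_subring: "is_subring S \<Longrightarrow> coeffs_in S p \<Longrightarrow> x \<in> S \<Longrightarrow> poly p x \<in> S"
  by (auto simp: poly_altdef coeffs_in_def intro!: subring_sum subring_mult subring_power)

lemma coeffs_in_division:
  assumes S: "is_subfield S" and m: "coeffs_in S m" "m \<noteq> 0" and p: "coeffs_in S p"
  shows "\<exists>q r. coeffs_in S q \<and> coeffs_in S r \<and> p = q * m + r \<and> (r = 0 \<or> degree r < degree m)"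
  using p
\<comment> \<open>The measure places the zero polynomial strictly below the nonzero constants, which
  have the same \<open>degree\<close>.\<close>
proof (induction "if p = 0 then 0 else Suc (degree p)" arbitrary: p rule: less_induct)
  case less
  note R = subfield_subring[OF S]
  show ?case
  proof (cases "p = 0 \<or> degree p < degree m")
    case True
    then show ?thesis using less.prems coeffs_in_0[OF R] by (intro exI[of _ 0] exI[of _ p]) auto
  next
    case False
    let ?c = "monom (lead_coeff p / lead_coeff m) (degree p - degree m)"
    let ?p' = "p - ?c * m"
    have c: "coeffs_in S ?c" using m less.prems
      by (intro coeffs_in_monom[OF R] subfield_divide[OF S]) (auto simp: coeffs_in_def)
    have p': "coeffs_in S ?p'" using c m less.prems by (intro coeffs_in_diff[OF R] coeffs_in_mult[OF R])
    have degc: "degree (?c * m) = degree p" using False m by (subst degree_mult_eq) (auto simp: degree_monom_eq)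
    have lc: "coeff (?c * m) (degree p) = lead_coeff p"
    proof -
      have "coeff (?c * m) (degree (?c * m)) = lead_coeff ?c * lead_coeff m" by (rule lead_coeff_mult)
      moreover have "lead_coeff ?c = lead_coeff p / lead_coeff m"
        by (cases "lead_coeff p / lead_coeff m = 0") (auto simp: degree_monom_eq)
      ultimately show ?thesis using degc m by simp
    qed
    have "?p' = 0 \<or> degree ?p' < degree p"
    proof (rule ccontr)
      assume n: "\<not> ?thesis"
      have "degree ?p' \<le> degree p" using degc by (simp add: degree_diff_le)
      then have e: "degree ?p' = degree p" using n by auto
      have "coeff ?p' (degree p) = 0" using lc by simp
      then have "lead_coeff ?p' = 0" unfolding e .
      then have "?p' = 0" by (simp only: leading_coeff_0_iff)
      then show False using n by blast
    qed
    then have "(if ?p' = 0 then 0 else Suc (degree ?p')) < (if p = 0 then 0 else Suc (degree p))"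
      using False by auto
    from less.hyps[OF this p'] obtain q r where qr: "coeffs_in S q" "coeffs_in S r" "?p' = q * m + r"
      "r = 0 \<or> degree r < degree m" by blast
    then show ?thesis
      by (intro exI[of _ "?c + q"] exI[of _ r]) (auto simp: algebra_simps c intro!: coeffs_in_add[OF R])
  qed
qed

section \<open>Algebraic elements and finite extensions\<close>

definition algover :: "'a::field set \<Rightarrow> 'a \<Rightarrow> bool" where
  "algover S x \<longleftrightarrow> (\<exists>p. p \<noteq> 0 \<and> coeffs_in S p \<and> poly p x = 0)"

lemma algover_mono: "algover S x \<Longrightarrow> S \<subseteq> T \<Longrightarrow> algover T x"
  unfolding algover_def using coeffs_in_mono by blast

lemma algover_self:
  assumes "is_subring S" "x \<in> S" shows "algover S x"
proof -
  have "coeffs_in S [:-x, 1:]"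
    by (intro coeffs_in_pCons coeffs_in_0 subring_uminus subring_1 assms)
  then show ?thesis unfolding algover_def by (intro exI[of _ "[:-x, 1:]"]) auto
qed

text \<open>Gaussian elimination on the equations: a vanishing row is dropped; otherwise a pivot
  unknown is solved for and removed from the other rows.\<close>

lemma linear_system_solution:
  fixes a :: "'i \<Rightarrow> 'j \<Rightarrow> 'a::field"
  assumes S: "is_subfield S" and "finite I" and "finite J" and "card I < card J"
    and "\<And>i j. i \<in> I \<Longrightarrow> j \<in> J \<Longrightarrow> a i j \<in> S"
  shows "\<exists>t. (\<forall>j\<in>J. t j \<in> S) \<and> (\<exists>j\<in>J. t j \<noteq> 0) \<and> (\<forall>i\<in>I. (\<Sum>j\<in>J. a i j * t j) = 0)"
  using assms(2-)
proof (induction I arbitrary: J a rule: finite_induct)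
  case empty
  then have "J \<noteq> {}" by auto
  then show ?case using subring_1[OF subfield_subring[OF S]] by (intro exI[of _ "\<lambda>_. 1"]) auto
next
  case (insert i0 I)
  note R = subfield_subring[OF S]
  show ?case
  proof (cases "\<forall>j\<in>J. a i0 j = 0")
    case True
    have "card I < card J" using insert by auto
    from insert.IH[OF insert.prems(1) this, of a] insert.prems(3)
    obtain t where "\<forall>j\<in>J. t j \<in> S" "\<exists>j\<in>J. t j \<noteq> 0" "\<forall>i\<in>I. (\<Sum>j\<in>J. a i j * t j) = 0" by auto
    then show ?thesis using True by (intro exI[of _ t]) auto
  next
    case False
    then obtain j0 where j0: "j0 \<in> J" "a i0 j0 \<noteq> 0" by auto
    define J' where "J' = J - {j0}"
    \<comment> \<open>Row \<open>i\<close> minus the multiple of row \<open>i0\<close> that clears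
      the pivot column \<open>j0\<close>.\<close>
    define b where "b i j = a i j - a i j0 * a i0 j / a i0 j0" for i j
    have J': "finite J'" "card I < card J'" using insert j0 by (auto simp: J'_def)
    have bS: "b i j \<in> S" if "i \<in> I" "j \<in> J'" for i j
      unfolding b_def using that insert.prems(3) j0
      by (intro subring_diff[OF R] subfield_divide[OF S] subring_mult[OF R]) (auto simp: J'_def)
    obtain t where t: "\<forall>j\<in>J'. t j \<in> S" "\<exists>j\<in>J'. t j \<noteq> 0" "\<forall>i\<in>I. (\<Sum>j\<in>J'. b i j * t j) = 0"
      using insert.IH[OF J', of b] bS by auto
    define t0 where "t0 = - (\<Sum>j\<in>J'. a i0 j * t j) / a i0 j0"
    define u where "u j = (if j = j0 then t0 else t j)" for j
    have sumu: "(\<Sum>j\<in>J. c j * u j) = c j0 * t0 + (\<Sum>j\<in>J'. c j * t j)" for c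
    proof -
      have "(\<Sum>j\<in>J. c j * u j) = c j0 * u j0 + (\<Sum>j\<in>J'. c j * u j)"
        unfolding J'_def using j0 insert.prems(1) by (simp add: sum.remove)
      also have "(\<Sum>j\<in>J'. c j * u j) = (\<Sum>j\<in>J'. c j * t j)"
        by (rule sum.cong) (auto simp: J'_def u_def)
      finally show ?thesis by (simp add: u_def)
    qed
    have "t0 \<in> S" unfolding t0_def using t(1) insert.prems(3) j0
      by (intro subfield_divide[OF S] subring_uminus[OF R] subring_sum[OF R] subring_mult[OF R])
        (auto simp: J'_def)
    then have "\<forall>j\<in>J. u j \<in> S" using t(1) by (auto simp: u_def J'_def)
    moreover have "\<exists>j\<in>J. u j \<noteq> 0" using t(2) by (auto simp: u_def J'_def)
    moreover have "(\<Sum>j\<in>J. a i0 j * u j) = 0" unfolding sumu t0_def using j0 by simp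
    moreover have "(\<Sum>j\<in>J. a i j * u j) = 0" if "i \<in> I" for i
    proof -
      have "(\<Sum>j\<in>J'. b i j * t j) = (\<Sum>j\<in>J'. a i j * t j) - (\<Sum>j\<in>J'. a i j0 * a i0 j / a i0 j0 * t j)"
        by (simp add: b_def algebra_simps sum_subtractf)
      also have "(\<Sum>j\<in>J'. a i j0 * a i0 j / a i0 j0 * t j) = - (a i j0 * t0)"
        by (simp add: t0_def sum_distrib_left sum_divide_distrib algebra_simps)
      finally show ?thesis using t(3) that unfolding sumu by (simp add: algebra_simps)
    qed
    ultimately show ?thesis by (intro exI[of _ u]) auto
  qed
qed

text \<open>Each combination runs over all of \<open>B\<close> at once, which describes the linear
  span for the finite \<open>B\<close> considered here.\<close>

definition lspan :: "'a::field set \<Rightarrow> 'a set \<Rightarrow> 'a set" where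
  "lspan S B = {\<Sum>b\<in>B. s b * b | s. \<forall>b\<in>B. s b \<in> S}"

lemma lspan_0: "is_subring S \<Longrightarrow> 0 \<in> lspan S B"
  unfolding lspan_def using subring_0 by (intro CollectI exI[of _ "\<lambda>_. 0"]) auto

lemma lspan_add:
  assumes "is_subring S" "x \<in> lspan S B" "y \<in> lspan S B" shows "x + y \<in> lspan S B"
proof -
  obtain s t where "x = (\<Sum>b\<in>B. s b * b)" "\<forall>b\<in>B. s b \<in> S" "y = (\<Sum>b\<in>B. t b * b)" "\<forall>b\<in>B. t b \<in> S"
    using assms unfolding lspan_def by blast
  then show ?thesis unfolding lspan_def using subring_add[OF assms(1)]
    by (intro CollectI exI[of _ "\<lambda>b. s b + t b"]) (auto simp: sum.distrib algebra_simps)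
qed

lemma lspan_sum: "is_subring S \<Longrightarrow> (\<And>i. i \<in> I \<Longrightarrow> f i \<in> lspan S B) \<Longrightarrow> sum f I \<in> lspan S B"
  by (induction I rule: infinite_finite_induct) (auto intro: lspan_0 lspan_add)

lemma lspan_base:
  assumes "is_subring S" "finite B" "b \<in> B" "s \<in> S" shows "s * b \<in> lspan S B"
proof -
  have "(\<Sum>c\<in>B. (if c = b then s else 0) * c) = s * b"
    using assms by (subst sum.remove[of B b]) (auto intro!: sum.neutral)
  then show ?thesis unfolding lspan_def using assms(4) subring_0[OF assms(1)]
    by (intro CollectI exI[of _ "\<lambda>c. if c = b then s else 0"]) auto
qed

text \<open>A relation among the \<open>w j\<close> holds as soon as the coefficient of every
  \<open>b\<close> vanishes: \<open>card B\<close> equations in \<open>card J\<close>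
  unknowns.\<close>

lemma lspan_dependent:
  assumes S: "is_subfield S" and B: "finite B" and J: "finite J" "card B < card J"
    and w: "\<And>j. j \<in> J \<Longrightarrow> w j \<in> lspan S B"
  shows "\<exists>t. (\<forall>j\<in>J. t j \<in> S) \<and> (\<exists>j\<in>J. t j \<noteq> 0) \<and> (\<Sum>j\<in>J. t j * w j) = 0"
proof -
  have "\<forall>j\<in>J. \<exists>s. w j = (\<Sum>b\<in>B. s b * b) \<and> (\<forall>b\<in>B. s b \<in> S)" using w unfolding lspan_def by blast
  then obtain s where s: "\<And>j. j \<in> J \<Longrightarrow> w j = (\<Sum>b\<in>B. s j b * b)" "\<And>j b. j \<in> J \<Longrightarrow> b \<in> B \<Longrightarrow> s j b \<in> S"
    by metis
  obtain t where t: "\<forall>j\<in>J. t j \<in> S" "\<exists>j\<in>J. t j \<noteq> 0" "\<forall>b\<in>B. (\<Sum>j\<in>J. s j b * t j) = 0"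
    using linear_system_solution[OF S B J, of "\<lambda>b j. s j b", OF s(2)] by auto
  have "(\<Sum>j\<in>J. t j * w j) = (\<Sum>j\<in>J. \<Sum>b\<in>B. s j b * t j * b)"
    using s(1) by (intro sum.cong) (auto simp: sum_distrib_left algebra_simps)
  also have "\<dots> = (\<Sum>b\<in>B. (\<Sum>j\<in>J. s j b * t j) * b)"
    by (subst sum.swap) (simp add: sum_distrib_right)
  also have "\<dots> = 0" using t(3) by simp
  finally show ?thesis using t by blast
qed

text \<open>Finite extensions of a subfield. A finite set whose span covers \<open>N\<close> bounds
  the dimension; no basis has to be carried along when extensions are iterated.\<close>

definition finalg :: "'a::field set \<Rightarrow> 'a set \<Rightarrow> bool" where
  "finalg S N \<longleftrightarrow> is_subring N \<and> S \<subseteq> N \<and> (\<exists>B. finite B \<and> N \<subseteq> lspan S B)"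

text \<open>The first \<open>card B + 1\<close> powers of \<open>y\<close> are linearly dependent
  over \<open>S\<close>.\<close>

lemma finalg_algover:
  assumes S: "is_subfield S" and N: "finalg S N" and y: "y \<in> N"
  shows "algover S y"
proof -
  obtain B where B: "finite B" "N \<subseteq> lspan S B" "is_subring N" using N unfolding finalg_def by blast
  let ?J = "{..card B}"
  have "y ^ j \<in> lspan S B" for j using B y subring_power by blast
  then obtain t where t: "\<forall>j\<in>?J. t j \<in> S" "\<exists>j\<in>?J. t j \<noteq> 0" "(\<Sum>j\<in>?J. t j * y ^ j) = 0"
    using lspan_dependent[OF S B(1), of ?J "\<lambda>j. y ^ j"] by auto
  let ?p = "\<Sum>j\<in>?J. monom (t j) j"
  have "coeffs_in S ?p" using t(1)
    by (intro coeffs_in_sum coeffs_in_monom subfield_subring S) auto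
  moreover have "poly ?p y = 0" using t(3) by (simp add: poly_sum poly_monom)
  moreover have "?p \<noteq> 0"
  proof -
    obtain j where "j \<in> ?J" "t j \<noteq> 0" using t(2) by blast
    then have "coeff ?p j \<noteq> 0" by (simp add: coeff_sum)
    then show ?thesis by auto
  qed
  ultimately show ?thesis unfolding algover_def by blast
qed

text \<open>An equation with nonzero constant term expresses the inverse of \<open>y\<close> as a
  polynomial in \<open>y\<close>; a zero constant term is removed by dividing the equation by
  \<open>y\<close>.\<close>

lemma algover_inverse_in:
  assumes S: "is_subfield S" and N: "is_subring N" "S \<subseteq> N" and y: "y \<in> N" "algover S y"
  shows "inverse y \<in> N"
proof (cases "y = 0")
  case True then show ?thesis using subring_0[OF N(1)] by simp
next
  case False
  obtain p where "p \<noteq> 0" "coeffs_in S p" "poly p y = 0" using y unfolding algover_def by blast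
  then show ?thesis
  proof (induction p)
    case 0 then show ?case by simp
  next
    case (pCons a p)
    have aS: "a \<in> S" "coeffs_in S p" using pCons.prems coeffs_in_pConsD by blast+
    show ?case
    proof (cases "a = 0")
      case True
      then show ?thesis using pCons False aS by auto
    next
      case a: False
      have "inverse y = - poly p y * inverse a"
        using pCons.prems(3) False a by (simp add: field_simps eq_neg_iff_add_eq_0)
      moreover have "poly p y \<in> N" using poly_in_subring[OF N(1) coeffs_in_mono[OF aS(2) N(2)] y(1)] .
      ultimately show ?thesis using subfield_inverse[OF S aS(1)] N
        by (auto intro!: subring_closed)
    qed
  qed
qed

lemma subfieldI: "is_subring S \<Longrightarrow> (\<And>x. x \<in> S \<Longrightarrow> inverse x \<in> S) \<Longrightarrow> is_subfield S"
  unfolding is_subfield_def is_subring_def by simp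

lemma finalg_subfield:
  assumes "is_subfield S" "finalg S N" shows "is_subfield N"
proof (rule subfieldI)
  show N: "is_subring N" using assms(2) unfolding finalg_def by simp
  show "inverse x \<in> N" if "x \<in> N" for x
    using algover_inverse_in[OF assms(1) N _ that finalg_algover[OF assms that]] assms(2)
    unfolding finalg_def by simp
qed

lemma subring_adjoin:
  assumes "is_subring N" shows "is_subring {poly p x |p. coeffs_in N p}"
proof -
  let ?N' = "{poly p x |p. coeffs_in N p}"
  have "u + v \<in> ?N' \<and> u - v \<in> ?N' \<and> u * v \<in> ?N'" if uv: "u \<in> ?N'" "v \<in> ?N'" for u v
  proof -
    obtain p q where "coeffs_in N p" "coeffs_in N q" "u = poly p x" "v = poly q x" using uv by blast
    then have "u + v = poly (p + q) x \<and> coeffs_in N (p + q)" "u - v = poly (p - q) x \<and> coeffs_in N (p - q)"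
      "u * v = poly (p * q) x \<and> coeffs_in N (p * q)"
      using coeffs_in_add[OF assms, of p q] coeffs_in_diff[OF assms, of p q] coeffs_in_mult[OF assms, of p q]
      by simp_all
    then show ?thesis by blast
  qed
  moreover have "0 \<in> ?N'" using coeffs_in_0[OF assms] by force
  moreover have "1 \<in> ?N'" using coeffs_in_1[OF assms] by force
  ultimately show ?thesis unfolding is_subring_def by blast
qed

lemma adjoin_superset:
  assumes "is_subring N" shows "insert x N \<subseteq> {poly p x |p. coeffs_in N p}"
proof -
  have "coeffs_in N [:0, 1:]" "\<And>a. a \<in> N \<Longrightarrow> coeffs_in N [:a:]"
    by (auto intro!: coeffs_in_pCons coeffs_in_0 subring_closed assms)
  moreover have "x = poly [:0, 1:] x" "\<And>a. a = poly [:a:] x" by auto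
  ultimately show ?thesis by blast
qed

text \<open>Dividing by an equation \<open>m\<close> of \<open>x\<close> over \<open>N\<close>
  leaves remainders of degree below \<open>degree m\<close>, so the ring of polynomials in
  \<open>x\<close> over \<open>N\<close> is spanned over \<open>S\<close> by products of the
  spanning set of \<open>N\<close> with the first powers of \<open>x\<close>.\<close>

lemma finalg_adjoin:
  assumes S: "is_subfield S" and N: "finalg S N" and x: "algover N x"
  shows "\<exists>N'. finalg S N' \<and> N \<subseteq> N' \<and> x \<in> N'"
proof -
  note SR = subfield_subring[OF S]
  have NF: "is_subfield N" using finalg_subfield[OF S N] .
  note NR = subfield_subring[OF NF]
  obtain B where B: "finite B" "N \<subseteq> lspan S B" and SN: "S \<subseteq> N" using N unfolding finalg_def by blast
  obtain m where m: "m \<noteq> 0" "coeffs_in N m" "poly m x = 0" using x unfolding algover_def by blast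
  let ?N' = "{poly p x |p. coeffs_in N p}"
  let ?B' = "(\<lambda>(b, j). b * x ^ j) ` (B \<times> {..<degree m})"
  have fB': "finite ?B'" using B by auto
  have "?N' \<subseteq> lspan S ?B'"
  proof
    fix y assume "y \<in> ?N'"
    then obtain p where p: "coeffs_in N p" "y = poly p x" by blast
    obtain q r where qr: "coeffs_in N q" "coeffs_in N r" "p = q * m + r" "r = 0 \<or> degree r < degree m"
      using coeffs_in_division[OF NF m(2,1) p(1)] by blast
    have y: "y = poly r x" using p(2) qr(3) m(3) by simp
    show "y \<in> lspan S ?B'"
    proof (cases "r = 0")
      case True then show ?thesis using y lspan_0[OF SR] by simp
    next
      case False
      have "coeff r j * x ^ j \<in> lspan S ?B'" if j: "j \<le> degree r" for j
      proof -
        have "coeff r j \<in> lspan S B" using qr(2) B(2) unfolding coeffs_in_def by blast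
        then obtain s where s: "coeff r j = (\<Sum>b\<in>B. s b * b)" "\<forall>b\<in>B. s b \<in> S" unfolding lspan_def by blast
        have "coeff r j * x ^ j = (\<Sum>b\<in>B. s b * (b * x ^ j))" unfolding s(1) by (simp add: sum_distrib_right mult.assoc)
        also have "\<dots> \<in> lspan S ?B'"
          using s(2) j qr(4) False by (intro lspan_sum[OF SR] lspan_base[OF SR fB']) auto
        finally show ?thesis .
      qed
      then show ?thesis unfolding y poly_altdef by (intro lspan_sum[OF SR]) auto
    qed
  qed
  then have "finalg S ?N'" unfolding finalg_def
    using subring_adjoin[OF NR] adjoin_superset[OF NR, of x] SN fB' by blast
  then show ?thesis using adjoin_superset[OF NR, of x] by blast
qed

lemma finalg_refl: "is_subfield S \<Longrightarrow> finalg S S"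
proof -
  assume S: "is_subfield S"
  have "S \<subseteq> lspan S {1}" using lspan_base[OF subfield_subring[OF S], of "{1}" 1] by auto
  then show ?thesis unfolding finalg_def using subfield_subring[OF S] by blast
qed

lemma finalg_finite_set:
  assumes S: "is_subfield S" and "finite A" and "\<And>x. x \<in> A \<Longrightarrow> algover S x"
  shows "\<exists>N. finalg S N \<and> A \<subseteq> N"
  using assms(2,3)
proof (induction A rule: finite_induct)
  case empty then show ?case using finalg_refl[OF S] by blast
next
  case (insert x A)
  then obtain N where N: "finalg S N" "A \<subseteq> N" by auto
  have "algover N x" using insert.prems N(1) unfolding finalg_def by (meson algover_mono insertI1)
  then show ?case using finalg_adjoin[OF S N(1)] N(2) by blast
qed

text \<open>Relatively algebraically closed subfields, the closed sets of the closure operator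
  \<open>acl\<close>. Inclusions of closures are proved by exhibiting such a set.\<close>

definition rclosed :: "'a::field set \<Rightarrow> bool" where
  "rclosed S \<longleftrightarrow> is_subfield S \<and> (\<forall>x. algover S x \<longrightarrow> x \<in> S)"

text \<open>Two algebraic elements lie in a common finite extension, which is a field. For
  transitivity, the finitely many coefficients of an equation lie in one finite extension, and
  adjoining the root keeps it finite.\<close>

lemma rclosed_algover:
  assumes S: "is_subfield S" shows "rclosed {x. algover S x}"
proof -
  let ?T = "{x. algover S x}"
  have ops: "x + y \<in> ?T \<and> x - y \<in> ?T \<and> x * y \<in> ?T \<and> inverse x \<in> ?T" if "x \<in> ?T" "y \<in> ?T" for x y
  proof -
    have "\<exists>N. finalg S N \<and> {x, y} \<subseteq> N" using that by (intro finalg_finite_set[OF S]) auto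
    then obtain N where N: "finalg S N" "{x, y} \<subseteq> N" by blast
    have NF: "is_subfield N" using finalg_subfield[OF S N(1)] .
    then have "x + y \<in> N \<and> x - y \<in> N \<and> x * y \<in> N \<and> inverse x \<in> N" using N(2) unfolding is_subfield_def by auto
    then show ?thesis using finalg_algover[OF S N(1)] by blast
  qed
  moreover have "0 \<in> ?T" "1 \<in> ?T" using algover_self[OF subfield_subring[OF S]] subring_0 subring_1 subfield_subring[OF S] by auto
  ultimately have T: "is_subfield ?T" unfolding is_subfield_def by blast
  moreover have "x \<in> ?T" if x: "algover ?T x" for x
  proof -
    obtain p where p: "p \<noteq> 0" "coeffs_in ?T p" "poly p x = 0" using x unfolding algover_def by blast
    let ?A = "set (coeffs p)"
    have "y \<in> ?T" if "y \<in> ?A" for y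
    proof -
      have "y \<in> range (coeff p)" unfolding range_coeff using that by simp
      then obtain i where "y = coeff p i" by (rule rangeE)
      then show ?thesis using p(2) unfolding coeffs_in_def by blast
    qed
    then obtain N where N: "finalg S N" "?A \<subseteq> N" using finalg_finite_set[OF S, of ?A] by auto
    have NF: "is_subfield N" using finalg_subfield[OF S N(1)] .
    have "coeffs_in N p" unfolding coeffs_in_def
    proof
      fix i
      show "coeff p i \<in> N"
      proof (cases "i \<le> degree p")
        case True
        then have "coeff p i \<in> ?A" using p(1) by (metis coeff_in_coeffs)
        then show ?thesis using N(2) by blast
      qed (simp add: coeff_eq_0 subring_0[OF subfield_subring[OF NF]])
    qed
    then have "algover N x" using p unfolding algover_def by blast
    then show ?thesis using finalg_adjoin[OF S N(1)] finalg_algover[OF S] by blast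
  qed
  ultimately show ?thesis unfolding rclosed_def by blast
qed

section \<open>Relative algebraic closure as a closure operator\<close>

definition acl :: "'a::field set \<Rightarrow> 'a set" where
  "acl A = {x. algover (gen_field A) x}"

lemma rclosed_acl: "rclosed (acl A)"
  unfolding acl_def by (rule rclosed_algover[OF subfield_gen_field])

lemma rclosed_subfield: "rclosed S \<Longrightarrow> is_subfield S"
  unfolding rclosed_def by blast

lemmas rclosed_subring = subfield_subring[OF rclosed_subfield]

lemma rclosed_root: "rclosed S \<Longrightarrow> p \<noteq> 0 \<Longrightarrow> coeffs_in S p \<Longrightarrow> poly p x = 0 \<Longrightarrow> x \<in> S"
  unfolding rclosed_def algover_def by blast

lemma subfield_acl: "is_subfield (acl A)" using rclosed_subfield[OF rclosed_acl] .
lemmas subring_acl = subfield_subring[OF subfield_acl]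

lemma gen_field_acl: "gen_field A \<subseteq> acl A"
  unfolding acl_def using algover_self[OF subfield_subring[OF subfield_gen_field]] by blast

lemma acl_superset: "A \<subseteq> acl A"
  using gen_field_acl gen_field_superset by blast

lemma acl_least: "rclosed S \<Longrightarrow> A \<subseteq> S \<Longrightarrow> acl A \<subseteq> S"
  unfolding acl_def using gen_field_least[of S A] algover_mono[of "gen_field A" _ S]
  unfolding rclosed_def by blast

lemma acl_rclosed: "rclosed S \<Longrightarrow> acl S = S"
  using acl_least[of S S] acl_superset by blast

lemma acl_subset: "A \<subseteq> acl B \<Longrightarrow> acl A \<subseteq> acl B"
  by (rule acl_least[OF rclosed_acl])

lemma acl_mono: "A \<subseteq> B \<Longrightarrow> acl A \<subseteq> acl B"
  using acl_subset acl_superset by (meson order_trans)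

lemma coeffs_in_common_finite:
  assumes "coeffs_in (gen_field A) p"
  shows "\<exists>F. finite F \<and> F \<subseteq> A \<and> coeffs_in (gen_field F) p"
proof -
  have "\<forall>i. \<exists>F. finite F \<and> F \<subseteq> A \<and> coeff p i \<in> gen_field F"
    using assms gen_field_finitary unfolding coeffs_in_def by blast
  then obtain F where F: "\<And>i. finite (F i)" "\<And>i. F i \<subseteq> A" "\<And>i. coeff p i \<in> gen_field (F i)" by metis
  let ?F = "\<Union>i\<le>degree p. F i"
  have "coeffs_in (gen_field ?F) p" unfolding coeffs_in_def
  proof
    fix i
    show "coeff p i \<in> gen_field ?F"
    proof (cases "i \<le> degree p")
      case True
      then show ?thesis using F(3)[of i] gen_field_mono[of "F i" ?F] by blast
    qed (simp add: coeff_eq_0 subring_0[OF subfield_subring[OF subfield_gen_field]])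
  qed
  then show ?thesis using F by (intro exI[of _ ?F]) auto
qed

lemma acl_finitary:
  assumes "x \<in> acl A"
  shows "\<exists>F. finite F \<and> F \<subseteq> A \<and> x \<in> acl F"
proof -
  obtain p where p: "p \<noteq> 0" "coeffs_in (gen_field A) p" "poly p x = 0"
    using assms unfolding acl_def algover_def by blast
  then show ?thesis using coeffs_in_common_finite[OF p(2)] unfolding acl_def algover_def by blast
qed

definition fracs :: "'a::field set \<Rightarrow> 'a set" where
  "fracs R = {u / v |u v. u \<in> R \<and> v \<in> R \<and> v \<noteq> 0}"

lemma subfield_fracs:
  assumes R: "is_subring R" shows "is_subfield (fracs R)"
proof -
  have fI: "u / v \<in> fracs R" if "u \<in> R" "v \<in> R" "v \<noteq> 0" for u v
    using that unfolding fracs_def by blast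
  have "x + y \<in> fracs R \<and> x - y \<in> fracs R \<and> x * y \<in> fracs R \<and> inverse x \<in> fracs R"
    if xy: "x \<in> fracs R" "y \<in> fracs R" for x y
  proof -
    obtain a b c d where e: "x = a / b" "y = c / d" "a \<in> R" "b \<in> R" "c \<in> R" "d \<in> R" "b \<noteq> 0" "d \<noteq> 0"
      using xy unfolding fracs_def by blast
    have 1: "x + y = (a * d + c * b) / (b * d)" "x - y = (a * d - c * b) / (b * d)"
      "x * y = (a * c) / (b * d)" using e by (auto simp: field_simps)
    have 2: "inverse x \<in> fracs R"
    proof (cases "a = 0")
      case True
      then have "inverse x = 0 / 1" using e by simp
      then show ?thesis using fI[OF subring_0[OF R] subring_1[OF R]] by simp
    next
      case False
      then have "inverse x = b / a" using e by simp
      then show ?thesis using fI[of b a] e False by simp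
    qed
    have "a * d + c * b \<in> R" "a * d - c * b \<in> R" "a * c \<in> R" "b * d \<in> R" "b * d \<noteq> 0"
      using e by (auto intro!: subring_closed R)
    then show ?thesis using 2 fI unfolding 1 by simp
  qed
  moreover have "0 \<in> fracs R" "1 \<in> fracs R"
    using fI[OF subring_0[OF R] subring_1[OF R]] fI[OF subring_1[OF R] subring_1[OF R]] by simp_all
  ultimately show ?thesis unfolding is_subfield_def by blast
qed

lemma fracs_superset: "is_subring R \<Longrightarrow> R \<subseteq> fracs R"
proof
  fix u assume "is_subring R" "u \<in> R"
  then show "u \<in> fracs R" unfolding fracs_def using subring_1[of R]
    by (intro CollectI exI[of _ u] exI[of _ 1]) simp
qed

lemma coeffs_clear_denominators:
  assumes R: "is_subring R" and p: "coeffs_in (fracs R) p"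
  shows "\<exists>d\<in>R. d \<noteq> 0 \<and> coeffs_in R (smult d p)"
  using p
proof (induction p)
  case 0 then show ?case using subring_1[OF R] coeffs_in_0[OF R] by (intro bexI[of _ 1]) simp_all
next
  case (pCons a p)
  have ap: "a \<in> fracs R" "coeffs_in (fracs R) p" using coeffs_in_pConsD[OF pCons.prems] by simp_all
  obtain d where d: "d \<in> R" "d \<noteq> 0" "coeffs_in R (smult d p)" using pCons.IH[OF ap(2)] by auto
  obtain u v where uv: "a = u / v" "u \<in> R" "v \<in> R" "v \<noteq> 0" using ap(1) unfolding fracs_def by auto
  have "smult (d * v) (pCons a p) = pCons (d * u) (smult v (smult d p))" using uv by (simp add: mult.commute)
  moreover have "coeffs_in R (pCons (d * u) (smult v (smult d p)))"
    by (rule coeffs_in_pCons[OF R subring_mult[OF R d(1) uv(2)] coeffs_in_smult[OF R uv(3) d(3)]])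
  ultimately show ?case using d uv subring_mult[OF R] by (intro bexI[of _ "d * v"]) auto
qed

text \<open>The coefficients of an equation over \<open>gen_field A\<close> are fractions over
  \<open>R\<close>, and multiplication by a common denominator moves the equation into
  \<open>R\<close>. With \<open>R\<close> a ring of polynomial values, this shows how the
  coefficients depend on the generators.\<close>

lemma acl_clear_denominators:
  assumes R: "is_subring R" and A: "A \<subseteq> fracs R" and x: "x \<in> acl A"
  shows "algover R x"
proof -
  have "gen_field A \<subseteq> fracs R" by (rule gen_field_least[OF subfield_fracs[OF R] A])
  then obtain p where p: "p \<noteq> 0" "coeffs_in (fracs R) p" "poly p x = 0"
    using x coeffs_in_mono unfolding acl_def algover_def by blast
  then obtain d where "d \<noteq> 0" "coeffs_in R (smult d p)" using coeffs_clear_denominators[OF R] by blast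
  then show ?thesis using p unfolding algover_def by (intro exI[of _ "smult d p"]) auto
qed

text \<open>An equation of \<open>y\<close> whose coefficients are polynomials in \<open>x\<close>
  is reread as an equation of \<open>x\<close> whose coefficients are polynomials in
  \<open>y\<close>. It stays nontrivial because \<open>y\<close>, being transcendental over
  \<open>acl A\<close>, annihilates no nonzero polynomial over that field.\<close>

lemma acl_exchange:
  assumes y: "y \<in> acl (insert x A)" "y \<notin> acl A"
  shows "x \<in> acl (insert y A)"
proof -
  let ?S = "acl A"
  have S: "rclosed ?S" by (rule rclosed_acl)
  let ?R = "{poly p x |p. coeffs_in ?S p}"
  have R: "is_subring ?R" by (rule subring_adjoin[OF subring_acl])
  have "insert x A \<subseteq> fracs ?R"
    using adjoin_superset[OF subring_acl, of x A] fracs_superset[OF R] acl_superset[of A] by blast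
  then obtain c where c: "c \<noteq> 0" "coeffs_in ?R c" "poly c y = 0"
    using acl_clear_denominators[OF R _ y(1)] unfolding algover_def by blast
  have "\<forall>k. \<exists>P. coeff c k = poly P x \<and> coeffs_in ?S P" using c(2) unfolding coeffs_in_def by blast
  then obtain P where P: "\<And>k. coeff c k = poly (P k) x" "\<And>k. coeffs_in ?S (P k)" by metis
  define N where "N = (\<Sum>k\<le>degree c. degree (P k))"
  have deg: "degree (P k) \<le> N" if "k \<le> degree c" for k
    unfolding N_def using that by (intro member_le_sum) auto
  \<comment> \<open>The family \<open>P\<close> transposed: \<open>D j\<close> gathers what
    multiplies \<open>x ^ j\<close>.\<close>
  define D where "D j = (\<Sum>k\<le>degree c. monom (coeff (P k) j) k)" for j
  have DS: "coeffs_in ?S (D j)" for j unfolding D_def using P(2)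
    by (intro coeffs_in_sum coeffs_in_monom subring_acl) (auto simp: coeffs_in_def)
  have Peval: "poly (P k) x = (\<Sum>j\<le>N. coeff (P k) j * x ^ j)" if "k \<le> degree c" for k
    unfolding poly_altdef using deg[OF that]
    by (intro sum.mono_neutral_left) (auto simp: coeff_eq_0)
  have "0 = (\<Sum>k\<le>degree c. poly (P k) x * y ^ k)" using c(3) P(1) by (simp add: poly_altdef)
  also have "\<dots> = (\<Sum>k\<le>degree c. \<Sum>j\<le>N. coeff (P k) j * x ^ j * y ^ k)"
    using Peval by (intro sum.cong) (auto simp: sum_distrib_right)
  also have "\<dots> = (\<Sum>j\<le>N. \<Sum>k\<le>degree c. coeff (P k) j * x ^ j * y ^ k)" by (rule sum.swap)
  also have "\<dots> = (\<Sum>j\<le>N. poly (D j) y * x ^ j)"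
    by (simp add: D_def poly_sum poly_monom sum_distrib_left mult.commute mult.left_commute)
  finally have rel: "(\<Sum>j\<le>N. poly (D j) y * x ^ j) = 0" by simp
  obtain k where k: "k \<le> degree c" "coeff c k \<noteq> 0" using c(1) by (metis leading_coeff_0_iff le_refl)
  then have "P k \<noteq> 0" using P(1)[of k] by auto
  then obtain j where j: "coeff (P k) j \<noteq> 0" by (metis leading_coeff_0_iff)
  then have jN: "j \<le> N" using deg[OF k(1)] by (meson le_degree order_trans)
  have "coeff (D j) k \<noteq> 0" using k j by (simp add: D_def coeff_sum)
  then have "D j \<noteq> 0" by auto
  then have nz: "poly (D j) y \<noteq> 0" using rclosed_root[OF S _ DS] y(2) by blast
  let ?q = "\<Sum>j\<le>N. monom (poly (D j) y) j"
  have "coeff ?q j \<noteq> 0" using nz jN by (simp add: coeff_sum)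
  then have "?q \<noteq> 0" by auto
  moreover have "poly ?q x = 0" using rel by (simp add: poly_sum poly_monom)
  moreover have "coeffs_in (acl (insert y A)) ?q"
  proof (intro coeffs_in_sum coeffs_in_monom subring_acl poly_in_subring)
    show "coeffs_in (acl (insert y A)) (D i)" for i
      by (rule coeffs_in_mono[OF DS acl_mono]) auto
    show "y \<in> acl (insert y A)" using acl_superset[of "insert y A"] by auto
  qed
  ultimately show ?thesis using rclosed_root[OF rclosed_acl] by blast
qed

section \<open>Algebraic independence and transcendence bases\<close>

definition acl_indep :: "'a::field set \<Rightarrow> 'a set \<Rightarrow> bool" where
  "acl_indep A B \<longleftrightarrow> (\<forall>b\<in>B. b \<notin> acl (A \<union> (B - {b})))"

lemma acl_indep_empty: "acl_indep A {}"
  by (simp add: acl_indep_def)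

lemma acl_indep_mono:
  assumes "acl_indep A' B'" "B \<subseteq> B'" "A \<subseteq> acl A'"
  shows "acl_indep A B"
  unfolding acl_indep_def
proof (intro ballI notI)
  fix b assume b: "b \<in> B" "b \<in> acl (A \<union> (B - {b}))"
  have "acl (A \<union> (B - {b})) \<subseteq> acl (A' \<union> (B' - {b}))"
  proof (rule acl_subset)
    have "acl A' \<subseteq> acl (A' \<union> (B' - {b}))" by (rule acl_mono) auto
    then show "A \<union> (B - {b}) \<subseteq> acl (A' \<union> (B' - {b}))"
      using assms(2,3) acl_superset[of "A' \<union> (B' - {b})"] by auto
  qed
  then show False using assms(1,2) b unfolding acl_indep_def by auto
qed

lemma acl_indep_insert:
  assumes B: "acl_indep A B" and x: "x \<notin> acl (A \<union> B)"
  shows "acl_indep A (insert x B)"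
  unfolding acl_indep_def
proof (intro ballI notI)
  fix b assume b: "b \<in> insert x B" "b \<in> acl (A \<union> (insert x B - {b}))"
  have xB: "x \<notin> B" using x acl_superset[of "A \<union> B"] by auto
  show False
  proof (cases "b = x")
    case True
    then show False using b(2) x xB by simp
  next
    case False
    then have bB: "b \<in> B" using b(1) by simp
    have e: "A \<union> (insert x B - {b}) = insert x (A \<union> (B - {b}))" using False by auto
    have "b \<notin> acl (A \<union> (B - {b}))" using B bB unfolding acl_indep_def by simp
    then have "x \<in> acl (insert b (A \<union> (B - {b})))" using acl_exchange b(2) unfolding e by auto
    moreover have "insert b (A \<union> (B - {b})) = A \<union> B" using bB by auto
    ultimately show False using x by simp
  qed
qed

lemma acl_indep_insertD:
  assumes "acl_indep A (insert x B)" "x \<notin> B"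
  shows "acl_indep A B" "x \<notin> acl (A \<union> B)"
  using acl_indep_mono[OF assms(1), of B A] acl_superset[of A] assms
  unfolding acl_indep_def[of A "insert x B"] by auto

text \<open>As long as \<open>B\<close> has an element outside \<open>X\<close>, it can be exchanged
  for an element of \<open>X\<close> without losing independence or changing the cardinality; the
  number of elements outside \<open>X\<close> drops each time.\<close>

lemma acl_steinitz:
  assumes "acl_indep A B" "finite B" "finite X" "B \<subseteq> acl (A \<union> X)"
  shows "card B \<le> card X"
  using assms
proof (induction "card (B - X)" arbitrary: B rule: less_induct)
  case less
  show ?case
  proof (cases "B \<subseteq> X")
    case True then show ?thesis using less.prems card_mono by auto
  next
    case False
    then obtain b where b: "b \<in> B" "b \<notin> X" by auto
    let ?A = "acl (A \<union> (B - {b}))"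
    have bn: "b \<notin> ?A" using less.prems(1) b(1) unfolding acl_indep_def by simp
    have "\<not> X \<subseteq> ?A"
    proof
      assume "X \<subseteq> ?A"
      then have "A \<union> X \<subseteq> ?A" using acl_superset[of "A \<union> (B - {b})"] by auto
      then have "acl (A \<union> X) \<subseteq> ?A" by (rule acl_subset)
      then show False using bn less.prems(4) b(1) by auto
    qed
    then obtain x where x: "x \<in> X" "x \<notin> ?A" by auto
    have xB: "x \<notin> B"
    proof
      assume "x \<in> B"
      then have "x \<in> A \<union> (B - {b})" using x(1) b(2) by auto
      then show False using x(2) acl_superset[of "A \<union> (B - {b})"] by auto
    qed
    let ?B' = "insert x (B - {b})"
    have "acl_indep A (B - {b})" using acl_indep_mono[OF less.prems(1)] acl_superset[of A] by auto
    then have 1: "acl_indep A ?B'" using x(2) by (rule acl_indep_insert)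
    have "x \<in> acl (A \<union> X)" using x(1) acl_superset[of "A \<union> X"] by auto
    then have 2: "?B' \<subseteq> acl (A \<union> X)" using less.prems(4) by auto
    have "?B' - X \<subset> B - X" using b x(1) by auto
    then have "card (?B' - X) < card (B - X)" using less.prems(2) by (intro psubset_card_mono) auto
    from less.hyps[OF this 1 _ less.prems(3) 2] have "card ?B' \<le> card X" using less.prems(2) by simp
    moreover have "card ?B' = card B" using less.prems(2) b(1) xB
      by (metis Diff_iff card.insert card_Suc_Diff1 finite_Diff)
    ultimately show ?thesis by simp
  qed
qed

lemma acl_indep_finitary:
  assumes "\<And>F. finite F \<Longrightarrow> F \<subseteq> B \<Longrightarrow> acl_indep A F"
  shows "acl_indep A B"
  unfolding acl_indep_def
proof (intro ballI notI)
  fix b assume b: "b \<in> B" "b \<in> acl (A \<union> (B - {b}))"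
  then obtain F where F: "finite F" "F \<subseteq> A \<union> (B - {b})" "b \<in> acl F" using acl_finitary by metis
  let ?G = "insert b (F \<inter> (B - {b}))"
  have "acl_indep A ?G" using F(1) b(1) by (intro assms) auto
  then have "b \<notin> acl (A \<union> (?G - {b}))" unfolding acl_indep_def by simp
  moreover have "F \<subseteq> A \<union> (?G - {b})" using F(2) by auto
  then have "acl F \<subseteq> acl (A \<union> (?G - {b}))" by (rule acl_mono)
  ultimately show False using F(3) by auto
qed

lemma acl_indep_Un:
  assumes "acl_indep A Q" "acl_indep (A \<union> Q) Y" "finite Y"
  shows "acl_indep A (Q \<union> Y) \<and> Q \<inter> Y = {}"
  using assms(3,2)
proof (induction Y rule: finite_induct)
  case empty then show ?case using assms(1) by simp
next
  case (insert y Y)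
  have y: "acl_indep (A \<union> Q) Y" "y \<notin> acl (A \<union> Q \<union> Y)" using acl_indep_insertD[OF insert.prems insert.hyps(2)] by auto
  then have "acl_indep A (insert y (Q \<union> Y))" using insert.IH by (intro acl_indep_insert) (auto simp: Un_assoc)
  moreover have "y \<notin> Q" using y(2) acl_superset[of "A \<union> Q \<union> Y"] by auto
  ultimately show ?case using insert.IH y(1) by auto
qed

lemma linear_order_finite_max:
  assumes "Linear_order r" "finite J" "J \<noteq> {}" "J \<subseteq> Field r"
  shows "\<exists>m\<in>J. \<forall>j\<in>J. (j, m) \<in> r"
  using assms(2-)
proof (induction J rule: finite_ne_induct)
  case (singleton x)
  then show ?case using assms(1)
    by (auto simp: linear_order_on_def partial_order_on_def preorder_on_def refl_on_def)
next
  case (insert x J)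
  then obtain m where m: "m \<in> J" "\<forall>j\<in>J. (j, m) \<in> r" by auto
  have r: "trans r" "total_on (Field r) r" "refl_on (Field r) r"
    using assms(1) by (auto simp: linear_order_on_def partial_order_on_def preorder_on_def)
  have xm: "x \<in> Field r" "m \<in> Field r" using insert.prems m by auto
  show ?case
  proof (cases "(x, m) \<in> r")
    case True then show ?thesis using m by auto
  next
    case False
    then have "x \<noteq> m" using r(3) xm by (auto simp: refl_on_def)
    then have "(m, x) \<in> r" using False r(2) xm by (auto simp: total_on_def)
    moreover have "(x, x) \<in> r" using r(3) xm by (auto simp: refl_on_def)
    ultimately show ?thesis using m r(1) by (intro bexI[of _ x]) (auto dest: transD)
  qed
qed

text \<open>Triangular families are independent. In a finite subfamily the member of largest index
  is new over the others and is adjoined last; independence of infinite families is a condition on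
  finite subfamilies.\<close>

lemma acl_indep_linear_order:
  assumes r: "Linear_order r" and I: "I \<subseteq> Field r"
    and f: "\<And>i. i \<in> I \<Longrightarrow> f i \<notin> acl (A \<union> f ` (I \<inter> underS r i))"
  shows "inj_on f I \<and> acl_indep A (f ` I)"
proof -
  have fin: "inj_on f J \<and> acl_indep A (f ` J)" if "finite J" "J \<subseteq> I" for J
    using that
  proof (induction "card J" arbitrary: J rule: less_induct)
    case less
    show ?case
    proof (cases "J = {}")
      case True then show ?thesis by (simp add: acl_indep_empty)
    next
      case False
      then obtain m where m: "m \<in> J" "\<forall>j\<in>J. (j, m) \<in> r"
        using linear_order_finite_max[OF r less.prems(1)] less.prems(2) I by auto
      let ?J = "J - {m}"
      have IH: "inj_on f ?J \<and> acl_indep A (f ` ?J)"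
        using less.prems card_Diff1_less[OF less.prems(1) m(1)] by (intro less.hyps) auto
      have "?J \<subseteq> I \<inter> underS r m" using m less.prems(2) unfolding underS_def by auto
      then have "acl (A \<union> f ` ?J) \<subseteq> acl (A \<union> f ` (I \<inter> underS r m))" by (intro acl_mono) auto
      then have fm: "f m \<notin> acl (A \<union> f ` ?J)" using f[of m] m(1) less.prems(2) by auto
      then have "f m \<notin> f ` ?J" using acl_superset[of "A \<union> f ` ?J"] by auto
      then have "inj_on f (insert m ?J)" using IH by (simp only: inj_on_insert Diff_insert_absorb Diff_idemp) simp
      moreover have "acl_indep A (f ` insert m ?J)" using acl_indep_insert[OF _ fm] IH unfolding image_insert by blast
      moreover have J: "insert m ?J = J" using m(1) by auto
      ultimately show ?thesis unfolding J by blast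
    qed
  qed
  have "inj_on f I"
  proof (rule inj_onI)
    fix x y assume xy: "x \<in> I" "y \<in> I" "f x = f y"
    then have "finite {x, y}" "{x, y} \<subseteq> I" by simp_all
    then have "inj_on f {x, y}" using fin by blast
    from inj_onD[OF this, of x y] show "x = y" using xy(3) by simp
  qed
  moreover have "acl_indep A (f ` I)"
  proof (rule acl_indep_finitary)
    fix F assume "finite F" "F \<subseteq> f ` I"
    then obtain J where "J \<subseteq> I" "finite J" "F = f ` J" by (meson finite_subset_image)
    then show "acl_indep A F" using fin by auto
  qed
  ultimately show ?thesis by blast
qed

lemma acl_basis_finite:
  assumes "finite X"
  shows "\<exists>B. B \<subseteq> X \<and> acl_indep A B \<and> X \<subseteq> acl (A \<union> B)"
  using assms
proof (induction X rule: finite_induct)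
  case empty then show ?case using acl_indep_empty by blast
next
  case (insert x X)
  then obtain B where B: "B \<subseteq> X" "acl_indep A B" "X \<subseteq> acl (A \<union> B)" by auto
  show ?case
  proof (cases "x \<in> acl (A \<union> B)")
    case True then show ?thesis using B by (intro exI[of _ B]) auto
  next
    case False
    have "acl (A \<union> B) \<subseteq> acl (A \<union> insert x B)" by (rule acl_mono) auto
    moreover have "x \<in> acl (A \<union> insert x B)" using acl_superset[of "A \<union> insert x B"] by auto
    ultimately show ?thesis using B acl_indep_insert[OF B(2) False] by (intro exI[of _ "insert x B"]) auto
  qed
qed

text \<open>A maximal independent set has everything in its closure, since an element outside could
  still be adjoined.\<close>

lemma acl_basis_exists:
  obtains X where "acl_indep A X" "acl (A \<union> X) = UNIV"
proof -
  let ?P = "{X. acl_indep A X}"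
  have "\<exists>M\<in>?P. \<forall>X\<in>?P. M \<subseteq> X \<longrightarrow> X = M"
  proof (rule subset_Zorn_nonempty)
    show "?P \<noteq> {}" using acl_indep_empty by auto
    fix \<C> assume C: "\<C> \<noteq> {}" "subset.chain ?P \<C>"
    have "acl_indep A (\<Union>\<C>)"
    proof (rule acl_indep_finitary)
      fix F assume F: "finite F" "F \<subseteq> \<Union>\<C>"
      obtain X where X: "X \<in> \<C>" "F \<subseteq> X"
        using finite_subset_Union_chain[OF F C(1)] C(2) by auto
      then have "acl_indep A X" using C(2) unfolding subset_chain_def by auto
      then show "acl_indep A F" using X(2) acl_indep_mono acl_superset by metis
    qed
    then show "\<Union>\<C> \<in> ?P" by simp
  qed
  then obtain M where M: "acl_indep A M" "\<And>X. acl_indep A X \<Longrightarrow> M \<subseteq> X \<Longrightarrow> X = M" by auto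
  have "acl (A \<union> M) = UNIV"
  proof (rule ccontr)
    assume "acl (A \<union> M) \<noteq> UNIV"
    then obtain x where x: "x \<notin> acl (A \<union> M)" by auto
    then have "insert x M = M" using M acl_indep_insert by (metis subset_insertI)
    then show False using x acl_superset[of "A \<union> M"] by auto
  qed
  then show thesis using that M(1) by blast
qed

section \<open>Countable closures\<close>

lemma countable_subfield_closure:
  assumes "countable A" shows "\<exists>S. is_subfield S \<and> A \<subseteq> S \<and> countable S"
proof -
  define step :: "'a set \<Rightarrow> 'a set" where
    "step G = G \<union> (\<lambda>(x, y). x + y) ` (G \<times> G) \<union> (\<lambda>(x, y). x - y) ` (G \<times> G)
       \<union> (\<lambda>(x, y). x * y) ` (G \<times> G) \<union> inverse ` G" for G
  define G where "G n = (step ^^ n) (A \<union> {0, 1})" for n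
  have cG: "countable (G n)" for n
    by (induction n) (auto simp: G_def step_def assms)
  have incr: "G n \<subseteq> G (Suc n)" for n by (auto simp: G_def step_def)
  have mono: "G m \<subseteq> G n" if "m \<le> n" for m n using lift_Suc_mono_le[of G, OF incr that] .
  let ?S = "\<Union>n. G n"
  have ops: "x + y \<in> ?S \<and> x - y \<in> ?S \<and> x * y \<in> ?S \<and> inverse x \<in> ?S" if xy: "x \<in> ?S" "y \<in> ?S" for x y
  proof -
    obtain m n where "x \<in> G m" "y \<in> G n" using xy by auto
    then have "x \<in> G (max m n)" "y \<in> G (max m n)" using mono[of m "max m n"] mono[of n "max m n"] by auto
    then have "x + y \<in> G (Suc (max m n)) \<and> x - y \<in> G (Suc (max m n)) \<and> x * y \<in> G (Suc (max m n))
      \<and> inverse x \<in> G (Suc (max m n))"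
      unfolding G_def step_def by auto
    then show ?thesis by blast
  qed
  have "A \<union> {0, 1} = G 0" by (simp add: G_def)
  then have G0: "A \<union> {0, 1} \<subseteq> ?S" by blast
  then have "is_subfield ?S" using ops unfolding is_subfield_def by simp
  then show ?thesis using G0 cG by (intro exI[of _ ?S]) auto
qed

text \<open>Every algebraic element is a root of one of countably many nonzero polynomials, coded by
  lists over a countable subfield.\<close>

lemma countable_acl:
  assumes "countable A" shows "countable (acl A)"
proof -
  obtain S where S: "is_subfield S" "A \<subseteq> S" "countable S" using countable_subfield_closure[OF assms] by blast
  have g: "gen_field A \<subseteq> S" by (rule gen_field_least[OF S(1,2)])
  have "acl A \<subseteq> (\<Union>xs\<in>{xs \<in> lists S. Poly xs \<noteq> 0}. {x. poly (Poly xs) x = 0})"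
  proof
    fix x assume "x \<in> acl A"
    then obtain p where p: "p \<noteq> 0" "coeffs_in S p" "poly p x = 0"
      unfolding acl_def algover_def using coeffs_in_mono[OF _ g] by auto
    have "set (coeffs p) \<subseteq> range (coeff p)" unfolding range_coeff by auto
    then have "coeffs p \<in> lists S" using p(2) unfolding coeffs_in_def by auto
    then show "x \<in> (\<Union>xs\<in>{xs \<in> lists S. Poly xs \<noteq> 0}. {x. poly (Poly xs) x = 0})"
      using p by (intro UN_I[of "coeffs p"]) auto
  qed
  moreover have "countable (\<Union>xs\<in>{xs \<in> lists S. Poly xs \<noteq> 0}. {x. poly (Poly xs) x = 0})"
    by (intro countable_UN countable_subset[OF _ countable_lists[OF S(3)]])
      (auto intro: countable_finite poly_roots_finite)
  ultimately show ?thesis by (rule countable_subset)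
qed

section \<open>Polynomial functions in several variables\<close>

lemma mpeval_superset:
  assumes "finite T" "{\<alpha>. c \<alpha> \<noteq> 0} \<subseteq> T"
  shows "mpeval m c p = (\<Sum>\<alpha>\<in>T. c \<alpha> * (\<Prod>i<m. p i ^ \<alpha> i))"
  unfolding mpeval_def by (rule sum.mono_neutral_left) (use assms in auto)

lemma mpeval_cong:
  assumes "\<And>i. i < m \<Longrightarrow> p i = q i" shows "mpeval m c p = mpeval m c q"
  unfolding mpeval_def using assms by (intro sum.cong arg_cong2[where f="(*)"] prod.cong) auto

text \<open>Polynomials are handled as functions with the coefficients hidden by an existential
  quantifier, so that sums, products and compositions can be formed without computing with exponent
  vectors.\<close>

definition pfun :: "'a::field set \<Rightarrow> nat \<Rightarrow> ((nat \<Rightarrow> 'a) \<Rightarrow> 'a) \<Rightarrow> bool" where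
  "pfun F m f \<longleftrightarrow> (\<exists>c. is_mpoly F m c \<and> (\<forall>p. mpeval m c p = f p))"

lemma pfunI: "is_mpoly F m c \<Longrightarrow> pfun F m (mpeval m c)"
  unfolding pfun_def by blast

lemma pfun_mono: "pfun F m f \<Longrightarrow> F \<subseteq> G \<Longrightarrow> pfun G m f"
  unfolding pfun_def is_mpoly_def by blast

lemma pfun_monomial:
  assumes F: "is_subring F" and "a \<in> F" and "\<And>i. i \<ge> m \<Longrightarrow> \<beta> i = 0"
  shows "pfun F m (\<lambda>p. a * (\<Prod>i<m. p i ^ \<beta> i))"
  unfolding pfun_def
proof (intro exI conjI allI)
  let ?c = "\<lambda>\<alpha>. if \<alpha> = \<beta> then a else 0"
  have s: "{\<alpha>. ?c \<alpha> \<noteq> 0} \<subseteq> {\<beta>}" by auto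
  show "is_mpoly F m ?c" unfolding is_mpoly_def using assms subring_0[OF F] finite_subset[OF s] by auto
  show "mpeval m ?c p = a * (\<Prod>i<m. p i ^ \<beta> i)" for p by (subst mpeval_superset[OF _ s]) auto
qed

lemma pfun_const: "is_subring F \<Longrightarrow> a \<in> F \<Longrightarrow> pfun F m (\<lambda>p. a)"
  using pfun_monomial[of F a m "\<lambda>_. 0"] by simp

lemma pfun_coord:
  assumes "is_subring F" "i < m" shows "pfun F m (\<lambda>p. p i)"
proof -
  have "(\<Prod>j<m. p j ^ (if j = i then 1 else 0)) = p i" for p :: "nat \<Rightarrow> 'a"
    using assms(2) by (subst prod.remove[of _ i]) auto
  then show ?thesis
    using pfun_monomial[OF assms(1) subring_1[OF assms(1)], of m "\<lambda>j. if j = i then 1 else 0"] assms(2) by simp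
qed

lemma pfun_add:
  assumes F: "is_subring F" and "pfun F m f" "pfun F m g"
  shows "pfun F m (\<lambda>p. f p + g p)"
proof -
  obtain c d where c: "is_mpoly F m c" "\<And>p. mpeval m c p = f p" and d: "is_mpoly F m d" "\<And>p. mpeval m d p = g p"
    using assms(2,3) unfolding pfun_def by metis
  let ?T = "{\<alpha>. c \<alpha> \<noteq> 0} \<union> {\<alpha>. d \<alpha> \<noteq> 0}"
  have T: "finite ?T" using c(1) d(1) unfolding is_mpoly_def by auto
  let ?e = "\<lambda>\<alpha>. c \<alpha> + d \<alpha>"
  have s: "{\<alpha>. ?e \<alpha> \<noteq> 0} \<subseteq> ?T" by auto
  have "?e \<alpha> \<in> F" for \<alpha> using c(1) d(1) subring_add[OF F] unfolding is_mpoly_def by simp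
  moreover have "\<alpha> i = 0" if "?e \<alpha> \<noteq> 0" "i \<ge> m" for \<alpha> i
  proof -
    have "c \<alpha> \<noteq> 0 \<or> d \<alpha> \<noteq> 0" using that(1) by auto
    then show ?thesis using c(1) d(1) that(2) unfolding is_mpoly_def by blast
  qed
  ultimately have "is_mpoly F m ?e" using finite_subset[OF s T] unfolding is_mpoly_def by simp
  moreover have "mpeval m ?e p = f p + g p" for p
    using mpeval_superset[OF T s, of m p] mpeval_superset[OF T, of c m p] mpeval_superset[OF T, of d m p] c(2) d(2)
    by (simp add: sum.distrib distrib_right)
  ultimately show ?thesis unfolding pfun_def by blast
qed

lemma pfun_sum: "is_subring F \<Longrightarrow> (\<And>i. i \<in> I \<Longrightarrow> pfun F m (f i)) \<Longrightarrow> pfun F m (\<lambda>p. \<Sum>i\<in>I. f i p)"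
  by (induction I rule: infinite_finite_induct) (auto intro: pfun_const pfun_add subring_0)

lemma pfun_mult:
  assumes F: "is_subring F" and "pfun F m f" "pfun F m g"
  shows "pfun F m (\<lambda>p. f p * g p)"
proof -
  obtain c d where c: "is_mpoly F m c" "\<And>p. mpeval m c p = f p" and d: "is_mpoly F m d" "\<And>p. mpeval m d p = g p"
    using assms(2,3) unfolding pfun_def by auto
  have "f p * g p = (\<Sum>\<alpha>\<in>{\<alpha>. c \<alpha> \<noteq> 0}. \<Sum>\<beta>\<in>{\<beta>. d \<beta> \<noteq> 0}. c \<alpha> * d \<beta> * (\<Prod>i<m. p i ^ (\<alpha> i + \<beta> i)))" for p
    unfolding c(2)[symmetric] d(2)[symmetric] mpeval_def sum_product
    by (simp add: power_add prod.distrib algebra_simps)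
  moreover have "pfun F m (\<lambda>p. \<Sum>\<alpha>\<in>{\<alpha>. c \<alpha> \<noteq> 0}. \<Sum>\<beta>\<in>{\<beta>. d \<beta> \<noteq> 0}. c \<alpha> * d \<beta> * (\<Prod>i<m. p i ^ (\<alpha> i + \<beta> i)))"
    using c(1) d(1) unfolding is_mpoly_def
    by (intro pfun_sum[OF F] pfun_monomial[OF F] subring_mult[OF F]) auto
  ultimately show ?thesis by simp
qed

lemma pfun_power: "is_subring F \<Longrightarrow> pfun F m f \<Longrightarrow> pfun F m (\<lambda>p. f p ^ n)"
  by (induction n) (auto intro: pfun_const pfun_mult subring_1)

lemma pfun_prod: "is_subring F \<Longrightarrow> (\<And>i. i \<in> I \<Longrightarrow> pfun F m (f i)) \<Longrightarrow> pfun F m (\<lambda>p. \<Prod>i\<in>I. f i p)"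
  by (induction I rule: infinite_finite_induct) (auto intro: pfun_const pfun_mult subring_1)

lemma pfun_scale: "is_subring F \<Longrightarrow> a \<in> F \<Longrightarrow> pfun F m f \<Longrightarrow> pfun F m (\<lambda>p. a * f p)"
  using pfun_mult[OF _ pfun_const] by blast

lemma pfun_diff: "is_subring F \<Longrightarrow> pfun F m f \<Longrightarrow> pfun F m g \<Longrightarrow> pfun F m (\<lambda>p. f p - g p)"
  using pfun_add[of F m f "\<lambda>p. (-1) * g p"] pfun_scale[of F "-1" m g]
  by (simp add: subring_uminus subring_1)

lemma pfun_compose:
  assumes F: "is_subring F" and f: "pfun F k f" and g: "\<And>i. i < k \<Longrightarrow> pfun F m (g i)"
  shows "pfun F m (\<lambda>p. f (\<lambda>i. g i p))"
proof -
  obtain c where c: "is_mpoly F k c" "\<And>p. mpeval k c p = f p" using f unfolding pfun_def by auto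
  have "pfun F m (\<lambda>p. \<Sum>\<alpha>\<in>{\<alpha>. c \<alpha> \<noteq> 0}. c \<alpha> * (\<Prod>i<k. g i p ^ \<alpha> i))"
    using c(1) g unfolding is_mpoly_def
    by (intro pfun_sum[OF F] pfun_scale[OF F] pfun_prod[OF F] pfun_power[OF F]) auto
  then show ?thesis unfolding c(2)[symmetric] mpeval_def .
qed

lemma pfun_in_subring:
  assumes F: "is_subring F" and f: "pfun F m f" and p: "\<And>i. i < m \<Longrightarrow> p i \<in> F"
  shows "f p \<in> F"
proof -
  obtain c where c: "is_mpoly F m c" "\<And>p. mpeval m c p = f p" using f unfolding pfun_def by auto
  show ?thesis unfolding c(2)[symmetric] mpeval_def using c(1) p unfolding is_mpoly_def
    by (intro subring_sum[OF F] subring_mult[OF F] subring_prod[OF F] subring_power[OF F]) auto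
qed

text \<open>Lets a polynomial function over the whole field be placed over a countable subfield,
  where generic points are available.\<close>

lemma pfun_finitely_many_coeffs:
  assumes "pfun F m f" shows "\<exists>G. finite G \<and> G \<subseteq> F \<and> (\<forall>H. is_subring H \<longrightarrow> G \<subseteq> H \<longrightarrow> pfun H m f)"
proof -
  obtain c where c: "is_mpoly F m c" "\<And>p. mpeval m c p = f p" using assms unfolding pfun_def by auto
  let ?G = "c ` {\<alpha>. c \<alpha> \<noteq> 0}"
  have "pfun H m f" if H: "is_subring H" "?G \<subseteq> H" for H
  proof -
    have "c \<alpha> \<in> H" for \<alpha> using H subring_0[OF H(1)] by (cases "c \<alpha> = 0") auto
    then have "is_mpoly H m c" using c(1) unfolding is_mpoly_def by auto
    then show ?thesis using c(2) unfolding pfun_def by blast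
  qed
  moreover have "finite ?G" "?G \<subseteq> F" using c(1) unfolding is_mpoly_def by auto
  ultimately show ?thesis by blast
qed

text \<open>The coefficient of the \<open>k\<close>-th power of the variable with index
  \<open>m\<close>. The value 0 for \<open>\<alpha> m \<noteq> 0\<close> makes it a polynomial in
  the variables of smaller index.\<close>

definition slice :: "nat \<Rightarrow> ((nat \<Rightarrow> nat) \<Rightarrow> 'a::field) \<Rightarrow> nat \<Rightarrow> (nat \<Rightarrow> nat) \<Rightarrow> 'a" where
  "slice m c k = (\<lambda>\<alpha>. if \<alpha> m = 0 then c (\<alpha>(m := k)) else 0)"

lemma is_mpoly_slice:
  assumes F: "is_subring F" and c: "is_mpoly F (Suc m) c"
  shows "is_mpoly F m (slice m c k)"
proof -
  have "{\<alpha>. slice m c k \<alpha> \<noteq> 0} \<subseteq> (\<lambda>\<beta>. \<beta>(m := 0)) ` {\<alpha>. c \<alpha> \<noteq> 0}"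
  proof
    fix \<alpha> assume "\<alpha> \<in> {\<alpha>. slice m c k \<alpha> \<noteq> 0}"
    then have "\<alpha> m = 0" "c (\<alpha>(m := k)) \<noteq> 0" by (auto simp: slice_def split: if_splits)
    then show "\<alpha> \<in> (\<lambda>\<beta>. \<beta>(m := 0)) ` {\<alpha>. c \<alpha> \<noteq> 0}"
      by (intro image_eqI[of _ _ "\<alpha>(m := k)"]) auto
  qed
  then have "finite {\<alpha>. slice m c k \<alpha> \<noteq> 0}" using c finite_subset unfolding is_mpoly_def by blast
  moreover have "\<alpha> i = 0" if "slice m c k \<alpha> \<noteq> 0" "i \<ge> m" for \<alpha> i
  proof (cases "i = m")
    case True then show ?thesis using that by (auto simp: slice_def split: if_splits)
  next
    case False
    have "c (\<alpha>(m := k)) \<noteq> 0" using that by (auto simp: slice_def split: if_splits)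
    then have "(\<alpha>(m := k)) i = 0" using c that False unfolding is_mpoly_def by auto
    then show ?thesis using False by simp
  qed
  moreover have "slice m c k \<alpha> \<in> F" for \<alpha>
    using c subring_0[OF F] unfolding is_mpoly_def slice_def by simp
  ultimately show ?thesis unfolding is_mpoly_def by simp
qed

lemma mpeval_Suc:
  assumes c: "is_mpoly F (Suc m) c" and N: "\<And>\<alpha>. c \<alpha> \<noteq> 0 \<Longrightarrow> \<alpha> m \<le> N"
  shows "mpeval (Suc m) c p = (\<Sum>k\<le>N. mpeval m (slice m c k) p * p m ^ k)"
proof -
  let ?T = "{\<alpha>. c \<alpha> \<noteq> 0}"
  have fT: "finite ?T" using c unfolding is_mpoly_def by auto
  have "mpeval (Suc m) c p = (\<Sum>k\<le>N. \<Sum>\<alpha>\<in>{\<alpha> \<in> ?T. \<alpha> m = k}. c \<alpha> * (\<Prod>i<Suc m. p i ^ \<alpha> i))"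
    unfolding mpeval_def using N by (subst sum.group[OF fT]) auto
  also have "\<dots> = (\<Sum>k\<le>N. mpeval m (slice m c k) p * p m ^ k)"
  proof (rule sum.cong)
    fix k
    have "bij_betw (\<lambda>\<alpha>. \<alpha>(m := k)) {\<alpha>. slice m c k \<alpha> \<noteq> 0} {\<alpha> \<in> ?T. \<alpha> m = k}"
      by (rule bij_betw_byWitness[where f'="\<lambda>\<alpha>. \<alpha>(m := 0)"]) (auto simp: slice_def split: if_splits)
    then have "(\<Sum>\<alpha>\<in>{\<alpha> \<in> ?T. \<alpha> m = k}. c \<alpha> * (\<Prod>i<Suc m. p i ^ \<alpha> i)) =
        (\<Sum>\<alpha>\<in>{\<alpha>. slice m c k \<alpha> \<noteq> 0}. c (\<alpha>(m := k)) * (\<Prod>i<Suc m. p i ^ (\<alpha>(m := k)) i))"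
      by (rule sum.reindex_bij_betw[symmetric])
    also have "\<dots> = (\<Sum>\<alpha>\<in>{\<alpha>. slice m c k \<alpha> \<noteq> 0}. slice m c k \<alpha> * (\<Prod>i<m. p i ^ \<alpha> i) * p m ^ k)"
      by (intro sum.cong) (auto simp: slice_def split: if_splits)
    finally show "(\<Sum>\<alpha>\<in>{\<alpha> \<in> ?T. \<alpha> m = k}. c \<alpha> * (\<Prod>i<Suc m. p i ^ \<alpha> i)) = mpeval m (slice m c k) p * p m ^ k"
      by (simp add: mpeval_def sum_distrib_right)
  qed simp
  finally show ?thesis .
qed

lemma mpoly_degree_bound:
  assumes "is_mpoly F n c" shows "\<exists>N. \<forall>\<alpha>. c \<alpha> \<noteq> 0 \<longrightarrow> \<alpha> m \<le> N"
proof -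
  have "finite ((\<lambda>\<alpha>. \<alpha> m) ` {\<alpha>. c \<alpha> \<noteq> 0})" using assms unfolding is_mpoly_def by auto
  then show ?thesis by (intro exI[of _ "Max ((\<lambda>\<alpha>. \<alpha> m) ` {\<alpha>. c \<alpha> \<noteq> 0})"]) auto
qed

lemma slice_nonzero: "c \<alpha> \<noteq> 0 \<Longrightarrow> slice m c (\<alpha> m) (\<alpha>(m := 0)) \<noteq> 0"
  by (simp add: slice_def)

text \<open>The inverse of slicing: prescribed coefficients of the powers up to \<open>N\<close> are
  put together to a polynomial in one more variable.\<close>

lemma mpoly_assemble:
  assumes F: "is_subring F" and d: "\<And>k. is_mpoly F m (d k)"
  shows "\<exists>c. is_mpoly F (Suc m) c \<and> (\<forall>k\<le>N. slice m c k = d k) \<and> (\<forall>\<alpha>. c \<alpha> \<noteq> 0 \<longrightarrow> \<alpha> m \<le> N)"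
proof -
  define c where "c \<alpha> = (if \<alpha> m \<le> N then d (\<alpha> m) (\<alpha>(m := 0)) else 0)" for \<alpha>
  have "{\<alpha>. c \<alpha> \<noteq> 0} \<subseteq> (\<Union>k\<le>N. (\<lambda>\<beta>. \<beta>(m := k)) ` {\<alpha>. d k \<alpha> \<noteq> 0})"
  proof
    fix \<alpha> assume "\<alpha> \<in> {\<alpha>. c \<alpha> \<noteq> 0}"
    then have "\<alpha> m \<le> N" "d (\<alpha> m) (\<alpha>(m := 0)) \<noteq> 0" by (auto simp: c_def split: if_splits)
    then show "\<alpha> \<in> (\<Union>k\<le>N. (\<lambda>\<beta>. \<beta>(m := k)) ` {\<alpha>. d k \<alpha> \<noteq> 0})"
      by (intro UN_I[of "\<alpha> m"] image_eqI[of _ _ "\<alpha>(m := 0)"]) auto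
  qed
  moreover have "finite (\<Union>k\<le>N. (\<lambda>\<beta>. \<beta>(m := k)) ` {\<alpha>. d k \<alpha> \<noteq> 0})"
    using d unfolding is_mpoly_def by auto
  ultimately have fin: "finite {\<alpha>. c \<alpha> \<noteq> 0}" by (rule finite_subset)
  have z: "\<alpha> i = 0" if "c \<alpha> \<noteq> 0" "i \<ge> Suc m" for \<alpha> i
  proof -
    have "d (\<alpha> m) (\<alpha>(m := 0)) \<noteq> 0" using that by (auto simp: c_def split: if_splits)
    then have "(\<alpha>(m := 0)) i = 0" using d that(2) unfolding is_mpoly_def by (metis Suc_leD)
    then show ?thesis using that(2) by (auto split: if_splits)
  qed
  have 1: "is_mpoly F (Suc m) c" unfolding is_mpoly_def using fin z d subring_0[OF F]
    by (auto simp: c_def is_mpoly_def)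
  have 2: "slice m c k = d k" if "k \<le> N" for k
  proof
    fix \<alpha>
    show "slice m c k \<alpha> = d k \<alpha>"
    proof (cases "\<alpha> m = 0")
      case True
      then have "\<alpha>(m := 0) = \<alpha>" by (metis fun_upd_triv)
      then show ?thesis using that True by (simp add: slice_def c_def)
    next
      case False
      then have "d k \<alpha> = 0" using d[of k] unfolding is_mpoly_def by auto
      then show ?thesis using False by (simp add: slice_def)
    qed
  qed
  have 3: "\<alpha> m \<le> N" if "c \<alpha> \<noteq> 0" for \<alpha> using that by (auto simp: c_def split: if_splits)
  show ?thesis using 1 2 3 by blast
qed

section \<open>Transcendence degree expressed by algebraic closure\<close>

lemma alg_indep_Nil: "alg_indep F []"
  unfolding alg_indep_def
proof (intro allI impI)
  fix c \<alpha> assume c: "is_mpoly F (length []) c \<and> mpeval (length []) c (\<lambda>i. [] ! i) = 0"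
  have s: "{\<alpha>. c \<alpha> \<noteq> 0} \<subseteq> {\<lambda>_. 0}" using c unfolding is_mpoly_def by auto
  have "c (\<lambda>_. 0) = 0" using c mpeval_superset[OF _ s, of 0] by auto
  then show "c \<alpha> = 0" using s by auto
qed

text \<open>Sorted by powers of the last variable, a relation among \<open>bs @ [b]\<close> is an
  equation for \<open>b\<close> whose coefficients are values at \<open>bs\<close> of polynomials
  over \<open>F\<close>. If \<open>bs\<close> is independent, such a value is 0 only for the zero
  polynomial.\<close>

lemma alg_indep_snoc:
  assumes F: "is_subfield F"
  shows "alg_indep F (bs @ [b]) \<longleftrightarrow> alg_indep F bs \<and> b \<notin> acl (F \<union> set bs)"
proof -
  note R = subfield_subring[OF F]
  define n where "n = length bs"
  define e where "e = (\<lambda>i. bs ! i)"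
  define e' where "e' = (\<lambda>i. (bs @ [b]) ! i)"
  have ee: "mpeval n c e' = mpeval n c e" for c
    by (rule mpeval_cong) (auto simp: e_def e'_def n_def nth_append)
  have e'n: "e' n = b" by (simp add: e'_def n_def nth_append)
  \<comment> \<open>The ring generated by \<open>F\<close> and \<open>bs\<close>, presented by
    polynomials, so that an equation of \<open>b\<close> with cleared denominators can be turned
    back into a relation.\<close>
  let ?R = "{f e |f. pfun F n f}"
  have Rr: "is_subring ?R"
  proof -
    have "0 \<in> ?R" "1 \<in> ?R" using pfun_const[OF R subring_0[OF R], of n] pfun_const[OF R subring_1[OF R], of n] by auto
    moreover have "x + y \<in> ?R \<and> x - y \<in> ?R \<and> x * y \<in> ?R" if xy: "x \<in> ?R" "y \<in> ?R" for x y
    proof -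
      obtain f g where fg: "pfun F n f" "pfun F n g" "x = f e" "y = g e" using xy by auto
      show ?thesis using pfun_add[OF R fg(1,2)] pfun_diff[OF R fg(1,2)] pfun_mult[OF R fg(1,2)] unfolding fg(3,4) by auto
    qed
    ultimately show ?thesis unfolding is_subring_def by auto
  qed
  have sup: "F \<union> set bs \<subseteq> ?R"
  proof
    fix x assume "x \<in> F \<union> set bs"
    then consider "x \<in> F" | i where "i < n" "x = bs ! i" by (auto simp: in_set_conv_nth n_def)
    then show "x \<in> ?R"
    proof cases
      case 1 then show ?thesis using pfun_const[OF R, of x n] by auto
    next
      case 2 then show ?thesis using pfun_coord[OF R, of i n] by (auto simp: e_def)
    qed
  qed
  let ?S = "acl (F \<union> set bs)"
  have e_in: "e i \<in> ?S" if "i < n" for i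
    using that acl_superset[of "F \<union> set bs"] by (auto simp: e_def n_def)
  show ?thesis
  proof
    assume L: "alg_indep F (bs @ [b])"
    have L': "c = (\<lambda>_. 0)" if "is_mpoly F (Suc n) c" "mpeval (Suc n) c e' = 0" for c
      using L that unfolding alg_indep_def by (auto simp: n_def e'_def)
    have "c = (\<lambda>_. 0)" if c: "is_mpoly F n c" "mpeval n c e = 0" for c
    proof -
      obtain d where d: "is_mpoly F (Suc n) d" "\<forall>k\<le>0. slice n d k = c" "\<forall>\<alpha>. d \<alpha> \<noteq> 0 \<longrightarrow> \<alpha> n \<le> 0"
        using mpoly_assemble[OF R, of n "\<lambda>_. c" 0] c(1) by auto
      have "mpeval (Suc n) d e' = mpeval n c e'" using mpeval_Suc[OF d(1), of 0] d by simp
      then have "d = (\<lambda>_. 0)" using L'[OF d(1)] c(2) ee by simp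
      then have "slice n d 0 = (\<lambda>_. 0)" by (simp add: slice_def fun_eq_iff)
      then show ?thesis using d(2) by simp
    qed
    then have 1: "alg_indep F bs" unfolding alg_indep_def by (auto simp: n_def e_def)
    have 2: "b \<notin> ?S"
    proof
      assume "b \<in> ?S"
      then obtain p where p: "p \<noteq> 0" "coeffs_in ?R p" "poly p b = 0"
        using acl_clear_denominators[OF Rr] sup fracs_superset[OF Rr] unfolding algover_def by (meson order_trans)
      have "\<forall>k. \<exists>c. is_mpoly F n c \<and> mpeval n c e = coeff p k"
      proof
        fix k
        obtain f where "pfun F n f" "coeff p k = f e" using p(2) unfolding coeffs_in_def by auto
        then show "\<exists>c. is_mpoly F n c \<and> mpeval n c e = coeff p k" unfolding pfun_def by auto
      qed
      then obtain d where d: "\<And>k. is_mpoly F n (d k)" "\<And>k. mpeval n (d k) e = coeff p k" by metis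
      obtain c where c: "is_mpoly F (Suc n) c" "\<forall>k\<le>degree p. slice n c k = d k" "\<forall>\<alpha>. c \<alpha> \<noteq> 0 \<longrightarrow> \<alpha> n \<le> degree p"
        using mpoly_assemble[OF R, of n d "degree p"] d(1) by auto
      have "mpeval (Suc n) c e' = (\<Sum>k\<le>degree p. mpeval n (slice n c k) e' * e' n ^ k)"
        using c by (intro mpeval_Suc[OF c(1)]) auto
      also have "\<dots> = (\<Sum>k\<le>degree p. coeff p k * b ^ k)"
        using c(2) d(2) ee e'n by (intro sum.cong) auto
      also have "\<dots> = 0" using p(3) by (simp add: poly_altdef)
      finally have "c = (\<lambda>_. 0)" using L'[OF c(1)] by simp
      then have "slice n c (degree p) = (\<lambda>_. 0)" by (simp add: slice_def fun_eq_iff)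
      then have "d (degree p) = (\<lambda>_. 0)" using c(2) by simp
      then have "coeff p (degree p) = 0" using d(2)[of "degree p"] by (simp add: mpeval_def)
      then show False using p(1) by simp
    qed
    show "alg_indep F bs \<and> b \<notin> ?S" using 1 2 by simp
  next
    assume H: "alg_indep F bs \<and> b \<notin> ?S"
    have "c = (\<lambda>_. 0)" if c: "is_mpoly F (Suc n) c" "mpeval (Suc n) c e' = 0" for c
    proof (rule ccontr)
      assume "c \<noteq> (\<lambda>_. 0)"
      then obtain \<alpha> where a: "c \<alpha> \<noteq> 0" by auto
      obtain N where N: "\<And>\<alpha>. c \<alpha> \<noteq> 0 \<Longrightarrow> \<alpha> n \<le> N" using mpoly_degree_bound[OF c(1)] by auto
      let ?p = "\<Sum>k\<le>N. monom (mpeval n (slice n c k) e) k"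
      have "mpeval n (slice n c k) e \<in> ?S" for k
      proof (rule pfun_in_subring[OF subring_acl _ e_in])
        have "pfun F n (mpeval n (slice n c k))" by (rule pfunI[OF is_mpoly_slice[OF R c(1)]])
        then show "pfun ?S n (mpeval n (slice n c k))"
          by (rule pfun_mono) (use acl_superset[of "F \<union> set bs"] in auto)
      qed
      then have pS: "coeffs_in ?S ?p" by (intro coeffs_in_sum coeffs_in_monom subring_acl)
      have "poly ?p b = mpeval (Suc n) c e'"
        using mpeval_Suc[OF c(1), of N e'] N by (simp add: poly_sum poly_monom ee e'n)
      then have "poly ?p b = 0" using c(2) by simp
      then have "?p = 0" using rclosed_root[OF rclosed_acl _ pS] H by auto
      then have "coeff ?p (\<alpha> n) = 0" by simp
      then have "mpeval n (slice n c (\<alpha> n)) e = 0" using N[OF a] by (simp add: coeff_sum)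
      then have "slice n c (\<alpha> n) (\<alpha>(n := 0)) = 0"
        using H is_mpoly_slice[OF R c(1)] unfolding alg_indep_def n_def e_def by blast
      then show False using slice_nonzero[of c \<alpha> n] a by simp
    qed
    then show "alg_indep F (bs @ [b])" unfolding alg_indep_def by (auto simp: n_def e'_def)
  qed
qed

text \<open>Transfers independence of lists to independence of sets; a list with a repetition
  satisfies the relation that two entries are equal.\<close>

lemma alg_indep_iff:
  assumes F: "is_subfield F"
  shows "alg_indep F bs \<longleftrightarrow> distinct bs \<and> acl_indep F (set bs)"
proof (induction bs rule: rev_induct)
  case Nil then show ?case by (simp add: alg_indep_Nil acl_indep_empty)
next
  case (snoc b bs)
  have "b \<notin> set bs" if "b \<notin> acl (F \<union> set bs)" using that acl_superset[of "F \<union> set bs"] by auto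
  then show ?case unfolding alg_indep_snoc[OF F] snoc.IH
    using acl_indep_insert[of F "set bs" b] acl_indep_insertD[of F b "set bs"] by auto
qed

text \<open>The Steinitz bound makes the set of lengths in \<open>trdeg\<close> finite, so that its
  \<open>Max\<close> is meaningful and equals the size of a basis chosen among the entries.\<close>

lemma trdeg_basis:
  assumes F: "is_subfield F"
  shows "\<exists>B. B \<subseteq> set xs \<and> acl_indep F B \<and> card B = trdeg F xs \<and> set xs \<subseteq> acl (F \<union> B)"
proof -
  obtain B where B: "B \<subseteq> set xs" "acl_indep F B" "set xs \<subseteq> acl (F \<union> B)"
    using acl_basis_finite[of "set xs" F] by auto
  have fB: "finite B" using B(1) finite_subset by auto
  have "Max {n. \<exists>bs. set bs \<subseteq> set xs \<and> length bs = n \<and> alg_indep F bs} = card B" (is "Max ?N = _")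
  proof (rule Max_eqI)
    have bd: "n \<le> card B" if "n \<in> ?N" for n
    proof -
      obtain bs where "set bs \<subseteq> set xs" "length bs = n" "distinct bs" "acl_indep F (set bs)"
        using \<open>n \<in> ?N\<close> unfolding alg_indep_iff[OF F] by auto
      then show ?thesis using acl_steinitz[of F "set bs" B] fB B(3) distinct_card[of bs] by auto
    qed
    then show "n \<le> card B" if "n \<in> ?N" for n using that .
    show "finite ?N" by (rule finite_subset[of _ "{..card B}"]) (use bd in blast, simp)
    obtain bs where "set bs = B" "distinct bs" using finite_distinct_list[OF fB] by auto
    then show "card B \<in> ?N" using B distinct_card[of bs] unfolding alg_indep_iff[OF F] by auto
  qed
  then have "card B = trdeg F xs" unfolding trdeg_def by simp
  then show ?thesis using B by (intro exI[of _ B]) simp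
qed

lemma card_le_trdeg:
  assumes F: "is_subfield F" and "acl_indep F B" "finite B" "B \<subseteq> acl (F \<union> set xs)"
  shows "card B \<le> trdeg F xs"
proof -
  obtain C where C: "C \<subseteq> set xs" "card C = trdeg F xs" "set xs \<subseteq> acl (F \<union> C)"
    using trdeg_basis[OF F, of xs] by auto
  have "F \<union> set xs \<subseteq> acl (F \<union> C)" using C(3) acl_superset[of "F \<union> C"] by auto
  then have "acl (F \<union> set xs) \<subseteq> acl (F \<union> C)" by (rule acl_subset)
  then show ?thesis using acl_steinitz[OF assms(2,3), of C] C(1,2) assms(4) finite_subset[OF C(1)] by auto
qed

section \<open>Extension of embeddings\<close>

text \<open>A partial embedding is handled as its graph, a subring of the product of the two fields in
  which either coordinate vanishes only together with the other; this makes the situation symmetric.\<close>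

definition gring :: "('a::field \<times> 'b::field) set \<Rightarrow> bool" where
  "gring G \<longleftrightarrow> (0, 0) \<in> G \<and> (1, 1) \<in> G \<and> (\<forall>x u y v. (x, u) \<in> G \<longrightarrow> (y, v) \<in> G \<longrightarrow>
     (x + y, u + v) \<in> G \<and> (x - y, u - v) \<in> G \<and> (x * y, u * v) \<in> G)"

definition gemb :: "('a::field \<times> 'b::field) set \<Rightarrow> bool" where
  "gemb G \<longleftrightarrow> gring G \<and> (\<forall>x u. (x, u) \<in> G \<longrightarrow> (x = 0 \<longleftrightarrow> u = 0))"

text \<open>A polynomial over the domain of the partial embedding together with its image under
  it.\<close>

definition gpoly :: "('a::field \<times> 'b::field) set \<Rightarrow> 'a poly \<Rightarrow> 'b poly \<Rightarrow> bool" where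
  "gpoly G p q \<longleftrightarrow> (\<forall>i. (coeff p i, coeff q i) \<in> G)"

definition gadjoin :: "('a::field \<times> 'b::field) set \<Rightarrow> 'a \<Rightarrow> 'b \<Rightarrow> ('a \<times> 'b) set" where
  "gadjoin G a u = {(poly p a, poly q u) |p q. gpoly G p q}"

lemma
  assumes "gring G"
  shows gring_0: "(0, 0) \<in> G" and gring_1: "(1, 1) \<in> G"
    and gring_add: "(x, u) \<in> G \<Longrightarrow> (y, v) \<in> G \<Longrightarrow> (x + y, u + v) \<in> G"
    and gring_diff: "(x, u) \<in> G \<Longrightarrow> (y, v) \<in> G \<Longrightarrow> (x - y, u - v) \<in> G"
    and gring_mult: "(x, u) \<in> G \<Longrightarrow> (y, v) \<in> G \<Longrightarrow> (x * y, u * v) \<in> G"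
  using assms unfolding gring_def by simp_all

lemma gring_sum: "gring G \<Longrightarrow> (\<And>i. i \<in> I \<Longrightarrow> (f i, g i) \<in> G) \<Longrightarrow> (sum f I, sum g I) \<in> G"
  by (induction I rule: infinite_finite_induct) (simp_all add: gring_0 gring_add)

lemma gemb_gring: "gemb G \<Longrightarrow> gring G" by (simp add: gemb_def)

lemma gemb_zero_iff: "gemb G \<Longrightarrow> (x, u) \<in> G \<Longrightarrow> x = 0 \<longleftrightarrow> u = 0"
  unfolding gemb_def by blast

lemma gemb_unique:
  assumes "gemb G" "(x, u) \<in> G" "(x, v) \<in> G" shows "u = v"
  using gemb_zero_iff[OF assms(1) gring_diff[OF gemb_gring[OF assms(1)] assms(2,3)]] by simp

lemma gpoly_const: "gring G \<Longrightarrow> (x, u) \<in> G \<Longrightarrow> gpoly G [:x:] [:u:]"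
  unfolding gpoly_def by (simp add: coeff_pCons gring_0 split: nat.split)

lemma gpoly_X: "gring G \<Longrightarrow> gpoly G [:0, 1:] [:0, 1:]"
  unfolding gpoly_def by (simp add: coeff_pCons gring_0 gring_1 split: nat.split)

lemma gpoly_add: "gring G \<Longrightarrow> gpoly G p q \<Longrightarrow> gpoly G p' q' \<Longrightarrow> gpoly G (p + p') (q + q')"
  unfolding gpoly_def by (simp add: gring_add)

lemma gpoly_diff: "gring G \<Longrightarrow> gpoly G p q \<Longrightarrow> gpoly G p' q' \<Longrightarrow> gpoly G (p - p') (q - q')"
  unfolding gpoly_def by (simp add: gring_diff)

lemma gpoly_mult: "gring G \<Longrightarrow> gpoly G p q \<Longrightarrow> gpoly G p' q' \<Longrightarrow> gpoly G (p * p') (q * q')"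
  unfolding gpoly_def coeff_mult by (simp add: gring_sum gring_mult)

lemma gpoly_monom: "gring G \<Longrightarrow> (x, u) \<in> G \<Longrightarrow> gpoly G (monom x n) (monom u n)"
  unfolding gpoly_def by (simp add: gring_0)

lemma gpoly_zero: "gring G \<Longrightarrow> gpoly G 0 0"
  unfolding gpoly_def by (simp add: gring_0)

lemma gpoly_coeff: "gpoly G p q \<Longrightarrow> (coeff p i, coeff q i) \<in> G"
  unfolding gpoly_def by blast

lemma gpoly_degree:
  assumes "gemb G" "gpoly G p q" shows "degree p = degree q" "p = 0 \<longleftrightarrow> q = 0"
proof -
  have *: "coeff p i = 0 \<longleftrightarrow> coeff q i = 0" for i
    using gemb_zero_iff[OF assms(1) gpoly_coeff[OF assms(2)]] .
  show "degree p = degree q" unfolding degree_def * ..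
  show "p = 0 \<longleftrightarrow> q = 0" unfolding poly_eq_iff using * by simp
qed

lemma gring_gadjoin:
  assumes G: "gring G" shows "gring (gadjoin G a u)"
proof -
  have mem: "(poly p a, poly q u) \<in> gadjoin G a u" if "gpoly G p q" for p q
    using that unfolding gadjoin_def by blast
  show ?thesis unfolding gring_def
  proof (intro conjI allI impI)
    show "(0, 0) \<in> gadjoin G a u" using mem[OF gpoly_zero[OF G]] by simp
    show "(1, 1) \<in> gadjoin G a u" using mem[OF gpoly_const[OF G gring_1[OF G]]] by simp
    fix x v y w assume "(x, v) \<in> gadjoin G a u" "(y, w) \<in> gadjoin G a u"
    then obtain p q p' q' where e: "gpoly G p q" "gpoly G p' q'" "x = poly p a" "v = poly q u"
      "y = poly p' a" "w = poly q' u" unfolding gadjoin_def by auto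
    show "(x + y, v + w) \<in> gadjoin G a u" "(x - y, v - w) \<in> gadjoin G a u" "(x * y, v * w) \<in> gadjoin G a u"
      using mem[OF gpoly_add[OF G e(1,2)]] mem[OF gpoly_diff[OF G e(1,2)]] mem[OF gpoly_mult[OF G e(1,2)]]
      unfolding e(3-) by simp_all
  qed
qed

lemma gadjoin_superset:
  assumes G: "gring G" shows "insert (a, u) G \<subseteq> gadjoin G a u"
proof -
  have mem: "(poly p a, poly q u) \<in> gadjoin G a u" if "gpoly G p q" for p q
    using that unfolding gadjoin_def by blast
  have "(x, v) \<in> gadjoin G a u" if "(x, v) \<in> G" for x v using mem[OF gpoly_const[OF G that]] by simp
  moreover have "(a, u) \<in> gadjoin G a u" using mem[OF gpoly_X[OF G]] by simp
  ultimately show ?thesis by auto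
qed

lemma gemb_gadjoin:
  assumes "gemb G" and "\<And>p q. gpoly G p q \<Longrightarrow> poly p a = 0 \<longleftrightarrow> poly q u = 0"
  shows "gemb (gadjoin G a u)"
  unfolding gemb_def
proof (intro conjI allI impI)
  show "gring (gadjoin G a u)" by (rule gring_gadjoin[OF gemb_gring[OF assms(1)]])
  fix x v assume "(x, v) \<in> gadjoin G a u"
  then obtain p q where "gpoly G p q" "x = poly p a" "v = poly q u" unfolding gadjoin_def by auto
  then show "x = 0 \<longleftrightarrow> v = 0" using assms(2) by simp
qed

lemma gadjoin_Domain_Range:
  assumes "gring G"
  shows "Domain (gadjoin G a u) \<subseteq> acl (insert a (Domain G))"
    and "Range (gadjoin G a u) \<subseteq> acl (insert u (Range G))"
proof -
  let ?A = "acl (insert a (Domain G))" and ?B = "acl (insert u (Range G))"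
  have *: "poly p a \<in> ?A \<and> poly q u \<in> ?B" if g: "gpoly G p q" for p q
  proof
    have "coeffs_in ?A p" unfolding coeffs_in_def
    proof
      fix i
      have "coeff p i \<in> Domain G" using gpoly_coeff[OF g, of i] by auto
      then show "coeff p i \<in> ?A" using acl_superset[of "insert a (Domain G)"] by auto
    qed
    then show "poly p a \<in> ?A" using acl_superset[of "insert a (Domain G)"]
      by (intro poly_in_subring[OF subring_acl]) auto
    have "coeffs_in ?B q" unfolding coeffs_in_def
    proof
      fix i
      have "coeff q i \<in> Range G" using gpoly_coeff[OF g, of i] by auto
      then show "coeff q i \<in> ?B" using acl_superset[of "insert u (Range G)"] by auto
    qed
    then show "poly q u \<in> ?B" using acl_superset[of "insert u (Range G)"]
      by (intro poly_in_subring[OF subring_acl]) auto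
  qed
  show "Domain (gadjoin G a u) \<subseteq> ?A" "Range (gadjoin G a u) \<subseteq> ?B"
    using * unfolding gadjoin_def by auto
qed

definition gfrac :: "('a::field \<times> 'b::field) set \<Rightarrow> ('a \<times> 'b) set" where
  "gfrac G = {(x / y, u / v) |x y u v. (x, u) \<in> G \<and> (y, v) \<in> G \<and> y \<noteq> 0}"

lemma gfrac_superset:
  assumes "gring G" shows "G \<subseteq> gfrac G"
proof (rule subrelI)
  fix x u assume "(x, u) \<in> G"
  then show "(x, u) \<in> gfrac G" unfolding gfrac_def using gring_1[OF assms]
    by (intro CollectI exI[of _ x] exI[of _ 1] exI[of _ u]) simp
qed

lemma gemb_gfrac:
  assumes G: "gemb G" shows "gemb (gfrac G)"
proof -
  note R = gemb_gring[OF G]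
  have mem: "(x / y, u / v) \<in> gfrac G" if "(x, u) \<in> G" "(y, v) \<in> G" "y \<noteq> 0" for x y u v
    using that unfolding gfrac_def by blast
  have "gring (gfrac G)" unfolding gring_def
  proof (intro conjI allI impI)
    show "(0, 0) \<in> gfrac G" "(1, 1) \<in> gfrac G" using gfrac_superset[OF R] gring_0[OF R] gring_1[OF R] by auto
    fix x v y w assume "(x, v) \<in> gfrac G" "(y, w) \<in> gfrac G"
    then obtain a b c d a' b' c' d' where e: "x = a / b" "v = a' / b'" "y = c / d" "w = c' / d'"
      "(a, a') \<in> G" "(b, b') \<in> G" "(c, c') \<in> G" "(d, d') \<in> G" "b \<noteq> 0" "d \<noteq> 0"
      unfolding gfrac_def by auto
    have nz: "b' \<noteq> 0" "d' \<noteq> 0" using e gemb_zero_iff[OF G e(6)] gemb_zero_iff[OF G e(8)] by auto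
    have bd: "(b * d, b' * d') \<in> G" "b * d \<noteq> 0" using e gring_mult[OF R] by auto
    have "(a * d + c * b, a' * d' + c' * b') \<in> G" "(a * d - c * b, a' * d' - c' * b') \<in> G" "(a * c, a' * c') \<in> G"
      using e by (auto intro!: gring_add[OF R] gring_diff[OF R] gring_mult[OF R])
    note m = mem[OF this(1) bd] mem[OF this(2) bd] mem[OF this(3) bd]
    have "x + y = (a * d + c * b) / (b * d)" "x - y = (a * d - c * b) / (b * d)" "x * y = (a * c) / (b * d)"
      "v + w = (a' * d' + c' * b') / (b' * d')" "v - w = (a' * d' - c' * b') / (b' * d')" "v * w = (a' * c') / (b' * d')"
      using e nz by (auto simp: field_simps)
    then show "(x + y, v + w) \<in> gfrac G" "(x - y, v - w) \<in> gfrac G" "(x * y, v * w) \<in> gfrac G"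
      using m by simp_all
  qed
  moreover have "x = 0 \<longleftrightarrow> v = 0" if xv: "(x, v) \<in> gfrac G" for x v
  proof -
    obtain a b a' b' where "(x, v) = (a / b, a' / b')" and e: "(a, a') \<in> G" "(b, b') \<in> G" "b \<noteq> 0"
      using xv unfolding gfrac_def by blast
    then have "x = a / b" "v = a' / b'" by simp_all
    then show ?thesis using gemb_zero_iff[OF G e(1)] gemb_zero_iff[OF G e(2)] e(3) by simp
  qed
  ultimately show ?thesis unfolding gemb_def by blast
qed

lemma gfrac_Domain_Range:
  "Domain (gfrac G) \<subseteq> acl (Domain G)" "Range (gfrac G) \<subseteq> acl (Range G)"
  using acl_superset[of "Domain G"] acl_superset[of "Range G"]
  unfolding gfrac_def by (auto intro!: subfield_divide[OF subfield_acl])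

text \<open>One division carried out in both fields at once; closure of the graph under quotients
  supplies corresponding leading coefficients.\<close>

lemma gpoly_division:
  assumes G: "gemb G" and frac: "\<And>x u y v. (x, u) \<in> G \<Longrightarrow> (y, v) \<in> G \<Longrightarrow> y \<noteq> 0 \<Longrightarrow> (x / y, u / v) \<in> G"
    and m: "gpoly G m m'" "m \<noteq> 0" and p: "gpoly G p p'"
  shows "\<exists>s s' r r'. gpoly G s s' \<and> gpoly G r r' \<and> p = s * m + r \<and> p' = s' * m' + r' \<and> (r = 0 \<or> degree r < degree m)"
  using p
proof (induction "if p = 0 then 0 else Suc (degree p)" arbitrary: p p' rule: less_induct)
  case less
  note R = gemb_gring[OF G]
  show ?case
  proof (cases "p = 0 \<or> degree p < degree m")
    case True
    then show ?thesis using less.prems gpoly_zero[OF R]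
      by (intro exI[of _ 0] exI[of _ p] exI[of _ p']) auto
  next
    case False
    let ?n = "degree p - degree m"
    let ?c = "monom (lead_coeff p / lead_coeff m) ?n"
    let ?c' = "monom (coeff p' (degree p) / coeff m' (degree m)) ?n"
    let ?q = "p - ?c * m" and ?q' = "p' - ?c' * m'"
    have c: "gpoly G ?c ?c'" using m(2)
      by (intro gpoly_monom[OF R] frac gpoly_coeff[OF m(1)] gpoly_coeff[OF less.prems]) simp
    have q: "gpoly G ?q ?q'" using c m less.prems by (intro gpoly_diff[OF R] gpoly_mult[OF R])
    have degc: "degree (?c * m) = degree p" using False m by (subst degree_mult_eq) (auto simp: degree_monom_eq)
    have lc: "coeff (?c * m) (degree p) = lead_coeff p"
    proof -
      have "coeff (?c * m) (degree (?c * m)) = lead_coeff ?c * lead_coeff m" by (rule lead_coeff_mult)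
      moreover have "lead_coeff ?c = lead_coeff p / lead_coeff m"
        by (cases "lead_coeff p / lead_coeff m = 0") (auto simp: degree_monom_eq)
      ultimately show ?thesis using degc m by simp
    qed
    have "?q = 0 \<or> degree ?q < degree p"
    proof (rule ccontr)
      assume n: "\<not> ?thesis"
      have "degree ?q \<le> degree p" using degc by (simp add: degree_diff_le)
      then have e: "degree ?q = degree p" using n by auto
      have "coeff ?q (degree p) = 0" using lc by simp
      then have "lead_coeff ?q = 0" unfolding e .
      then have "?q = 0" by (simp only: leading_coeff_0_iff)
      then show False using n by blast
    qed
    then have "(if ?q = 0 then 0 else Suc (degree ?q)) < (if p = 0 then 0 else Suc (degree p))"
      using False by auto
    from less.hyps[OF this q] obtain s s' r r' where sr: "gpoly G s s'" "gpoly G r r'" "?q = s * m + r"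
      "?q' = s' * m' + r'" "r = 0 \<or> degree r < degree m" by blast
    have "gpoly G (?c + s) (?c' + s')" using c sr(1) by (rule gpoly_add[OF R])
    moreover have "p = (?c + s) * m + r" "p' = (?c' + s') * m' + r'"
      using sr(3,4) by (simp_all add: algebra_simps)
    ultimately show ?thesis using sr(2,5) by blast
  qed
qed

text \<open>\<open>u\<close> is a root of the image of a minimal polynomial \<open>m\<close> of
  \<open>a\<close>. For \<open>a\<close> and \<open>u\<close> to satisfy the same equations, an
  equation \<open>k\<close> of least degree for \<open>u\<close> is pulled back and shown to hold
  for \<open>a\<close>; then remainders modulo \<open>k\<close> decide vanishing on both
  sides.\<close>

lemma gemb_adjoin_algebraic:
  fixes G :: "('a::field \<times> 'b::field) set"
  assumes G: "gemb G" and frac: "\<And>x u y v. (x, u) \<in> G \<Longrightarrow> (y, v) \<in> G \<Longrightarrow> y \<noteq> 0 \<Longrightarrow> (x / y, u / v) \<in> G"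
    and ac: "alg_closed_field TYPE('b)" and a: "gpoly G m0 m0'" "m0 \<noteq> 0" "poly m0 a = 0"
  shows "\<exists>u. u \<in> acl (Range G) \<and> gemb (gadjoin G a u)"
proof -
  note R = gemb_gring[OF G]
  let ?P = "\<lambda>n. \<exists>m m'. gpoly G m m' \<and> m \<noteq> 0 \<and> poly m a = 0 \<and> degree m = n"
  have "?P (degree m0)" using a by blast
  then obtain m m' where m: "gpoly G m m'" "m \<noteq> 0" "poly m a = 0" "degree m = (LEAST n. ?P n)"
    using LeastI[of ?P] by blast
  have mmin: "degree m \<le> degree p" if "gpoly G p q" "p \<noteq> 0" "poly p a = 0" for p q
    unfolding m(4) by (rule Least_le) (use that in blast)
  have "degree m > 0"
  proof (rule ccontr)
    assume "\<not> degree m > 0"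
    then obtain c where "m = [:c:]" using degree_eq_zeroE by auto
    then show False using m(2,3) by simp
  qed
  then have "degree m' > 0" using gpoly_degree(1)[OF G m(1)] by simp
  then obtain u where u: "poly m' u = 0" using ac unfolding alg_closed_field_def by blast
  have m'0: "m' \<noteq> 0" using gpoly_degree(2)[OF G m(1)] m(2) by simp
  let ?Q = "\<lambda>n. \<exists>k k'. gpoly G k k' \<and> k \<noteq> 0 \<and> poly k' u = 0 \<and> degree k = n"
  have "?Q (degree m)" using m u by blast
  then obtain k k' where k: "gpoly G k k'" "k \<noteq> 0" "poly k' u = 0" "degree k = (LEAST n. ?Q n)"
    using LeastI[of ?Q] by blast
  have kmin: "degree k \<le> degree p" if "gpoly G p q" "p \<noteq> 0" "poly q u = 0" for p q
    unfolding k(4) by (rule Least_le) (use that in blast)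
  \<comment> \<open>\<open>k\<close> divides \<open>m\<close>. If the cofactor vanished at
    \<open>a\<close>, minimality of \<open>m\<close> would force \<open>k\<close> to be constant,
    but a nonzero constant has no root \<open>u\<close>.\<close>
  have ka: "poly k a = 0"
  proof -
    obtain s s' r r' where d: "gpoly G s s'" "gpoly G r r'" "m = s * k + r" "m' = s' * k' + r'"
      "r = 0 \<or> degree r < degree k" using gpoly_division[OF G frac k(1,2) m(1)] by blast
    have "poly r' u = 0" using d(4) u k(3) by simp
    then have r: "r = 0" using kmin[OF d(2)] d(5) by (meson leD)
    then have "poly s a = 0 \<or> poly k a = 0" using d(3) m(3) by simp
    moreover have "poly s a \<noteq> 0"
    proof
      assume sa: "poly s a = 0"
      have s0: "s \<noteq> 0" using d(3) r m(2) by auto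
      then have "degree m \<le> degree s" using mmin[OF d(1)] sa by simp
      moreover have "degree m = degree s + degree k" using d(3) r s0 k(2) by (simp add: degree_mult_eq)
      ultimately have "degree k' = 0" using gpoly_degree(1)[OF G k(1)] by simp
      then obtain c where c: "k' = [:c:]" using degree_eq_zeroE by blast
      then have "k' = 0" using k(3) by simp
      then show False using gpoly_degree(2)[OF G k(1)] k(2) by simp
    qed
    ultimately show ?thesis by simp
  qed
  have km: "degree k \<le> degree m" using kmin[OF m(1,2) u] .
  have iff: "poly p a = 0 \<longleftrightarrow> poly q u = 0" if pq: "gpoly G p q" for p q
  proof -
    obtain s s' r r' where d: "gpoly G s s'" "gpoly G r r'" "p = s * k + r" "q = s' * k' + r'"
      "r = 0 \<or> degree r < degree k" using gpoly_division[OF G frac k(1,2) pq] by blast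
    have "poly p a = 0 \<longleftrightarrow> poly r a = 0" using d(3) ka by simp
    also have "\<dots> \<longleftrightarrow> r = 0" using mmin[OF d(2)] d(5) km poly_0[of a] by (meson leD order_trans)
    also have "\<dots> \<longleftrightarrow> poly r' u = 0"
      using kmin[OF d(2)] d(5) gpoly_degree(2)[OF G d(2)] poly_0[of u] by (metis leD)
    also have "\<dots> \<longleftrightarrow> poly q u = 0" using d(4) k(3) by simp
    finally show ?thesis .
  qed
  have "coeffs_in (acl (Range G)) m'" unfolding coeffs_in_def
  proof
    fix i
    have "coeff m' i \<in> Range G" using gpoly_coeff[OF m(1), of i] by auto
    then show "coeff m' i \<in> acl (Range G)" using acl_superset[of "Range G"] by auto
  qed
  then have "u \<in> acl (Range G)" by (rule rclosed_root[OF rclosed_acl m'0 _ u])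
  then show ?thesis using gemb_gadjoin[OF G iff] by blast
qed

text \<open>The values at 0 and 1 are fixed outright, whatever \<open>S\<close> is; in particular
  \<open>map_poly h\<close> then acts coefficientwise.\<close>

definition emb :: "'a::field set \<Rightarrow> ('a \<Rightarrow> 'b::field) \<Rightarrow> bool" where
  "emb S h \<longleftrightarrow> h 0 = 0 \<and> h 1 = 1 \<and> (\<forall>x\<in>S. h x = 0 \<longrightarrow> x = 0) \<and>
     (\<forall>x\<in>S. \<forall>y\<in>S. h (x + y) = h x + h y \<and> h (x - y) = h x - h y \<and> h (x * y) = h x * h y)"

lemma gpoly_lift:
  assumes "gring G" "coeffs_in (Domain G) p" shows "\<exists>q. gpoly G p q"
proof -
  have "\<forall>i. \<exists>v. (coeff p i, v) \<in> G" using assms(2) unfolding coeffs_in_def by auto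
  then obtain v where v: "\<And>i. (coeff p i, v i) \<in> G" by metis
  have "gpoly G (\<Sum>i\<le>n. monom (coeff p i) i) (\<Sum>i\<le>n. monom (v i) i)" for n
    by (induction n) (simp_all add: gpoly_monom gpoly_add assms(1) v)
  from this[of "degree p"] show ?thesis by (auto simp: poly_as_sum_of_monoms)
qed

text \<open>Zorn's lemma on graphs. The bounds on \<open>Domain\<close> and \<open>Range\<close>
  record that only those basis elements have been spent that are already in the graph; so each
  remaining \<open>b\<close> and its prescribed image are transcendental over the two sides.\<close>

theorem embedding_extension:
  fixes h0 :: "'a::field \<Rightarrow> 'b::field"
  assumes ac: "alg_closed_field TYPE('b)"
    and S0: "is_subring S0" and h0: "emb S0 h0"
    and B: "acl_indep S0 B" and \<beta>: "\<And>b. b \<in> B \<Longrightarrow> \<beta> b \<notin> acl (h0 ` S0 \<union> \<beta> ` (B - {b}))"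
  shows "\<exists>h. emb (acl (S0 \<union> B)) h \<and> (\<forall>x\<in>S0. h x = h0 x) \<and> (\<forall>b\<in>B. h b = \<beta> b)"
proof -
  define G0 where "G0 = (\<lambda>x. (x, h0 x)) ` S0"
  define X where "X G = {b \<in> B. (b, \<beta> b) \<in> G}" for G
  let ?P = "{G. gemb G \<and> G0 \<subseteq> G \<and> Domain G \<subseteq> acl (S0 \<union> X G) \<and> Range G \<subseteq> acl (h0 ` S0 \<union> \<beta> ` X G)}"
  have G0: "gemb G0" unfolding gemb_def gring_def
  proof (intro conjI allI impI)
    show "(0, 0) \<in> G0" "(1, 1) \<in> G0" using S0 h0 unfolding G0_def is_subring_def emb_def by force+
    fix x u y v assume "(x, u) \<in> G0" "(y, v) \<in> G0"
    then show "(x + y, u + v) \<in> G0" "(x - y, u - v) \<in> G0" "(x * y, u * v) \<in> G0"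
      using S0 h0 unfolding G0_def is_subring_def emb_def by auto
  next
    fix x u assume "(x, u) \<in> G0"
    then show "x = 0 \<longleftrightarrow> u = 0" using h0 unfolding G0_def emb_def by auto
  qed
  have X_mono: "X G \<subseteq> X H" if "G \<subseteq> H" for G H using that unfolding X_def by auto
  have aX: "acl (S0 \<union> X G) \<subseteq> acl (S0 \<union> X H)" "acl (h0 ` S0 \<union> \<beta> ` X G) \<subseteq> acl (h0 ` S0 \<union> \<beta> ` X H)"
    if "G \<subseteq> H" for G H
    using acl_mono[of "S0 \<union> X G" "S0 \<union> X H"] acl_mono[of "h0 ` S0 \<union> \<beta> ` X G" "h0 ` S0 \<union> \<beta> ` X H"]
      X_mono[OF that] image_mono[OF X_mono[OF that], of \<beta>] by blast+
  have "\<exists>M\<in>?P. \<forall>G\<in>?P. M \<subseteq> G \<longrightarrow> G = M"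
  proof (rule subset_Zorn_nonempty)
    have "Domain G0 \<subseteq> acl (S0 \<union> X G0)" "Range G0 \<subseteq> acl (h0 ` S0 \<union> \<beta> ` X G0)"
      using acl_superset[of "S0 \<union> X G0"] acl_superset[of "h0 ` S0 \<union> \<beta> ` X G0"] by (auto simp: G0_def)
    then show "?P \<noteq> {}" using G0 by blast
    fix \<C> assume C: "\<C> \<noteq> {}" "subset.chain ?P \<C>"
    have CP: "G \<in> ?P" if "G \<in> \<C>" for G using C(2) that unfolding subset_chain_def by blast
    have C2: "\<exists>U\<in>\<C>. \<sigma> \<in> U \<and> \<tau> \<in> U" if "\<sigma> \<in> \<Union>\<C>" "\<tau> \<in> \<Union>\<C>" for \<sigma> \<tau>
    proof -
      obtain S T where ST: "S \<in> \<C>" "T \<in> \<C>" "\<sigma> \<in> S" "\<tau> \<in> T" using \<open>\<sigma> \<in> \<Union>\<C>\<close> \<open>\<tau> \<in> \<Union>\<C>\<close> by blast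
      then have "S \<subseteq> T \<or> T \<subseteq> S" using C(2) unfolding subset_chain_def by blast
      then show ?thesis using ST by blast
    qed
    obtain G1 where G1: "G1 \<in> \<C>" using C(1) by blast
    have "gemb (\<Union>\<C>)" unfolding gemb_def gring_def
    proof (intro conjI allI impI)
      have "gring G1" using CP[OF G1] by (simp add: gemb_gring)
      from gring_0[OF this] gring_1[OF this] show "(0, 0) \<in> \<Union>\<C>" "(1, 1) \<in> \<Union>\<C>" using G1 by blast+
      fix x u y v assume "(x, u) \<in> \<Union>\<C>" "(y, v) \<in> \<Union>\<C>"
      then obtain U where U: "U \<in> \<C>" "(x, u) \<in> U" "(y, v) \<in> U" using C2 by blast
      have "gring U" using CP[OF U(1)] by (simp add: gemb_gring)
      from gring_add[OF this U(2,3)] gring_diff[OF this U(2,3)] gring_mult[OF this U(2,3)]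
      show "(x + y, u + v) \<in> \<Union>\<C>" "(x - y, u - v) \<in> \<Union>\<C>" "(x * y, u * v) \<in> \<Union>\<C>"
        using U(1) by blast+
    next
      fix x u assume "(x, u) \<in> \<Union>\<C>"
      then obtain U where "U \<in> \<C>" "(x, u) \<in> U" by blast
      moreover have "gemb U" using CP[OF \<open>U \<in> \<C>\<close>] by simp
      ultimately show "x = 0 \<longleftrightarrow> u = 0" using gemb_zero_iff[of U x u] by simp
    qed
    moreover have "G0 \<subseteq> \<Union>\<C>" using CP[OF G1] G1 by blast
    moreover have "Domain G \<subseteq> acl (S0 \<union> X (\<Union>\<C>)) \<and> Range G \<subseteq> acl (h0 ` S0 \<union> \<beta> ` X (\<Union>\<C>))"
      if "G \<in> \<C>" for G
    proof -
      have "G \<subseteq> \<Union>\<C>" using that by blast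
      then show ?thesis using CP[OF that] aX[of G "\<Union>\<C>"] by auto
    qed
    then have "Domain (\<Union>\<C>) \<subseteq> acl (S0 \<union> X (\<Union>\<C>))" "Range (\<Union>\<C>) \<subseteq> acl (h0 ` S0 \<union> \<beta> ` X (\<Union>\<C>))"
      by (auto simp: Domain_iff Range_iff)
    ultimately show "\<Union>\<C> \<in> ?P" by simp
  qed
  then obtain M where M: "gemb M" "G0 \<subseteq> M" "Domain M \<subseteq> acl (S0 \<union> X M)" "Range M \<subseteq> acl (h0 ` S0 \<union> \<beta> ` X M)"
    and max: "\<And>G. G \<in> ?P \<Longrightarrow> M \<subseteq> G \<Longrightarrow> G = M" by auto
  note R = gemb_gring[OF M(1)]
  \<comment> \<open>An extension that is algebraic on both sides preserves the two bounds, hence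
    equals \<open>M\<close>. This yields closure under quotients and under roots.\<close>
  have maxD: "G = M" if "gemb G" "M \<subseteq> G" "Domain G \<subseteq> acl (Domain M)" "Range G \<subseteq> acl (Range M)" for G
  proof (rule max)
    have "acl (Domain M) \<subseteq> acl (S0 \<union> X M)" "acl (Range M) \<subseteq> acl (h0 ` S0 \<union> \<beta> ` X M)"
      using acl_subset[OF M(3)] acl_subset[OF M(4)] by simp_all
    then have "Domain G \<subseteq> acl (S0 \<union> X G)" "Range G \<subseteq> acl (h0 ` S0 \<union> \<beta> ` X G)"
      using that(3,4) aX[OF that(2)] by (meson order_trans)+
    then show "G \<in> ?P" using that(1,2) M(2) by blast
  qed (rule that(2))
  have frac: "(x / y, u / v) \<in> M" if "(x, u) \<in> M" "(y, v) \<in> M" "y \<noteq> 0" for x u y v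
  proof -
    have "gfrac M = M" by (rule maxD[OF gemb_gfrac[OF M(1)] gfrac_superset[OF R] gfrac_Domain_Range])
    moreover have "(x / y, u / v) \<in> gfrac M" using that unfolding gfrac_def by blast
    ultimately show ?thesis by simp
  qed
  have sub: "is_subfield (Domain M)"
  proof (rule subfieldI)
    show "is_subring (Domain M)" unfolding is_subring_def
      using gring_0[OF R] gring_1[OF R] gring_add[OF R] gring_diff[OF R] gring_mult[OF R]
      by (auto simp: Domain_iff) blast+
    fix x assume "x \<in> Domain M"
    then obtain u where xu: "(x, u) \<in> M" by auto
    show "inverse x \<in> Domain M"
    proof (cases "x = 0")
      case True then show ?thesis using gring_0[OF R] by auto
    next
      case False
      then show ?thesis using frac[OF gring_1[OF R] xu] by (auto simp: divide_inverse)
    qed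
  qed
  have rc: "rclosed (Domain M)" unfolding rclosed_def
  proof (intro conjI allI impI)
    show "is_subfield (Domain M)" by (rule sub)
    fix a assume a: "algover (Domain M) a"
    then obtain p where p: "p \<noteq> 0" "coeffs_in (Domain M) p" "poly p a = 0" unfolding algover_def by blast
    obtain q where q: "gpoly M p q" using gpoly_lift[OF R p(2)] by blast
    obtain u where u: "u \<in> acl (Range M)" "gemb (gadjoin M a u)"
      using gemb_adjoin_algebraic[OF M(1) frac ac q p(1,3)] by blast
    have aD: "a \<in> acl (Domain M)" unfolding acl_def using algover_mono[OF a gen_field_superset] by simp
    have "gadjoin M a u = M"
    proof (rule maxD[OF u(2)])
      show "M \<subseteq> gadjoin M a u" using gadjoin_superset[OF R, of a u] by simp
      have "acl (insert a (Domain M)) \<subseteq> acl (Domain M)" "acl (insert u (Range M)) \<subseteq> acl (Range M)"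
        using acl_subset[of "insert a (Domain M)" "Domain M"] acl_subset[of "insert u (Range M)" "Range M"]
          aD u(1) acl_superset[of "Domain M"] acl_superset[of "Range M"] by simp_all
      then show "Domain (gadjoin M a u) \<subseteq> acl (Domain M)" "Range (gadjoin M a u) \<subseteq> acl (Range M)"
        using gadjoin_Domain_Range[OF R, of a u] by auto
    qed
    then have "(a, u) \<in> M" using gadjoin_superset[OF R, of a u] by auto
    then show "a \<in> Domain M" by auto
  qed
  have BX: "b \<in> X M" if b: "b \<in> B" for b
  proof (rule ccontr)
    assume bX: "b \<notin> X M"
    then have XB: "X M \<subseteq> B - {b}" unfolding X_def by auto
    have bD: "b \<notin> Domain M"
    proof
      assume "b \<in> Domain M"
      moreover have "acl (S0 \<union> X M) \<subseteq> acl (S0 \<union> (B - {b}))" using XB by (intro acl_mono) auto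
      ultimately show False using M(3) B b unfolding acl_indep_def by auto
    qed
    have "acl (Range M) \<subseteq> acl (h0 ` S0 \<union> \<beta> ` X M)" using M(4) by (rule acl_subset)
    also have "\<dots> \<subseteq> acl (h0 ` S0 \<union> \<beta> ` (B - {b}))" using XB by (intro acl_mono) auto
    finally have \<beta>b: "\<beta> b \<notin> acl (Range M)" using \<beta>[OF b] by auto
    \<comment> \<open>No nonzero polynomial vanishes on either side, since both \<open>b\<close> and
      its image are transcendental over the graph.\<close>
    have iff: "poly p b = 0 \<longleftrightarrow> poly q (\<beta> b) = 0" if pq: "gpoly M p q" for p q
    proof (cases "p = 0")
      case True
      then show ?thesis using gpoly_degree(2)[OF M(1) pq] by simp
    next
      case False
      have "coeffs_in (Domain M) p" unfolding coeffs_in_def using gpoly_coeff[OF pq] by auto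
      then have 1: "poly p b \<noteq> 0" using rclosed_root[OF rc False] bD by blast
      have "coeff q i \<in> acl (Range M)" for i using gpoly_coeff[OF pq, of i] acl_superset[of "Range M"] by auto
      then have "coeffs_in (acl (Range M)) q" unfolding coeffs_in_def by simp
      moreover have "q \<noteq> 0" using False gpoly_degree(2)[OF M(1) pq] by simp
      ultimately have "poly q (\<beta> b) \<noteq> 0" using rclosed_root[OF rclosed_acl, of q "Range M" "\<beta> b"] \<beta>b by blast
      then show ?thesis using 1 by simp
    qed
    let ?G = "gadjoin M b (\<beta> b)"
    have sup: "insert (b, \<beta> b) M \<subseteq> ?G" by (rule gadjoin_superset[OF R])
    then have MG: "M \<subseteq> ?G" by simp
    have bXG: "b \<in> X ?G" using b sup unfolding X_def by auto
    have "insert b (Domain M) \<subseteq> acl (S0 \<union> X ?G)"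
      using M(3) aX(1)[OF MG] bXG acl_superset[of "S0 \<union> X ?G"] by auto
    then have D: "Domain ?G \<subseteq> acl (S0 \<union> X ?G)" using gadjoin_Domain_Range(1)[OF R, of b "\<beta> b"] acl_subset by blast
    have "insert (\<beta> b) (Range M) \<subseteq> acl (h0 ` S0 \<union> \<beta> ` X ?G)"
      using M(4) aX(2)[OF MG] bXG acl_superset[of "h0 ` S0 \<union> \<beta> ` X ?G"] by auto
    then have E: "Range ?G \<subseteq> acl (h0 ` S0 \<union> \<beta> ` X ?G)" using gadjoin_Domain_Range(2)[OF R, of b "\<beta> b"] acl_subset by blast
    have "gemb ?G" by (rule gemb_gadjoin[OF M(1) iff])
    then have "?G = M" using M(2) MG D E by (intro max) auto
    then show False using sup bX b unfolding X_def by auto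
  qed
  have "S0 \<union> B \<subseteq> Domain M" using M(2) BX unfolding G0_def X_def by auto
  then have dom: "acl (S0 \<union> B) \<subseteq> Domain M" by (rule acl_least[OF rc])
  define h where "h x = (if x \<in> Domain M then (THE u. (x, u) \<in> M) else 0)" for x
  have hM: "(x, h x) \<in> M" if x: "x \<in> Domain M" for x
  proof -
    obtain u where u: "(x, u) \<in> M" using x by auto
    then have "(THE u. (x, u) \<in> M) = u" using gemb_unique[OF M(1)] by blast
    then show ?thesis using u x by (simp add: h_def)
  qed
  have hI: "h x = u" if "(x, u) \<in> M" for x u
  proof -
    have "x \<in> Domain M" using that by auto
    then show ?thesis using gemb_unique[OF M(1) hM that] by simp
  qed
  have "emb (acl (S0 \<union> B)) h" unfolding emb_def
  proof (intro conjI ballI impI)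
    show "h 0 = 0" by (rule hI[OF gring_0[OF R]])
    show "h 1 = 1" by (rule hI[OF gring_1[OF R]])
    show "x = 0" if "x \<in> acl (S0 \<union> B)" "h x = 0" for x
      using hM[of x] that dom gemb_zero_iff[OF M(1)] by auto
    fix x y assume "x \<in> acl (S0 \<union> B)" "y \<in> acl (S0 \<union> B)"
    then have "(x, h x) \<in> M" "(y, h y) \<in> M" using dom hM by auto
    note xy = this
    show "h (x + y) = h x + h y" by (rule hI[OF gring_add[OF R xy]])
    show "h (x - y) = h x - h y" by (rule hI[OF gring_diff[OF R xy]])
    show "h (x * y) = h x * h y" by (rule hI[OF gring_mult[OF R xy]])
  qed
  moreover have "h x = h0 x" if "x \<in> S0" for x using hI[of x "h0 x"] M(2) that unfolding G0_def by auto
  moreover have "h b = \<beta> b" if "b \<in> B" for b using hI[of b "\<beta> b"] BX[OF that] unfolding X_def by auto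
  ultimately show ?thesis by blast
qed

section \<open>Calculation with partial embeddings\<close>

lemma
  assumes "emb S h"
  shows emb_0: "h 0 = 0" and emb_1: "h 1 = 1"
    and emb_zeroD: "x \<in> S \<Longrightarrow> h x = 0 \<Longrightarrow> x = 0"
    and emb_add: "x \<in> S \<Longrightarrow> y \<in> S \<Longrightarrow> h (x + y) = h x + h y"
    and emb_diff: "x \<in> S \<Longrightarrow> y \<in> S \<Longrightarrow> h (x - y) = h x - h y"
    and emb_mult: "x \<in> S \<Longrightarrow> y \<in> S \<Longrightarrow> h (x * y) = h x * h y"
  using assms unfolding emb_def by simp_all

lemma emb_subset: "emb S h \<Longrightarrow> T \<subseteq> S \<Longrightarrow> emb T h"
  unfolding emb_def by (meson subsetD)

lemma emb_id: "emb S (\<lambda>x. x)" by (simp add: emb_def)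

lemma emb_inj:
  assumes h: "emb S h" and S: "is_subring S" shows "inj_on h S"
proof (rule inj_onI)
  fix x y assume xy: "x \<in> S" "y \<in> S" and e: "h x = h y"
  have "h (x - y) = 0" using emb_diff[OF h xy] e by simp
  then show "x = y" using emb_zeroD[OF h subring_diff[OF S xy]] by simp
qed

lemma emb_uminus: "emb S h \<Longrightarrow> is_subring S \<Longrightarrow> x \<in> S \<Longrightarrow> h (- x) = - h x"
  using emb_diff[of S h 0 x] emb_0[of S h] subring_0[of S] by simp

lemma emb_inverse:
  assumes h: "emb S h" and S: "is_subfield S" and x: "x \<in> S" shows "h (inverse x) = inverse (h x)"
proof (cases "x = 0")
  case False
  have "h x * h (inverse x) = 1"
    using emb_mult[OF h x subfield_inverse[OF S x]] emb_1[OF h] False by simp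
  then show ?thesis by (simp add: inverse_unique)
qed (simp add: emb_0[OF h])

lemma emb_sum: "emb S h \<Longrightarrow> is_subring S \<Longrightarrow> (\<And>i. i \<in> I \<Longrightarrow> f i \<in> S) \<Longrightarrow> h (sum f I) = (\<Sum>i\<in>I. h (f i))"
  by (induction I rule: infinite_finite_induct) (simp_all add: emb_0 emb_add subring_sum)

lemma emb_prod: "emb S h \<Longrightarrow> is_subring S \<Longrightarrow> (\<And>i. i \<in> I \<Longrightarrow> f i \<in> S) \<Longrightarrow> h (prod f I) = (\<Prod>i\<in>I. h (f i))"
  by (induction I rule: infinite_finite_induct) (simp_all add: emb_1 emb_mult subring_prod)

lemma emb_power: "emb S h \<Longrightarrow> is_subring S \<Longrightarrow> x \<in> S \<Longrightarrow> h (x ^ n) = h x ^ n"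
  by (induction n) (simp_all add: emb_1 emb_mult subring_power)

lemma emb_poly:
  assumes h: "emb S h" and S: "is_subring S" and p: "coeffs_in S p" and x: "x \<in> S"
  shows "h (poly p x) = poly (map_poly h p) (h x)"
proof -
  have c: "coeff p i \<in> S" for i using p unfolding coeffs_in_def by simp
  have "h (poly p x) = (\<Sum>i\<le>degree p. h (coeff p i) * h x ^ i)" unfolding poly_altdef
    by (subst emb_sum[OF h S]) (simp_all add: emb_mult[OF h] emb_power[OF h S] c x subring_mult[OF S] subring_power[OF S])
  also have "\<dots> = (\<Sum>i\<le>degree p. coeff (map_poly h p) i * h x ^ i)"
    by (simp add: coeff_map_poly emb_0[OF h])
  also have "\<dots> = (\<Sum>i\<le>degree (map_poly h p). coeff (map_poly h p) i * h x ^ i)"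
  proof (rule sum.mono_neutral_right)
    have "degree (map_poly h p) \<le> degree p"
      by (rule degree_le) (simp add: coeff_map_poly emb_0[OF h] coeff_eq_0)
    then show "{..degree (map_poly h p)} \<subseteq> {..degree p}" by simp
  qed (simp_all add: coeff_eq_0)
  finally show ?thesis by (simp add: poly_altdef)
qed

lemma emb_map_poly_nonzero:
  assumes h: "emb S h" and p: "coeffs_in S p" "p \<noteq> 0" shows "map_poly h p \<noteq> 0"
proof
  assume "map_poly h p = 0"
  then have "coeff (map_poly h p) (degree p) = 0" by simp
  then have "h (lead_coeff p) = 0" by (simp add: coeff_map_poly emb_0[OF h])
  moreover have "lead_coeff p \<in> S" using p(1) unfolding coeffs_in_def by simp
  ultimately have "lead_coeff p = 0" by (intro emb_zeroD[OF h])
  then show False using p(2) by simp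
qed

text \<open>Applying \<open>h\<close> to the coefficients of an equation of \<open>x\<close> gives
  an equation of \<open>h x\<close> over \<open>T\<close>.\<close>

lemma emb_preimage_rclosed:
  assumes h: "emb S h" and S: "rclosed S" and T: "rclosed T"
  shows "rclosed {x \<in> S. h x \<in> T}"
proof -
  note SF = rclosed_subfield[OF S] and TF = rclosed_subfield[OF T]
  let ?U = "{x \<in> S. h x \<in> T}"
  have U: "is_subfield ?U" unfolding is_subfield_def
    using SF TF emb_0[OF h] emb_1[OF h] emb_add[OF h] emb_diff[OF h] emb_mult[OF h] emb_inverse[OF h SF]
    unfolding is_subfield_def by simp
  have *: "x \<in> ?U" if x: "algover ?U x" for x
  proof -
    obtain p where p: "p \<noteq> 0" "coeffs_in ?U p" "poly p x = 0" using x unfolding algover_def by blast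
    have pS: "coeffs_in S p" using p(2) unfolding coeffs_in_def by simp
    have xS: "x \<in> S" using rclosed_root[OF S p(1) pS p(3)] .
    have "coeffs_in T (map_poly h p)" using p(2) unfolding coeffs_in_def by (simp add: coeff_map_poly emb_0[OF h])
    moreover have "poly (map_poly h p) (h x) = 0"
      using emb_poly[OF h subfield_subring[OF SF] pS xS] p(3) emb_0[OF h] by simp
    ultimately have "h x \<in> T" using rclosed_root[OF T emb_map_poly_nonzero[OF h pS p(1)]] by simp
    then show ?thesis using xS by simp
  qed
  show ?thesis unfolding rclosed_def by (intro conjI allI impI U *)
qed

lemma emb_acl:
  assumes h: "emb S h" and S: "rclosed S" and A: "A \<subseteq> S" and x: "x \<in> acl A"
  shows "h x \<in> acl (h ` A)"
proof -
  have "acl A \<subseteq> {x \<in> S. h x \<in> acl (h ` A)}"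
    using A acl_superset[of "h ` A"] by (intro acl_least[OF emb_preimage_rclosed[OF h S rclosed_acl]]) auto
  then show ?thesis using x by auto
qed

lemma emb_pfun:
  assumes h: "emb S h" and S: "is_subring S" and L: "L \<subseteq> S" "\<And>x. x \<in> L \<Longrightarrow> h x = x"
    and f: "pfun L m f" and p: "\<And>i. i < m \<Longrightarrow> p i \<in> S"
  shows "h (f p) = f (\<lambda>i. h (p i))"
proof -
  obtain c where c: "is_mpoly L m c" "\<And>p. mpeval m c p = f p" using f unfolding pfun_def by auto
  have cL: "c \<alpha> \<in> L" for \<alpha> using c(1) unfolding is_mpoly_def by simp
  then have cS: "c \<alpha> \<in> S" for \<alpha> using L(1) by auto
  have "h (mpeval m c p) = (\<Sum>\<alpha>\<in>{\<alpha>. c \<alpha> \<noteq> 0}. h (c \<alpha> * (\<Prod>i<m. p i ^ \<alpha> i)))" unfolding mpeval_def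
    by (rule emb_sum[OF h S]) (auto intro!: subring_mult[OF S] subring_prod[OF S] subring_power[OF S] cS p)
  also have "\<dots> = (\<Sum>\<alpha>\<in>{\<alpha>. c \<alpha> \<noteq> 0}. c \<alpha> * (\<Prod>i<m. h (p i) ^ \<alpha> i))"
  proof (rule sum.cong)
    fix \<alpha>
    have "h (\<Prod>i<m. p i ^ \<alpha> i) = (\<Prod>i<m. h (p i) ^ \<alpha> i)"
      by (subst emb_prod[OF h S]) (auto intro!: prod.cong subring_power[OF S] emb_power[OF h S] p)
    moreover have "(\<Prod>i<m. p i ^ \<alpha> i) \<in> S" by (auto intro!: subring_prod[OF S] subring_power[OF S] p)
    ultimately show "h (c \<alpha> * (\<Prod>i<m. p i ^ \<alpha> i)) = c \<alpha> * (\<Prod>i<m. h (p i) ^ \<alpha> i)"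
      using emb_mult[OF h cS] L(2)[OF cL] by simp
  qed simp
  finally show ?thesis unfolding c(2)[symmetric] mpeval_def .
qed

section \<open>Transcendence bases of saturated fields\<close>

lemma teval_cong: "(\<And>i. i \<in> tvars t \<Longrightarrow> \<rho> i = \<rho>' i) \<Longrightarrow> teval \<rho> t = teval \<rho>' t"
  by (induction t) auto

lemma teval_poly: "\<exists>P. \<forall>x. teval (\<lambda>_. x) t = poly P x"
proof (induction t)
  case (RVar n) show ?case by (intro exI[of _ "[:0, 1:]"]) simp
next
  case (RParam a) show ?case by (intro exI[of _ "[:a:]"]) simp
next
  case RZero show ?case by (intro exI[of _ 0]) simp
next
  case ROne show ?case by (intro exI[of _ 1]) simp
next
  case (RAdd s t)
  then obtain P Q where "\<forall>x. teval (\<lambda>_. x) s = poly P x" "\<forall>x. teval (\<lambda>_. x) t = poly Q x" by auto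
  then show ?case by (intro exI[of _ "P + Q"]) simp
next
  case (RNeg s)
  then obtain P where "\<forall>x. teval (\<lambda>_. x) s = poly P x" by auto
  then show ?case by (intro exI[of _ "- P"]) simp
next
  case (RMul s t)
  then obtain P Q where "\<forall>x. teval (\<lambda>_. x) s = poly P x" "\<forall>x. teval (\<lambda>_. x) t = poly Q x" by auto
  then show ?case by (intro exI[of _ "P * Q"]) simp
qed

text \<open>The type saying that no nontrivial polynomial over \<open>A\<close> vanishes is finitely
  satisfiable, because a nonzero polynomial has finitely many roots and the field is
  infinite.\<close>

lemma saturated_transcendental:
  fixes A :: "'a::field_char_0 set"
  assumes sat: "saturated TYPE('a)" and A: "(card_of A, card_of (UNIV::'a set)) \<in> ordLess"
  shows "\<exists>x. x \<notin> acl A"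
proof -
  \<comment> \<open>Nontriviality of a term is expressed by a point where it does not vanish, since
    a term has no coefficients to inspect.\<close>
  define T where "T = {t :: 'a rterm. tvars t \<subseteq> {0} \<and> tparams t \<subseteq> A \<and> (\<exists>x. teval (\<lambda>_. x) t \<noteq> 0)}"
  let ?f = "\<lambda>t. RNot (REq t RZero)"
  have "\<exists>x. \<forall>\<phi>\<in>?f ` T. fsat (\<lambda>_. x) \<phi>"
  proof -
    have 1: "\<forall>\<phi>\<in>?f ` T. ffree \<phi> \<subseteq> {0} \<and> fparams \<phi> \<subseteq> A" by (auto simp: T_def)
    have 2: "\<forall>\<Phi>0. finite \<Phi>0 \<and> \<Phi>0 \<subseteq> ?f ` T \<longrightarrow> (\<exists>x. \<forall>\<phi>\<in>\<Phi>0. fsat (\<lambda>_. x) \<phi>)"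
    proof (intro allI impI)
      fix \<Phi>0 assume "finite \<Phi>0 \<and> \<Phi>0 \<subseteq> ?f ` T"
      then obtain T0 where T0: "finite T0" "T0 \<subseteq> T" "\<Phi>0 = ?f ` T0" by (meson finite_subset_image)
      obtain P where P: "\<And>t x. teval (\<lambda>_. x) t = poly (P t) (x :: 'a)" using teval_poly by metis
      have nz: "P t \<noteq> 0" if "t \<in> T0" for t using that T0(2) P[of _ t] unfolding T_def by auto
      then have "finite (\<Union>t\<in>T0. {x. poly (P t) x = 0})" using T0(1) poly_roots_finite by auto
      then obtain x where "x \<notin> (\<Union>t\<in>T0. {x. poly (P t) x = 0})" using ex_new_if_finite[OF infinite_UNIV_char_0] by blast
      then have "\<forall>t\<in>T0. teval (\<lambda>_. x) t \<noteq> 0" unfolding P by blast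
      then show "\<exists>x. \<forall>\<phi>\<in>\<Phi>0. fsat (\<lambda>_. x) \<phi>" unfolding T0(3) by (intro exI[of _ x]) simp
    qed
    show ?thesis
      by (rule sat[unfolded saturated_def, THEN spec[of _ A], THEN spec[of _ "?f ` T"],
            THEN mp, OF A, THEN mp, OF 1, THEN mp, OF 2])
  qed
  then obtain x where x: "\<And>t. t \<in> T \<Longrightarrow> teval (\<lambda>_. x) t \<noteq> 0" by auto
  \<comment> \<open>The ring generated by \<open>A\<close>, given by closed terms, so that a
    polynomial over it can be written as a term again.\<close>
  define R where "R = {teval (\<lambda>_. 0) t |t. tvars t = {} \<and> tparams t \<subseteq> A}"
  have RI: "teval (\<lambda>_. 0) t \<in> R" if "tvars t = {}" "tparams t \<subseteq> A" for t using that unfolding R_def by blast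
  have R: "is_subring R"
  proof -
    have "0 \<in> R" "1 \<in> R" using RI[of RZero] RI[of ROne] by simp_all
    moreover have "a + b \<in> R \<and> a - b \<in> R \<and> a * b \<in> R" if "a \<in> R" "b \<in> R" for a b
    proof -
      obtain s t where st: "tvars s = {}" "tparams s \<subseteq> A" "tvars t = {}" "tparams t \<subseteq> A"
        "a = teval (\<lambda>_. 0) s" "b = teval (\<lambda>_. 0) t" using \<open>a \<in> R\<close> \<open>b \<in> R\<close> unfolding R_def by blast
      show ?thesis using RI[of "RAdd s t"] RI[of "RAdd s (RNeg t)"] RI[of "RMul s t"] st by simp
    qed
    ultimately show ?thesis unfolding is_subring_def by simp
  qed
  have "A \<subseteq> R"
  proof
    fix a assume "a \<in> A" then show "a \<in> R" using RI[of "RParam a"] by simp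
  qed
  then have AR: "A \<subseteq> fracs R" using fracs_superset[OF R] by simp
  have "x \<notin> acl A"
  proof
    assume "x \<in> acl A"
    then obtain p where p: "p \<noteq> 0" "coeffs_in R p" "poly p x = 0"
      using acl_clear_denominators[OF R AR] unfolding algover_def by blast
    have "\<exists>t. tvars t \<subseteq> {0} \<and> tparams t \<subseteq> A \<and> (\<forall>y. teval (\<lambda>_. y) t = poly p y)" using p(2)
    proof (induction p)
      case 0 show ?case by (intro exI[of _ RZero]) simp
    next
      case (pCons c p)
      have cp: "c \<in> R" "coeffs_in R p" using coeffs_in_pConsD[OF pCons.prems] by simp_all
      obtain s where s: "tvars s = {}" "tparams s \<subseteq> A" "c = teval (\<lambda>_. 0) s" using cp(1) unfolding R_def by blast
      have sc: "teval (\<lambda>_. y) s = c" for y using teval_cong[of s "\<lambda>_. y" "\<lambda>_. 0"] s by simp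
      from pCons.IH[OF cp(2)]
      obtain t where t: "tvars t \<subseteq> {0}" "tparams t \<subseteq> A" "\<forall>y. teval (\<lambda>_. y) t = poly p y"
        by (elim exE conjE)
      show ?case using s t sc by (intro exI[of _ "RAdd s (RMul (RVar 0) t)"]) simp
    qed
    then obtain t where t: "tvars t \<subseteq> {0}" "tparams t \<subseteq> A" "\<forall>y. teval (\<lambda>_. y) t = poly p y"
      by (elim exE conjE)
    have "finite {y. poly p y = 0}" using p(1) by (rule poly_roots_finite)
    then obtain y where "poly p y \<noteq> 0" using ex_new_if_finite[OF infinite_UNIV_char_0] by blast
    then have "t \<in> T" unfolding T_def using t by (intro CollectI conjI exI[of _ y]) simp_all
    from x[OF this] show False using t(3) p(3) by simp
  qed
  then show ?thesis by blast
qed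

text \<open>Levels are indexed by the field itself; its cardinal is a well-order all of whose initial segments are smaller.\<close>

abbreviation idx :: "'a rel" where "idx \<equiv> card_of (UNIV :: 'a set)"

abbreviation below :: "'a \<Rightarrow> 'a set" where "below \<equiv> underS idx"

lemma idx_well_order: "Well_order idx" by (rule card_of_Well_order)

lemma idx_linear_order: "Linear_order (idx :: 'a rel)"
  using idx_well_order[where 'a='a] unfolding well_order_on_def by (rule conjunct1)

lemma idx_Field: "Field (idx :: 'a rel) = UNIV" by (rule Field_card_of)

lemma idx_wf: "wf ((idx :: 'a rel) - Id)"
  using idx_well_order[where 'a='a] unfolding well_order_on_def by (rule conjunct2)

lemma below_iff: "i \<in> below j \<longleftrightarrow> (i, j) \<in> idx - Id"
  unfolding underS_def by auto

lemma idx_trans: "(i :: 'a) \<in> below j \<Longrightarrow> j \<in> below k \<Longrightarrow> i \<in> below k"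
  using idx_linear_order[where 'a='a] unfolding underS_def linear_order_on_def partial_order_on_def preorder_on_def
  by (auto dest: transD antisymD)

lemma idx_irrefl: "i \<notin> below i" by (simp add: underS_def)

lemma idx_linear: "(i :: 'a) \<in> below j \<or> i = j \<or> j \<in> below i"
  using idx_linear_order[where 'a='a] idx_Field[where 'a='a] unfolding underS_def linear_order_on_def total_on_def by auto

lemma below_subset: "i \<in> below j \<Longrightarrow> insert i (below i) \<subseteq> below j"
  using idx_trans by auto

lemma finite_max_idx:
  assumes "finite J" "J \<noteq> {}" shows "\<exists>m\<in>J. J \<subseteq> insert m (below m)"
  using linear_order_finite_max[OF idx_linear_order assms] unfolding idx_Field by (auto simp: underS_def)

lemma card_below_insert:
  assumes "infinite (UNIV :: 'a set)"
  shows "(card_of (insert (m :: 'a) (below m)), card_of (UNIV :: 'a set)) \<in> ordLess"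
proof -
  have "(card_of (below m), (idx :: 'a rel)) \<in> ordLess"
    using card_of_underS[OF card_of_Card_order[of "UNIV :: 'a set"], of m] unfolding Field_card_of by simp
  moreover have "(card_of {m}, card_of (UNIV :: 'a set)) \<in> ordLess"
    using finite_ordLess_infinite[OF card_of_Well_order card_of_Well_order, of "{m}" "UNIV :: 'a set"] assms
    unfolding Field_card_of by simp
  ultimately have "(card_of ({m} \<union> below m), card_of (UNIV :: 'a set)) \<in> ordLess"
    using card_of_Un_ordLess_infinite[OF assms] by blast
  then show ?thesis by simp
qed

text \<open>The index order has no greatest element: an initial segment with its top has smaller
  cardinality than the infinite field.\<close>

lemma finite_below:
  assumes "infinite (UNIV :: 'a set)" "finite (F :: 'a set)"
  shows "\<exists>m. F \<subseteq> below m"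
proof (cases "F = {}")
  case False
  then obtain m where m: "F \<subseteq> insert m (below m)" using finite_max_idx[OF assms(2)] by auto
  have "insert m (below m) \<noteq> UNIV"
    using card_below_insert[OF assms(1), of m] ordLess_irreflexive[of "card_of (UNIV :: 'a set)"] by metis
  then obtain k where "k \<notin> insert m (below m)" by blast
  then have "m \<in> below k" using idx_linear[of m k] by auto
  then show ?thesis using m below_subset[of m k] by blast
qed simp

definition tbasis :: "('a::field \<Rightarrow> 'a) \<Rightarrow> bool" where
  "tbasis \<xi> \<longleftrightarrow> inj \<xi> \<and> acl_indep {} (range \<xi>) \<and> acl (range \<xi>) = UNIV"

text \<open>A transcendence basis of smaller cardinality would leave, by saturation, an element
  transcendental over it.\<close>

lemma tbasis_exists:
  assumes sat: "saturated TYPE('a::field_char_0)"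
  shows "\<exists>\<xi> :: 'a \<Rightarrow> 'a. tbasis \<xi>"
proof -
  obtain X :: "'a set" where X: "acl_indep {} X" "acl ({} \<union> X) = UNIV" by (rule acl_basis_exists)
  have "(card_of X, card_of (UNIV :: 'a set)) \<notin> ordLess"
    using saturated_transcendental[OF sat, of X] X(2) by auto
  moreover have "(card_of X, card_of (UNIV :: 'a set)) \<in> ordLeq" by (rule card_of_mono1) simp
  ultimately have "(card_of X, card_of (UNIV :: 'a set)) \<in> ordIso" using ordLeq_iff_ordLess_or_ordIso by blast
  then obtain f where "bij_betw f X (UNIV :: 'a set)" using card_of_ordIso by blast
  then have "bij_betw (inv_into X f) UNIV X" by (rule bij_betw_inv_into)
  then show ?thesis using X unfolding tbasis_def bij_betw_def by (intro exI[of _ "inv_into X f"]) simp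
qed

lemma tbasis_finite_support:
  assumes "tbasis \<xi>" shows "\<exists>F. finite F \<and> a \<in> acl (\<xi> ` F)"
proof -
  have "a \<in> acl (range \<xi>)" using assms unfolding tbasis_def by simp
  then obtain G where "finite G" "G \<subseteq> range \<xi>" "a \<in> acl G" using acl_finitary by blast
  then show ?thesis by (metis finite_subset_image)
qed

lemma tbasis_notin:
  assumes "tbasis \<xi>" "i \<notin> A" shows "\<xi> i \<notin> acl (\<xi> ` A)"
proof
  assume h: "\<xi> i \<in> acl (\<xi> ` A)"
  have "\<xi> ` A \<subseteq> range \<xi> - {\<xi> i}" using assms unfolding tbasis_def by (auto dest: injD)
  then have "\<xi> i \<in> acl (range \<xi> - {\<xi> i})" using h acl_mono by blast
  then show False using assms(1) unfolding tbasis_def acl_indep_def by auto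
qed

text \<open>Assigns to every element \<open>a\<close> and every tag \<open>i\<close> a private level
  later than all levels that \<open>a\<close> involves. The tags 0 to 3 will separate four kinds of
  use.\<close>

lemma tbasis_index_function:
  assumes \<xi>: "tbasis (\<xi> :: 'a::field_char_0 \<Rightarrow> 'a)"
  shows "\<exists>g :: 'a \<Rightarrow> nat \<Rightarrow> 'a. (\<forall>a i b j. g a i = g b j \<longrightarrow> a = b \<and> i = j) \<and>
    (\<forall>a i. a \<in> acl (\<xi> ` below (g a i)))"
proof -
  have inf: "infinite (UNIV :: 'a set)" by (rule infinite_UNIV_char_0)
  obtain P where P: "bij_betw P ((UNIV :: 'a set) \<times> (UNIV :: 'a set)) (UNIV :: 'a set)"
    using card_of_Times_same_infinite[OF inf] card_of_ordIso by blast
  then have Pi: "P (a, b) = P (c, d) \<longleftrightarrow> a = c \<and> b = d" for a b c d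
    by (simp add: bij_betw_def inj_eq)
  \<comment> \<open>The pair of \<open>a\<close> and the tag is padded by a free parameter
    \<open>k\<close>. The codes obtained this way are as many as the field has elements, so they do
    not fit into a proper initial segment and some code lies above the levels of
    \<open>a\<close>.\<close>
  have "\<exists>k. a \<in> acl (\<xi> ` below (P (P (a, of_nat i), k)))" for a i
  proof -
    obtain F where F: "finite F" "a \<in> acl (\<xi> ` F)" using tbasis_finite_support[OF \<xi>] by blast
    obtain m where m: "F \<subseteq> below m" using finite_below[OF inf F(1)] by blast
    let ?f = "\<lambda>k. P (P (a, of_nat i), k)"
    have "inj ?f" by (rule injI) (simp add: Pi)
    then have "(card_of (UNIV :: 'a set), card_of (range ?f)) \<in> ordLeq"
      by (intro card_of_ordLeqI[of ?f]) auto
    moreover have "(card_of (range ?f), card_of (UNIV :: 'a set)) \<in> ordLess" if "range ?f \<subseteq> insert m (below m)"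
      using card_of_mono1[OF that] card_below_insert[OF inf, of m] by (rule ordLeq_ordLess_trans)
    ultimately have "\<not> range ?f \<subseteq> insert m (below m)" using not_ordLess_ordLeq by blast
    then obtain k where "?f k \<notin> insert m (below m)" by blast
    then have "m \<in> below (?f k)" using idx_linear[of m "?f k"] by auto
    then have "F \<subseteq> below (?f k)" using m below_subset[of m "?f k"] by simp
    then have "acl (\<xi> ` F) \<subseteq> acl (\<xi> ` below (?f k))" by (intro acl_mono) auto
    then show ?thesis using F(2) by blast
  qed
  then obtain k where k: "\<And>a i. a \<in> acl (\<xi> ` below (P (P (a, of_nat i), k a i)))" by metis
  show ?thesis using k Pi by (intro exI[of _ "\<lambda>a i. P (P (a, of_nat i), k a i)"]) simp
qed

section \<open>An ultrapower of the complex numbers with a hierarchy of infinitesimals\<close>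

text \<open>The ultrapower is indexed by functions \<open>x\<close> from levels to reals. The
  coordinate \<open>x i\<close> will represent the infinitesimal of level \<open>i\<close>, and the
  level of an element is read off from the coordinates its representative uses.\<close>

definition depends_on :: "'i set \<Rightarrow> (('i \<Rightarrow> real) \<Rightarrow> 'b) \<Rightarrow> bool" where
  "depends_on A g \<longleftrightarrow> (\<forall>x y. (\<forall>i\<in>A. x i = y i) \<longrightarrow> g x = g y)"

lemma depends_onD: "depends_on A g \<Longrightarrow> (\<And>i. i \<in> A \<Longrightarrow> x i = y i) \<Longrightarrow> g x = g y"
  unfolding depends_on_def by blast

lemma depends_on_mono: "depends_on A g \<Longrightarrow> A \<subseteq> B \<Longrightarrow> depends_on B g"
  unfolding depends_on_def by blast

text \<open>These sets generate the filter that forces the \<open>i\<close>-th coordinate below all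
  positive functions of the earlier ones. Where \<open>g\<close> is not positive, no upper bound is
  imposed.\<close>

definition tiny :: "'i \<Rightarrow> (('i \<Rightarrow> real) \<Rightarrow> real) \<Rightarrow> ('i \<Rightarrow> real) set" where
  "tiny i g = {x. 0 < x i \<and> (0 < g x \<longrightarrow> x i < g x)}"

text \<open>The coordinate of the largest index is chosen last: the conditions on it involve only
  earlier coordinates, and no other condition reads it.\<close>

lemma tiny_finite_intersection:
  assumes "finite s" and "\<And>i g. (i, g) \<in> s \<Longrightarrow> depends_on (below i) g"
  shows "\<exists>x. \<forall>(i, g)\<in>s. x \<in> tiny i g"
  using assms
proof (induction "card (fst ` s)" arbitrary: s rule: less_induct)
  case less
  show ?case
  proof (cases "s = {}")
    case False
    then obtain m where m: "m \<in> fst ` s" "fst ` s \<subseteq> insert m (below m)"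
      using finite_max_idx[of "fst ` s"] less.prems(1) by blast
    define s' where "s' = {p \<in> s. fst p \<noteq> m}"
    have "fst ` s' = fst ` s - {m}" by (auto simp: s'_def)
    then have "card (fst ` s') < card (fst ` s)" using card_Diff1_less[of "fst ` s" m] m(1) less.prems(1) by simp
    then have "\<exists>x. \<forall>(i, g)\<in>s'. x \<in> tiny i g"
      using less.prems by (intro less.hyps) (auto simp: s'_def)
    then obtain x where x: "\<And>i g. (i, g) \<in> s' \<Longrightarrow> x \<in> tiny i g" by blast
    \<comment> \<open>All positive bounds at the point already found; the entry 1 keeps the set
      nonempty.\<close>
    let ?V = "insert 1 {v \<in> (\<lambda>(i, g). g x) ` s. 0 < v}"
    define v where "v = Min ?V / 2"
    have fV: "finite ?V" using less.prems(1) by simp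
    have "0 < Min ?V" using fV by (subst Min_gr_iff) auto
    then have v: "0 < v" "v < Min ?V" by (simp_all add: v_def)
    have vl: "v < w" if "w \<in> ?V" for w using v(2) Min_le[OF fV that] by linarith
    have "x(m := v) \<in> tiny i g" if ig: "(i, g) \<in> s" for i g
    proof -
      have im: "i \<in> insert m (below m)" using m(2) ig by force
      have "m \<notin> below i" using im idx_trans[of m i m] idx_irrefl[of m] by auto
      then have g: "g (x(m := v)) = g x"
        by (intro depends_onD[OF less.prems(2)[OF ig]]) (metis fun_upd_other)
      show ?thesis
      proof (cases "i = m")
        case True
        have "v < g x" if "0 < g x" using ig that by (intro vl) force
        then show ?thesis using True v(1) g unfolding tiny_def by simp
      next
        case False
        then have "x \<in> tiny i g" using ig by (intro x) (simp add: s'_def)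
        then show ?thesis using False g unfolding tiny_def by simp
      qed
    qed
    then show ?thesis by blast
  qed simp
qed

section \<open>Ultrafilters\<close>

definition fip :: "'x set set \<Rightarrow> bool" where
  "fip S \<longleftrightarrow> (\<forall>F. finite F \<longrightarrow> F \<subseteq> S \<longrightarrow> \<Inter>F \<noteq> {})"

text \<open>A maximal family with the finite intersection property contains every set that meets all
  its finite intersections; all filter properties and the dichotomy follow from this.\<close>

lemma ultrafilter_exists:
  assumes "fip (S0 :: 'x set set)"
  shows "\<exists>U :: 'x filter. (\<forall>A\<in>S0. eventually (\<lambda>x. x \<in> A) U) \<and> U \<noteq> bot \<and>
    (\<forall>P. eventually P U \<or> eventually (\<lambda>x. \<not> P x) U)"
proof -
  let ?P = "{S. fip S \<and> S0 \<subseteq> S}"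
  have "\<exists>M\<in>?P. \<forall>S\<in>?P. M \<subseteq> S \<longrightarrow> S = M"
  proof (rule subset_Zorn_nonempty)
    show "?P \<noteq> {}" using assms by blast
    fix \<C> assume C: "\<C> \<noteq> {}" "subset.chain ?P \<C>"
    have "fip (\<Union>\<C>)" unfolding fip_def
    proof (intro allI impI)
      fix F assume F: "finite F" "F \<subseteq> \<Union>\<C>"
      obtain S where "S \<in> \<C>" "F \<subseteq> S" using finite_subset_Union_chain[OF F C(1)] C(2) by blast
      then show "\<Inter>F \<noteq> {}" using C(2) F(1) unfolding subset_chain_def fip_def by blast
    qed
    moreover have "S0 \<subseteq> \<Union>\<C>" using C unfolding subset_chain_def by blast
    ultimately show "\<Union>\<C> \<in> ?P" by blast
  qed
  then obtain M where M: "fip M" "S0 \<subseteq> M" and max: "\<And>S. fip S \<Longrightarrow> M \<subseteq> S \<Longrightarrow> S = M"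
    by (metis (no_types, lifting) mem_Collect_eq order_trans)
  have ins: "A \<in> M" if "\<And>F. finite F \<Longrightarrow> F \<subseteq> M \<Longrightarrow> A \<inter> \<Inter>F \<noteq> {}" for A
  proof -
    have "fip (insert A M)" unfolding fip_def
    proof (intro allI impI)
      fix F assume F: "finite F" "F \<subseteq> insert A M"
      then have "A \<inter> \<Inter>(F - {A}) \<noteq> {}" using that[of "F - {A}"] by blast
      then show "\<Inter>F \<noteq> {}" by blast
    qed
    then show ?thesis using max[of "insert A M"] by blast
  qed
  have up: "B \<in> M" if "A \<in> M" "A \<subseteq> B" for A B
  proof (rule ins)
    fix F assume "finite F" "F \<subseteq> M"
    then have "\<Inter>(insert A F) \<noteq> {}" using M(1) that(1) unfolding fip_def by (metis finite_insert insert_subset)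
    then show "B \<inter> \<Inter>F \<noteq> {}" using that(2) by blast
  qed
  have int: "A \<inter> B \<in> M" if "A \<in> M" "B \<in> M" for A B
  proof (rule ins)
    fix F assume "finite F" "F \<subseteq> M"
    then have "\<Inter>(insert A (insert B F)) \<noteq> {}" using M(1) that unfolding fip_def by (metis finite_insert insert_subset)
    then show "A \<inter> B \<inter> \<Inter>F \<noteq> {}" by blast
  qed
  have univ: "UNIV \<in> M"
  proof (rule ins)
    fix F assume "finite F" "F \<subseteq> M"
    then show "UNIV \<inter> \<Inter>F \<noteq> {}" using M(1) unfolding fip_def by simp
  qed
  have ult: "A \<in> M \<or> - A \<in> M" for A
  proof (rule ccontr)
    assume n: "\<not> ?thesis"
    then obtain F G where FG: "finite F" "F \<subseteq> M" "A \<inter> \<Inter>F = {}" "finite G" "G \<subseteq> M" "- A \<inter> \<Inter>G = {}"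
      using ins[of A] ins[of "- A"] by metis
    then have "\<Inter>(F \<union> G) \<noteq> {}" using M(1) unfolding fip_def by simp
    then show False using FG(3,6) by blast
  qed
  have em: "{} \<notin> M"
  proof
    assume "{} \<in> M"
    then have "finite {{}}" "{{}} \<subseteq> M" by simp_all
    then have "\<Inter>{{}} \<noteq> ({} :: 'x set)" using M(1) unfolding fip_def by blast
    then show False by simp
  qed
  define U where "U = Abs_filter (\<lambda>P. {x. P x} \<in> M)"
  have ev: "eventually P U \<longleftrightarrow> {x. P x} \<in> M" for P unfolding U_def
  proof (rule eventually_Abs_filter, rule is_filter.intro)
    show "{x. True} \<in> M" using univ by simp
    show "{x. P x \<and> Q x} \<in> M" if "{x. P x} \<in> M" "{x. Q x} \<in> M" for P Q
      using int[OF that] by (simp add: Collect_conj_eq)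
    show "{x. Q x} \<in> M" if "\<forall>x. P x \<longrightarrow> Q x" "{x. P x} \<in> M" for P Q
      by (rule up[OF that(2)]) (use that(1) in auto)
  qed
  show ?thesis
  proof (intro exI[of _ U] conjI ballI allI)
    show "eventually (\<lambda>x. x \<in> A) U" if "A \<in> S0" for A using that M(2) unfolding ev by auto
    show "U \<noteq> bot" using em ev[of "\<lambda>_. False"] by (auto simp: trivial_limit_def)
    show "eventually P U \<or> eventually (\<lambda>x. \<not> P x) U" for P
      using ult[of "{x. P x}"] unfolding ev by (simp add: Collect_neg_eq)
  qed
qed

definition is_hyper_filter :: "('i \<Rightarrow> real) filter \<Rightarrow> bool" where
  "is_hyper_filter U \<longleftrightarrow> (\<forall>i g. depends_on (below i) g \<longrightarrow> eventually (\<lambda>x. x \<in> tiny i g) U) \<and> U \<noteq> bot \<and>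
    (\<forall>P. eventually P U \<or> eventually (\<lambda>x. \<not> P x) U)"

definition hyper :: "('i \<Rightarrow> real) filter" where
  "hyper = (SOME U. is_hyper_filter U)"

lemma is_hyper_filter_hyper: "is_hyper_filter (hyper :: ('i \<Rightarrow> real) filter)"
proof -
  let ?I = "{(i :: 'i, g). depends_on (below i) g}"
  let ?S0 = "(\<lambda>(i, g). tiny i g) ` ?I"
  have "fip ?S0" unfolding fip_def
  proof (intro allI impI)
    fix F assume "finite F" "F \<subseteq> ?S0"
    then obtain s where s: "finite s" "s \<subseteq> ?I" "F = (\<lambda>(i, g). tiny i g) ` s" by (meson finite_subset_image)
    obtain x where "\<forall>(i, g)\<in>s. x \<in> tiny i g" using tiny_finite_intersection[OF s(1)] s(2) by blast
    then have "x \<in> \<Inter>F" unfolding s(3) by auto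
    then show "\<Inter>F \<noteq> {}" by blast
  qed
  from ultrafilter_exists[OF this] obtain U where U: "\<forall>A\<in>?S0. eventually (\<lambda>x. x \<in> A) U" "U \<noteq> bot"
    "\<forall>P. eventually P U \<or> eventually (\<lambda>x. \<not> P x) U" by blast
  then have "is_hyper_filter U" unfolding is_hyper_filter_def by auto
  then show ?thesis unfolding hyper_def by (rule someI)
qed

lemma hyper_tiny:
  fixes i :: 'i
  shows "depends_on (below i) g \<Longrightarrow> eventually (\<lambda>x. 0 < x i \<and> (0 < g x \<longrightarrow> x i < g x)) hyper"
  using is_hyper_filter_hyper[where 'i='i] unfolding is_hyper_filter_def tiny_def by simp

lemma hyper_not_bot: "(hyper :: ('i \<Rightarrow> real) filter) \<noteq> bot"
  using is_hyper_filter_hyper[where 'i='i] unfolding is_hyper_filter_def by simp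

lemma hyper_False: "\<not> eventually (\<lambda>x :: 'i \<Rightarrow> real. False) hyper"
  using hyper_not_bot[where 'i='i] by (simp add: trivial_limit_def)

lemma hyper_not:
  fixes P :: "('i \<Rightarrow> real) \<Rightarrow> bool"
  shows "eventually (\<lambda>x. \<not> P x) hyper \<longleftrightarrow> \<not> eventually P hyper"
proof
  assume a: "eventually (\<lambda>x. \<not> P x) hyper"
  show "\<not> eventually P hyper"
  proof
    assume "eventually P hyper"
    with a have "eventually (\<lambda>x :: 'i \<Rightarrow> real. False) hyper" by eventually_elim blast
    then show False using hyper_False by blast
  qed
next
  assume "\<not> eventually P hyper"
  then show "eventually (\<lambda>x. \<not> P x) hyper" using is_hyper_filter_hyper[where 'i='i] unfolding is_hyper_filter_def by blast
qed

lemma hyper_imp: "eventually (\<lambda>x. P x \<longrightarrow> Q x) hyper \<longleftrightarrow> (eventually P hyper \<longrightarrow> eventually Q hyper)"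
proof
  assume "eventually (\<lambda>x. P x \<longrightarrow> Q x) hyper"
  then show "eventually P hyper \<longrightarrow> eventually Q hyper" using eventually_mp by blast
next
  assume "eventually P hyper \<longrightarrow> eventually Q hyper"
  then have "eventually (\<lambda>x. \<not> P x) hyper \<or> eventually Q hyper" unfolding hyper_not by blast
  then show "eventually (\<lambda>x. P x \<longrightarrow> Q x) hyper"
    by (elim disjE) (erule eventually_mono, simp)+
qed

lemma hyper_disj: "eventually (\<lambda>x. P x \<or> Q x) hyper \<longleftrightarrow> eventually P hyper \<or> eventually Q hyper"
proof -
  have "eventually (\<lambda>x. P x \<or> Q x) hyper \<longleftrightarrow> eventually (\<lambda>x. \<not> P x \<longrightarrow> Q x) hyper"
    by (rule arg_cong2[where f=eventually]) auto
  then show ?thesis unfolding hyper_imp hyper_not by blast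
qed

text \<open>The ultrafilter decides between finitely many cases. This selects a root of a polynomial
  and, later, an integer multiple of the period.\<close>

lemma hyper_bex:
  assumes "finite J" "eventually (\<lambda>x. \<exists>j\<in>J. P j x) hyper"
  shows "\<exists>j\<in>J. eventually (P j) hyper"
  using assms
proof (induction J rule: finite_induct)
  case empty
  then show ?case by (simp add: hyper_False)
next
  case (insert j J)
  then show ?case by (simp add: hyper_disj) blast
qed

section \<open>The field structure of the ultrapower\<close>

definition hyper_eq :: "(('i \<Rightarrow> real) \<Rightarrow> complex) \<Rightarrow> (('i \<Rightarrow> real) \<Rightarrow> complex) \<Rightarrow> bool" where
  "hyper_eq f g \<longleftrightarrow> eventually (\<lambda>x. f x = g x) hyper"

lemma equivp_hyper_eq: "equivp hyper_eq"
proof (rule equivpI)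
  show "reflp hyper_eq" by (rule reflpI) (simp add: hyper_eq_def)
  show "symp hyper_eq" by (rule sympI) (simp add: hyper_eq_def eq_commute)
  show "transp hyper_eq"
    by (rule transpI) (unfold hyper_eq_def, erule (1) eventually_elim2, simp)
qed

quotient_type 'i hc = "('i \<Rightarrow> real) \<Rightarrow> complex" / hyper_eq
  by (rule equivp_hyper_eq)

lift_definition hcof :: "(('i \<Rightarrow> real) \<Rightarrow> complex) \<Rightarrow> 'i hc" is "\<lambda>f. f" .

lemma hcof_eq: "hcof f = hcof g \<longleftrightarrow> eventually (\<lambda>x. f x = g x) hyper"
  by (transfer, simp add: hyper_eq_def)

lemma hcof_surj: obtains f where "a = hcof f"
  by (metis hcof.abs_eq Quotient_abs_rep[OF Quotient_hc] hcof_def id_apply map_fun_apply)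

lift_definition hmap :: "(complex \<Rightarrow> complex) \<Rightarrow> 'i hc \<Rightarrow> 'i hc" is "\<lambda>\<phi> f x. \<phi> (f x)"
  unfolding hyper_eq_def by (erule eventually_mono) simp

text \<open>Comparison of absolute values; smallness relative to a level is expressed through
  it.\<close>

lift_definition hlt :: "'i hc \<Rightarrow> 'i hc \<Rightarrow> bool" is "\<lambda>f g. eventually (\<lambda>x. cmod (f x) < cmod (g x)) hyper"
  unfolding hyper_eq_def by (rule eventually_subst, erule (1) eventually_elim2) simp

instantiation hc :: (type) field
begin

lift_definition zero_hc :: "'a hc" is "\<lambda>_. 0" .
lift_definition one_hc :: "'a hc" is "\<lambda>_. 1" .
lift_definition plus_hc :: "'a hc \<Rightarrow> 'a hc \<Rightarrow> 'a hc" is "\<lambda>f g x. f x + g x"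
  unfolding hyper_eq_def by (erule (1) eventually_elim2) simp
lift_definition minus_hc :: "'a hc \<Rightarrow> 'a hc \<Rightarrow> 'a hc" is "\<lambda>f g x. f x - g x"
  unfolding hyper_eq_def by (erule (1) eventually_elim2) simp
lift_definition times_hc :: "'a hc \<Rightarrow> 'a hc \<Rightarrow> 'a hc" is "\<lambda>f g x. f x * g x"
  unfolding hyper_eq_def by (erule (1) eventually_elim2) simp
lift_definition divide_hc :: "'a hc \<Rightarrow> 'a hc \<Rightarrow> 'a hc" is "\<lambda>f g x. f x / g x"
  unfolding hyper_eq_def by (erule (1) eventually_elim2) simp
lift_definition uminus_hc :: "'a hc \<Rightarrow> 'a hc" is "\<lambda>f x. - f x"
  unfolding hyper_eq_def by (erule eventually_mono) simp
lift_definition inverse_hc :: "'a hc \<Rightarrow> 'a hc" is "\<lambda>f x. inverse (f x)"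
  unfolding hyper_eq_def by (erule eventually_mono) simp

instance
proof
  fix a b c :: "'a hc"
  show "a + b + c = a + (b + c)" by transfer (simp add: hyper_eq_def add.assoc)
  show "a + b = b + a" by transfer (simp add: hyper_eq_def add.commute)
  show "0 + a = a" by transfer (simp add: hyper_eq_def)
  show "- a + a = 0" by transfer (simp add: hyper_eq_def)
  show "a - b = a + - b" by transfer (simp add: hyper_eq_def)
  show "a * b * c = a * (b * c)" by transfer (simp add: hyper_eq_def mult.assoc)
  show "a * b = b * a" by transfer (simp add: hyper_eq_def mult.commute)
  show "1 * a = a" by transfer (simp add: hyper_eq_def)
  show "(a + b) * c = a * c + b * c" by transfer (simp add: hyper_eq_def algebra_simps)
  show "(0 :: 'a hc) \<noteq> 1" by transfer (simp add: hyper_eq_def hyper_False)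
  show "a div b = a * inverse b" by transfer (simp add: hyper_eq_def divide_inverse)
  show "inverse (0 :: 'a hc) = 0" by transfer (simp add: hyper_eq_def)
  show "a \<noteq> 0 \<Longrightarrow> inverse a * a = 1"
    by transfer (auto simp: hyper_eq_def simp flip: hyper_not elim: eventually_mono)
qed

end

lemma hcof_0: "hcof (\<lambda>_. 0) = 0" by transfer (simp add: hyper_eq_def)
lemma hcof_1: "hcof (\<lambda>_. 1) = 1" by transfer (simp add: hyper_eq_def)
lemma hcof_add: "hcof f + hcof g = hcof (\<lambda>x. f x + g x)" by transfer (simp add: hyper_eq_def)
lemma hcof_diff: "hcof f - hcof g = hcof (\<lambda>x. f x - g x)" by transfer (simp add: hyper_eq_def)
lemma hcof_mult: "hcof f * hcof g = hcof (\<lambda>x. f x * g x)" by transfer (simp add: hyper_eq_def)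
lemma hcof_divide: "hcof f / hcof g = hcof (\<lambda>x. f x / g x)" by transfer (simp add: hyper_eq_def)
lemma hcof_uminus: "- hcof f = hcof (\<lambda>x. - f x)" by transfer (simp add: hyper_eq_def)
lemma hcof_inverse: "inverse (hcof f) = hcof (\<lambda>x. inverse (f x))" by transfer (simp add: hyper_eq_def)
lemma hmap_hcof: "hmap \<phi> (hcof f) = hcof (\<lambda>x. \<phi> (f x))" by transfer (simp add: hyper_eq_def)
lemma hlt_hcof: "hlt (hcof f) (hcof g) \<longleftrightarrow> eventually (\<lambda>x. cmod (f x) < cmod (g x)) hyper"
  by transfer simp
lemma hcof_power: "hcof f ^ n = hcof (\<lambda>x. f x ^ n)"
  by (induction n) (simp_all add: hcof_1 hcof_mult)
lemma hcof_sum: "(\<Sum>i\<in>I. hcof (f i)) = hcof (\<lambda>x. \<Sum>i\<in>I. f i x)"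
  by (induction I rule: infinite_finite_induct) (simp_all add: hcof_0 hcof_add)
lemma hcof_of_nat: "of_nat n = hcof (\<lambda>_. of_nat n)"
  by (induction n) (simp_all add: hcof_0 hcof_add flip: hcof_1)
lemma hcof_of_int: "of_int n = hcof (\<lambda>_. of_int n)"
  by (cases n) (simp_all add: hcof_of_nat hcof_uminus hcof_diff hcof_add flip: hcof_1)

lemmas hcof_ops = hcof_add hcof_diff hcof_mult hcof_divide hcof_uminus hcof_inverse hcof_power hcof_sum hmap_hcof

instance hc :: (type) field_char_0
proof
  show "inj (of_nat :: nat \<Rightarrow> 'a hc)"
  proof (rule injI)
    fix m n assume "(of_nat m :: 'a hc) = of_nat n"
    then have "eventually (\<lambda>x :: 'a \<Rightarrow> real. (of_nat m :: complex) = of_nat n) hyper" unfolding hcof_of_nat hcof_eq .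
    then show "m = n" by (cases "m = n") (auto simp: hyper_False)
  qed
qed

lemma hcof_of_rat: "of_rat q = hcof (\<lambda>_. of_rat q)"
  by (cases q) (simp add: of_rat_rat hcof_of_int hcof_divide)

text \<open>The polynomial over the ultrapower is represented by the family of complex polynomials
  obtained from representatives of its coefficients.\<close>

lemma hc_poly_repr:
  fixes p :: "'i hc poly"
  assumes "\<And>i. coeff p i \<in> hcof ` F"
  shows "\<exists>P f. (\<forall>x i. coeff (P x) i = (if i \<le> degree p then f i x else 0)) \<and> (\<forall>i. f i \<in> F) \<and>
    (\<forall>g. poly p (hcof g) = hcof (\<lambda>x. poly (P x) (g x))) \<and>
    (p \<noteq> 0 \<longrightarrow> eventually (\<lambda>x. degree (P x) = degree p \<and> P x \<noteq> 0) hyper)"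
proof -
  have "\<forall>i. \<exists>f\<in>F. coeff p i = hcof f" using assms by blast
  then obtain f where f: "\<And>i. f i \<in> F" "\<And>i. coeff p i = hcof (f i)" by metis
  define P where "P x = (\<Sum>i\<le>degree p. monom (f i x) i)" for x
  have c: "coeff (P x) i = (if i \<le> degree p then f i x else 0)" for x i
    by (simp add: P_def coeff_sum)
  have d: "degree (P x) \<le> degree p" for x by (rule degree_le) (simp add: c)
  have e: "poly p (hcof g) = hcof (\<lambda>x. poly (P x) (g x))" for g
    by (simp add: poly_altdef[of p] f(2) hcof_ops P_def poly_sum poly_monom)
  have n: "eventually (\<lambda>x. degree (P x) = degree p \<and> P x \<noteq> 0) hyper" if "p \<noteq> 0"
  proof -
    have "hcof (f (degree p)) \<noteq> hcof (\<lambda>_. 0)" using that f(2)[of "degree p"] by (metis hcof_0 leading_coeff_0_iff)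
    then have "eventually (\<lambda>x. f (degree p) x \<noteq> 0) hyper" unfolding hcof_eq hyper_not[symmetric] .
    then show ?thesis
    proof eventually_elim
      case (elim x)
      then have "coeff (P x) (degree p) \<noteq> 0" by (simp add: c)
      then show ?case using d[of x] le_degree[of "P x" "degree p"] by auto
    qed
  qed
  show ?thesis using c f(1) e n by (intro exI[of _ P] exI[of _ f] conjI allI impI) simp_all
qed

text \<open>The field of all elements whose levels lie in \<open>A\<close>. It is stable under
  arbitrary functions applied pointwise, hence also contains moduli, conjugates and logarithms of
  its elements.\<close>

definition CF :: "'i set \<Rightarrow> 'i hc set" where
  "CF A = hcof ` {f. depends_on A f}"

lemma CF_I: "depends_on A f \<Longrightarrow> hcof f \<in> CF A"
  unfolding CF_def by blast

lemma CF_E: assumes "a \<in> CF A" obtains f where "a = hcof f" "depends_on A f"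
  using assms unfolding CF_def by blast

lemma CF_mono: "A \<subseteq> B \<Longrightarrow> CF A \<subseteq> CF B"
  unfolding CF_def using depends_on_mono by blast

lemma CF_hmap: "a \<in> CF A \<Longrightarrow> hmap \<phi> a \<in> CF A"
proof (elim CF_E)
  fix f assume "a = hcof f" "depends_on A f"
  moreover have "depends_on A (\<lambda>x. \<phi> (f x))" using \<open>depends_on A f\<close> unfolding depends_on_def by metis
  ultimately show ?thesis using CF_I by (simp add: hmap_hcof)
qed

lemma CF_const: "hcof (\<lambda>_. c) \<in> CF A"
  by (rule CF_I) (simp add: depends_on_def)

lemma CF_subfield: "is_subfield (CF A)"
proof -
  have ops: "a + b \<in> CF A \<and> a - b \<in> CF A \<and> a * b \<in> CF A \<and> inverse a \<in> CF A" if ab: "a \<in> CF A" "b \<in> CF A" for a b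
  proof -
    obtain f where f: "a = hcof f" "depends_on A f" using CF_E[OF ab(1)] .
    obtain g where g: "b = hcof g" "depends_on A g" using CF_E[OF ab(2)] .
    have *: "depends_on A (\<lambda>x. h (f x) (g x))" for h :: "complex \<Rightarrow> complex \<Rightarrow> complex"
      using depends_onD[OF f(2)] depends_onD[OF g(2)] unfolding depends_on_def by metis
    show ?thesis unfolding f(1) g(1) hcof_ops
      by (intro conjI CF_I *[of "(+)"] *[of "(-)"] *[of "(*)"] *[of "\<lambda>u v. inverse u"])
  qed
  moreover have "0 \<in> CF A" "1 \<in> CF A" using CF_const[of 0 A] CF_const[of 1 A] by (simp_all add: hcof_0 hcof_1)
  ultimately show ?thesis unfolding is_subfield_def by simp
qed

text \<open>Pointwise, a root occurs in the list of all roots of the polynomial at that index. The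
  list length is bounded by the degree, so the ultrafilter fixes one position, and the root at a
  fixed position depends on no further coordinates.\<close>

lemma rclosed_CF: "rclosed (CF (A :: 'i set))"
proof -
  have root: "y \<in> CF A" if y: "algover (CF A) y" for y
  proof -
    obtain p where p: "p \<noteq> 0" "coeffs_in (CF A) p" "poly p y = 0" using y unfolding algover_def by blast
    obtain g where g: "y = hcof g" by (rule hcof_surj)
    have "coeff p i \<in> hcof ` {f. depends_on A f}" for i using p(2) unfolding coeffs_in_def CF_def by simp
    from hc_poly_repr[of p, OF this] obtain P f where
      P: "\<forall>x i. coeff (P x) i = (if i \<le> degree p then f i x else 0)"
      "\<forall>i. f i \<in> {f. depends_on A f}" "\<forall>g. poly p (hcof g) = hcof (\<lambda>x. poly (P x) (g x))"
      "p \<noteq> 0 \<longrightarrow> eventually (\<lambda>x. degree (P x) = degree p \<and> P x \<noteq> 0) hyper" by (elim exE conjE)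
    \<comment> \<open>The enumeration is a function of the polynomial alone; equal coefficients
      yield the same list.\<close>
    define L where "L q = (SOME xs. set xs = {z :: complex. poly q z = 0} \<and> distinct xs)" for q
    have L: "set (L q) = {z. poly q z = 0} \<and> distinct (L q)" if "q \<noteq> 0" for q
      unfolding L_def by (rule someI_ex) (use finite_distinct_list[OF poly_roots_finite[OF that]] in blast)
    have "eventually (\<lambda>x. poly (P x) (g x) = 0) hyper"
      using p(3) unfolding g P(3)[rule_format] by (simp add: hcof_0[symmetric] hcof_eq)
    with P(4)[rule_format, OF p(1)] have "eventually (\<lambda>x. \<exists>j\<in>{..degree p}. g x = L (P x) ! j) hyper"
    proof eventually_elim
      case (elim x)
      then have nz: "P x \<noteq> 0" by simp
      have "g x \<in> set (L (P x))" using L[OF nz] elim by simp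
      then obtain j where j: "j < length (L (P x))" "g x = L (P x) ! j" by (auto simp: in_set_conv_nth)
      have "length (L (P x)) = card {z. poly (P x) z = 0}" using L[OF nz] distinct_card by metis
      also have "\<dots> \<le> degree (P x)" using nz by (rule card_poly_roots_bound)
      finally show ?case using j elim by (intro bexI[of _ j]) auto
    qed
    then obtain j where "eventually (\<lambda>x. g x = L (P x) ! j) hyper" using hyper_bex[of "{..degree p}" "\<lambda>j x. g x = L (P x) ! j"] by blast
    then have "y = hcof (\<lambda>x. L (P x) ! j)" unfolding g hcof_eq .
    moreover have "depends_on A (\<lambda>x. L (P x) ! j)" unfolding depends_on_def
    proof (intro allI impI)
      fix x x' :: "'i \<Rightarrow> real" assume "\<forall>i\<in>A. x i = x' i"
      then have "f i x = f i x'" for i using P(2) by (intro depends_onD[of A "f i"]) auto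
      then have "P x = P x'" by (intro poly_eqI) (simp add: P(1))
      then show "L (P x) ! j = L (P x') ! j" by simp
    qed
    ultimately show ?thesis using CF_I by simp
  qed
  show ?thesis unfolding rclosed_def by (intro conjI allI impI CF_subfield root)
qed

lemma alg_closed_hc: "alg_closed_field TYPE('i hc)"
  unfolding alg_closed_field_def
proof (intro allI impI)
  fix p :: "'i hc poly" assume d: "degree p > 0"
  have "coeff p i \<in> hcof ` UNIV" for i using hcof_surj by (metis rangeI)
  from hc_poly_repr[of p, OF this] obtain P f where
    P: "\<forall>g. poly p (hcof g) = hcof (\<lambda>x. poly (P x) (g x))"
    "p \<noteq> 0 \<longrightarrow> eventually (\<lambda>x. degree (P x) = degree p \<and> P x \<noteq> 0) hyper" by (elim exE conjE)
  have "\<forall>x. \<exists>z. degree (P x) > 0 \<longrightarrow> poly (P x) z = 0"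
    using Fundamental_Theorem_Algebra.fundamental_theorem_of_algebra constant_degree by (metis neq0_conv)
  then obtain g where g: "\<And>x. degree (P x) > 0 \<Longrightarrow> poly (P x) (g x) = 0" by metis
  have "p \<noteq> 0" using d by auto
  from P(2)[rule_format, OF this] have "eventually (\<lambda>x. poly (P x) (g x) = 0) hyper"
    by eventually_elim (use g d in auto)
  then have "poly p (hcof g) = 0" unfolding P(1)[rule_format] by (simp add: hcof_0[symmetric] hcof_eq)
  then show "\<exists>x. poly p x = 0" by blast
qed

definition hx :: "'i \<Rightarrow> 'i hc" where "hx i = hcof (\<lambda>x. of_real (x i))"

lemma hx_CF: "i \<in> A \<Longrightarrow> hx i \<in> CF A"
  unfolding hx_def by (rule CF_I) (simp add: depends_on_def)

text \<open>A representative depending on earlier coordinates would agree in modulus with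
  \<open>x i\<close>, while \<open>x i\<close> lies strictly below every positive such
  function.\<close>

lemma hx_notin_CF: "hx i \<notin> CF (below i)"
proof
  assume "hx i \<in> CF (below i)"
  then obtain f where f: "hx i = hcof f" "depends_on (below i) f" by (rule CF_E)
  have "depends_on (below i) (\<lambda>x. cmod (f x))" using f(2) unfolding depends_on_def by metis
  from hyper_tiny[OF this] f(1)[unfolded hx_def hcof_eq]
  have "eventually (\<lambda>x :: 'a \<Rightarrow> real. False) hyper"
  proof eventually_elim
    case (elim x)
    then have "cmod (f x) = x i" by (metis abs_of_pos norm_of_real)
    then show ?case using elim by auto
  qed
  then show False using hyper_False by blast
qed

section \<open>Generic conjugates\<close>

text \<open>The closure of a countable set is countable, so an uncountable field always offers a
  further transcendental element.\<close>

lemma independent_images: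
  assumes unc: "uncountable (UNIV :: 'a::field set)" and C: "countable (C :: 'a set)" and "finite B"
  shows "\<exists>\<beta>. inj_on \<beta> B \<and> acl_indep C (\<beta> ` B)"
  using \<open>finite B\<close>
proof (induction B rule: finite_induct)
  case empty then show ?case by (simp add: acl_indep_empty)
next
  case (insert b B)
  then obtain \<beta> where \<beta>: "inj_on \<beta> B" "acl_indep C (\<beta> ` B)" by blast
  have "countable (acl (C \<union> \<beta> ` B))" using C insert.hyps(1) by (intro countable_acl) (auto intro: countable_finite)
  then have "acl (C \<union> \<beta> ` B) \<noteq> UNIV" using unc by auto
  then obtain x where x: "x \<notin> acl (C \<union> \<beta> ` B)" by blast
  let ?\<beta> = "\<beta>(b := x)"
  have im: "?\<beta> ` B = \<beta> ` B" using insert.hyps(2) by auto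
  have "x \<notin> \<beta> ` B" using x acl_superset[of "C \<union> \<beta> ` B"] by auto
  then have "inj_on ?\<beta> (insert b B)" using \<beta>(1) insert.hyps(2) im
    by (auto simp: inj_on_def)
  moreover have "acl_indep C (?\<beta> ` insert b B)"
    using acl_indep_insert[OF \<beta>(2) x] unfolding image_insert im by simp
  ultimately show ?case by blast
qed

lemma fixed_subfield:
  assumes h: "emb S h" and S: "is_subfield S" shows "is_subfield {x \<in> S. h x = x}"
  using S emb_0[OF h] emb_1[OF h] emb_add[OF h] emb_diff[OF h] emb_mult[OF h] emb_inverse[OF h S]
  unfolding is_subfield_def by simp

text \<open>The elements of \<open>T\<close> are adjoined one at a time; \<open>t\<close> is the one
  whose adjunction captures \<open>n\<close>.\<close>

lemma acl_split_off:
  assumes "finite T" "n \<in> acl (L \<union> T)" "n \<notin> acl L"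
  shows "\<exists>B t. insert t B \<subseteq> T \<and> t \<notin> B \<and> n \<notin> acl (L \<union> B) \<and> n \<in> acl (L \<union> insert t B)"
  using assms(1,2)
proof (induction T rule: finite_induct)
  case empty then show ?case using assms(3) by simp
next
  case (insert x T)
  show ?case
  proof (cases "n \<in> acl (L \<union> T)")
    case True
    then obtain B t where "insert t B \<subseteq> T" "t \<notin> B" "n \<notin> acl (L \<union> B)" "n \<in> acl (L \<union> insert t B)"
      using insert.IH by blast
    then show ?thesis by (intro exI[of _ B] exI[of _ t]) auto
  next
    case False
    then show ?thesis using insert by (intro exI[of _ T] exI[of _ x]) auto
  qed
qed

text \<open>A suitable translation of one of the transcendentals moves any given element outside the base field:
  otherwise that transcendental, being algebraic over the element, would have infinitely many conjugates.\<close>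

lemma moving_embedding:
  fixes C :: "'a::field_char_0 set"
  assumes ac: "alg_closed_field TYPE('a)" and L: "rclosed L" and LC: "L \<subseteq> C"
    and T: "acl_indep C T" "finite T" and n: "n \<in> acl (L \<union> T)" "n \<notin> L"
  shows "\<exists>h. emb (acl (C \<union> T)) h \<and> (\<forall>x\<in>C. h x = x) \<and> h ` acl (L \<union> T) \<subseteq> acl (L \<union> T) \<and> h n \<noteq> n"
proof -
  have "n \<notin> acl L" using n(2) acl_rclosed[OF L] by simp
  then obtain B t where Bt: "insert t B \<subseteq> T" "t \<notin> B" "n \<notin> acl (L \<union> B)" "n \<in> acl (L \<union> insert t B)"
    using acl_split_off[OF T(2) n(1)] by blast
  have tn: "t \<in> acl (insert n (L \<union> B))" using acl_exchange[of n t "L \<union> B"] Bt(3,4) by simp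
  let ?T0 = "acl (C \<union> (T - {t}))"
  have t0: "t \<notin> ?T0" using T(1) Bt(1) unfolding acl_indep_def by auto
  have sup: "C \<union> (T - {t}) \<subseteq> ?T0" by (rule acl_superset)
  have CT: "acl (C \<union> T) \<subseteq> acl (?T0 \<union> {t})"
    by (rule acl_mono) (use sup in auto)
  \<comment> \<open>Translation of \<open>t\<close> by a natural number keeps it transcendental over
    the rest and so extends to an embedding fixing the rest.\<close>
  have emb: "\<exists>h. emb (acl (?T0 \<union> {t})) h \<and> (\<forall>x\<in>?T0. h x = x) \<and> h t = t + of_nat k" for k :: nat
  proof -
    have k: "of_nat k \<in> ?T0" by (rule subring_of_nat[OF subring_acl])
    have "t + of_nat k \<notin> ?T0" using subring_diff[OF subring_acl, of "t + of_nat k" "C \<union> (T - {t})" "of_nat k"] k t0 by auto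
    then have "t + of_nat k \<notin> acl ((\<lambda>x. x) ` ?T0 \<union> (\<lambda>_. t + of_nat k) ` ({t} - {t}))"
      by (simp add: acl_rclosed[OF rclosed_acl])
    moreover have "acl_indep ?T0 {t}" using t0 by (simp add: acl_indep_def acl_rclosed[OF rclosed_acl])
    ultimately show ?thesis
      using embedding_extension[OF ac subring_acl emb_id, of "C \<union> (T - {t})" "{t}" "\<lambda>_. t + of_nat k"] by auto
  qed
  then obtain h where h: "\<And>k. emb (acl (?T0 \<union> {t})) (h k)" "\<And>k x. x \<in> ?T0 \<Longrightarrow> h k x = x"
    "\<And>k. h k t = t + of_nat k" by metis
  let ?S = "acl (?T0 \<union> {t})"
  have SF: "is_subfield ?S" by (rule subfield_acl)
  have "\<exists>k. h k n \<noteq> n"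
  proof (rule ccontr)
    assume "\<not> ?thesis"
    then have hn: "h k n = n" for k by simp
    obtain p where p: "p \<noteq> 0" "coeffs_in (gen_field (insert n (L \<union> B))) p" "poly p t = 0"
      using tn unfolding acl_def algover_def by blast
    have nS: "n \<in> ?S" using n(1) CT acl_mono[of "L \<union> T" "C \<union> T"] LC by auto
    have tS: "t \<in> ?S" using acl_superset[of "?T0 \<union> {t}"] by auto
    have "poly p (t + of_nat k) = 0" for k
    proof -
      have "L \<union> B \<subseteq> ?T0" using sup LC Bt(1,2) by auto
      then have "insert n (L \<union> B) \<subseteq> {x \<in> ?S. h k x = x}"
        using nS hn h(2) acl_superset[of "?T0 \<union> {t}"] by auto
      then have g: "gen_field (insert n (L \<union> B)) \<subseteq> {x \<in> ?S. h k x = x}"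
        by (rule gen_field_least[OF fixed_subfield[OF h(1) SF]])
      have c: "coeff p i \<in> ?S \<and> h k (coeff p i) = coeff p i" for i
        using p(2) g unfolding coeffs_in_def by auto
      then have pS: "coeffs_in ?S p" unfolding coeffs_in_def by simp
      have "map_poly (h k) p = p" using c by (intro poly_eqI) (simp add: coeff_map_poly emb_0[OF h(1)])
      then have "poly p (h k t) = h k (poly p t)" using emb_poly[OF h(1) subring_acl pS tS] by simp
      then show ?thesis using p(3) emb_0[OF h(1)] h(3) by simp
    qed
    then have "range (\<lambda>k :: nat. t + of_nat k) \<subseteq> {x. poly p x = 0}" by auto
    then have "finite (range (\<lambda>k :: nat. t + of_nat k))" using poly_roots_finite[OF p(1)] finite_subset by blast
    moreover have "inj (\<lambda>k :: nat. t + of_nat k)" by (rule injI) simp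
    ultimately show False using finite_imageD infinite_UNIV_nat by blast
  qed
  then obtain k where k: "h k n \<noteq> n" by blast
  have sub: "L \<union> T \<subseteq> ?S" using LC sup acl_superset[of "?T0 \<union> {t}"] by auto
  have img: "h k ` (L \<union> T) \<subseteq> acl (L \<union> T)"
  proof
    fix y assume "y \<in> h k ` (L \<union> T)"
    then obtain x where x: "x \<in> L \<union> T" "y = h k x" by blast
    have xin: "x \<in> acl (L \<union> T)" using x(1) acl_superset[of "L \<union> T"] by auto
    show "y \<in> acl (L \<union> T)"
    proof (cases "x = t")
      case True
      then show ?thesis using x h(3) xin by (auto intro!: subring_add[OF subring_acl] subring_of_nat[OF subring_acl])
    next
      case False
      then have "x \<in> ?T0" using x(1) LC sup by auto
      then show ?thesis using x(2) h(2) xin by simp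
    qed
  qed
  have "h k ` acl (L \<union> T) \<subseteq> acl (L \<union> T)"
    using emb_acl[OF h(1) rclosed_acl sub] acl_subset[OF img] by blast
  moreover have "emb (acl (C \<union> T)) (h k)" using emb_subset[OF h(1) CT] .
  moreover have "\<forall>x\<in>C. h k x = x" using h(2) sup by auto
  ultimately show ?thesis using k by blast
qed

text \<open>Linear disjointness: a shortest relation is shortened further by a moving embedding.\<close>

lemma linear_disjoint:
  fixes C :: "'a::field_char_0 set"
  assumes ac: "alg_closed_field TYPE('a)" and L: "rclosed L" and LC: "L \<subseteq> C"
    and T: "acl_indep C T" "finite T"
    and "finite J" "\<And>j. j \<in> J \<Longrightarrow> c j \<in> C" "\<And>j. j \<in> J \<Longrightarrow> n j \<in> acl (L \<union> T)"
    and "(\<Sum>j\<in>J. c j * n j) = 0" "\<exists>j\<in>J. n j \<noteq> 0"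
  shows "\<exists>l. (\<forall>j\<in>J. l j \<in> L) \<and> (\<exists>j\<in>J. l j \<noteq> 0) \<and> (\<Sum>j\<in>J. c j * l j) = 0"
  using assms(6-)
proof (induction "card J" arbitrary: J n rule: less_induct)
  case less
  let ?N = "acl (L \<union> T)" and ?S = "acl (C \<union> T)"
  obtain j0 where j0: "j0 \<in> J" "n j0 \<noteq> 0" using less.prems(5) by blast
  \<comment> \<open>Normalised so that the entry at \<open>j0\<close> is 1. An embedding fixes it,
    and the difference with the moved relation has one summand less.\<close>
  define n' where "n' j = n j / n j0" for j
  have n'N: "n' j \<in> ?N" if "j \<in> J" for j
    unfolding n'_def using less.prems(3) that j0 by (intro subfield_divide[OF subfield_acl])
  have "(\<Sum>j\<in>J. c j * n' j) = (\<Sum>j\<in>J. c j * n j) / n j0" by (simp add: n'_def sum_divide_distrib)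
  then have sum': "(\<Sum>j\<in>J. c j * n' j) = 0" using less.prems(4) by simp
  have one: "n' j0 = 1" using j0 by (simp add: n'_def)
  show ?case
  proof (cases "\<forall>j\<in>J. n' j \<in> L")
    case True
    then show ?thesis using sum' one j0(1) by (intro exI[of _ n'] conjI bexI[of _ j0]) auto
  next
    case False
    then obtain j1 where j1: "j1 \<in> J" "n' j1 \<notin> L" by blast
    obtain h where h: "emb ?S h" "\<forall>x\<in>C. h x = x" "h ` ?N \<subseteq> ?N" "h (n' j1) \<noteq> n' j1"
      using moving_embedding[OF ac L LC T n'N[OF j1(1)] j1(2)] by blast
    have NS: "?N \<subseteq> ?S" using LC by (intro acl_mono) auto
    have CS: "C \<subseteq> ?S" using acl_superset[of "C \<union> T"] by auto
    define d where "d j = n' j - h (n' j)" for j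
    have dN: "d j \<in> ?N" if "j \<in> J" for j
      unfolding d_def using n'N[OF that] h(3) by (intro subring_diff[OF subring_acl]) auto
    have "(\<Sum>j\<in>J. c j * h (n' j)) = (\<Sum>j\<in>J. h (c j * n' j))"
    proof (rule sum.cong)
      fix j assume j: "j \<in> J"
      have "h (c j * n' j) = h (c j) * h (n' j)" using less.prems(2)[OF j] n'N[OF j] NS CS by (intro emb_mult[OF h(1)]) auto
      then show "c j * h (n' j) = h (c j * n' j)" using h(2) less.prems(2)[OF j] by simp
    qed simp
    also have "\<dots> = h (\<Sum>j\<in>J. c j * n' j)"
    proof (rule emb_sum[OF h(1) subring_acl, symmetric])
      fix j assume j: "j \<in> J"
      show "c j * n' j \<in> ?S" using less.prems(2)[OF j] n'N[OF j] NS CS by (intro subring_mult[OF subring_acl]) auto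
    qed
    finally have sumh: "(\<Sum>j\<in>J. c j * h (n' j)) = 0" using sum' emb_0[OF h(1)] by simp
    have "(\<Sum>j\<in>J. c j * d j) = 0" unfolding d_def right_diff_distrib sum_subtractf using sum' sumh by simp
    moreover have dj0: "d j0 = 0" using one emb_1[OF h(1)] by (simp add: d_def)
    ultimately have sumd: "(\<Sum>j\<in>J - {j0}. c j * d j) = 0"
      using sum.remove[OF less.prems(1) j0(1), of "\<lambda>j. c j * d j"] by simp
    have "d j1 \<noteq> 0" using h(4) by (simp add: d_def)
    then have ex: "\<exists>j\<in>J - {j0}. d j \<noteq> 0" using dj0 j1(1) by (intro bexI[of _ j1]) auto
    have "card (J - {j0}) < card J" by (rule card_Diff1_less[OF less.prems(1) j0(1)])
    from less.hyps[OF this _ _ _ sumd ex]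
    obtain l where l: "\<forall>j\<in>J - {j0}. l j \<in> L" "\<exists>j\<in>J - {j0}. l j \<noteq> 0" "(\<Sum>j\<in>J - {j0}. c j * l j) = 0"
      using less.prems(1,2) dN by auto
    let ?l = "l(j0 := 0)"
    have "(\<Sum>j\<in>J - {j0}. c j * ?l j) = (\<Sum>j\<in>J - {j0}. c j * l j)" by (rule sum.cong) auto
    then have "(\<Sum>j\<in>J. c j * ?l j) = 0"
      using sum.remove[OF less.prems(1) j0(1), of "\<lambda>j. c j * ?l j"] l(3) by simp
    moreover have "\<forall>j\<in>J. ?l j \<in> L" using l(1) subring_0[OF rclosed_subring[OF L]] by auto
    moreover have "\<exists>j\<in>J. ?l j \<noteq> 0" using l(2) by auto
    ultimately show ?thesis by blast
  qed
qed

text \<open>If some \<open>f j\<close> does not vanish at \<open>p'\<close>, linear disjointness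
  turns the relation with coefficients in \<open>C\<close> into a relation \<open>l\<close> over
  \<open>L\<close>. With its help one summand is eliminated. Once all \<open>f j\<close> vanish at
  \<open>p'\<close>, they vanish at \<open>q\<close> by assumption.\<close>

lemma vanishing_transfer:
  fixes C :: "'a::field_char_0 set"
  assumes ac: "alg_closed_field TYPE('a)" and L: "rclosed L" and LC: "L \<subseteq> C"
    and T: "acl_indep C T" "finite T"
    and p': "\<And>i. i < m \<Longrightarrow> p' i \<in> acl (L \<union> T)"
    and q: "\<And>f. pfun L m f \<Longrightarrow> f p' = 0 \<Longrightarrow> f q = 0"
    and "finite J" "\<And>j. j \<in> J \<Longrightarrow> c j \<in> C" "\<And>j. j \<in> J \<Longrightarrow> pfun L m (f j)"
    and "(\<Sum>j\<in>J. c j * f j p') = 0"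
  shows "(\<Sum>j\<in>J. c j * f j q) = 0"
  using assms(8-)
proof (induction "card J" arbitrary: J f rule: less_induct)
  case less
  note R = rclosed_subring[OF L]
  show ?case
  proof (cases "\<exists>j\<in>J. f j p' \<noteq> 0")
    case False
    then have "f j q = 0" if "j \<in> J" for j using q[OF less.prems(3)] that by simp
    then show ?thesis by simp
  next
    case True
    have fin: "f j p' \<in> acl (L \<union> T)" if "j \<in> J" for j
    proof (rule pfun_in_subring[OF subring_acl _ p'])
      show "pfun (acl (L \<union> T)) m (f j)" using acl_superset[of "L \<union> T"] by (intro pfun_mono[OF less.prems(3)[OF that]]) auto
    qed
    obtain l where l: "\<forall>j\<in>J. l j \<in> L" "\<exists>j\<in>J. l j \<noteq> 0" "(\<Sum>j\<in>J. c j * l j) = 0"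
      using linear_disjoint[OF ac L LC T less.prems(1,2) fin less.prems(4) True] by blast
    obtain j0 where j0: "j0 \<in> J" "l j0 \<noteq> 0" using l(2) by blast
    \<comment> \<open>Subtracting these multiples of \<open>f j0\<close> leaves the sum unchanged
      while the summand \<open>j0\<close> disappears, because the \<open>l j\<close> satisfy the
      same linear relation.\<close>
    let ?g = "\<lambda>j x. f j x - (l j / l j0) * f j0 x"
    have l0: "(\<Sum>j\<in>J - {j0}. c j * l j) = - (c j0 * l j0)"
      using l(3) sum.remove[OF less.prems(1) j0(1), of "\<lambda>j. c j * l j"] by (simp add: eq_neg_iff_add_eq_0 add.commute)
    have id: "(\<Sum>j\<in>J - {j0}. c j * ?g j x) = (\<Sum>j\<in>J. c j * f j x)" for x
    proof -
      have "(\<Sum>j\<in>J - {j0}. c j * ?g j x) = (\<Sum>j\<in>J - {j0}. c j * f j x) - (\<Sum>j\<in>J - {j0}. c j * l j) * (f j0 x / l j0)"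
        by (simp add: right_diff_distrib sum_subtractf sum_distrib_left sum_divide_distrib algebra_simps)
      also have "\<dots> = (\<Sum>j\<in>J - {j0}. c j * f j x) + c j0 * f j0 x" unfolding l0 using j0(2) by simp
      also have "\<dots> = (\<Sum>j\<in>J. c j * f j x)"
        using sum.remove[OF less.prems(1) j0(1), of "\<lambda>j. c j * f j x"] by simp
      finally show ?thesis .
    qed
    have "card (J - {j0}) < card J" by (rule card_Diff1_less[OF less.prems(1) j0(1)])
    then have "(\<Sum>j\<in>J - {j0}. c j * ?g j q) = 0"
    proof (rule less.hyps)
      show "pfun L m (?g j)" if "j \<in> J - {j0}" for j
        using that l(1) j0 less.prems(3)
        by (intro pfun_diff[OF R] pfun_scale[OF R] subfield_divide[OF rclosed_subfield[OF L]]) auto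
      show "(\<Sum>j\<in>J - {j0}. c j * ?g j p') = 0" unfolding id by (rule less.prems(4))
    qed (use less.prems(1,2) in auto)
    then show ?thesis unfolding id .
  qed
qed

text \<open>Moves a point, over \<open>L\<close>, into general position with respect to a larger
  countable field \<open>C\<close>. A transcendence basis of the coordinates over \<open>L\<close>
  is sent to elements independent over \<open>C\<close>, so the image is linearly disjoint from
  \<open>C\<close> over \<open>L\<close>: it acquires no new elements of \<open>C\<close> and
  satisfies no equations over \<open>C\<close> beyond those implied over \<open>L\<close>.\<close>

lemma generic_conjugate:
  fixes p :: "nat \<Rightarrow> 'a::field_char_0"
  assumes ac: "alg_closed_field TYPE('a)" and unc: "uncountable (UNIV :: 'a set)"
    and L: "rclosed L" and C: "rclosed C" "countable C" and LC: "L \<subseteq> C"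
  shows "\<exists>\<tau> N. rclosed N \<and> L \<subseteq> N \<and> (\<forall>i<m. p i \<in> N) \<and> emb N \<tau> \<and> (\<forall>x\<in>L. \<tau> x = x) \<and>
    (\<forall>x\<in>N. \<tau> x \<in> C \<longrightarrow> x \<in> L) \<and>
    (\<forall>f q. pfun C m f \<longrightarrow> f (\<lambda>i. \<tau> (p i)) = 0 \<longrightarrow> (\<forall>g. pfun L m g \<longrightarrow> g p = 0 \<longrightarrow> g q = 0) \<longrightarrow> f q = 0)"
proof -
  obtain B where B: "B \<subseteq> p ` {..<m}" "acl_indep L B" "p ` {..<m} \<subseteq> acl (L \<union> B)"
    using acl_basis_finite[of "p ` {..<m}" L] by auto
  have fB: "finite B" using B(1) finite_subset by blast
  obtain \<beta> where \<beta>: "inj_on \<beta> B" "acl_indep C (\<beta> ` B)" using independent_images[OF unc C(2) fB] by blast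
  let ?N = "acl (L \<union> B)" and ?T = "\<beta> ` B"
  have "\<beta> b \<notin> acl ((\<lambda>x. x) ` L \<union> \<beta> ` (B - {b}))" if "b \<in> B" for b
  proof -
    have "\<beta> b \<notin> acl (C \<union> (\<beta> ` B - {\<beta> b}))" using \<beta>(2) that unfolding acl_indep_def by simp
    moreover have "\<beta> ` (B - {b}) \<subseteq> \<beta> ` B - {\<beta> b}" using \<beta>(1) that unfolding inj_on_def by auto
    then have "acl ((\<lambda>x. x) ` L \<union> \<beta> ` (B - {b})) \<subseteq> acl (C \<union> (\<beta> ` B - {\<beta> b}))" using LC by (intro acl_mono) auto
    ultimately show ?thesis by blast
  qed
  from embedding_extension[OF ac rclosed_subring[OF L] emb_id B(2) this]
  obtain \<tau> where \<tau>: "emb ?N \<tau>" "\<forall>x\<in>L. \<tau> x = x" "\<forall>b\<in>B. \<tau> b = \<beta> b" by blast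
  have LBN: "L \<union> B \<subseteq> ?N" by (rule acl_superset)
  have \<tau>N: "\<tau> x \<in> acl (L \<union> ?T)" if "x \<in> ?N" for x
  proof -
    have "\<tau> ` (L \<union> B) = L \<union> ?T" unfolding image_Un using \<tau>(2,3) by force
    then show ?thesis using emb_acl[OF \<tau>(1) rclosed_acl LBN that] by simp
  qed
  have pN: "p i \<in> ?N" if "i < m" for i using B(3) that by auto
  have 1: "x \<in> L" if x: "x \<in> ?N" "\<tau> x \<in> C" for x
  proof -
    \<comment> \<open>The trivial identity \<open>1 * \<tau> x - \<tau> x * 1 = 0\<close>, read with
      one factor in \<open>C\<close> and the other in the image field; linear disjointness makes
      \<open>\<tau> x\<close> a quotient of elements of \<open>L\<close>.\<close>
    let ?c = "\<lambda>j :: nat. if j = 0 then 1 else - \<tau> x" and ?n = "\<lambda>j :: nat. if j = 0 then \<tau> x else 1"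
    have "\<exists>l. (\<forall>j\<in>{0, 1}. l j \<in> L) \<and> (\<exists>j\<in>{0, 1}. l j \<noteq> 0) \<and> (\<Sum>j\<in>{0, 1}. ?c j * l j) = 0"
    proof (rule linear_disjoint[OF ac L LC \<beta>(2) finite_imageI[OF fB], where n="?n"])
      show "?c j \<in> C" for j using x(2) subring_1[OF rclosed_subring[OF C(1)]] subring_uminus[OF rclosed_subring[OF C(1)]] by simp
      show "?n j \<in> acl (L \<union> ?T)" for j using \<tau>N[OF x(1)] subring_1[OF subring_acl[of "L \<union> ?T"]] by simp
    qed simp_all
    then obtain l where l: "l 0 \<in> L" "l 1 \<in> L" "l 0 \<noteq> 0 \<or> l 1 \<noteq> 0" "l (0 :: nat) - \<tau> x * l 1 = 0" by auto
    then have "l 1 \<noteq> 0" by auto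
    then have e: "\<tau> x = l 0 / l 1" using l(4) by (simp add: field_simps)
    then have L': "\<tau> x \<in> L" using l(1,2) subfield_divide[OF rclosed_subfield[OF L]] by simp
    \<comment> \<open>\<open>\<tau>\<close> fixes \<open>\<tau> x\<close>, which lies in
      \<open>L\<close>; injectivity then gives \<open>x = \<tau> x\<close>.\<close>
    then have "\<tau> (x - \<tau> x) = 0" using emb_diff[OF \<tau>(1) x(1), of "\<tau> x"] \<tau>(2) LBN by auto
    moreover have "x - \<tau> x \<in> ?N" using x(1) L' LBN by (intro subring_diff[OF subring_acl]) auto
    ultimately have "x - \<tau> x = 0" using emb_zeroD[OF \<tau>(1)] by blast
    then show ?thesis using L' by simp
  qed
  have 2: "f q = 0" if f: "pfun C m f" "f (\<lambda>i. \<tau> (p i)) = 0" and q: "\<forall>g. pfun L m g \<longrightarrow> g p = 0 \<longrightarrow> g q = 0" for f q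
  proof -
    obtain c where c: "is_mpoly C m c" "\<And>p. mpeval m c p = f p" using f(1) unfolding pfun_def by auto
    let ?p' = "\<lambda>i. \<tau> (p i)"
    have "(\<Sum>\<alpha>\<in>{\<alpha>. c \<alpha> \<noteq> 0}. c \<alpha> * (\<Prod>i<m. q i ^ \<alpha> i)) = 0"
    proof (rule vanishing_transfer[OF ac L LC \<beta>(2) finite_imageI[OF fB], where p'="?p'" and m=m
          and f="\<lambda>\<alpha> p. (\<Prod>i<m. p i ^ \<alpha> i)"])
      show "?p' i \<in> acl (L \<union> ?T)" if "i < m" for i using \<tau>N[OF pN[OF that]] .
      show "g q = 0" if g: "pfun L m g" "g ?p' = 0" for g
      proof -
        have "\<tau> (g p) = g ?p'" using emb_pfun[OF \<tau>(1) subring_acl _ _ g(1), of p] pN \<tau>(2) LBN by auto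
        then have "\<tau> (g p) = 0" using g(2) by simp
        moreover have "g p \<in> ?N" using pfun_in_subring[OF subring_acl pfun_mono[OF g(1)] pN] LBN by auto
        ultimately have "g p = 0" using emb_zeroD[OF \<tau>(1)] by blast
        then show ?thesis using q g(1) by blast
      qed
      show "finite {\<alpha>. c \<alpha> \<noteq> 0}" "\<And>\<alpha>. c \<alpha> \<in> C" using c(1) unfolding is_mpoly_def by auto
      show "pfun L m (\<lambda>p. \<Prod>i<m. p i ^ \<alpha> i)" if "\<alpha> \<in> {\<alpha>. c \<alpha> \<noteq> 0}" for \<alpha>
        by (intro pfun_prod pfun_power pfun_coord rclosed_subring[OF L]) simp
      show "(\<Sum>\<alpha>\<in>{\<alpha>. c \<alpha> \<noteq> 0}. c \<alpha> * (\<Prod>i<m. ?p' i ^ \<alpha> i)) = 0"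
        using f(2) c(2)[of ?p'] unfolding mpeval_def by simp
    qed
    then show ?thesis using c(2)[of q] unfolding mpeval_def by simp
  qed
  show ?thesis
    by (rule exI[of _ \<tau>], rule exI[of _ ?N]) (use 1 2 \<tau>(1,2) pN LBN rclosed_acl in auto)
qed

section \<open>Dimension of Zariski closed sets\<close>

lemma zclosed_overI:
  assumes "U \<subseteq> aff m" "\<And>f. f \<in> P \<Longrightarrow> pfun F m f"
  shows "zclosed_over F m U {p \<in> U. \<forall>f\<in>P. f p = 0}"
proof -
  have "\<forall>f\<in>P. \<exists>c. is_mpoly F m c \<and> (\<forall>p. mpeval m c p = f p)" using assms(2) unfolding pfun_def by blast
  then obtain c where c: "\<And>f. f \<in> P \<Longrightarrow> is_mpoly F m (c f)" "\<And>f p. f \<in> P \<Longrightarrow> mpeval m (c f) p = f p" by metis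
  have "{p \<in> U. \<forall>f\<in>P. f p = 0} = U \<inter> zset m (c ` P)" unfolding zset_def using assms(1) c(2) by auto
  then show ?thesis unfolding zclosed_over_def using c(1) by (intro exI[of _ "c ` P"]) auto
qed

lemma zclosed_over_pfun:
  assumes "zclosed_over F m U X"
  shows "\<exists>P. (\<forall>f\<in>P. pfun F m f) \<and> X = {p \<in> U \<inter> aff m. \<forall>f\<in>P. f p = 0}"
proof -
  obtain S where S: "\<forall>c\<in>S. is_mpoly F m c" "X = U \<inter> zset m S" using assms unfolding zclosed_over_def by blast
  have "\<forall>f\<in>mpeval m ` S. pfun F m f" using S(1) pfunI by blast
  moreover have "X = {p \<in> U \<inter> aff m. \<forall>f\<in>mpeval m ` S. f p = 0}" unfolding S(2) zset_def by auto
  ultimately show ?thesis by blast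
qed

lemma zclosed_restrict:
  assumes U: "U \<subseteq> aff m" and X: "zclosed_over F m U X" and f: "pfun F m f"
  shows "zclosed_over F m U {p \<in> X. f p = 0}"
proof -
  from zclosed_over_pfun[OF X] obtain P where P0: "\<forall>f\<in>P. pfun F m f" "X = {p \<in> U \<inter> aff m. \<forall>f\<in>P. f p = 0}"
      by (elim exE conjE)
    note P = P0(1)[rule_format] P0(2)
  have "zclosed_over F m U {p \<in> U. \<forall>g\<in>insert f P. g p = 0}" using P(1) f by (intro zclosed_overI[OF U]) auto
  moreover have "{p \<in> U. \<forall>g\<in>insert f P. g p = 0} = {p \<in> X. f p = 0}" unfolding P(2) using U by auto
  ultimately show ?thesis by simp
qed

text \<open>The ideal of an irreducible set is prime, because the zero sets of the two factors cover
  it.\<close>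

lemma zirred_prime:
  assumes U: "U \<subseteq> aff m" and Y: "zirred m U Y" and f: "pfun UNIV m f" and g: "pfun UNIV m g"
    and fg: "\<And>p. p \<in> Y \<Longrightarrow> f p * g p = 0"
  shows "(\<forall>p\<in>Y. f p = 0) \<or> (\<forall>p\<in>Y. g p = 0)"
proof -
  have c: "zclosed m U Y" using Y unfolding zirred_def by blast
  have "Y = {p \<in> Y. f p = 0} \<union> {p \<in> Y. g p = 0}" using fg by auto
  then have "Y = {p \<in> Y. f p = 0} \<or> Y = {p \<in> Y. g p = 0}"
    using Y zclosed_restrict[OF U c f] zclosed_restrict[OF U c g] unfolding zirred_def by blast
  then show ?thesis by blast
qed

lemma pfun_UNIV_compose:
  "pfun UNIV k f \<Longrightarrow> (\<And>i. i < k \<Longrightarrow> pfun UNIV m (g i)) \<Longrightarrow> pfun UNIV m (\<lambda>p. f (\<lambda>i. g i p))"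
  by (rule pfun_compose[OF subfield_subring[OF subfield_UNIV]])

text \<open>Each step of the chain contributes a function \<open>f\<close> vanishing on the smaller
  set but not on the larger one. A relation over the larger set, divided by the lowest power of
  \<open>f\<close> and restricted to the smaller set, is a relation among the earlier
  functions.\<close>

lemma chain_independent:
  fixes Y :: "nat \<Rightarrow> (nat \<Rightarrow> 'a::field) set"
  assumes U: "U \<subseteq> aff m" and "\<forall>j\<le>k. zirred m U (Y j)" and "\<forall>j<k. Y j \<subset> Y (Suc j)"
  shows "\<exists>g. (\<forall>i<k. pfun UNIV m (g i)) \<and>
    (\<forall>c. is_mpoly UNIV k c \<longrightarrow> (\<forall>p\<in>Y k. mpeval k c (\<lambda>i. g i p) = 0) \<longrightarrow> c = (\<lambda>_. 0))"
  using assms(2,3)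
proof (induction k)
  case 0
  have "Y 0 \<noteq> {}" using 0 unfolding zirred_def by auto
  then obtain p where p: "p \<in> Y 0" by blast
  have "c = (\<lambda>_. 0)" if c: "is_mpoly UNIV 0 c" "\<forall>p\<in>Y 0. mpeval 0 c (\<lambda>i. undefined i p) = 0" for c :: "(nat \<Rightarrow> nat) \<Rightarrow> 'a"
  proof -
    have "mpeval 0 c (\<lambda>i. [] ! i) = mpeval 0 c (\<lambda>i. undefined i p)" by (rule mpeval_cong) simp
    then have "mpeval 0 c (\<lambda>i. [] ! i) = 0" using c(2) p by simp
    then show ?thesis using alg_indep_Nil[of "UNIV :: 'a set"] c(1) unfolding alg_indep_def by auto
  qed
  then show ?case by (intro exI[of _ undefined]) simp
next
  case (Suc k)
  note R = subfield_subring[OF subfield_UNIV]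
  obtain g where g: "\<forall>i<k. pfun UNIV m (g i)"
    "\<forall>c. is_mpoly UNIV k c \<longrightarrow> (\<forall>p\<in>Y k. mpeval k c (\<lambda>i. g i p) = 0) \<longrightarrow> c = (\<lambda>_. 0)"
    using Suc.IH Suc.prems by auto
  have Yk: "zclosed m U (Y k)" "Y k \<subset> Y (Suc k)" "zirred m U (Y (Suc k))" using Suc.prems unfolding zirred_def by auto
  from zclosed_over_pfun[OF Yk(1)] obtain P where P0: "\<forall>f\<in>P. pfun UNIV m f" "Y k = {p \<in> U \<inter> aff m. \<forall>f\<in>P. f p = 0}"
      by (elim exE conjE)
    note P = P0(1)[rule_format] P0(2)
  obtain p1 where p1: "p1 \<in> Y (Suc k)" "p1 \<notin> Y k" using Yk(2) by blast
  have "zclosed m U (Y (Suc k))" using Yk(3) unfolding zirred_def by blast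
  then have "p1 \<in> U \<inter> aff m" using p1(1) unfolding zclosed_over_def zset_def by auto
  then obtain f where f: "f \<in> P" "f p1 \<noteq> 0" using p1(2) P(2) by auto
  have fY: "f p = 0" if "p \<in> Y k" for p using that P(2) f(1) by auto
  let ?g = "g(k := f)"
  have gp: "\<forall>i<Suc k. pfun UNIV m (?g i)" using g(1) P(1)[OF f(1)] by (simp add: less_Suc_eq)
  have "c = (\<lambda>_. 0)" if c: "is_mpoly UNIV (Suc k) c" "\<forall>p\<in>Y (Suc k). mpeval (Suc k) c (\<lambda>i. ?g i p) = 0" for c
  proof (rule ccontr)
    assume "c \<noteq> (\<lambda>_. 0)"
    then obtain \<alpha> where a: "c \<alpha> \<noteq> 0" by auto
    \<comment> \<open>The lowest power of the new function that occurs in the relation.\<close>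
    let ?P = "\<lambda>j. slice k c j \<noteq> (\<lambda>_. 0)"
    have "?P (\<alpha> k)" using slice_nonzero[of c \<alpha> k] a by (auto simp: fun_eq_iff)
    then have j: "?P (LEAST j. ?P j)" by (rule LeastI[of ?P])
    have jmin: "\<And>i. i < (LEAST j. ?P j) \<Longrightarrow> \<not> ?P i" by (rule not_less_Least[of _ ?P])
    define j where "j = (LEAST j. ?P j)"
    obtain N0 where N0: "\<And>\<alpha>. c \<alpha> \<noteq> 0 \<Longrightarrow> \<alpha> k \<le> N0" using mpoly_degree_bound[OF c(1)] by blast
    define N where "N = N0 + j"
    have N: "\<And>\<alpha>. c \<alpha> \<noteq> 0 \<Longrightarrow> \<alpha> k \<le> N" using N0 by (auto simp: N_def intro: trans_le_add1)
    have sm: "is_mpoly UNIV k (slice k c i)" for i by (rule is_mpoly_slice[OF R c(1)])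
    let ?s = "\<lambda>i p. mpeval k (slice k c i) (\<lambda>i. g i p)"
    let ?h = "\<lambda>p. \<Sum>i\<le>N0. ?s (i + j) p * f p ^ i"
    have hp: "pfun UNIV m ?h"
      using g(1) P(1)[OF f(1)] by (intro pfun_sum[OF R] pfun_mult[OF R] pfun_power[OF R] pfun_UNIV_compose[OF pfunI[OF sm]]) auto
    have ev: "mpeval (Suc k) c (\<lambda>i. ?g i p) = f p ^ j * ?h p" for p
    proof -
      have s: "mpeval k (slice k c i) (\<lambda>i. ?g i p) = ?s i p" for i by (rule mpeval_cong) simp
      have "mpeval (Suc k) c (\<lambda>i. ?g i p) = (\<Sum>i\<le>N. ?s i p * f p ^ i)"
        using mpeval_Suc[OF c(1), of N "\<lambda>i. ?g i p"] N unfolding s by simp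
      also have "\<dots> = (\<Sum>i\<in>{j..N}. ?s i p * f p ^ i)"
        using jmin unfolding j_def[symmetric]
        by (intro sum.mono_neutral_right) (auto simp: mpeval_def not_le)
      also have "\<dots> = (\<Sum>i\<in>{0..N0}. ?s (i + j) p * f p ^ (i + j))"
        using sum.shift_bounds_cl_nat_ivl[of "\<lambda>i. ?s i p * f p ^ i" 0 j N0] by (simp add: N_def)
      also have "\<dots> = f p ^ j * ?h p" by (simp add: sum_distrib_left power_add atLeast0AtMost algebra_simps)
      finally show ?thesis .
    qed
    \<comment> \<open>By primality the power of \<open>f\<close> can be cancelled; on
      \<open>Y k\<close>, where \<open>f\<close> vanishes, only the lowest coefficient
      remains.\<close>
    have "(\<forall>p\<in>Y (Suc k). f p ^ j = 0) \<or> (\<forall>p\<in>Y (Suc k). ?h p = 0)"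
    proof (rule zirred_prime[OF U Yk(3) pfun_power[OF R P(1)[OF f(1)]] hp])
      show "f p ^ j * ?h p = 0" if "p \<in> Y (Suc k)" for p using c(2) that unfolding ev by blast
    qed
    then have h0: "?h p = 0" if "p \<in> Y (Suc k)" for p using p1(1) f(2) that by auto
    have "?s j p = 0" if p: "p \<in> Y k" for p
    proof -
      have "?h p = (\<Sum>i\<in>{0}. ?s (i + j) p * f p ^ i)"
        using fY[OF p] by (intro sum.mono_neutral_right) auto
      then have "?h p = ?s j p" by simp
      then show ?thesis using h0[of p] p Yk(2) by auto
    qed
    then have "slice k c j = (\<lambda>_. 0)" using g(2) sm by blast
    then show False using j unfolding j_def by blast
  qed
  then show ?case using gp by blast
qed

section \<open>Dimension through chains of irreducible sets\<close>

definition zchain :: "nat \<Rightarrow> (nat \<Rightarrow> 'a::field) set \<Rightarrow> (nat \<Rightarrow> 'a) set \<Rightarrow> nat \<Rightarrow> bool" where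
  "zchain m U X k \<longleftrightarrow> (\<exists>Y. (\<forall>j\<le>k. zirred m U (Y j)) \<and> (\<forall>j<k. Y j \<subset> Y (Suc j)) \<and> Y k \<subseteq> X)"

lemma zdim_zchain: "zdim m U X = Sup {k. zchain m U X k}"
  unfolding zdim_def zchain_def ..

text \<open>An upper bound for the dimension from test points: over every countable
  \<open>C\<close>, some \<open>q\<close> of transcendence degree at most \<open>e\<close> satisfies
  only equations valid on all of \<open>W\<close>. The independent functions of a chain stay
  independent at such a point.\<close>

lemma zchain_le:
  fixes W :: "(nat \<Rightarrow> 'a::field_char_0) set"
  assumes U: "U \<subseteq> aff m" and ch: "zchain m U W k" and C0: "countable C0"
    and gen: "\<And>C. countable C \<Longrightarrow> rclosed C \<Longrightarrow> C0 \<subseteq> C \<Longrightarrow>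
      \<exists>q B. finite B \<and> card B \<le> e \<and> (\<forall>i<m. q i \<in> acl (C \<union> B)) \<and>
        (\<forall>f. pfun C m f \<longrightarrow> f q = 0 \<longrightarrow> (\<forall>p\<in>W. f p = 0))"
  shows "k \<le> e"
proof (rule ccontr)
  assume ke: "\<not> k \<le> e"
  obtain Y where Y: "\<forall>j\<le>k. zirred m U (Y j)" "\<forall>j<k. Y j \<subset> Y (Suc j)" "Y k \<subseteq> W" using ch unfolding zchain_def by blast
  obtain g where g: "\<forall>i<k. pfun UNIV m (g i)"
    "\<And>c. is_mpoly UNIV k c \<Longrightarrow> \<forall>p\<in>Y k. mpeval k c (\<lambda>i. g i p) = 0 \<Longrightarrow> c = (\<lambda>_. 0)"
    using chain_independent[OF U Y(1,2)] by blast
  have "\<forall>i. \<exists>G. finite G \<and> (i < k \<longrightarrow> (\<forall>H. is_subring H \<longrightarrow> G \<subseteq> H \<longrightarrow> pfun H m (g i)))"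
    using pfun_finitely_many_coeffs g(1) by (metis finite.emptyI)
  then obtain G where G: "\<And>i. finite (G i)" "\<And>i H. i < k \<Longrightarrow> is_subring H \<Longrightarrow> G i \<subseteq> H \<Longrightarrow> pfun H m (g i)" by metis
  \<comment> \<open>Large enough to contain the coefficients of the functions of the chain, so that
    \<open>q\<close> is generic for the relation sought.\<close>
  define C where "C = acl (C0 \<union> (\<Union>i<k. G i))"
  have Cc: "countable C" unfolding C_def using C0 G(1) by (intro countable_acl) (auto intro: countable_finite)
  have C: "rclosed C" "C0 \<subseteq> C" using acl_superset[of "C0 \<union> (\<Union>i<k. G i)"] by (auto simp: C_def rclosed_acl)
  note R = rclosed_subring[OF C(1)]
  have gC: "pfun C m (g i)" if "i < k" for i
    using acl_superset[of "C0 \<union> (\<Union>i<k. G i)"] that by (intro G(2)[OF that R]) (auto simp: C_def)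
  obtain q B where qB: "finite B" "card B \<le> e" "\<forall>i<m. q i \<in> acl (C \<union> B)"
    "\<And>f. pfun C m f \<Longrightarrow> f q = 0 \<Longrightarrow> \<forall>p\<in>W. f p = 0" using gen[OF Cc C] by blast
  have CB: "C \<subseteq> acl (C \<union> B)" using acl_superset[of "C \<union> B"] by auto
  let ?bs = "map (\<lambda>i. g i q) [0..<k]"
  have "set ?bs \<subseteq> acl (C \<union> B)"
    using qB(3) pfun_in_subring[OF subring_acl pfun_mono[OF gC CB]] by auto
  then have "acl_indep C (set ?bs) \<Longrightarrow> card (set ?bs) \<le> e"
    using acl_steinitz[of C "set ?bs" B] qB(1,2) by simp
  moreover have "distinct ?bs \<Longrightarrow> card (set ?bs) = k" using distinct_card[of ?bs] by simp
  ultimately have "\<not> alg_indep C ?bs" using ke unfolding alg_indep_iff[OF rclosed_subfield[OF C(1)]] by auto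
  moreover have lb: "length ?bs = k" by simp
  ultimately have "\<exists>c. (is_mpoly C k c \<and> mpeval k c (\<lambda>i. ?bs ! i) = 0) \<and> (\<exists>\<alpha>. c \<alpha> \<noteq> 0)"
    unfolding alg_indep_def lb by (simp only: not_all not_imp)
  then obtain c \<alpha> where c: "is_mpoly C k c" "mpeval k c (\<lambda>i. ?bs ! i) = 0" and ca: "c \<alpha> \<noteq> 0"
    by (elim exE conjE)
  have c0: "c \<noteq> (\<lambda>_. 0)" using ca by (auto simp: fun_eq_iff)
  have "mpeval k c (\<lambda>i. g i q) = mpeval k c (\<lambda>i. ?bs ! i)" by (rule mpeval_cong) simp
  then have cq: "mpeval k c (\<lambda>i. g i q) = 0" using c(2) by (rule trans)
  have "pfun C m (\<lambda>p. mpeval k c (\<lambda>i. g i p))" by (rule pfun_compose[OF R pfunI[OF c(1)] gC])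
  from qB(4)[OF this cq] have "\<forall>p\<in>Y k. mpeval k c (\<lambda>i. g i p) = 0" using Y(3) by (meson subsetD)
  moreover have "is_mpoly UNIV k c" using c(1) unfolding is_mpoly_def by simp
  ultimately have "c = (\<lambda>_. 0)" by (intro g(2))
  then show False using c0 by (rule notE[rotated])
qed

text \<open>Elements that are independent over \<open>C\<close> are the coordinates of a generic
  point of affine space. The bound is needed because \<open>zdim\<close> is a supremum of natural
  numbers.\<close>

lemma zchain_bounded:
  fixes U :: "(nat \<Rightarrow> 'a::field_char_0) set"
  assumes unc: "uncountable (UNIV :: 'a set)" and U: "U \<subseteq> aff m" and ch: "zchain m U X k"
  shows "k \<le> m"
proof (rule zchain_le[OF U, of UNIV k "{}" m])
  show "zchain m U UNIV k" using ch unfolding zchain_def by blast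
  fix C :: "'a set" assume C: "countable C" "rclosed C" "{} \<subseteq> C"
  obtain \<beta> where \<beta>: "inj_on \<beta> {..<m}" "acl_indep C (\<beta> ` {..<m})" using independent_images[OF unc C(1), of "{..<m}"] by auto
  have "alg_indep C (map \<beta> [0..<m])"
    using \<beta> unfolding alg_indep_iff[OF rclosed_subfield[OF C(2)]] by (simp add: distinct_map atLeast0LessThan)
  moreover have e: "mpeval m c (\<lambda>i. map \<beta> [0..<m] ! i) = mpeval m c \<beta>" for c by (rule mpeval_cong) simp
  ultimately have ind: "c = (\<lambda>_. 0)" if "is_mpoly C m c" "mpeval m c \<beta> = 0" for c
    using that unfolding alg_indep_def by auto
  have "f p = 0" if f: "pfun C m f" "f \<beta> = 0" for f p
  proof -
    obtain c where c: "is_mpoly C m c" "\<And>p. mpeval m c p = f p" using f(1) unfolding pfun_def by auto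
    then have "c = (\<lambda>_. 0)" using ind f(2) by simp
    then show ?thesis using c(2)[of p] by (simp add: mpeval_def)
  qed
  then show "\<exists>q B. finite B \<and> card B \<le> m \<and> (\<forall>i<m. q i \<in> acl (C \<union> B)) \<and>
        (\<forall>f. pfun C m f \<longrightarrow> f q = 0 \<longrightarrow> (\<forall>p\<in>UNIV. f p = 0))"
    using card_image_le[of "{..<m}" \<beta>] acl_superset[of "C \<union> \<beta> ` {..<m}"]
    by (intro exI[of _ \<beta>] exI[of _ "\<beta> ` {..<m}"]) auto
qed simp

lemma zdim_ge:
  fixes U :: "(nat \<Rightarrow> 'a::field_char_0) set"
  assumes unc: "uncountable (UNIV :: 'a set)" and U: "U \<subseteq> aff m" and ch: "zchain m U X k"
  shows "k \<le> zdim m U X"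
  unfolding zdim_zchain
proof (rule cSup_upper)
  show "bdd_above {k. zchain m U X k}" using zchain_bounded[OF unc U] by (intro bdd_aboveI[of _ m]) auto
qed (simp add: ch)

lemma zdim_le: "(\<And>k. zchain m U X k \<Longrightarrow> k \<le> e) \<Longrightarrow> zdim m U X \<le> e"
proof (cases "{k. zchain m U X k} = {}")
  case True
  then show ?thesis unfolding zdim_zchain by (simp only: Sup_nat_empty)
next
  case False
  assume "\<And>k. zchain m U X k \<Longrightarrow> k \<le> e"
  then show ?thesis unfolding zdim_zchain using False by (intro cSup_least) auto
qed

section \<open>Loci of points over countable fields\<close>

lemma Gn_subset_aff: "Gn n \<subseteq> aff (2 * n)"
  unfolding Gn_def by auto

text \<open>For \<open>p\<close> in \<open>Gn n\<close> this is the Zariski closure of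
  \<open>p\<close> over the field \<open>L\<close>.\<close>

definition Loc :: "'a::field set \<Rightarrow> nat \<Rightarrow> (nat \<Rightarrow> 'a) \<Rightarrow> (nat \<Rightarrow> 'a) set" where
  "Loc L n p = {q \<in> Gn n. \<forall>f. pfun L (2 * n) f \<longrightarrow> f p = 0 \<longrightarrow> f q = 0}"

lemma Loc_mono: "L \<subseteq> L' \<Longrightarrow> Loc L' n p \<subseteq> Loc L n p"
  unfolding Loc_def using pfun_mono by blast

lemma emb_image_in_Gn:
  assumes \<tau>: "emb N \<tau>" and p: "p \<in> Gn n" "\<And>i. i < 2 * n \<Longrightarrow> p i \<in> N"
  shows "(\<lambda>i. \<tau> (p i)) \<in> Gn n"
proof -
  have "\<tau> (p (n + i)) \<noteq> 0" if "i < n" for i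
    using that p(1) emb_zeroD[OF \<tau> p(2)[of "n + i"]] unfolding Gn_def by auto
  moreover have "\<tau> (p j) = 0" if "j \<ge> 2 * n" for j
    using that p(1) emb_0[OF \<tau>] unfolding Gn_def aff_def by simp
  ultimately show ?thesis unfolding Gn_def aff_def by simp
qed

lemma emb_image_in_Loc:
  assumes N: "rclosed N" and \<tau>: "emb N \<tau>" and L: "L \<subseteq> N" "\<And>x. x \<in> L \<Longrightarrow> \<tau> x = x"
    and p: "p \<in> Gn n" "\<And>i. i < 2 * n \<Longrightarrow> p i \<in> N"
  shows "(\<lambda>i. \<tau> (p i)) \<in> Loc L n p"
proof -
  have "f (\<lambda>i. \<tau> (p i)) = 0" if f: "pfun L (2 * n) f" "f p = 0" for f
    using emb_pfun[OF \<tau> rclosed_subring[OF N] L f(1), of p] p(2) f(2) emb_0[OF \<tau>] by simp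
  then show ?thesis using emb_image_in_Gn[OF \<tau> p] unfolding Loc_def by simp
qed

text \<open>If two proper closed subsets covered the locus, each would be killed by a function not
  vanishing on the whole locus. A conjugate of \<open>p\<close> generic over the coefficients of
  both functions lies in one of the subsets, so its function would vanish on the whole
  locus.\<close>

lemma Loc_irreducible:
  fixes p :: "nat \<Rightarrow> 'a::field_char_0"
  assumes ac: "alg_closed_field TYPE('a)" and unc: "uncountable (UNIV :: 'a set)"
    and L: "rclosed L" "countable L" and p: "p \<in> Gn n"
  shows "zirred (2 * n) (Gn n) (Loc L n p)"
  unfolding zirred_def
proof (intro conjI allI impI)
  have "Loc L n p = {q \<in> Gn n. \<forall>f\<in>{f. pfun L (2 * n) f \<and> f p = 0}. f q = 0}" unfolding Loc_def by auto
  moreover have "zclosed (2 * n) (Gn n) {q \<in> Gn n. \<forall>f\<in>{f. pfun L (2 * n) f \<and> f p = 0}. f q = 0}"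
    by (rule zclosed_overI[OF Gn_subset_aff]) (auto intro: pfun_mono)
  ultimately show "zclosed (2 * n) (Gn n) (Loc L n p)" by simp
  have "p \<in> Loc L n p" using p unfolding Loc_def by simp
  then show "Loc L n p \<noteq> {}" by blast
  fix Y1 Y2 assume Y: "zclosed (2 * n) (Gn n) Y1 \<and> zclosed (2 * n) (Gn n) Y2 \<and> Loc L n p = Y1 \<union> Y2"
  show "Loc L n p = Y1 \<or> Loc L n p = Y2"
  proof (rule ccontr)
    assume ne: "\<not> ?thesis"
    have sep: "\<exists>f q. pfun UNIV (2 * n) f \<and> (\<forall>y\<in>Z. f y = 0) \<and> q \<in> Loc L n p \<and> f q \<noteq> 0"
      if Z: "zclosed (2 * n) (Gn n) Z" "Z \<subset> Loc L n p" for Z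
    proof -
      from zclosed_over_pfun[OF Z(1)] obtain P where P0: "\<forall>f\<in>P. pfun UNIV (2 * n) f" "Z = {p \<in> Gn n \<inter> aff (2 * n). \<forall>f\<in>P. f p = 0}"
      by (elim exE conjE)
    note P = P0(1)[rule_format] P0(2)
      obtain q where q: "q \<in> Loc L n p" "q \<notin> Z" using Z(2) by blast
      then have "q \<in> Gn n \<inter> aff (2 * n)" using Gn_subset_aff[of n] unfolding Loc_def by auto
      then obtain f where "f \<in> P" "f q \<noteq> 0" using q(2) P(2) by auto
      then show ?thesis using P q(1) by (intro exI[of _ f] exI[of _ q]) auto
    qed
    obtain f1 q1 where f1: "pfun UNIV (2 * n) f1" "\<forall>y\<in>Y1. f1 y = 0" "q1 \<in> Loc L n p" "f1 q1 \<noteq> 0"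
      using sep[of Y1] Y ne by blast
    obtain f2 q2 where f2: "pfun UNIV (2 * n) f2" "\<forall>y\<in>Y2. f2 y = 0" "q2 \<in> Loc L n p" "f2 q2 \<noteq> 0"
      using sep[of Y2] Y ne by blast
    obtain G1 where G1: "finite G1" "\<And>H. is_subring H \<Longrightarrow> G1 \<subseteq> H \<Longrightarrow> pfun H (2 * n) f1" using pfun_finitely_many_coeffs[OF f1(1)] by blast
    obtain G2 where G2: "finite G2" "\<And>H. is_subring H \<Longrightarrow> G2 \<subseteq> H \<Longrightarrow> pfun H (2 * n) f2" using pfun_finitely_many_coeffs[OF f2(1)] by blast
    let ?C = "acl (L \<union> G1 \<union> G2)"
    have sup: "L \<union> G1 \<union> G2 \<subseteq> ?C" by (rule acl_superset)
    have C: "countable ?C" using L(2) G1(1) G2(1) by (intro countable_acl) (auto intro: countable_finite)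
    obtain \<tau> N where t: "rclosed N" "L \<subseteq> N" "\<forall>i<2 * n. p i \<in> N" "emb N \<tau>" "\<forall>x\<in>L. \<tau> x = x"
      "\<And>f q. pfun ?C (2 * n) f \<Longrightarrow> f (\<lambda>i. \<tau> (p i)) = 0 \<Longrightarrow> \<forall>g. pfun L (2 * n) g \<longrightarrow> g p = 0 \<longrightarrow> g q = 0 \<Longrightarrow> f q = 0"
      using generic_conjugate[OF ac unc L(1) rclosed_acl C, of "2 * n" p] sup by auto
    have "(\<lambda>i. \<tau> (p i)) \<in> Loc L n p" using t by (intro emb_image_in_Loc[OF t(1) t(4) t(2) _ p]) auto
    then consider "f1 (\<lambda>i. \<tau> (p i)) = 0" | "f2 (\<lambda>i. \<tau> (p i)) = 0" using Y f1(2) f2(2) by blast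
    then show False
    proof cases
      case 1
      have "pfun ?C (2 * n) f1" using sup by (intro G1(2) subring_acl) auto
      from t(6)[OF this 1, of q1] show False using f1(3,4) unfolding Loc_def by blast
    next
      case 2
      have "pfun ?C (2 * n) f2" using sup by (intro G2(2) subring_acl) auto
      from t(6)[OF this 2, of q2] show False using f2(3,4) unfolding Loc_def by blast
    qed
  qed
qed

text \<open>If a polynomial vanishing at the generic solution did not vanish on the variety, the loci of the
  solution over a growing sequence of fields would form a chain that is too long.\<close>

lemma generic_point_locus:
  fixes p :: "nat \<Rightarrow> 'a::field_char_0"
  assumes ac: "alg_closed_field TYPE('a)" and unc: "uncountable (UNIV :: 'a set)"
    and V: "irred_subvar n V" "zclosed_over F (2 * n) (Gn n) V"
    and F: "countable F" and p: "p \<in> V"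
    and B: "B \<subseteq> p ` {..<2 * n}" "acl_indep F B" "zdim (2 * n) (Gn n) V \<le> card B"
  shows "V = Loc (acl F) n p"
proof (rule ccontr)
  assume ne: "V \<noteq> Loc (acl F) n p"
  from zclosed_over_pfun[OF V(2)] obtain P where P0: "\<forall>f\<in>P. pfun F (2 * n) f" "V = {p \<in> Gn n \<inter> aff (2 * n). \<forall>f\<in>P. f p = 0}"
      by (elim exE conjE)
    note P = P0(1)[rule_format] P0(2)
  have pG: "p \<in> Gn n" using p P(2) by blast
  have LV: "Loc (acl F) n p \<subseteq> V"
  proof
    fix q assume q: "q \<in> Loc (acl F) n p"
    have "f q = 0" if "f \<in> P" for f
      using q pfun_mono[OF P(1)[OF that] acl_superset] that p P(2) unfolding Loc_def by auto
    then show "q \<in> V" unfolding P(2) using q Gn_subset_aff[of n] unfolding Loc_def by auto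
  qed
  have fB: "finite B" using B(1) finite_subset by blast
  obtain bs where bs: "set bs = B" "distinct bs" using finite_distinct_list[OF fB] by blast
  define d where "d = card B"
  have lbs: "length bs = d" using distinct_card[OF bs(2)] bs(1) by (simp add: d_def)
  define L where "L i = acl (F \<union> set (take i bs))" for i
  have L: "rclosed (L i)" "countable (L i)" for i
    unfolding L_def using F by (auto simp: rclosed_acl countable_finite intro!: countable_acl)
  \<comment> \<open>Fewer adjoined elements give a larger locus, hence the reversed index
    \<open>d - j\<close>; \<open>V\<close> itself is placed on top as one extra member.\<close>
  define Y where "Y j = (if j \<le> d then Loc (L (d - j)) n p else V)" for j
  \<comment> \<open>A conjugate over \<open>L i\<close>, generic over \<open>L (Suc i)\<close>,
    stays in the larger locus but moves the coordinate \<open>?b\<close>, which is constant on the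
    smaller one.\<close>
  have strict: "Loc (L (Suc i)) n p \<subset> Loc (L i) n p" if i: "i < d" for i
  proof -
    let ?b = "bs ! i"
    have bB: "?b \<in> B" using i lbs bs(1) by auto
    have tk: "set (take (Suc i) bs) = insert ?b (set (take i bs))" using i lbs by (simp add: take_Suc_conv_app_nth)
    have nb: "?b \<notin> set (take i bs)" using bs(2) i lbs by (auto simp: in_set_conv_nth nth_eq_iff_index_eq)
    have bL: "?b \<notin> L i"
    proof
      assume h: "?b \<in> L i"
      have "set (take i bs) \<subseteq> B - {?b}" using nb bs(1) set_take_subset[of i bs] by blast
      then have "L i \<subseteq> acl (F \<union> (B - {?b}))" unfolding L_def by (intro acl_mono) auto
      then show False using h B(2) bB unfolding acl_indep_def by blast
    qed
    have LL: "L i \<subseteq> L (Suc i)" unfolding L_def tk by (intro acl_mono) auto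
    have bS: "?b \<in> L (Suc i)" using acl_superset[of "F \<union> set (take (Suc i) bs)"] unfolding L_def tk by auto
    obtain l where l: "l < 2 * n" "?b = p l" using bB B(1) by blast
    obtain \<tau> N where t: "rclosed N" "L i \<subseteq> N" "\<forall>i<2 * n. p i \<in> N" "emb N \<tau>" "\<forall>x\<in>L i. \<tau> x = x"
      "\<forall>x\<in>N. \<tau> x \<in> L (Suc i) \<longrightarrow> x \<in> L i"
      using generic_conjugate[OF ac unc L(1)[of i] L[of "Suc i"] LL, of "2 * n" p] by auto
    have 1: "(\<lambda>i. \<tau> (p i)) \<in> Loc (L i) n p" using t by (intro emb_image_in_Loc[OF t(1) t(4) t(2) _ pG]) auto
    have "(\<lambda>i. \<tau> (p i)) \<notin> Loc (L (Suc i)) n p"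
    proof
      assume "(\<lambda>i. \<tau> (p i)) \<in> Loc (L (Suc i)) n p"
      moreover have "pfun (L (Suc i)) (2 * n) (\<lambda>q. q l - ?b)"
        using l(1) bS by (intro pfun_diff pfun_coord pfun_const rclosed_subring[OF L(1)])
      ultimately have "\<tau> (p l) - ?b = 0" using l(2) unfolding Loc_def by auto
      then have "\<tau> (p l) \<in> L (Suc i)" using bS by simp
      then show False using t(3,6) l bL by auto
    qed
    then show ?thesis using 1 Loc_mono[OF LL, of n p] by blast
  qed
  have "zchain (2 * n) (Gn n) V (Suc d)" unfolding zchain_def
  proof (intro exI[of _ Y] conjI allI impI)
    fix j assume "j \<le> Suc d"
    show "zirred (2 * n) (Gn n) (Y j)"
      using Loc_irreducible[OF ac unc L pG] V(1) unfolding Y_def irred_subvar_def by simp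
  next
    fix j assume j: "j < Suc d"
    show "Y j \<subset> Y (Suc j)"
    proof (cases "j = d")
      case True
      have "L 0 = acl F" by (simp add: L_def)
      then show ?thesis using True LV ne by (auto simp: Y_def)
    next
      case False
      then have "j < d" using j by simp
      then have "Suc (d - Suc j) = d - j" "d - Suc j < d" by auto
      then show ?thesis using strict[of "d - Suc j"] \<open>j < d\<close> by (simp add: Y_def)
    qed
  next
    show "Y (Suc d) \<subseteq> V" by (simp add: Y_def)
  qed
  from zdim_ge[OF unc Gn_subset_aff this] show False using B(3) by (simp add: d_def)
qed

text \<open>Regular functions on \<open>Gn n\<close>: a power of the product of the multiplicative
  coordinates clears the denominators that negative matrix entries introduce.\<close>

definition lfun :: "'a::field set \<Rightarrow> nat \<Rightarrow> ((nat \<Rightarrow> 'a) \<Rightarrow> 'a) \<Rightarrow> bool" where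
  "lfun F n f \<longleftrightarrow> (\<exists>s g. pfun F (2 * n) g \<and> (\<forall>x\<in>Gn n. (\<Prod>j<n. x (n + j)) ^ s * f x = g x))"

lemma lfun_pfun: "pfun F (2 * n) f \<Longrightarrow> lfun F n f"
  unfolding lfun_def by (intro exI[of _ 0] exI[of _ f]) simp

lemma pfun_monomial_denominator: "is_subring F \<Longrightarrow> pfun F (2 * n) (\<lambda>x. (\<Prod>j<n. x (n + j)) ^ s)"
  by (intro pfun_power pfun_prod pfun_coord) auto

lemma lfun_add:
  assumes F: "is_subring F" and "lfun F n f" "lfun F n g" shows "lfun F n (\<lambda>x. f x + g x)"
proof -
  let ?D = "\<lambda>x :: nat \<Rightarrow> 'a. \<Prod>j<n. x (n + j)"
  obtain s f' where f: "pfun F (2 * n) f'" "\<forall>x\<in>Gn n. ?D x ^ s * f x = f' x" using assms(2) unfolding lfun_def by blast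
  obtain t g' where g: "pfun F (2 * n) g'" "\<forall>x\<in>Gn n. ?D x ^ t * g x = g' x" using assms(3) unfolding lfun_def by blast
  have "pfun F (2 * n) (\<lambda>x. ?D x ^ t * f' x + ?D x ^ s * g' x)"
    by (intro pfun_add[OF F] pfun_mult[OF F] pfun_monomial_denominator[OF F] f(1) g(1))
  moreover have "?D x ^ (s + t) * (f x + g x) = ?D x ^ t * f' x + ?D x ^ s * g' x" if "x \<in> Gn n" for x
    using f(2)[rule_format, OF that, symmetric] g(2)[rule_format, OF that, symmetric]
    by (simp add: power_add algebra_simps)
  ultimately show ?thesis unfolding lfun_def by blast
qed

lemma lfun_mult:
  assumes F: "is_subring F" and "lfun F n f" "lfun F n g" shows "lfun F n (\<lambda>x. f x * g x)"
proof -
  let ?D = "\<lambda>x :: nat \<Rightarrow> 'a. \<Prod>j<n. x (n + j)"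
  obtain s f' where f: "pfun F (2 * n) f'" "\<forall>x\<in>Gn n. ?D x ^ s * f x = f' x" using assms(2) unfolding lfun_def by blast
  obtain t g' where g: "pfun F (2 * n) g'" "\<forall>x\<in>Gn n. ?D x ^ t * g x = g' x" using assms(3) unfolding lfun_def by blast
  have "pfun F (2 * n) (\<lambda>x. f' x * g' x)" by (intro pfun_mult[OF F] f(1) g(1))
  moreover have "?D x ^ (s + t) * (f x * g x) = f' x * g' x" if "x \<in> Gn n" for x
    using f(2)[rule_format, OF that, symmetric] g(2)[rule_format, OF that, symmetric]
    by (simp add: power_add algebra_simps)
  ultimately show ?thesis unfolding lfun_def by blast
qed

lemma lfun_const: "is_subring F \<Longrightarrow> a \<in> F \<Longrightarrow> lfun F n (\<lambda>_. a)"
  by (intro lfun_pfun pfun_const)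

lemma lfun_power: "is_subring F \<Longrightarrow> lfun F n f \<Longrightarrow> lfun F n (\<lambda>x. f x ^ k)"
  by (induction k) (auto intro: lfun_const lfun_mult subring_1)

lemma lfun_sum: "is_subring F \<Longrightarrow> (\<And>i. i \<in> I \<Longrightarrow> lfun F n (f i)) \<Longrightarrow> lfun F n (\<lambda>x. \<Sum>i\<in>I. f i x)"
  by (induction I rule: infinite_finite_induct) (auto intro: lfun_const lfun_add subring_0)

lemma lfun_prod: "is_subring F \<Longrightarrow> (\<And>i. i \<in> I \<Longrightarrow> lfun F n (f i)) \<Longrightarrow> lfun F n (\<lambda>x. \<Prod>i\<in>I. f i x)"
  by (induction I rule: infinite_finite_induct) (auto intro: lfun_const lfun_mult subring_1)

lemma lfun_inverse_coord:
  assumes F: "is_subring F" and j: "j < n" shows "lfun F n (\<lambda>x. inverse (x (n + j)))"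
proof -
  have "pfun F (2 * n) (\<lambda>x. \<Prod>i\<in>{..<n} - {j}. x (n + i))" using F by (intro pfun_prod pfun_coord) auto
  moreover have "(\<Prod>i<n. x (n + i)) ^ 1 * inverse (x (n + j)) = (\<Prod>i\<in>{..<n} - {j}. x (n + i))"
    if "x \<in> Gn n" for x :: "nat \<Rightarrow> 'a"
    using that j unfolding Gn_def by (simp add: prod.remove[of "{..<n}" j])
  ultimately show ?thesis unfolding lfun_def by blast
qed

lemma lfun_powi:
  assumes F: "is_subring F" and j: "j < n" shows "lfun F n (\<lambda>x. x (n + j) powi k)"
proof (cases "k \<ge> 0")
  case True
  then show ?thesis using lfun_power[OF F lfun_pfun[OF pfun_coord[OF F]], of "n + j" n "nat k"] j
    by (simp add: power_int_def)
next
  case False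
  then show ?thesis using lfun_power[OF F lfun_inverse_coord[OF F j], of "nat (- k)"]
    by (simp add: power_int_def)
qed

lemma lfun_compose:
  assumes F: "is_subring F" and f: "pfun F k f" and g: "\<And>i. i < k \<Longrightarrow> lfun F n (g i)"
  shows "lfun F n (\<lambda>x. f (\<lambda>i. g i x))"
proof -
  obtain c where c: "is_mpoly F k c" "\<And>p. mpeval k c p = f p" using f unfolding pfun_def by auto
  have "lfun F n (\<lambda>x. \<Sum>\<alpha>\<in>{\<alpha>. c \<alpha> \<noteq> 0}. c \<alpha> * (\<Prod>i<k. g i x ^ \<alpha> i))"
    using c(1) g unfolding is_mpoly_def
    by (intro lfun_sum[OF F] lfun_mult[OF F] lfun_const[OF F] lfun_prod[OF F] lfun_power[OF F]) auto
  then show ?thesis unfolding c(2)[symmetric] mpeval_def .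
qed

lemma lfun_mact:
  assumes F: "is_subring F" shows "lfun F n (\<lambda>x. mact n n M x i)"
  unfolding mact_def using F
  by (cases "i < n"; cases "i < 2 * n")
    (auto intro!: lfun_sum lfun_mult lfun_const lfun_prod lfun_powi lfun_pfun[OF pfun_coord] subring_of_int subring_0)

lemma mact_in_Gn: "x \<in> Gn n \<Longrightarrow> mact n n M x \<in> Gn n"
  unfolding Gn_def aff_def mact_def by auto

lemma emb_powi:
  assumes h: "emb S h" and S: "is_subfield S" and x: "x \<in> S" shows "h (x powi k) = h x powi k"
  using emb_power[OF h subfield_subring[OF S] x] emb_power[OF h subfield_subring[OF S] subfield_inverse[OF S x]]
    emb_inverse[OF h S x]
  by (simp add: power_int_def)

lemma emb_of_int:
  assumes h: "emb S h" and S: "is_subring S" shows "h (of_int k) = of_int k"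
proof -
  have n: "h (of_nat m) = of_nat m" for m
    by (induction m) (simp_all add: emb_0[OF h] emb_1[OF h] emb_add[OF h subring_1[OF S] subring_of_nat[OF S]])
  show ?thesis
  proof (cases k)
    case (nonneg m) then show ?thesis using n by simp
  next
    case (neg m)
    then have "of_int k = - (of_nat (Suc m) :: 'a)" "of_int k = - (of_nat (Suc m) :: 'b)" by simp_all
    then show ?thesis using emb_uminus[OF h S subring_of_nat[OF S], of "Suc m"] n[of "Suc m"] by metis
  qed
qed

lemma emb_mact:
  assumes h: "emb N \<tau>" and N: "rclosed N" and x: "\<And>i. i < 2 * n \<Longrightarrow> x i \<in> N"
  shows "\<tau> (mact n n M x i) = mact n n M (\<lambda>i. \<tau> (x i)) i"
proof -
  note R = rclosed_subring[OF N] and S = rclosed_subfield[OF N]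
  have "\<tau> (\<Sum>j<n. of_int (M i j) * x j) = (\<Sum>j<n. of_int (M i j) * \<tau> (x j))"
    using x by (subst emb_sum[OF h R]) (auto intro!: sum.cong subring_mult[OF R] subring_of_int[OF R]
      simp: emb_mult[OF h subring_of_int[OF R]] emb_of_int[OF h R])
  moreover have "\<tau> (\<Prod>j<n. x (n + j) powi M (i - n) j) = (\<Prod>j<n. \<tau> (x (n + j)) powi M (i - n) j)"
    using x by (subst emb_prod[OF h R]) (auto intro!: prod.cong subfield_powi[OF S] simp: emb_powi[OF h S])
  ultimately show ?thesis using emb_0[OF h] by (simp add: mact_def)
qed

text \<open>The solution \<open>p\<close> is generic on \<open>V\<close>, so an equation over
  \<open>C\<close> that holds at the image of a conjugate of \<open>p\<close> generic over
  \<open>C\<close> holds on the image of \<open>V\<close> and hence on its closure. The image of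
  that conjugate is a test point algebraic over \<open>C\<close> and the conjugate of
  \<open>Q\<close>.\<close>

lemma zdim_image_le:
  fixes p :: "nat \<Rightarrow> 'a::field_char_0"
  assumes ac: "alg_closed_field TYPE('a)" and unc: "uncountable (UNIV :: 'a set)"
    and V: "irred_subvar n V" "zclosed_over F (2 * n) (Gn n) V"
    and F: "countable F" and p: "p \<in> V"
    and B: "B \<subseteq> p ` {..<2 * n}" "acl_indep F B" "zdim (2 * n) (Gn n) V \<le> card B"
    and Q: "finite Q" "Q \<subseteq> acl (F \<union> p ` {..<2 * n})" "\<And>i. i < 2 * n \<Longrightarrow> mact n n M p i \<in> acl (F \<union> Q)"
  shows "zdim (2 * n) (Gn n) (mimg n n M V) \<le> card Q"
proof (rule zdim_le)
  fix k assume ch: "zchain (2 * n) (Gn n) (mimg n n M V) k"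
  have VL: "V = Loc (acl F) n p" by (rule generic_point_locus[OF ac unc V F p B])
  then have pG: "p \<in> Gn n" and VG: "V \<subseteq> Gn n" using p unfolding Loc_def by auto
  show "k \<le> card Q"
  proof (rule zchain_le[OF Gn_subset_aff ch F])
    fix C assume C: "countable C" "rclosed C" "F \<subseteq> C"
    have LC: "acl F \<subseteq> C" by (rule acl_least[OF C(2,3)])
    from generic_conjugate[OF ac unc rclosed_acl C(2,1) LC, of "2 * n" p]
    obtain \<tau> N where t: "rclosed N" "acl F \<subseteq> N" "\<forall>i<2 * n. p i \<in> N" "emb N \<tau>" "\<forall>x\<in>acl F. \<tau> x = x"
      "\<forall>f q. pfun C (2 * n) f \<longrightarrow> f (\<lambda>i. \<tau> (p i)) = 0 \<longrightarrow>
        (\<forall>g. pfun (acl F) (2 * n) g \<longrightarrow> g p = 0 \<longrightarrow> g q = 0) \<longrightarrow> f q = 0"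
      by (elim exE conjE)
    let ?p' = "\<lambda>i. \<tau> (p i)"
    have p'G: "?p' \<in> Gn n" using t(3) by (intro emb_image_in_Gn[OF t(4) pG]) auto
    let ?q = "mact n n M ?p'"
    have FN: "F \<subseteq> N" using t(2) acl_superset[of F] by auto
    then have "acl (F \<union> p ` {..<2 * n}) \<subseteq> N" using t(3) by (intro acl_least[OF t(1)]) auto
    then have QN: "F \<union> Q \<subseteq> N" using Q(2) FN by auto
    have 1: "?q i \<in> acl (C \<union> \<tau> ` Q)" if "i < 2 * n" for i
    proof -
      have "?q i = \<tau> (mact n n M p i)" using emb_mact[OF t(4,1), of n p M i] t(3) by simp
      then have "?q i \<in> acl (\<tau> ` (F \<union> Q))" using emb_acl[OF t(4,1) QN Q(3)[OF that]] by simp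
      moreover have "\<tau> x \<in> C" if "x \<in> F" for x
      proof -
        have "x \<in> acl F" using that acl_superset[of F] by (rule subsetD[rotated])
        then show ?thesis using t(5) C(3) that by auto
      qed
      then have "\<tau> ` (F \<union> Q) \<subseteq> C \<union> \<tau> ` Q" by auto
      then have "acl (\<tau> ` (F \<union> Q)) \<subseteq> acl (C \<union> \<tau> ` Q)" by (rule acl_mono)
      ultimately show ?thesis by (rule subsetD[rotated])
    qed
    have 2: "f y = 0" if f: "pfun C (2 * n) f" "f ?q = 0" and y: "y \<in> mimg n n M V" for f y
    proof -
      note R = rclosed_subring[OF C(2)]
      have lf: "lfun C n (\<lambda>x. f (\<lambda>i. mact n n M x i))" by (rule lfun_compose[OF R f(1) lfun_mact[OF R]])
      obtain s g where g: "pfun C (2 * n) g" "\<And>x. x \<in> Gn n \<Longrightarrow> (\<Prod>j<n. x (n + j)) ^ s * f (mact n n M x) = g x"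
        using lf unfolding lfun_def by auto
      have "g ?p' = 0" using g(2)[OF p'G] f(2) by simp
      then have gV: "g x = 0" if "x \<in> V" for x
        using t(6)[THEN spec[of _ g], THEN spec[of _ x]] g(1) that unfolding VL Loc_def by auto
      have fV: "f (mact n n M x) = 0" if x: "x \<in> V" for x
      proof -
        have xG: "x \<in> Gn n" using x VG by blast
        then have "(\<Prod>j<n. x (n + j)) \<noteq> 0" unfolding Gn_def by auto
        then show ?thesis using g(2)[OF xG] gV[OF x] by simp
      qed
      have "zclosed (2 * n) (Gn n) {x \<in> Gn n. \<forall>h\<in>{f}. h x = 0}"
        using pfun_mono[OF f(1)] by (intro zclosed_overI[OF Gn_subset_aff]) auto
      moreover have "mact n n M ` V \<subseteq> {x \<in> Gn n. \<forall>h\<in>{f}. h x = 0}" using fV VG by (auto intro!: mact_in_Gn)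
      ultimately have "mimg n n M V \<subseteq> {x \<in> Gn n. \<forall>h\<in>{f}. h x = 0}" unfolding mimg_def zcl_def by blast
      then show ?thesis using y by auto
    qed
    show "\<exists>q B. finite B \<and> card B \<le> card Q \<and> (\<forall>i<2 * n. q i \<in> acl (C \<union> B)) \<and>
        (\<forall>f. pfun C (2 * n) f \<longrightarrow> f q = 0 \<longrightarrow> (\<forall>p\<in>mimg n n M V. f p = 0))"
      using 1 2 Q(1) card_image_le[OF Q(1), of \<tau>] by (intro exI[of _ ?q] exI[of _ "\<tau> ` Q"]) auto
  qed
qed

section \<open>Freely constructed exponentials\<close>

global_interpretation Q: vector_space "\<lambda>(q :: rat) (x :: 'a::field_char_0). of_rat q * x"
  by unfold_locales (simp_all add: of_rat_add of_rat_mult algebra_simps)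

lemma rclosed_power_root:
  assumes G: "rclosed G" and n: "n > 0" and x: "x ^ n \<in> G" shows "x \<in> G"
proof -
  let ?p = "monom 1 n - [:x ^ n:]"
  note R = rclosed_subring[OF G]
  have "coeff ?p n = 1" using n by (simp add: coeff_pCons split: nat.split)
  then have "?p \<noteq> 0" by (metis coeff_0 zero_neq_one)
  moreover have "coeffs_in G ?p"
    by (intro coeffs_in_diff[OF R] coeffs_in_monom[OF R] coeffs_in_pCons[OF R] coeffs_in_0[OF R] subring_1[OF R] x)
  moreover have "poly ?p x = 0" by (simp add: poly_monom)
  ultimately show ?thesis by (rule rclosed_root[OF G])
qed

lemma rclosed_of_rat: "rclosed G \<Longrightarrow> of_rat q \<in> G"
  by (rule subfield_of_rat[OF rclosed_subfield])

section \<open>Homomorphisms from addition to multiplication, and rational multiples\<close>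

lemma E_zero: "ax_E E \<Longrightarrow> E 0 = 1"
  unfolding ax_E_def by (metis add.right_neutral mult_cancel_left1)

lemma E_add: "ax_E E \<Longrightarrow> E (x + y) = E x * E y"
  unfolding ax_E_def by blast

lemma E_nonzero: "ax_E E \<Longrightarrow> E x \<noteq> 0"
  unfolding ax_E_def by blast

lemma E_uminus:
  assumes E: "ax_E E" shows "E (- x) = inverse (E x)"
proof -
  have "E x * E (- x) = 1" using E_add[OF E, of x "- x"] E_zero[OF E] by simp
  then show ?thesis by (simp add: inverse_unique)
qed

lemma E_of_nat: "ax_E E \<Longrightarrow> E (of_nat n * x) = E x ^ n"
  by (induction n) (simp_all add: E_zero E_add distrib_right)

lemma E_of_int: "ax_E E \<Longrightarrow> E (of_int k * x) = E x powi k"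
  using E_of_nat[of E "nat k" x] E_of_nat[of E "nat (- k)" x] E_uminus[of E "of_nat (nat (- k)) * x"]
  by (cases "k \<ge> 0") (simp_all add: power_int_def power_inverse)

lemma E_sum: "ax_E E \<Longrightarrow> E (\<Sum>i\<in>I. f i) = (\<Prod>i\<in>I. E (f i))"
  by (induction I rule: infinite_finite_induct) (simp_all add: E_zero E_add)

definition expclosed :: "('a::field \<Rightarrow> 'a) \<Rightarrow> 'a set \<Rightarrow> 'a set" where
  "expclosed E G = {z. z \<in> G \<and> E z \<in> G}"

text \<open>A power of the value at a rational multiple is an integer power of \<open>E x\<close>,
  and relatively algebraically closed fields contain roots.\<close>

lemma E_of_rat_mem:
  assumes E: "ax_E E" and G: "rclosed G" and x: "E x \<in> G" shows "E (of_rat q * x) \<in> G"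
proof -
  obtain a b where q: "q = Fract a b" "b > 0" by (cases q) auto
  have "of_nat (nat b) * (of_rat q * x) = of_int a * x" using q by (simp add: of_rat_rat)
  then have "E (of_rat q * x) ^ nat b = E x powi a" using E_of_nat[OF E] E_of_int[OF E] by metis
  then have *: "E (of_rat q * x) ^ nat b \<in> G" using subfield_powi[OF rclosed_subfield[OF G] x] by simp
  have "nat b > 0" using q(2) by simp
  then show ?thesis by (rule rclosed_power_root[OF G _ *])
qed

lemma expclosed_subspace:
  assumes E: "ax_E E" and G: "rclosed G" shows "Q.subspace (expclosed E G)"
  unfolding Q.subspace_def expclosed_def
  using E_zero[OF E] E_add[OF E] E_of_rat_mem[OF E G] rclosed_of_rat[OF G] rclosed_subring[OF G]
  by (auto intro!: subring_0 subring_1 subring_add subring_mult)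

lemma qrank_ge:
  assumes rs: "set rs \<subseteq> {..<k}"
    "\<And>q :: nat \<Rightarrow> rat. (\<forall>j<n. (\<Sum>l<length rs. q l * of_int (M (rs ! l) j)) = 0) \<Longrightarrow> \<forall>l<length rs. q l = 0"
  shows "length rs \<le> qrank k n M"
proof -
  let ?R = "{r. \<exists>rs :: nat list. length rs = r \<and> set rs \<subseteq> {..<k} \<and>
      (\<forall>q :: nat \<Rightarrow> rat. (\<forall>j<n. (\<Sum>l<r. q l * of_int (M (rs ! l) j)) = 0) \<longrightarrow> (\<forall>l<r. q l = 0))}"
  have "r \<le> k" if "r \<in> ?R" for r
  proof -
    obtain xs :: "nat list" where xs: "length xs = r" "set xs \<subseteq> {..<k}"
      "\<forall>q :: nat \<Rightarrow> rat. (\<forall>j<n. (\<Sum>l<r. q l * of_int (M (xs ! l) j)) = 0) \<longrightarrow> (\<forall>l<r. q l = 0)"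
      using \<open>r \<in> ?R\<close> by blast
    have "distinct xs"
    proof (rule ccontr)
      assume "\<not> distinct xs"
      then obtain a b where ab: "a < r" "b < r" "a \<noteq> b" "xs ! a = xs ! b" using xs(1) distinct_conv_nth by blast
      let ?q = "\<lambda>l. if l = a then 1 else if l = b then - 1 else (0 :: rat)"
      have *: "(\<Sum>l<r. ?q l * of_int (M (xs ! l) j)) = 0" for j
      proof -
        have "(\<Sum>l<r. ?q l * of_int (M (xs ! l) j)) = (\<Sum>l\<in>{a, b}. ?q l * of_int (M (xs ! l) j))"
          using ab by (intro sum.mono_neutral_right) auto
        then show ?thesis using ab by simp
      qed
      have "\<forall>l<r. ?q l = 0" by (rule xs(3)[THEN spec[of _ ?q], THEN mp]) (intro allI impI *)
      then have "?q a = 0" using ab(1) by blast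
      then show False by simp
    qed
    then show ?thesis using card_mono[OF _ xs(2)] distinct_card[of xs] xs(1) by simp
  qed
  then have "finite ?R" by (intro finite_subset[of ?R "{..k}"]) auto
  moreover have "length rs \<in> ?R" using rs by blast
  ultimately show ?thesis unfolding qrank_def by (rule Max_ge)
qed

lemma countable_bounded_functions:
  assumes "countable L" shows "countable {z \<in> aff n. \<forall>i<n. z i \<in> L}"
proof -
  have "inj_on (\<lambda>z. map z [0..<n]) {z \<in> aff n. \<forall>i<n. z i \<in> L}"
  proof (rule inj_onI)
    fix z w :: "nat \<Rightarrow> 'a" assume zw: "z \<in> {z \<in> aff n. \<forall>i<n. z i \<in> L}" "w \<in> {z \<in> aff n. \<forall>i<n. z i \<in> L}"
      "map z [0..<n] = map w [0..<n]"
    show "z = w"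
    proof
      fix i show "z i = w i" using zw unfolding aff_def by (cases "i < n") auto
    qed
  qed
  moreover have "(\<lambda>z. map z [0..<n]) ` {z \<in> aff n. \<forall>i<n. z i \<in> L} \<subseteq> lists L" by auto
  then have "countable ((\<lambda>z. map z [0..<n]) ` {z \<in> aff n. \<forall>i<n. z i \<in> L})"
    using countable_lists[OF assms] by (rule countable_subset)
  ultimately show ?thesis by (rule countable_image_inj_on[rotated])
qed

text \<open>Isolates what (SP) and (CCP) use, away from order and topology: over the levels below
  \<open>ind c\<close>, one of \<open>c\<close> and \<open>E c\<close> is algebraic and the other
  brings in exactly the transcendental of level \<open>ind c\<close>.\<close>

locale free_exp =
  fixes E :: "'a::field_char_0 \<Rightarrow> 'a" and \<xi> :: "'a \<Rightarrow> 'a" and CC :: "'a set" and ind :: "'a \<Rightarrow> 'a"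
  assumes tb: "tbasis \<xi>" and E: "ax_E E"
    and CC: "Q.independent CC" "Q.span CC = UNIV" and ind: "inj_on ind CC"
    and free: "\<And>c. c \<in> CC \<Longrightarrow> \<exists>y y'. (y = c \<and> y' = E c \<or> y = E c \<and> y' = c) \<and>
      y \<in> acl (\<xi> ` insert (ind c) (below (ind c))) \<and> y \<notin> acl (\<xi> ` below (ind c)) \<and> y' \<in> acl (\<xi> ` below (ind c))"
begin

text \<open>The part of the domain of \<open>E\<close> built at the levels in \<open>S\<close>;
  rational independence is counted modulo it.\<close>

definition DS :: "'a set \<Rightarrow> 'a set" where "DS S = Q.span {c \<in> CC. ind c \<in> S}"

definition closedS :: "'a set \<Rightarrow> bool" where
  "closedS S \<longleftrightarrow> (\<forall>c\<in>CC. ind c \<in> S \<longrightarrow> c \<in> expclosed E (acl (\<xi> ` S)))"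

abbreviation rp :: "'a \<Rightarrow> 'a \<Rightarrow> rat" where "rp v c \<equiv> Q.representation CC v c"

text \<open>\<open>c\<close> is the leading term of \<open>v\<close> when terms with level in
  \<open>S\<close> are disregarded. Leading terms are unique because \<open>ind\<close> is injective
  on the basis.\<close>

definition istop :: "'a set \<Rightarrow> 'a \<Rightarrow> 'a \<Rightarrow> bool" where
  "istop S c v \<longleftrightarrow> c \<in> CC \<and> ind c \<notin> S \<and> rp v c \<noteq> 0 \<and>
     (\<forall>c'. rp v c' \<noteq> 0 \<longrightarrow> ind c' \<notin> S \<longrightarrow> c' \<noteq> c \<longrightarrow> ind c' \<in> below (ind c))"

lemma rp_CC: "rp v c \<noteq> 0 \<Longrightarrow> c \<in> CC"
  using Q.representation_ne_zero by blast

lemma finite_rp: "finite {c. rp v c \<noteq> 0}"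
  by (rule Q.finite_representation)

lemma rp_sum: "(\<Sum>c | rp v c \<noteq> 0. of_rat (rp v c) * c) = v"
  using Q.sum_nonzero_representation_eq[OF CC(1), of v] CC(2) by simp

lemma rp_add: "rp (v + w) c = rp v c + rp w c"
  using Q.representation_add[OF CC(1), of w v] CC(2) by simp

lemma rp_scale: "rp (of_rat q * v) c = q * rp v c"
  using Q.representation_scale[OF CC(1), of v q] CC(2) by simp

lemma in_DS: "(\<And>c. rp v c \<noteq> 0 \<Longrightarrow> ind c \<in> S) \<Longrightarrow> v \<in> DS S"
  unfolding DS_def using rp_CC
  by (subst rp_sum[of v, symmetric], intro Q.span_sum, intro Q.span_scale, intro Q.span_base) auto

lemma subspace_DS: "Q.subspace (DS S)"
  unfolding DS_def by (rule Q.subspace_span)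

lemma istop_exists:
  assumes "v \<notin> DS S" shows "\<exists>c. istop S c v"
proof -
  let ?J = "{c. rp v c \<noteq> 0 \<and> ind c \<notin> S}"
  have "?J \<noteq> {}" using in_DS[of v S] assms by blast
  moreover have "finite ?J" using finite_rp[of v] by (rule finite_subset[rotated]) blast
  ultimately obtain m where m: "m \<in> ind ` ?J" "ind ` ?J \<subseteq> insert m (below m)" using finite_max_idx[of "ind ` ?J"] by blast
  then obtain c where c: "c \<in> ?J" "m = ind c" by blast
  have "ind c' \<in> below (ind c)" if c': "rp v c' \<noteq> 0" "ind c' \<notin> S" "c' \<noteq> c" for c'
  proof -
    have "ind c' \<noteq> ind c" using c' c(1) rp_CC ind by (auto dest: inj_onD)
    moreover have "ind c' \<in> insert m (below m)" using c' m(2) by blast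
    ultimately show ?thesis using c(2) by blast
  qed
  then show ?thesis using c(1) rp_CC unfolding istop_def by (intro exI[of _ c]) blast
qed

text \<open>Over the levels below \<open>i\<close>, the elements \<open>y\<close> and
  \<open>\<xi> i\<close> are algebraic over each other, so an algebraic \<open>y\<close> would make
  \<open>\<xi> i\<close> depend on other members of the transcendence basis.\<close>

lemma new_element:
  assumes i: "i \<notin> S" and y: "y \<in> acl (\<xi> ` insert i (below i))" "y \<notin> acl (\<xi> ` below i)"
  shows "y \<notin> acl (\<xi> ` (S \<union> below i))"
proof
  assume h: "y \<in> acl (\<xi> ` (S \<union> below i))"
  have "\<xi> i \<in> acl (insert y (\<xi> ` below i))" using acl_exchange[of y "\<xi> i" "\<xi> ` below i"] y by simp
  also have "\<dots> \<subseteq> acl (\<xi> ` (S \<union> below i))"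
    using h acl_superset[of "\<xi> ` (S \<union> below i)"] by (intro acl_subset) auto
  finally show False using tbasis_notin[OF tb, of i "S \<union> below i"] i idx_irrefl[of i] by auto
qed

text \<open>Freeness passes from the leading basis element to \<open>v\<close>: the two differ by a
  rational factor and a remainder \<open>s\<close>, and both \<open>s\<close> and \<open>E s\<close>
  lie in the lower field, which is closed under roots.\<close>

lemma top_pair:
  assumes S: "closedS S" and c: "istop S c v"
  shows "\<exists>y y'. (y = v \<and> y' = E v \<or> y = E v \<and> y' = v) \<and>
    y \<in> acl (\<xi> ` (S \<union> insert (ind c) (below (ind c)))) \<and> y \<notin> acl (\<xi> ` (S \<union> below (ind c))) \<and>
    y' \<in> acl (\<xi> ` (S \<union> below (ind c)))"
proof -
  let ?i = "ind c"
  let ?G = "acl (\<xi> ` (S \<union> below ?i))" and ?H = "acl (\<xi> ` (S \<union> insert ?i (below ?i)))"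
  have GH: "?G \<subseteq> ?H" by (intro acl_mono) auto
  have iS: "?i \<notin> S" and cCC: "c \<in> CC" and cnz: "rp v c \<noteq> 0" using c unfolding istop_def by auto
  have low: "c' \<in> expclosed E ?G" if c': "rp v c' \<noteq> 0" "c' \<noteq> c" for c'
  proof (cases "ind c' \<in> S")
    case True
    have "acl (\<xi> ` S) \<subseteq> ?G" by (intro acl_mono) auto
    then show ?thesis using S True rp_CC[OF c'(1)] unfolding closedS_def expclosed_def by auto
  next
    case False
    then have b: "ind c' \<in> below ?i" using c c' unfolding istop_def by blast
    have "acl (\<xi> ` insert (ind c') (below (ind c'))) \<subseteq> ?G" "acl (\<xi> ` below (ind c')) \<subseteq> ?G"
      using below_subset[OF b] by (auto intro!: acl_mono)
    then show ?thesis using free[OF rp_CC[OF c'(1)]] unfolding expclosed_def by auto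
  qed
  define s where "s = (\<Sum>c'\<in>{c'. rp v c' \<noteq> 0} - {c}. of_rat (rp v c') * c')"
  have sG: "s \<in> expclosed E ?G" unfolding s_def
    using low by (intro Q.subspace_sum[OF expclosed_subspace[OF E rclosed_acl]] Q.subspace_scale[OF expclosed_subspace[OF E rclosed_acl]]) auto
  have v: "v = of_rat (rp v c) * c + s"
    using rp_sum[of v] sum.remove[OF finite_rp[of v], of c "\<lambda>c. of_rat (rp v c) * c"] cnz by (simp add: s_def)
  have c_eq: "c = of_rat (inverse (rp v c)) * (v - s)"
  proof -
    have "of_rat (inverse (rp v c)) * (of_rat (rp v c) * c) = c" using cnz by (simp flip: of_rat_mult mult.assoc)
    then show ?thesis using v by (metis add_diff_cancel_right')
  qed
  have memv: "v \<in> G \<longleftrightarrow> c \<in> G" "E v \<in> G \<longleftrightarrow> E c \<in> G" if G: "rclosed G" "?G \<subseteq> G" for G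
  proof -
    have s: "s \<in> G" "E s \<in> G" using sG G(2) unfolding expclosed_def by auto
    note R = rclosed_subring[OF G(1)] and F = rclosed_subfield[OF G(1)]
    show "v \<in> G \<longleftrightarrow> c \<in> G"
    proof
      assume "v \<in> G" then show "c \<in> G" using s(1) rclosed_of_rat[OF G(1)]
        by (subst c_eq) (intro subring_mult[OF R] subring_diff[OF R])
    next
      assume "c \<in> G" then show "v \<in> G" using s(1) rclosed_of_rat[OF G(1)]
        by (subst v) (intro subring_mult[OF R] subring_add[OF R])
    qed
    show "E v \<in> G \<longleftrightarrow> E c \<in> G"
    proof
      assume "E v \<in> G"
      then have "E (v + - s) \<in> G" using s(2) unfolding E_add[OF E] E_uminus[OF E]
        by (intro subring_mult[OF R] subfield_inverse[OF F])
      then have "E (v - s) \<in> G" by simp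
      then show "E c \<in> G" by (subst c_eq) (rule E_of_rat_mem[OF E G(1)])
    next
      assume "E c \<in> G"
      then show "E v \<in> G" using s(2) by (subst v) (auto simp: E_add[OF E] intro!: subring_mult[OF R] E_of_rat_mem[OF E G(1)])
    qed
  qed
  obtain y y' where y: "y = c \<and> y' = E c \<or> y = E c \<and> y' = c" "y \<in> acl (\<xi> ` insert ?i (below ?i))"
    "y \<notin> acl (\<xi> ` below ?i)" "y' \<in> acl (\<xi> ` below ?i)" using free[OF cCC] by blast
  have "acl (\<xi> ` below ?i) \<subseteq> ?G" "acl (\<xi> ` insert ?i (below ?i)) \<subseteq> ?H" by (auto intro!: acl_mono)
  then have y2: "y \<in> ?H" "y' \<in> ?G" "y \<notin> ?G" using y(2,4) new_element[OF iS y(2,3)] by auto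
  from y(1) show ?thesis
  proof
    assume "y = c \<and> y' = E c"
    then show ?thesis using y2 memv[OF rclosed_acl, of "\<xi> ` (S \<union> below ?i)"] memv(1)[OF rclosed_acl GH]
      by (intro exI[of _ v] exI[of _ "E v"]) auto
  next
    assume "y = E c \<and> y' = c"
    then show ?thesis using y2 memv[OF rclosed_acl, of "\<xi> ` (S \<union> below ?i)"] memv(2)[OF rclosed_acl GH]
      by (intro exI[of _ "E v"] exI[of _ v]) auto
  qed
qed

definition indepS :: "'a set \<Rightarrow> 'i set \<Rightarrow> ('i \<Rightarrow> 'a) \<Rightarrow> bool" where
  "indepS S I z \<longleftrightarrow> (\<forall>q :: 'i \<Rightarrow> rat. (\<Sum>i\<in>I. of_rat (q i) * z i) \<in> DS S \<longrightarrow> (\<forall>i\<in>I. q i = 0))"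

text \<open>Elimination: multiples of \<open>z k\<close> are subtracted from the other elements
  until the leading basis element \<open>c0\<close> of \<open>z k\<close> occurs in none of them, so
  their combinations have other leading elements.\<close>

lemma many_tops:
  assumes "finite I" "indepS S I z"
  shows "\<exists>CS. finite CS \<and> card CS = card I \<and> (\<forall>c\<in>CS. \<exists>v\<in>Q.span (z ` I). istop S c v)"
  using assms
proof (induction I arbitrary: z rule: finite_induct)
  case empty then show ?case by (intro exI[of _ "{}"]) simp
next
  case (insert k I)
  have zk: "z k \<notin> DS S"
  proof
    assume h: "z k \<in> DS S"
    let ?q = "\<lambda>i. if i = k then 1 else (0 :: rat)"
    have "(\<Sum>i\<in>I. of_rat (?q i) * z i) = 0" using insert.hyps(2) by (intro sum.neutral) auto
    then have "(\<Sum>i\<in>insert k I. of_rat (?q i) * z i) = z k" using insert.hyps by simp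
    then have "\<forall>i\<in>insert k I. ?q i = 0" using insert.prems[unfolded indepS_def, THEN spec[of _ ?q]] h by simp
    then show False by simp
  qed
  obtain c0 where c0: "istop S c0 (z k)" using istop_exists[OF zk] by blast
  then have nz: "rp (z k) c0 \<noteq> 0" unfolding istop_def by blast
  define t where "t i = rp (z i) c0 / rp (z k) c0" for i
  define z' where "z' i = z i + of_rat (- t i) * z k" for i
  have rz': "rp (z' i) c0 = 0" for i unfolding z'_def rp_add rp_scale t_def using nz by simp
  have "indepS S I z'" unfolding indepS_def
  proof (intro allI impI)
    fix q :: "'b \<Rightarrow> rat" assume q: "(\<Sum>i\<in>I. of_rat (q i) * z' i) \<in> DS S"
    let ?q = "\<lambda>i. if i = k then - (\<Sum>i\<in>I. q i * t i) else q i"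
    have "(\<Sum>i\<in>insert k I. of_rat (?q i) * z i) = of_rat (- (\<Sum>i\<in>I. q i * t i)) * z k + (\<Sum>i\<in>I. of_rat (q i) * z i)"
      using insert.hyps by (auto intro!: sum.cong arg_cong2[where f="(+)"])
    also have "\<dots> = (\<Sum>i\<in>I. of_rat (q i) * z' i)"
      by (simp add: z'_def of_rat_sum of_rat_mult of_rat_minus sum.distrib sum_subtractf sum_negf sum_distrib_left sum_distrib_right algebra_simps)
    finally have "\<forall>i\<in>insert k I. ?q i = 0" using insert.prems[unfolded indepS_def, THEN spec[of _ ?q]] q by simp
    then show "\<forall>i\<in>I. q i = 0" using insert.hyps(2) by (auto split: if_splits)
  qed
  then obtain CS where CS: "finite CS" "card CS = card I" "\<forall>c\<in>CS. \<exists>v\<in>Q.span (z' ` I). istop S c v"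
    using insert.IH by blast
  have "z' ` I \<subseteq> {v. rp v c0 = 0}" using rz' by auto
  moreover have "Q.subspace {v. rp v c0 = 0}" unfolding Q.subspace_def
    by (simp add: rp_add rp_scale Q.representation_zero)
  ultimately have sp0: "Q.span (z' ` I) \<subseteq> {v. rp v c0 = 0}" by (rule Q.span_minimal)
  have sp: "Q.span (z' ` I) \<subseteq> Q.span (z ` insert k I)"
  proof (rule Q.span_minimal[OF _ Q.subspace_span])
    have "z' i \<in> Q.span (z ` insert k I)" if "i \<in> I" for i unfolding z'_def
      by (rule Q.span_add[OF Q.span_base Q.span_scale[OF Q.span_base]]) (use that in auto)
    then show "z' ` I \<subseteq> Q.span (z ` insert k I)" by auto
  qed
  have "c0 \<notin> CS"
  proof
    assume "c0 \<in> CS"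
    then obtain v where "v \<in> Q.span (z' ` I)" "istop S c0 v" using CS(3) by blast
    then show False using sp0 unfolding istop_def by auto
  qed
  then have "card (insert c0 CS) = card (insert k I)" using CS insert.hyps by simp
  moreover have "\<exists>v\<in>Q.span (z ` insert k I). istop S c v" if "c \<in> insert c0 CS" for c
  proof (cases "c = c0")
    case True
    have "z k \<in> Q.span (z ` insert k I)" by (rule Q.span_base) simp
    then show ?thesis using c0 True by blast
  next
    case False
    then show ?thesis using that CS(3) sp by blast
  qed
  ultimately show ?case using CS(1) by (intro exI[of _ "insert c0 CS"]) auto
qed

text \<open>Elements with distinct leading levels give distinct new transcendentals, independent by
  triangularity. If the levels in \<open>S\<close> are closed under exponentials and logarithms, one
  further independent element arises at the lowest new level.\<close>

lemma lower_bound: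
  assumes S: "closedS S" and I: "finite I" "indepS S I z"
  shows "\<exists>Y. finite Y \<and> acl_indep (acl (\<xi> ` S)) Y \<and> Y \<subseteq> acl (z ` I \<union> E ` z ` I) \<and> card I \<le> card Y \<and>
    (I \<noteq> {} \<longrightarrow> (\<forall>v. v \<in> acl (\<xi> ` S) \<or> E v \<in> acl (\<xi> ` S) \<longrightarrow> v \<in> DS S) \<longrightarrow> card Y = Suc (card I))"
proof -
  let ?L = "acl (\<xi> ` S)" and ?H = "acl (z ` I \<union> E ` z ` I)"
  obtain CS where CS: "finite CS" "card CS = card I" "\<forall>c\<in>CS. \<exists>v\<in>Q.span (z ` I). istop S c v"
    using many_tops[OF I] by blast
  obtain v where v: "\<And>c. c \<in> CS \<Longrightarrow> v c \<in> Q.span (z ` I)" "\<And>c. c \<in> CS \<Longrightarrow> istop S c (v c)" using CS(3) by metis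
  have vDS: "v c \<notin> DS S" if c: "c \<in> CS" for c
  proof
    assume h: "v c \<in> DS S"
    have "{c \<in> CC. ind c \<in> S} \<subseteq> {w. rp w c = 0}"
    proof
      fix b assume b: "b \<in> {c \<in> CC. ind c \<in> S}"
      then have "b \<noteq> c" using v(2)[OF c] unfolding istop_def by auto
      then show "b \<in> {w. rp w c = 0}" using Q.representation_basis[OF CC(1), of b] b by simp
    qed
    moreover have "Q.subspace {w. rp w c = 0}" unfolding Q.subspace_def
      by (simp add: rp_add rp_scale Q.representation_zero)
    ultimately have "DS S \<subseteq> {w. rp w c = 0}" unfolding DS_def by (rule Q.span_minimal)
    then show False using h v(2)[OF c] unfolding istop_def by auto
  qed
  have "z ` I \<subseteq> expclosed E ?H" unfolding expclosed_def using acl_superset[of "z ` I \<union> E ` z ` I"] by auto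
  then have "Q.span (z ` I) \<subseteq> expclosed E ?H" by (rule Q.span_minimal[OF _ expclosed_subspace[OF E rclosed_acl]])
  then have vH: "v c \<in> ?H" "E (v c) \<in> ?H" if "c \<in> CS" for c using v(1)[OF that] unfolding expclosed_def by auto
  have CSC: "CS \<subseteq> CC" using v(2) unfolding istop_def by blast
  define J where "J = ind ` CS"
  have J: "finite J" "card J = card I"
    using CS card_image[OF inj_on_subset[OF ind CSC]] by (simp_all add: J_def)
  define cc where "cc i = inv_into CS ind i" for i
  have cc: "cc i \<in> CS" "ind (cc i) = i" if "i \<in> J" for i
    using that unfolding cc_def J_def by (auto intro: inv_into_into f_inv_into_f)
  let ?G = "\<lambda>i. acl (\<xi> ` (S \<union> below i))"
  have "\<forall>i\<in>J. \<exists>y y'. (y = v (cc i) \<and> y' = E (v (cc i)) \<or> y = E (v (cc i)) \<and> y' = v (cc i)) \<and>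
      y \<in> acl (\<xi> ` (S \<union> insert i (below i))) \<and> y \<notin> ?G i \<and> y' \<in> ?G i"
  proof
    fix i assume "i \<in> J"
    then show "\<exists>y y'. (y = v (cc i) \<and> y' = E (v (cc i)) \<or> y = E (v (cc i)) \<and> y' = v (cc i)) \<and>
      y \<in> acl (\<xi> ` (S \<union> insert i (below i))) \<and> y \<notin> ?G i \<and> y' \<in> ?G i"
      using top_pair[OF S v(2)[OF cc(1)], of i] unfolding cc(2)[OF \<open>i \<in> J\<close>] by simp
  qed
  then obtain y y' where y: "\<And>i. i \<in> J \<Longrightarrow> y i = v (cc i) \<and> y' i = E (v (cc i)) \<or> y i = E (v (cc i)) \<and> y' i = v (cc i)"
    "\<And>i. i \<in> J \<Longrightarrow> y i \<in> acl (\<xi> ` (S \<union> insert i (below i)))" "\<And>i. i \<in> J \<Longrightarrow> y i \<notin> ?G i"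
    "\<And>i. i \<in> J \<Longrightarrow> y' i \<in> ?G i" by metis
  have G_mono: "?G j \<subseteq> ?G i" "acl (\<xi> ` (S \<union> insert j (below j))) \<subseteq> ?G i" if "j \<in> below i" for i j
    using below_subset[OF that] by (auto intro!: acl_mono)
  have LG: "?L \<subseteq> ?G i" for i by (rule acl_mono) auto
  have ind_seq: "inj_on y J \<and> acl_indep A (y ` J)" if A: "\<And>i. i \<in> J \<Longrightarrow> A \<subseteq> ?G i" for A
  proof (rule acl_indep_linear_order[OF idx_linear_order])
    show "J \<subseteq> Field idx" unfolding idx_Field by simp
    fix i assume i: "i \<in> J"
    have "y ` (J \<inter> below i) \<subseteq> ?G i" using y(2) G_mono(2)[of _ i] by blast
    then have "acl (A \<union> y ` (J \<inter> below i)) \<subseteq> ?G i" using A[OF i] by (intro acl_subset) auto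
    then show "y i \<notin> acl (A \<union> y ` (J \<inter> below i))" using y(3)[OF i] by blast
  qed
  have yH: "y i \<in> ?H" "y' i \<in> ?H" if "i \<in> J" for i using y(1)[OF that] vH[OF cc(1)[OF that]] by auto
  show ?thesis
  proof (cases "I \<noteq> {} \<and> (\<forall>v. v \<in> ?L \<or> E v \<in> ?L \<longrightarrow> v \<in> DS S)")
    case False
    have "inj_on y J \<and> acl_indep ?L (y ` J)" by (rule ind_seq) (rule LG)
    then show ?thesis using False J yH card_image[of y J] by (intro exI[of _ "y ` J"]) auto
  next
    case True
    have "J \<noteq> {}" using True J I(1) by auto
    then have "\<exists>m. m \<in> J \<and> (\<forall>j. j \<in> below m \<longrightarrow> j \<notin> J)"
      using wfE_min[OF idx_wf, of _ J] unfolding below_iff by (metis all_not_in_conv)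
    then obtain m where m: "m \<in> J" "\<And>j. j \<in> below m \<Longrightarrow> j \<notin> J" by blast
    \<comment> \<open>Outside \<open>DS S\<close> neither \<open>v\<close> nor \<open>E v\<close> is
      algebraic over \<open>?L\<close>, so the lower partner at the least level \<open>m\<close> is
      new as well. It lies in every \<open>?G i\<close>, hence leaves the triangularity of the
      others intact.\<close>
    have y'L: "y' m \<notin> ?L" using y(1)[OF m(1)] True vDS[OF cc(1)[OF m(1)]] by auto
    have y'G: "y' m \<in> ?G i" if "i \<in> J" for i
      using y(4)[OF m(1)] G_mono(1)[of m i] idx_linear[of m i] m(2)[of i] that by blast
    have s: "inj_on y J \<and> acl_indep (?L \<union> {y' m}) (y ` J)"
      using LG y'G by (intro ind_seq) auto
    have "acl_indep ?L {y' m}" using y'L by (simp add: acl_indep_def acl_rclosed[OF rclosed_acl])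
    then have u: "acl_indep ?L ({y' m} \<union> y ` J) \<and> {y' m} \<inter> y ` J = {}"
      using s J(1) by (intro acl_indep_Un) auto
    have "card ({y' m} \<union> y ` J) = Suc (card J)" using u J(1) s card_image[of y J] by simp
    then show ?thesis using u J yH m(1) by (intro exI[of _ "{y' m} \<union> y ` J"]) auto
  qed
qed

text \<open>The case of the empty \<open>S\<close>: the space \<open>DS {}\<close> is zero, so
  independence modulo it is plain rational independence.\<close>

lemma free_SP: "ax_SP E"
  unfolding ax_SP_def
proof (intro allI impI)
  fix zs :: "'a list"
  assume zs: "\<forall>q :: nat \<Rightarrow> rat. (\<Sum>i<length zs. of_rat (q i) * zs ! i) = 0 \<longrightarrow> (\<forall>i<length zs. q i = 0)"
  have "DS {} = {0}" unfolding DS_def by simp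
  then have "indepS {} {..<length zs} (\<lambda>i. zs ! i)" using zs unfolding indepS_def by simp
  moreover have "closedS {}" unfolding closedS_def by simp
  ultimately obtain Y where Y: "finite Y" "acl_indep (acl (\<xi> ` {})) Y"
    "Y \<subseteq> acl ((\<lambda>i. zs ! i) ` {..<length zs} \<union> E ` (\<lambda>i. zs ! i) ` {..<length zs})" "length zs \<le> card Y"
    using lower_bound[of "{}" "{..<length zs}" "\<lambda>i. zs ! i"] by auto
  have "(\<lambda>i. zs ! i) ` {..<length zs} = set zs" by (auto simp: set_conv_nth)
  then have "acl ((\<lambda>i. zs ! i) ` {..<length zs} \<union> E ` (\<lambda>i. zs ! i) ` {..<length zs}) \<subseteq> acl (\<rat> \<union> set (zs @ map E zs))"
    by (intro acl_mono) auto
  moreover have "(\<rat> :: 'a set) \<subseteq> acl (acl (\<xi> ` {}))"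
    using rclosed_of_rat[OF rclosed_acl] by (auto elim!: Rats_cases)
  then have "acl_indep \<rat> Y" by (rule acl_indep_mono[OF Y(2) order_refl])
  ultimately have "card Y \<le> trdeg \<rat> (zs @ map E zs)" using Y(1,3) by (intro card_le_trdeg[OF subfield_Rats]) auto
  then show "trdeg \<rat> (zs @ map E zs) \<ge> length zs" using Y(4) by simp
qed

text \<open>A countable iteration adds the levels of basis elements and their exponentials, and the
  basis expansions of field elements and of one logarithm each. By (STD) all logarithms of an
  element differ by multiples of \<open>\<omega>\<close>, so one logarithm and
  \<open>\<omega>\<close> suffice and countability is kept.\<close>

lemma countable_closed_index_set:
  assumes STD: "{z. E z = 1} = range (\<lambda>k :: int. \<omega> * of_int k)" and A: "finite A"
  shows "\<exists>S. countable S \<and> closedS S \<and> A \<subseteq> acl (\<xi> ` S) \<and>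
    (\<forall>v. v \<in> acl (\<xi> ` S) \<or> E v \<in> acl (\<xi> ` S) \<longrightarrow> v \<in> DS S)"
proof -
  obtain sx where sx: "\<And>a. finite (sx a)" "\<And>a. a \<in> acl (\<xi> ` sx a)" using tbasis_finite_support[OF tb] by metis
  define sc where "sc v = ind ` {c. rp v c \<noteq> 0}" for v
  define lg where "lg a = (SOME z. E z = a)" for a
  define step where "step S = S \<union> (\<Union>c\<in>{c \<in> CC. ind c \<in> S}. sx c \<union> sx (E c)) \<union> (\<Union>a\<in>acl (\<xi> ` S). sc a \<union> sc (lg a)) \<union> sc \<omega>" for S
  define T where "T n = (step ^^ n) (\<Union>a\<in>A. sx a)" for n
  have fsc: "finite (sc v)" for v unfolding sc_def using finite_rp by simp
  have cT: "countable (T n)" for n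
  proof (induction n)
    case 0 show ?case using A sx(1) by (auto simp: T_def intro: countable_finite)
  next
    case (Suc n)
    have "countable {c \<in> CC. ind c \<in> T n}"
      by (rule countable_image_inj_on[of ind]) (use Suc ind in \<open>auto intro: countable_subset[of _ "T n"] inj_on_subset\<close>)
    moreover have "countable (acl (\<xi> ` T n))" using Suc by (intro countable_acl) auto
    moreover have "T (Suc n) = step (T n)" by (simp add: T_def)
    ultimately show ?case using Suc sx(1) fsc unfolding step_def by (auto intro!: countable_UN intro: countable_finite)
  qed
  have TS: "step (T n) = T (Suc n)" for n by (simp add: T_def)
  have incr: "T n \<subseteq> T (Suc n)" for n unfolding TS[symmetric] step_def by auto
  have mono: "T m \<subseteq> T n" if "m \<le> n" for m n using lift_Suc_mono_le[of T, OF incr that] .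
  define S where "S = (\<Union>n. T n)"
  have T_sub: "T n \<subseteq> S" for n unfolding S_def by blast
  have aclT: "\<exists>n. a \<in> acl (\<xi> ` T n)" if a: "a \<in> acl (\<xi> ` S)" for a
  proof -
    obtain G where G: "finite G" "G \<subseteq> \<xi> ` S" "a \<in> acl G" using acl_finitary[OF a] by blast
    then obtain F where F: "finite F" "F \<subseteq> S" "G = \<xi> ` F" by (meson finite_subset_image)
    have "\<exists>n. F \<subseteq> T n" using F(1,2)
    proof (induction F rule: finite_induct)
      case empty show ?case by simp
    next
      case (insert x F)
      then obtain n k where "F \<subseteq> T n" "x \<in> T k" unfolding S_def by auto
      then have "insert x F \<subseteq> T (max n k)" using mono[of n "max n k"] mono[of k "max n k"] by auto
      then show ?case by blast
    qed
    then obtain n where "F \<subseteq> T n" by blast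
    then have "acl G \<subseteq> acl (\<xi> ` T n)" unfolding F(3) by (intro acl_mono) auto
    then show ?thesis using G(3) by blast
  qed
  have sxS: "a \<in> acl (\<xi> ` S)" if "sx a \<subseteq> S" for a
  proof -
    have "acl (\<xi> ` sx a) \<subseteq> acl (\<xi> ` S)" using that by (intro acl_mono) auto
    then show ?thesis using sx(2) by blast
  qed
  have scS: "v \<in> DS S" if "sc v \<subseteq> S" for v using that by (intro in_DS) (auto simp: sc_def)
  have 1: "closedS S" unfolding closedS_def expclosed_def
  proof (intro ballI impI CollectI)
    fix c assume c: "c \<in> CC" "ind c \<in> S"
    then obtain n where "ind c \<in> T n" unfolding S_def by blast
    then have "sx c \<union> sx (E c) \<subseteq> T (Suc n)" using c(1) unfolding TS[symmetric] step_def by blast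
    then show "c \<in> acl (\<xi> ` S) \<and> E c \<in> acl (\<xi> ` S)" using T_sub[of "Suc n"] by (intro conjI sxS) auto
  qed
  have key: "a \<in> DS S \<and> lg a \<in> DS S" if a: "a \<in> acl (\<xi> ` S)" for a
  proof -
    obtain n where "a \<in> acl (\<xi> ` T n)" using aclT[OF a] by blast
    then have "sc a \<union> sc (lg a) \<subseteq> T (Suc n)" unfolding TS[symmetric] step_def by blast
    then show ?thesis using T_sub[of "Suc n"] by (intro conjI scS) auto
  qed
  have "sc \<omega> \<subseteq> T (Suc 0)" unfolding TS[symmetric] step_def by blast
  then have om: "\<omega> \<in> DS S" using T_sub[of "Suc 0"] by (intro scS) blast
  have 2: "v \<in> DS S" if v: "E v \<in> acl (\<xi> ` S)" for v
  proof -
    have lg: "E (lg (E v)) = E v" unfolding lg_def by (rule someI) simp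
    have "E (v + - lg (E v)) = 1" unfolding E_add[OF E] E_uminus[OF E] lg using E_nonzero[OF E, of v] by simp
    then have "v + - lg (E v) \<in> range (\<lambda>k :: int. \<omega> * of_int k)" using STD by blast
    then obtain k :: int where "v + - lg (E v) = \<omega> * of_int k" by blast
    then have "v = of_rat (of_int k) * \<omega> + lg (E v)" by (simp add: algebra_simps)
    then show ?thesis using om key[OF v] Q.subspace_add[OF subspace_DS] Q.subspace_scale[OF subspace_DS] by metis
  qed
  have "sx a \<subseteq> S" if "a \<in> A" for a
  proof -
    have "sx a \<subseteq> T 0" using that by (auto simp: T_def)
    then show ?thesis using T_sub by blast
  qed
  then have "A \<subseteq> acl (\<xi> ` S)" using sxS by blast
  moreover have "countable S" unfolding S_def using cT by simp
  ultimately show ?thesis using 1 2 key by blast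
qed

text \<open>A generic solution outside of the countable exponential subfield generated by the parameters would,
  by rotundity, have too small a transcendence degree.\<close>

lemma free_CCP:
  assumes ac: "alg_closed_field TYPE('a)" and STD: "ax_STD E"
  shows "ax_CCP E"
  unfolding ax_CCP_def
proof (intro allI impI)
  fix n V cs
  assume "irred_subvar n V \<and> abs_free n V \<and> rotund n V \<and> depth0 n V \<and> E_defined E n V cs"
  then have V: "irred_subvar n V" "rotund n V" "depth0 n V" "zclosed_over (param_field E cs) (2 * n) (Gn n) V"
    unfolding E_defined_def by auto
  let ?F = "param_field E cs"
  show "countable (generic_solutions E n V cs)"
  \<comment> \<open>Over a countable field there are only countably many points at all. Otherwise
    generic conjugates over countable fields exist and dimension theory is available.\<close>
  proof (cases "countable (UNIV :: 'a set)")
    case True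
    show ?thesis by (rule countable_subset[OF _ countable_bounded_functions[OF True, of n]])
        (auto simp: generic_solutions_def)
  next
    case unc: False
    obtain \<omega> where \<omega>: "{z. E z = 1} = range (\<lambda>k :: int. \<omega> * of_int k)" using STD unfolding ax_STD_def by blast
    obtain S where S: "countable S" "closedS S" "set cs \<subseteq> acl (\<xi> ` S)"
      "\<And>v. v \<in> acl (\<xi> ` S) \<or> E v \<in> acl (\<xi> ` S) \<Longrightarrow> v \<in> DS S"
      using countable_closed_index_set[OF \<omega>, of "set cs"] by auto
    let ?L = "acl (\<xi> ` S)"
    have cL: "countable ?L" using S(1) by (intro countable_acl) auto
    have "{c \<in> CC. ind c \<in> S} \<subseteq> expclosed E ?L" using S(2) unfolding closedS_def by auto
    then have DL: "DS S \<subseteq> expclosed E ?L" unfolding DS_def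
      by (rule Q.span_minimal[OF _ expclosed_subspace[OF E rclosed_acl]])
    have EL: "E v \<in> ?L" if "v \<in> ?L" for v using S(4)[of v] DL that unfolding expclosed_def by auto
    have FL: "?F \<subseteq> ?L" unfolding param_field_def using S(3) EL by (intro gen_field_least subfield_acl) auto
    have FF: "is_subfield ?F" unfolding param_field_def by (rule subfield_gen_field)
    have cF: "countable ?F" using FL cL by (rule countable_subset)
    have "z i \<in> ?L" if z: "z \<in> generic_solutions E n V cs" and i: "i < n" for z i
    proof (rule ccontr)
      assume ziL: "z i \<notin> ?L"
      let ?p = "graph_pt E n z"
      let ?xs = "map z [0..<n] @ map (E \<circ> z) [0..<n]"
      have p: "?p \<in> V" and tr: "trdeg ?F ?xs = zdim (2 * n) (Gn n) V" using z unfolding generic_solutions_def by auto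
      have dV: "zdim (2 * n) (Gn n) V = n" using V(3) unfolding depth0_def .
      have pz: "?p j = z j" "?p (n + j) = E (z j)" if "j < n" for j using that unfolding graph_pt_def by auto
      have img: "?p ` {..<2 * n} = z ` {..<n} \<union> E ` z ` {..<n}"
      proof
        show "?p ` {..<2 * n} \<subseteq> z ` {..<n} \<union> E ` z ` {..<n}" unfolding graph_pt_def by auto
        have "z j = ?p j" "E (z j) = ?p (n + j)" if "j < n" for j using pz[OF that] by simp_all
        then show "z ` {..<n} \<union> E ` z ` {..<n} \<subseteq> ?p ` {..<2 * n}" by (force intro: image_eqI)
      qed
      have xs: "set ?xs = ?p ` {..<2 * n}" unfolding img by (auto simp: atLeast0LessThan image_comp)
      obtain B where B: "B \<subseteq> ?p ` {..<2 * n}" "acl_indep ?F B" "card B = n" "?p ` {..<2 * n} \<subseteq> acl (?F \<union> B)"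
        using trdeg_basis[OF FF, of ?xs] unfolding xs tr dV by blast
      have fB: "finite B" using B(1) finite_subset by blast
      let ?K = "acl (?F \<union> ?p ` {..<2 * n})"
      have KB: "?K \<subseteq> acl (?F \<union> B)" using B(4) acl_superset[of "?F \<union> B"] by (intro acl_subset) auto
      have pK: "?p j \<in> ?K" if "j < 2 * n" for j using that acl_superset[of "?F \<union> ?p ` {..<2 * n}"] by auto
      have "\<exists>I. I \<subseteq> {..<n} \<and> indepS S I z \<and> (\<forall>I'. I' \<subseteq> {..<n} \<longrightarrow> indepS S I' z \<longrightarrow> card I' \<le> card I)"
      proof -
        let ?J = "{I \<in> Pow {..<n}. indepS S I z}"
        have fJ: "finite (card ` ?J)" by simp
        have "{} \<in> ?J" by (simp add: indepS_def)
        then have "Max (card ` ?J) \<in> card ` ?J" using fJ by (intro Max_in) auto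
        then obtain I where I: "I \<in> ?J" "card I = Max (card ` ?J)" by (metis (no_types, lifting) imageE)
        have "card I' \<le> card I" if "I' \<subseteq> {..<n}" "indepS S I' z" for I'
          unfolding I(2) using that by (intro Max_ge[OF fJ] imageI) simp
        then show ?thesis using I(1) by blast
      qed
      then obtain I where I: "I \<subseteq> {..<n}" "indepS S I z"
        "\<And>I'. I' \<subseteq> {..<n} \<Longrightarrow> indepS S I' z \<Longrightarrow> card I' \<le> card I" by blast
      have fI: "finite I" using I(1) finite_subset by blast
      have ziD: "z i \<notin> DS S" using ziL DL unfolding expclosed_def by auto
      have Ine: "I \<noteq> {}"
      proof
        assume "I = {}"
        have "indepS S {i} z" unfolding indepS_def
        proof (intro allI impI)
          fix q :: "nat \<Rightarrow> rat" assume h: "(\<Sum>i\<in>{i}. of_rat (q i) * z i) \<in> DS S"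
          show "\<forall>i\<in>{i}. q i = 0"
          proof (rule ccontr)
            assume "\<not> ?thesis"
            then have q: "q i \<noteq> 0" by simp
            have "of_rat (q i) * z i \<in> DS S" using h by simp
            then have "of_rat (inverse (q i)) * (of_rat (q i) * z i) \<in> DS S" by (rule Q.subspace_scale[OF subspace_DS])
            moreover have "of_rat (inverse (q i)) * (of_rat (q i) * z i) = z i"
              using q by (simp add: of_rat_inverse)
            ultimately show False using ziD by metis
          qed
        qed
        then have "card {i} \<le> card I" using i by (intro I(3)) auto
        then show False using \<open>I = {}\<close> by simp
      qed
      \<comment> \<open>By maximality of \<open>I\<close>, each other coordinate depends on those in
        \<open>I\<close> modulo \<open>DS S\<close>; the common denominator \<open>d\<close> makes
        the relation integral.\<close>
      have rel: "\<exists>a :: nat \<Rightarrow> int. a j \<noteq> 0 \<and> (\<forall>l. l \<notin> insert j I \<longrightarrow> a l = 0) \<and> (\<Sum>l<n. of_int (a l) * z l) \<in> DS S"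
        if j: "j \<in> {..<n} - I" for j
      proof -
        have "\<not> indepS S (insert j I) z"
        proof
          assume "indepS S (insert j I) z"
          then have "card (insert j I) \<le> card I" using I(1) j by (intro I(3)) auto
          then show False using fI j by simp
        qed
        then obtain q :: "nat \<Rightarrow> rat" where q: "(\<Sum>l\<in>insert j I. of_rat (q l) * z l) \<in> DS S" "\<exists>l\<in>insert j I. q l \<noteq> 0"
          unfolding indepS_def by blast
        have qj: "q j \<noteq> 0"
        proof
          assume "q j = 0"
          then have "(\<Sum>l\<in>I. of_rat (q l) * z l) \<in> DS S" using q(1) fI j by simp
          then have "\<forall>l\<in>I. q l = 0" using I(2) unfolding indepS_def by blast
          then show False using q(2) \<open>q j = 0\<close> by auto
        qed
        define d where "d = (\<Prod>l\<in>insert j I. snd (quotient_of (q l)))"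
        have d0: "d \<noteq> 0" unfolding d_def using fI quotient_of_denom_pos' by (auto simp: prod_zero_iff) (metis less_irrefl)+
        have "\<exists>b :: int. of_int b = of_int d * q l" if l: "l \<in> insert j I" for l
        proof -
          define u v where "u = fst (quotient_of (q l))" and "v = snd (quotient_of (q l))"
          have "v dvd d" unfolding d_def v_def using fI l by (intro dvd_prodI) auto
          then obtain e where e: "d = v * e" by (rule dvdE)
          have ql: "q l = of_int u / of_int v" unfolding u_def v_def by (rule quotient_of_div) simp
          have v0: "v \<noteq> 0" using quotient_of_denom_pos'[of "q l"] by (simp add: v_def)
          have "of_int d * q l = of_int d * (of_int u / of_int v)" by (rule arg_cong[OF ql])
          also have "\<dots> = of_int (e * u)" unfolding e using v0 by (simp add: field_simps)
          finally show ?thesis by (intro exI[of _ "e * u"]) simp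
        qed
        then obtain b :: "nat \<Rightarrow> int" where b: "\<And>l. l \<in> insert j I \<Longrightarrow> of_int (b l) = of_int d * q l" by metis
        let ?a = "\<lambda>l. if l \<in> insert j I then b l else 0"
        have "(\<Sum>l<n. of_int (?a l) * z l) = (\<Sum>l\<in>insert j I. of_int (?a l) * z l)"
          using I(1) j by (intro sum.mono_neutral_right) auto
        also have "\<dots> = (\<Sum>l\<in>insert j I. of_rat (of_int d) * (of_rat (q l) * z l))"
        proof (rule sum.cong)
          fix l assume l: "l \<in> insert j I"
          have "(of_int (b l) :: 'a) = of_rat (of_int (b l))" by simp
          also have "\<dots> = of_rat (of_int d) * of_rat (q l)" unfolding b[OF l] of_rat_mult ..
          finally show "of_int (?a l) * z l = of_rat (of_int d) * (of_rat (q l) * z l)" using l by simp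
        qed simp
        also have "\<dots> = of_rat (of_int d) * (\<Sum>l\<in>insert j I. of_rat (q l) * z l)" by (rule sum_distrib_left[symmetric])
        finally have "(\<Sum>l<n. of_int (?a l) * z l) \<in> DS S" using Q.subspace_scale[OF subspace_DS q(1)] by metis
        moreover have "b j \<noteq> 0"
        proof
          assume "b j = 0"
          then have "of_int d * q j = 0" using b[of j] by simp
          then show False using d0 qj by simp
        qed
        ultimately show ?thesis by (intro exI[of _ ?a]) auto
      qed
      then obtain a :: "nat \<Rightarrow> nat \<Rightarrow> int" where a: "\<And>j. j \<in> {..<n} - I \<Longrightarrow> a j j \<noteq> 0"
        "\<And>j l. j \<in> {..<n} - I \<Longrightarrow> l \<notin> insert j I \<Longrightarrow> a j l = 0"
        "\<And>j. j \<in> {..<n} - I \<Longrightarrow> (\<Sum>l<n. of_int (a j l) * z l) \<in> DS S" by metis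
      \<comment> \<open>The rows outside \<open>I\<close> are these relations and the others are
        zero. So \<open>M\<close> maps the solution into the countable field \<open>?L\<close>, and
        the nonzero diagonal entries give rank at least \<open>n - card I\<close>.\<close>
      define M where "M j l = (if j \<in> {..<n} - I then a j l else 0)" for j l
      have MD: "(\<Sum>l<n. of_int (M j l) * z l) \<in> DS S" for j
      proof (cases "j \<in> {..<n} - I")
        case True
        then show ?thesis using a(3)[OF True] by (simp add: M_def)
      next
        case False
        then show ?thesis using Q.subspace_0[OF subspace_DS] by (auto simp: M_def)
      qed
      let ?q = "mact n n M ?p"
      have qL: "?q j \<in> ?L" for j
      proof -
        have 1: "(\<Sum>l<n. of_int (M j l) * ?p l) \<in> ?L" for j
          using MD[of j] DL pz(1) unfolding expclosed_def by auto
        have "(\<Prod>l<n. ?p (n + l) powi M j l) = E (\<Sum>l<n. of_int (M j l) * z l)" for j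
          unfolding E_sum[OF E] E_of_int[OF E] by (intro prod.cong) (auto simp: pz)
        then have 2: "(\<Prod>l<n. ?p (n + l) powi M j l) \<in> ?L" for j
          using MD[of j] DL unfolding expclosed_def by auto
        show ?thesis unfolding mact_def using 1 2 subring_0[OF subring_acl] by auto
      qed
      have qK: "?q j \<in> ?K" for j
        unfolding mact_def using pK
        by (auto intro!: subring_sum[OF subring_acl] subring_mult[OF subring_acl] subring_of_int[OF subring_acl]
            subring_prod[OF subring_acl] subfield_powi[OF subfield_acl] subring_0[OF subring_acl])
      \<comment> \<open>A transcendence basis of the image coordinates over \<open>?F\<close>: its
        size bounds the dimension of the image variety from above.\<close>
      obtain Q where Q: "Q \<subseteq> ?q ` {..<2 * n}" "acl_indep ?F Q" "?q ` {..<2 * n} \<subseteq> acl (?F \<union> Q)"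
        using acl_basis_finite[of "?q ` {..<2 * n}" ?F] by auto
      have fQ: "finite Q" using Q(1) finite_subset by blast
      have le: "zdim (2 * n) (Gn n) (mimg n n M V) \<le> card Q"
        using Q(1,3) qK by (intro zdim_image_le[OF ac unc V(1,4) cF p B(1,2) _ fQ]) (auto simp: dV B(3))
      have rk: "n - card I \<le> qrank n n M"
      proof -
        let ?rows = "sorted_list_of_set ({..<n} - I)"
        have rows: "set ?rows = {..<n} - I" "distinct ?rows" "length ?rows = n - card I"
          using I(1) fI by (simp_all add: card_Diff_subset)
        have "length ?rows \<le> qrank n n M"
        proof (rule qrank_ge)
          show "set ?rows \<subseteq> {..<n}" using rows(1) by auto
          fix q :: "nat \<Rightarrow> rat"
          assume q: "\<forall>j<n. (\<Sum>l<length ?rows. q l * of_int (M (?rows ! l) j)) = 0"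
          show "\<forall>l<length ?rows. q l = 0"
          proof (intro allI impI)
            fix l assume l: "l < length ?rows"
            let ?j = "?rows ! l"
            have rin: "?rows ! k \<in> {..<n} - I" if "k < length ?rows" for k using that rows(1) nth_mem by metis
            have j: "?j \<in> {..<n} - I" by (rule rin[OF l])
            have "q k * of_int (M (?rows ! k) ?j) = 0" if "k < length ?rows" "k \<noteq> l" for k
            proof -
              have "?rows ! k \<noteq> ?j" using rows(2) that l by (simp add: nth_eq_iff_index_eq)
              then have "a (?rows ! k) ?j = 0" using a(2)[OF rin[OF that(1)], of ?j] j by auto
              then show ?thesis using rin[OF that(1)] by (simp add: M_def)
            qed
            then have "(\<Sum>k<length ?rows. q k * of_int (M (?rows ! k) ?j)) = (\<Sum>k\<in>{l}. q k * of_int (M (?rows ! k) ?j))"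
              using l by (intro sum.mono_neutral_right) auto
            then have "q l * of_int (M ?j ?j) = 0" using q j by auto
            then show "q l = 0" using a(1)[OF j] j by (simp add: M_def)
          qed
        qed
        then show ?thesis unfolding rows(3) .
      qed
      \<comment> \<open>The count: rotundity gives \<open>n - card I\<close> independent elements
        inside \<open>?L\<close>, and \<open>Y\<close> adds \<open>card I + 1\<close> elements
        independent over \<open>?L\<close>, one more in total than the transcendence degree
        \<open>n\<close>.\<close>
      have "n - card I \<le> card Q" using V(2) rk le unfolding rotund_def by (meson order_trans)
      moreover obtain Y where Y: "finite Y" "acl_indep ?L Y" "Y \<subseteq> acl (z ` I \<union> E ` z ` I)" "card Y = Suc (card I)"
        using lower_bound[OF S(2) fI I(2)] Ine S(4) by blast
      have "acl (z ` I \<union> E ` z ` I) \<subseteq> ?K" unfolding img using I(1) by (intro acl_mono) auto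
      then have YK: "Y \<subseteq> acl (?F \<union> B)" using Y(3) KB by blast
      have QK: "Q \<subseteq> acl (?F \<union> B)" using Q(1) qK KB by blast
      have "?F \<union> Q \<subseteq> acl ?L" using FL Q(1) qL unfolding acl_rclosed[OF rclosed_acl] by auto
      then have "acl_indep (?F \<union> Q) Y" by (rule acl_indep_mono[OF Y(2) order_refl])
      then have QY: "acl_indep ?F (Q \<union> Y) \<and> Q \<inter> Y = {}" using acl_indep_Un[OF Q(2)] Y(1) by blast
      then have "card (Q \<union> Y) \<le> card B"
        using fQ Y(1) fB YK QK by (intro acl_steinitz[of ?F]) auto
      moreover have "card (Q \<union> Y) = card Q + card Y" using QY fQ Y(1) by (simp add: card_Un_disjoint)
      ultimately show False using Y(4) B(3) by linarith
    qed
    then have "generic_solutions E n V cs \<subseteq> {z \<in> aff n. \<forall>i<n. z i \<in> ?L}" by (auto simp: generic_solutions_def)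
    then show ?thesis using countable_bounded_functions[OF cL] by (rule countable_subset)
  qed
qed

end

section \<open>Infinitesimal levels of the ultrapower\<close>

text \<open>Convex subgroups whose traces on \<open>K\<close> are a neighbourhood basis of 0.
  Smallness is measured against the whole field \<open>CF (below i)\<close> rather than the image of
  \<open>K\<close>, so it survives multiplication by that field.\<close>

definition UU :: "'i \<Rightarrow> 'i hc set" where
  "UU i = {y. \<forall>g\<in>CF (below i). g \<noteq> 0 \<longrightarrow> hlt y g}"

lemma hcof_nonzero: "hcof f \<noteq> 0 \<longleftrightarrow> eventually (\<lambda>x. f x \<noteq> 0) hyper"
  unfolding hcof_0[symmetric] hcof_eq hyper_not by simp

lemma hlt_trans: "hlt a b \<Longrightarrow> hlt b c \<Longrightarrow> hlt a c"
proof -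
  obtain f g h where e: "a = hcof f" "b = hcof g" "c = hcof h" using hcof_surj by metis
  show "hlt a b \<Longrightarrow> hlt b c \<Longrightarrow> hlt a c" unfolding e hlt_hcof by (erule (1) eventually_elim2) simp
qed

lemma hlt_irrefl: "\<not> hlt a a"
proof -
  obtain f where "a = hcof f" by (rule hcof_surj)
  then show ?thesis by (simp add: hlt_hcof hyper_False)
qed

lemma hlt_0: "\<not> hlt a 0"
proof -
  obtain f where "a = hcof f" by (rule hcof_surj)
  then show ?thesis by (simp add: hlt_hcof hyper_False flip: hcof_0)
qed

lemma hlt_add:
  assumes "hlt a (g / 2)" "hlt b (g / 2)" shows "hlt (a + b) g"
proof -
  obtain f h k where e: "a = hcof f" "b = hcof h" "g = hcof k" using hcof_surj by metis
  have two: "(2 :: 'i hc) = hcof (\<lambda>_. 2)" using hcof_of_nat[of 2] by simp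
  show ?thesis using assms unfolding e two hcof_ops hlt_hcof
  proof (rule eventually_elim2)
    fix x assume "cmod (f x) < cmod (k x / 2)" "cmod (h x) < cmod (k x / 2)"
    then show "cmod (f x + h x) < cmod (k x)" using norm_triangle_ineq[of "f x" "h x"] by (simp add: norm_divide)
  qed
qed

lemma hlt_mult:
  assumes "hlt a g" "hlt b h" shows "hlt (a * b) (g * h)"
proof -
  obtain f1 f2 f3 f4 where e: "a = hcof f1" "b = hcof f2" "g = hcof f3" "h = hcof f4" using hcof_surj by metis
  show ?thesis using assms unfolding e hcof_ops hlt_hcof
    by (rule eventually_elim2) (auto simp: norm_mult intro: mult_strict_mono')
qed

lemma not_hlt_mult:
  assumes "\<not> hlt a g" "\<not> hlt b h" shows "\<not> hlt (a * b) (g * h)"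
proof -
  obtain f1 f2 f3 f4 where e: "a = hcof f1" "b = hcof f2" "g = hcof f3" "h = hcof f4" using hcof_surj by metis
  show ?thesis using assms unfolding e hcof_ops hlt_hcof hyper_not[symmetric]
    by (rule eventually_elim2) (auto simp: norm_mult not_less intro: mult_mono)
qed

lemma hlt_le_trans:
  assumes "a = hcof f" "b = hcof g" "\<And>x. cmod (f x) \<le> cmod (g x)" "hlt b c" shows "hlt a c"
proof -
  obtain h where c: "c = hcof h" by (rule hcof_surj)
  show ?thesis using assms(4) unfolding assms(1,2) c hlt_hcof
    by (rule eventually_mono) (use assms(3) in \<open>metis order_le_less_trans\<close>)
qed

lemma CF_half: "g \<in> CF A \<Longrightarrow> g \<noteq> 0 \<Longrightarrow> g / 2 \<in> CF A \<and> g / 2 \<noteq> 0"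
  using subfield_divide[OF CF_subfield] subring_of_nat[OF subfield_subring[OF CF_subfield], of 2] by force

lemma UU_add: "a \<in> UU i \<Longrightarrow> b \<in> UU i \<Longrightarrow> a + b \<in> UU i"
  unfolding UU_def using CF_half hlt_add by blast

lemma UU_0: "0 \<in> UU i"
  unfolding UU_def
proof (intro CollectI ballI impI)
  fix g :: "'a hc" assume g: "g \<noteq> 0"
  obtain f where f: "g = hcof f" by (rule hcof_surj)
  have "eventually (\<lambda>x. f x \<noteq> 0) hyper" using g unfolding f hcof_nonzero .
  then show "hlt 0 g" unfolding f hcof_0[symmetric] hlt_hcof by eventually_elim simp
qed

lemma UU_mult:
  assumes y: "y \<in> UU i" and z: "hlt z h" "h \<in> CF (below i)" shows "y * z \<in> UU i"
  unfolding UU_def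
proof (intro CollectI ballI impI)
  fix g assume g: "g \<in> CF (below i)" "g \<noteq> 0"
  have h: "h \<noteq> 0" using z(1) hlt_0 by auto
  have "g / h \<in> CF (below i)" "g / h \<noteq> 0" using g z(2) h subfield_divide[OF CF_subfield] by auto
  then have "hlt y (g / h)" using y unfolding UU_def by blast
  then have "hlt (y * z) (g / h * h)" using z(1) by (rule hlt_mult)
  then show "hlt (y * z) g" using h by simp
qed

lemma hlt_double: assumes "c \<noteq> 0" shows "hlt c (2 * c)"
proof -
  obtain f where f: "c = hcof f" by (rule hcof_surj)
  have two: "(2 :: 'i hc) = hcof (\<lambda>_. 2)" using hcof_of_nat[of 2] by simp
  show ?thesis using assms unfolding f two hcof_ops hlt_hcof hcof_nonzero
    by eventually_elim (simp add: norm_mult)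
qed

lemma CF_bounded: "c \<in> CF A \<Longrightarrow> \<exists>h\<in>CF A. hlt c h"
proof (cases "c = 0")
  case True
  have "1 \<in> CF (below (undefined :: 'a))" by (rule subring_1[OF subfield_subring[OF CF_subfield]])
  then have "hlt 0 (1 :: 'a hc)" using UU_0[of "undefined :: 'a"] unfolding UU_def by auto
  then show ?thesis using True subring_1[OF subfield_subring[OF CF_subfield]] by blast
next
  case False
  assume "c \<in> CF A"
  then have "2 * c \<in> CF A"
    using subring_mult[OF subfield_subring[OF CF_subfield]] subring_of_nat[OF subfield_subring[OF CF_subfield], of 2] by force
  then show ?thesis using hlt_double[OF False] by blast
qed

lemma UU_scale: "y \<in> UU i \<Longrightarrow> c \<in> CF (below i) \<Longrightarrow> c * y \<in> UU i"
  using CF_bounded[of c "below i"] UU_mult[of y i c] by (auto simp: mult.commute)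

lemma UU_CF: "c \<in> CF (below i) \<Longrightarrow> c \<in> UU i \<Longrightarrow> c = 0"
  using hlt_irrefl unfolding UU_def by blast

lemma CF_of_rat: "of_rat q \<in> CF A"
  by (rule subfield_of_rat[OF CF_subfield])

lemma UU_subspace: "Q.subspace (UU i)"
  by (rule Q.subspaceI) (simp_all add: UU_0 UU_add UU_scale CF_of_rat)

lemma UU_diff: "a \<in> UU i \<Longrightarrow> b \<in> UU i \<Longrightarrow> a - b \<in> UU i"
  by (rule Q.subspace_diff[OF UU_subspace])

lemma UU_mono: "below i \<subseteq> below j \<Longrightarrow> UU j \<subseteq> UU i"
  unfolding UU_def using CF_mono by blast

text \<open>Not being small means being at least as large as some nonzero element of the lower
  field, a property inherited by products.\<close>

lemma UU_prime:
  assumes "a * b \<in> UU i" shows "a \<in> UU i \<or> b \<in> UU i"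
proof (rule ccontr)
  assume "\<not> ?thesis"
  then obtain g h where "g \<in> CF (below i)" "g \<noteq> 0" "\<not> hlt a g" "h \<in> CF (below i)" "h \<noteq> 0" "\<not> hlt b h"
    unfolding UU_def by blast
  moreover from this have "g * h \<in> CF (below i)" "g * h \<noteq> 0"
    by (auto intro: subring_mult[OF subfield_subring[OF CF_subfield]])
  ultimately show False using assms not_hlt_mult unfolding UU_def by blast
qed

lemma hx_UU: "hx i \<in> UU i"
  unfolding UU_def
proof (intro CollectI ballI impI)
  fix g assume g: "g \<in> CF (below i)" "g \<noteq> 0"
  obtain f where f: "g = hcof f" "depends_on (below i) f" using CF_E[OF g(1)] .
  have "depends_on (below i) (\<lambda>x. cmod (f x))" using f(2) unfolding depends_on_def by metis
  from hyper_tiny[OF this] g(2)[unfolded f hcof_nonzero]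
  show "hlt (hx i) g" unfolding f hx_def hlt_hcof by eventually_elim simp
qed

lemma hx_nonzero: "hx i \<noteq> 0"
  using hx_notin_CF subring_0[OF subfield_subring[OF CF_subfield]] by metis

section \<open>Complex conjugation on the ultrapower\<close>

abbreviation cj :: "'i hc \<Rightarrow> 'i hc" where "cj \<equiv> hmap cnj"

lemma emb_cj: "emb UNIV cj"
proof -
  have ops: "cj (a + b) = cj a + cj b \<and> cj (a - b) = cj a - cj b \<and> cj (a * b) = cj a * cj b" for a b :: "'a hc"
  proof -
    obtain f g where e: "a = hcof f" "b = hcof g" using hcof_surj by metis
    show ?thesis unfolding e hcof_ops by simp
  qed
  have "cj a = 0 \<Longrightarrow> a = 0" for a :: "'a hc"
  proof -
    obtain f where e: "a = hcof f" by (rule hcof_surj)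
    show "cj a = 0 \<Longrightarrow> a = 0" unfolding e hcof_ops hcof_0[symmetric] hcof_eq by simp
  qed
  moreover have "cj (0 :: 'a hc) = 0" "cj (1 :: 'a hc) = 1"
    unfolding hcof_0[symmetric] hcof_1[symmetric] hcof_ops by simp_all
  ultimately show ?thesis using ops unfolding emb_def by blast
qed

lemma cj_cj: "cj (cj a) = a"
proof -
  obtain f where e: "a = hcof f" by (rule hcof_surj)
  show ?thesis unfolding e hcof_ops by simp
qed

lemma cj_hx: "cj (hx i) = hx i"
  unfolding hx_def hcof_ops by simp

lemma UU_cj: assumes "a \<in> UU i" shows "cj a \<in> UU i"
proof -
  obtain f where e: "a = hcof f" by (rule hcof_surj)
  show ?thesis using assms unfolding UU_def e hcof_ops
    by (auto intro: hlt_le_trans[OF refl refl, of "\<lambda>x. cnj (f x)" f])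
qed

section \<open>Embedding into the ultrapower\<close>

lemma rclosed_UNIV: "rclosed UNIV"
  unfolding rclosed_def using subfield_UNIV by auto

lemma subspace_acl: "Q.subspace (acl A)"
  unfolding Q.subspace_def using subring_0[OF subring_acl] subring_add[OF subring_acl]
    subring_mult[OF subring_acl] rclosed_of_rat[OF rclosed_acl] by blast

text \<open>Lets primality of \<open>UU i\<close> be applied to a polynomial value that is small:
  one of the linear factors must be small.\<close>

lemma alg_closed_factorization:
  fixes p :: "'a::field poly"
  assumes ac: "alg_closed_field TYPE('a)" and "p \<noteq> 0"
  shows "\<exists>as. p = smult (lead_coeff p) (\<Prod>a\<leftarrow>as. [:- a, 1:])"
  using \<open>p \<noteq> 0\<close>
proof (induction "degree p" arbitrary: p rule: less_induct)
  case less
  show ?case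
  proof (cases "degree p = 0")
    case True
    then obtain c where "p = [:c:]" by (rule degree_eq_zeroE)
    then show ?thesis by (intro exI[of _ "[]"]) simp
  next
    case False
    then obtain a where "poly p a = 0" using ac unfolding alg_closed_field_def by blast
    then obtain q where q: "p = [:- a, 1:] * q" using poly_eq_0_iff_dvd by (metis dvdE)
    have q0: "q \<noteq> 0" using q less.prems by auto
    have deg: "degree p = Suc (degree q)" unfolding q using q0 by (subst degree_mult_eq) auto
    have lc: "lead_coeff p = lead_coeff q" unfolding q lead_coeff_mult by simp
    obtain as where "q = smult (lead_coeff q) (\<Prod>a\<leftarrow>as. [:- a, 1:])" using less.hyps[of q] deg q0 by auto
    then have "[:- a, 1:] * q = [:- a, 1:] * smult (lead_coeff q) (\<Prod>a\<leftarrow>as. [:- a, 1:])" by (rule arg_cong)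
    then have "p = smult (lead_coeff p) (\<Prod>a\<leftarrow>a # as. [:- a, 1:])"
      unfolding lc q[symmetric] list.map prod_list.Cons mult_smult_right .
    then show ?thesis by (rule exI)
  qed
qed

locale hyper_embedding =
  fixes \<xi> :: "'a::field_char_0 \<Rightarrow> 'a" and \<phi> :: "'a \<Rightarrow> 'a hc"
  assumes ac: "alg_closed_field TYPE('a)" and tb: "tbasis \<xi>"
    and \<phi>: "emb UNIV \<phi>" and \<phi>_\<xi>: "\<And>i. \<phi> (\<xi> i) = hx i"

text \<open>The infinitesimals \<open>hx i\<close> are independent because each is new over the
  field of earlier levels; hence the extension theorem may send the transcendence basis to
  them.\<close>

lemma hyper_embedding_exists:
  fixes \<xi> :: "'a::field_char_0 \<Rightarrow> 'a"
  assumes ac: "alg_closed_field TYPE('a)" and tb: "tbasis \<xi>"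
  shows "\<exists>\<phi>. hyper_embedding \<xi> \<phi>"
proof -
  \<comment> \<open>The unique embedding of the prime field, from which the extension
    starts.\<close>
  define h0 :: "'a \<Rightarrow> 'a hc" where "h0 x = of_rat (THE q. x = of_rat q)" for x
  have h0: "h0 (of_rat q) = of_rat q" for q unfolding h0_def by simp
  have h0_img: "h0 ` \<rat> \<subseteq> \<rat>" using h0 by (auto elim!: Rats_cases)
  have e0: "emb \<rat> h0" unfolding emb_def
  proof (intro conjI ballI impI)
    show "h0 0 = 0" "h0 1 = 1" using h0[of 0] h0[of 1] by simp_all
    fix x assume "x \<in> (\<rat> :: 'a set)"
    then obtain p where x: "x = of_rat p" by (rule Rats_cases)
    show "x = 0" if "h0 x = 0" using that unfolding x h0 by simp
    fix y assume "y \<in> (\<rat> :: 'a set)"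
    then obtain q where y: "y = of_rat q" by (rule Rats_cases)
    show "h0 (x + y) = h0 x + h0 y" "h0 (x - y) = h0 x - h0 y" "h0 (x * y) = h0 x * h0 y"
      unfolding x y by (simp_all add: h0 flip: of_rat_add of_rat_diff of_rat_mult)
  qed
  have "inj_on hx (UNIV :: 'a set) \<and> acl_indep \<rat> (hx ` (UNIV :: 'a set))"
  proof (rule acl_indep_linear_order[OF idx_linear_order])
    fix i :: 'a
    have "\<rat> \<union> hx ` (UNIV \<inter> below i) \<subseteq> CF (below i)"
      using CF_of_rat hx_CF[where 'a='a] by (auto elim!: Rats_cases)
    then have "acl (\<rat> \<union> hx ` (UNIV \<inter> below i)) \<subseteq> CF (below i)" by (rule acl_least[OF rclosed_CF])
    then show "hx i \<notin> acl (\<rat> \<union> hx ` (UNIV \<inter> below i))" using hx_notin_CF[of i] by (rule contra_subsetD)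
  qed (simp add: idx_Field)
  then have hxi: "inj (hx :: 'a \<Rightarrow> 'a hc)" "acl_indep \<rat> (range (hx :: 'a \<Rightarrow> 'a hc))" by auto
  have inj: "inj \<xi>" using tb unfolding tbasis_def by blast
  let ?\<beta> = "\<lambda>b. hx (inv \<xi> b)"
  have "?\<beta> b \<notin> acl (h0 ` \<rat> \<union> ?\<beta> ` (range \<xi> - {b}))" if b: "b \<in> range \<xi>" for b
  proof -
    obtain i where i: "b = \<xi> i" using b by blast
    have "h0 ` \<rat> \<union> ?\<beta> ` (range \<xi> - {b}) \<subseteq> \<rat> \<union> (range hx - {hx i})"
      using h0_img hxi(1) inj by (auto simp: i inj_eq)
    then have "acl (h0 ` \<rat> \<union> ?\<beta> ` (range \<xi> - {b})) \<subseteq> acl (\<rat> \<union> (range hx - {hx i}))" by (rule acl_mono)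
    moreover have "?\<beta> b = hx i" using inj by (simp add: i)
    moreover have "hx i \<notin> acl (\<rat> \<union> (range hx - {hx i}))" using hxi(2) unfolding acl_indep_def by blast
    ultimately show ?thesis by auto
  qed
  moreover have "acl_indep \<rat> (range \<xi>)"
  proof (rule acl_indep_mono[of "{}" "range \<xi>"])
    show "acl_indep {} (range \<xi>)" using tb unfolding tbasis_def by blast
    show "\<rat> \<subseteq> acl ({} :: 'a set)" using rclosed_of_rat[OF rclosed_acl] by (auto elim!: Rats_cases)
  qed simp
  ultimately obtain \<phi> where \<phi>: "emb (acl (\<rat> \<union> range \<xi>)) \<phi>" "\<forall>b\<in>range \<xi>. \<phi> b = ?\<beta> b"
    using embedding_extension[OF alg_closed_hc subfield_subring[OF subfield_Rats] e0, of "range \<xi>" ?\<beta>] by blast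
  have "acl (range \<xi>) \<subseteq> acl (\<rat> \<union> range \<xi>)" by (rule acl_mono) simp
  then have "acl (\<rat> \<union> range \<xi>) = UNIV" using tb unfolding tbasis_def by auto
  then have "hyper_embedding \<xi> \<phi>" using ac tb \<phi> inj by unfold_locales auto
  then show ?thesis by blast
qed

lemma span_Int:
  assumes T: "Q.independent T" and P: "P \<subseteq> T" and P': "P' \<subseteq> T" and x: "x \<in> Q.span P" "x \<in> Q.span P'"
  shows "x \<in> Q.span (P \<inter> P')"
proof -
  have "Q.representation T x = Q.representation P x" by (rule Q.representation_extend[OF T x(1) P])
  moreover have "Q.representation T x = Q.representation P' x" by (rule Q.representation_extend[OF T x(2) P'])
  ultimately have s: "b \<in> P \<inter> P'" if "Q.representation T x b \<noteq> 0" for b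
    using that Q.representation_ne_zero[of P x b] Q.representation_ne_zero[of P' x b] by auto
  have "x \<in> Q.span T" using x(1) Q.span_mono[OF P] by blast
  then have "(\<Sum>b | Q.representation T x b \<noteq> 0. of_rat (Q.representation T x b) * b) = x"
    by (rule Q.sum_nonzero_representation_eq[OF T])
  moreover have "(\<Sum>b | Q.representation T x b \<noteq> 0. of_rat (Q.representation T x b) * b) \<in> Q.span (P \<inter> P')"
    using s by (intro Q.span_sum Q.span_scale Q.span_base) blast
  ultimately show ?thesis by simp
qed

lemma independent_Un:
  assumes S: "Q.independent S" and T: "Q.independent T" and d: "Q.span S \<inter> Q.span T \<subseteq> {0}"
  shows "Q.independent (S \<union> T)"
proof -
  have half: False if S: "Q.independent S" and d: "Q.span S \<inter> Q.span T \<subseteq> {0}" and a: "a \<in> S" "a \<in> Q.span (S \<union> T - {a})"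
    for a and S T :: "'a set"
  proof -
    have "S \<union> T - {a} \<subseteq> (S - {a}) \<union> T" by blast
    then have "a \<in> Q.span ((S - {a}) \<union> T)" using a(2) Q.span_mono by blast
    then obtain s t where st: "a = s + t" "s \<in> Q.span (S - {a})" "t \<in> Q.span T" unfolding Q.span_Un by blast
    have "s \<in> Q.span S" using st(2) Q.span_mono[of "S - {a}" S] by blast
    then have "a - s \<in> Q.span S" using Q.span_base[OF a(1)] by (rule Q.span_diff[rotated])
    then have "t = 0" using st d by auto
    then show False using st a(1) S unfolding Q.dependent_def by auto
  qed
  show ?thesis unfolding Q.dependent_def
  proof
    assume "\<exists>a\<in>S \<union> T. a \<in> Q.span (S \<union> T - {a})"
    then obtain a where "a \<in> S \<union> T" "a \<in> Q.span (S \<union> T - {a})" by blast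
    then show False using half[OF S d, of a] half[OF T, of S a] d by (auto simp: Un_commute Int_commute)
  qed
qed

section \<open>The automorphism and its fixed field\<close>

context hyper_embedding
begin

lemma \<phi>_0: "\<phi> 0 = 0" and \<phi>_1: "\<phi> 1 = 1" and \<phi>_add: "\<phi> (x + y) = \<phi> x + \<phi> y"
  and \<phi>_diff: "\<phi> (x - y) = \<phi> x - \<phi> y" and \<phi>_mult: "\<phi> (x * y) = \<phi> x * \<phi> y"
  using \<phi> unfolding emb_def by auto

lemma \<phi>_inj: "\<phi> x = \<phi> y \<longleftrightarrow> x = y"
  using emb_inj[OF \<phi> subfield_subring[OF subfield_UNIV]] by (auto dest: injD)

lemma \<phi>_inverse: "\<phi> (inverse x) = inverse (\<phi> x)"
  using emb_inverse[OF \<phi> subfield_UNIV] by simp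

lemma \<phi>_uminus: "\<phi> (- x) = - \<phi> x"
  using emb_uminus[OF \<phi> subfield_subring[OF subfield_UNIV]] by simp

lemma \<phi>_divide: "\<phi> (x / y) = \<phi> x / \<phi> y"
  by (simp add: divide_inverse \<phi>_mult \<phi>_inverse)

lemma \<phi>_of_int: "\<phi> (of_int n) = of_int n"
  using emb_of_int[OF \<phi> subfield_subring[OF subfield_UNIV]] .

lemma \<phi>_of_rat: "\<phi> (of_rat q) = of_rat q"
  by (cases q) (simp add: of_rat_rat \<phi>_divide \<phi>_of_int)

lemma \<phi>_CF: "x \<in> acl (\<xi> ` A) \<Longrightarrow> \<phi> x \<in> CF A"
proof -
  assume x: "x \<in> acl (\<xi> ` A)"
  have "\<phi> x \<in> acl (\<phi> ` \<xi> ` A)" by (rule emb_acl[OF \<phi> rclosed_UNIV _ x]) simp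
  moreover have "acl (\<phi> ` \<xi> ` A) \<subseteq> CF A" using \<phi>_\<xi> hx_CF by (intro acl_least[OF rclosed_CF]) auto
  ultimately show ?thesis by blast
qed

lemma \<phi>_UNIV: "x \<in> acl (range \<xi>)"
  using tb unfolding tbasis_def by simp

text \<open>The image is isomorphic to the algebraically closed \<open>K\<close>. The inverse
  isomorphism extends to all elements algebraic over the image, and injectivity of the extension
  leaves room for no new ones.\<close>

lemma rclosed_range: "rclosed (range \<phi>)"
proof -
  have sub: "is_subring (range \<phi>)" unfolding is_subring_def
    by (auto simp flip: \<phi>_add \<phi>_diff \<phi>_mult intro: range_eqI[of _ _ 0] range_eqI[of _ _ 1] simp: \<phi>_0 \<phi>_1)
  have e: "emb (range \<phi>) (inv \<phi>)" unfolding emb_def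
  proof (intro conjI ballI impI)
    have i: "inv \<phi> (\<phi> x) = x" for x by (rule inv_f_f) (rule injI, simp add: \<phi>_inj)
    show "inv \<phi> 0 = 0" "inv \<phi> 1 = 1" using i[of 0] i[of 1] by (simp_all add: \<phi>_0 \<phi>_1)
    fix a assume "a \<in> range \<phi>"
    then obtain x where a: "a = \<phi> x" by blast
    show "a = 0" if "inv \<phi> a = 0" using that unfolding a i by (simp add: \<phi>_0)
    fix b assume "b \<in> range \<phi>"
    then obtain y where b: "b = \<phi> y" by blast
    show "inv \<phi> (a + b) = inv \<phi> a + inv \<phi> b" "inv \<phi> (a - b) = inv \<phi> a - inv \<phi> b" "inv \<phi> (a * b) = inv \<phi> a * inv \<phi> b"
      unfolding a b \<phi>_add[symmetric] \<phi>_diff[symmetric] \<phi>_mult[symmetric] i by simp_all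
  qed
  obtain h where h: "emb (acl (range \<phi> \<union> {})) h" "\<forall>x\<in>range \<phi>. h x = inv \<phi> x"
    using embedding_extension[OF ac sub e acl_indep_empty, of undefined] by auto
  have "acl (range \<phi>) \<subseteq> range \<phi>"
  proof
    fix y assume y: "y \<in> acl (range \<phi>)"
    have "inj \<phi>" by (rule injI) (simp add: \<phi>_inj)
    then have "h (\<phi> (h y)) = h y" using h(2) inv_f_f[of \<phi> "h y"] by simp
    then have "h (\<phi> (h y) - y) = 0"
      using emb_diff[OF h(1), of "\<phi> (h y)" y] y acl_superset[of "range \<phi>"] by auto
    moreover have "\<phi> (h y) - y \<in> acl (range \<phi>)"
      using y acl_superset[of "range \<phi>"] by (intro subring_diff[OF subring_acl]) auto
    ultimately have "\<phi> (h y) - y = 0" by (intro emb_zeroD[OF h(1)]) simp_all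
    then have "y = \<phi> (h y)" by simp
    then show "y \<in> range \<phi>" by (rule range_eqI)
  qed
  then have "acl (range \<phi>) = range \<phi>" using acl_superset by blast
  then show ?thesis using rclosed_acl by metis
qed

text \<open>Conjugation fixes every \<open>hx i\<close>, and the image is algebraic over these; the
  elements with conjugate in the image form a relatively closed field.\<close>

lemma cj_range: "cj (\<phi> x) \<in> range \<phi>"
proof -
  have "rclosed {y \<in> UNIV. cj y \<in> range \<phi>}" by (rule emb_preimage_rclosed[OF emb_cj rclosed_UNIV rclosed_range])
  moreover have "\<phi> ` range \<xi> \<subseteq> {y \<in> UNIV. cj y \<in> range \<phi>}"
    using rangeI[of \<phi> "\<xi> i" for i] by (auto simp: \<phi>_\<xi> cj_hx)
  ultimately have "acl (\<phi> ` range \<xi>) \<subseteq> {y \<in> UNIV. cj y \<in> range \<phi>}" by (rule acl_least)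
  moreover have "\<phi> x \<in> acl (\<phi> ` range \<xi>)" by (rule emb_acl[OF \<phi> rclosed_UNIV _ \<phi>_UNIV]) simp
  ultimately show ?thesis by blast
qed

definition \<sigma> :: "'a \<Rightarrow> 'a" where "\<sigma> x = inv \<phi> (cj (\<phi> x))"

lemma \<phi>_\<sigma>: "\<phi> (\<sigma> x) = cj (\<phi> x)"
  unfolding \<sigma>_def by (rule f_inv_into_f[OF cj_range])

lemma \<sigma>_\<sigma>: "\<sigma> (\<sigma> x) = x"
  unfolding \<phi>_inj[symmetric] \<phi>_\<sigma> cj_cj ..

lemma emb_\<sigma>: "emb UNIV \<sigma>"
  using emb_cj[where 'a='a] unfolding emb_def
  by (auto simp: \<phi>_\<sigma> \<phi>_0 \<phi>_1 \<phi>_add \<phi>_diff \<phi>_mult simp flip: \<phi>_inj)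

lemma \<sigma>_\<xi>: "\<sigma> (\<xi> i) = \<xi> i"
  unfolding \<phi>_inj[symmetric] \<phi>_\<sigma> \<phi>_\<xi> cj_hx ..

lemma \<sigma>_acl: "x \<in> acl (\<xi> ` A) \<Longrightarrow> \<sigma> x \<in> acl (\<xi> ` A)"
  using emb_acl[OF emb_\<sigma> rclosed_UNIV, of "\<xi> ` A" x] by (simp add: image_image \<sigma>_\<xi>)

lemma \<sigma>_add: "\<sigma> (x + y) = \<sigma> x + \<sigma> y" and \<sigma>_diff: "\<sigma> (x - y) = \<sigma> x - \<sigma> y"
  and \<sigma>_mult: "\<sigma> (x * y) = \<sigma> x * \<sigma> y" and \<sigma>_0: "\<sigma> 0 = 0" and \<sigma>_1: "\<sigma> 1 = 1"
  using emb_\<sigma> unfolding emb_def by auto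

lemma \<sigma>_of_rat: "\<sigma> (of_rat q) = of_rat q"
proof -
  have "(of_rat q :: 'a) \<in> acl (\<xi> ` {})" by (rule rclosed_of_rat[OF rclosed_acl])
  have "is_subfield {x \<in> UNIV. \<sigma> x = x}" by (rule fixed_subfield[OF emb_\<sigma> subfield_UNIV])
  then show ?thesis using subfield_of_rat[of "{x \<in> UNIV. \<sigma> x = x}" q] by simp
qed

definition RR :: "'a set" where "RR = {x. \<sigma> x = x}"

lemma subfield_RR: "is_subfield RR"
  using fixed_subfield[OF emb_\<sigma> subfield_UNIV] unfolding RR_def by simp

lemmas subring_RR = subfield_subring[OF subfield_RR]

lemma subspace_RR: "Q.subspace RR"
  unfolding Q.subspace_def using subring_0[OF subring_RR] subring_add[OF subring_RR]
    subring_mult[OF subring_RR] subfield_of_rat[OF subfield_RR] by blast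

text \<open>A bounded element that is algebraic over the lower levels and one further infinitesimal has a
  standard part: reduce a polynomial relation modulo the infinitesimal.\<close>

lemma standard_part:
  assumes y: "y \<in> acl (\<xi> ` insert i (below i))" and bd: "hlt (\<phi> y) g" "g \<in> CF (below i)"
  shows "\<exists>c\<in>acl (\<xi> ` below i). \<phi> (y - c) \<in> UU i"
proof -
  let ?k = "acl (\<xi> ` below i)" and ?x = "\<xi> i"
  have kCF: "\<phi> c \<in> CF (below i)" if "c \<in> ?k" for c using \<phi>_CF[OF that] .
  have x0: "?x \<noteq> 0" using tbasis_notin[OF tb idx_irrefl, of i] subring_0[OF subring_acl] by metis
  let ?R = "{poly p ?x |p. coeffs_in ?k p}"
  have R: "is_subring ?R" by (rule subring_adjoin[OF subring_acl])
  have "\<xi> ` insert i (below i) \<subseteq> fracs ?R"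
    using adjoin_superset[OF subring_acl, of ?x "\<xi> ` below i"] fracs_superset[OF R] acl_superset[of "\<xi> ` below i"] by blast
  then obtain c where c: "c \<noteq> 0" "coeffs_in ?R c" "poly c y = 0"
    using acl_clear_denominators[OF R _ y] unfolding algover_def by blast
  have "\<forall>k. \<exists>P. coeff c k = poly P ?x \<and> coeffs_in ?k P" using c(2) unfolding coeffs_in_def by blast
  then obtain P0 where P0: "\<And>k. coeff c k = poly (P0 k) ?x" "\<And>k. coeffs_in ?k (P0 k)" by metis
  define n where "n = degree c"
  have "P0 n \<noteq> 0" using P0(1)[of n] c(1) by (auto simp: n_def)
  moreover have "(\<Sum>k\<le>n. poly (P0 k) ?x * y ^ k) = 0" using c(3) P0(1) by (simp add: poly_altdef n_def)
  \<comment> \<open>Common factors \<open>\<xi> i\<close> are divided out of all coefficients until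
    one of them has a nonzero constant term, so that reduction does not give the zero
    polynomial.\<close>
  ultimately have "\<exists>P. (\<forall>k. coeffs_in ?k (P k)) \<and> (\<exists>k\<le>n. poly (P k) 0 \<noteq> 0) \<and> (\<Sum>k\<le>n. poly (P k) ?x * y ^ k) = 0"
    using P0(2)
  proof (induction "\<Sum>k\<le>n. degree (P0 k)" arbitrary: P0 rule: less_induct)
    case less
    show ?case
    proof (cases "\<exists>k\<le>n. poly (P0 k) 0 \<noteq> 0")
      case True then show ?thesis using less.prems by blast
    next
      case False
      have "\<forall>k. \<exists>P'. coeffs_in ?k P' \<and> (k \<le> n \<longrightarrow> P0 k = pCons 0 P')"
      proof
        fix k
        obtain a P' where aP: "P0 k = pCons a P'" by (cases "P0 k")
        then have "coeffs_in ?k P'" using coeffs_in_pConsD less.prems(3)[of k] by metis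
        moreover have "k \<le> n \<longrightarrow> a = 0" using False aP by auto
        ultimately show "\<exists>P'. coeffs_in ?k P' \<and> (k \<le> n \<longrightarrow> P0 k = pCons 0 P')" using aP by auto
      qed
      then obtain P' where P': "\<And>k. coeffs_in ?k (P' k)" "\<And>k. k \<le> n \<Longrightarrow> P0 k = pCons 0 (P' k)" by metis
      have n0: "P' n \<noteq> 0" using P'(2)[of n] less.prems(1) by auto
      have "(\<Sum>k\<le>n. degree (P' k)) < (\<Sum>k\<le>n. degree (P0 k))"
      proof (rule sum_strict_mono_ex1)
        show "\<forall>k\<in>{..n}. degree (P' k) \<le> degree (P0 k)" using P'(2) by (auto simp: degree_pCons_eq_if)
        show "\<exists>k\<in>{..n}. degree (P' k) < degree (P0 k)" using P'(2)[of n] n0 by (intro bexI[of _ n]) auto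
      qed simp
      moreover have "?x * (\<Sum>k\<le>n. poly (P' k) ?x * y ^ k) = (\<Sum>k\<le>n. poly (P0 k) ?x * y ^ k)"
        unfolding sum_distrib_left using P'(2) by (intro sum.cong) (auto simp: algebra_simps)
      then have "(\<Sum>k\<le>n. poly (P' k) ?x * y ^ k) = 0" using less.prems(2) x0 by simp
      ultimately show ?thesis using less.hyps[of P'] n0 P'(1) by blast
    qed
  qed
  then obtain P where P: "\<And>k. coeffs_in ?k (P k)" "\<exists>k\<le>n. poly (P k) 0 \<noteq> 0" "(\<Sum>k\<le>n. poly (P k) ?x * y ^ k) = 0" by blast
  have "\<forall>k. \<exists>r. coeffs_in ?k r \<and> P k = pCons (poly (P k) 0) r"
  proof
    fix k
    obtain a r where ar: "P k = pCons a r" by (cases "P k")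
    then have "coeffs_in ?k r" using coeffs_in_pConsD P(1)[of k] by metis
    then show "\<exists>r. coeffs_in ?k r \<and> P k = pCons (poly (P k) 0) r" using ar by auto
  qed
  then obtain r where r: "\<And>k. coeffs_in ?k (r k)" "\<And>k. P k = pCons (poly (P k) 0) (r k)" by metis
  \<comment> \<open>The reduced equation: each coefficient is replaced by its constant term in
    \<open>\<xi> i\<close>.\<close>
  define p where "p = (\<Sum>k\<le>n. monom (poly (P k) 0) k)"
  have pk: "coeffs_in ?k p" unfolding p_def
    using P(1) subring_0[OF subring_acl] by (intro coeffs_in_sum coeffs_in_monom subring_acl poly_in_subring) auto
  have p0: "p \<noteq> 0"
  proof -
    obtain k where "k \<le> n" "poly (P k) 0 \<noteq> 0" using P(2) by blast
    then have "coeff p k \<noteq> 0" by (simp add: p_def coeff_sum)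
    then show ?thesis by auto
  qed
  define Fin where "Fin = {z. \<exists>h\<in>CF (below i). hlt z h}"
  have CF1: "1 \<in> CF (below i)" by (rule subring_1[OF subfield_subring[OF CF_subfield]])
  have CF_O: "c \<in> Fin" if "c \<in> CF (below i)" for c using CF_bounded[OF that] unfolding Fin_def by blast
  have O_mult: "a * b \<in> Fin" if ab: "a \<in> Fin" "b \<in> Fin" for a b
    using ab hlt_mult subring_mult[OF subfield_subring[OF CF_subfield]] unfolding Fin_def by blast
  have O_add: "a + b \<in> Fin" if ab: "a \<in> Fin" "b \<in> Fin" for a b
  proof -
    obtain h h' where h: "h \<in> CF (below i)" "hlt a h" "h' \<in> CF (below i)" "hlt b h'" using ab unfolding Fin_def by blast
    obtain f1 f2 f3 f4 where e: "a = hcof f1" "b = hcof f2" "h = hcof f3" "h' = hcof f4" using hcof_surj by metis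
    \<comment> \<open>The moduli of the bounds are added, as the bounds themselves might
      cancel.\<close>
    let ?H = "hmap (\<lambda>z. of_real (cmod z)) h + hmap (\<lambda>z. of_real (cmod z)) h'"
    have "hlt (a + b) ?H" using h(2,4) unfolding e hcof_ops hlt_hcof
    proof (rule eventually_elim2)
      fix x assume "cmod (f1 x) < cmod (f3 x)" "cmod (f2 x) < cmod (f4 x)"
      then have "cmod (f1 x + f2 x) < cmod (f3 x) + cmod (f4 x)" using norm_triangle_ineq[of "f1 x" "f2 x"] by linarith
      also have "\<dots> = cmod (of_real (cmod (f3 x)) + of_real (cmod (f4 x)))"
        unfolding of_real_add[symmetric] norm_of_real by simp
      finally show "cmod (f1 x + f2 x) < cmod (of_real (cmod (f3 x)) + of_real (cmod (f4 x)))" .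
    qed
    moreover have "?H \<in> CF (below i)" using h(1,3) by (intro subring_add[OF subfield_subring[OF CF_subfield]] CF_hmap)
    ultimately show ?thesis unfolding Fin_def by blast
  qed
  have yO: "\<phi> y \<in> Fin" using bd unfolding Fin_def by blast
  have xO: "hx i \<in> Fin" using hx_UU[of i] CF1 unfolding UU_def Fin_def by force
  have O_0: "0 \<in> Fin" and O_1: "1 \<in> Fin" using CF_O CF1 subring_0[OF subfield_subring[OF CF_subfield]] by blast+
  have O_pow: "a ^ m \<in> Fin" if "a \<in> Fin" for a m by (induction m) (auto intro: O_1 O_mult that)
  have O_sum: "sum f J \<in> Fin" if "\<And>j. j \<in> J \<Longrightarrow> f j \<in> Fin" for f and J :: "nat set"
    using that by (induction J rule: infinite_finite_induct) (auto intro: O_0 O_add)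
  have \<phi>_sum: "\<phi> (sum f J) = (\<Sum>j\<in>J. \<phi> (f j))" for f and J :: "nat set"
    using emb_sum[OF \<phi> subfield_subring[OF subfield_UNIV]] by simp
  have \<phi>_pow: "\<phi> (a ^ m) = \<phi> a ^ m" for a m by (induction m) (simp_all add: \<phi>_1 \<phi>_mult)
  have r_O: "\<phi> (poly (r k) ?x) \<in> Fin" for k
    unfolding poly_altdef \<phi>_sum \<phi>_mult \<phi>_pow \<phi>_\<xi>
    using r(1) kCF unfolding coeffs_in_def by (intro O_sum O_mult O_pow xO CF_O) blast
  define s where "s = (\<Sum>k\<le>n. poly (r k) ?x * y ^ k)"
  have sO: "\<phi> s \<in> Fin" unfolding s_def \<phi>_sum \<phi>_mult \<phi>_pow by (intro O_sum O_mult O_pow yO r_O)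
  have "poly (P k) ?x = poly (P k) 0 + ?x * poly (r k) ?x" for k by (subst r(2)) simp
  then have "(\<Sum>k\<le>n. poly (P k) ?x * y ^ k) = poly p y + ?x * s"
    by (simp add: p_def poly_sum poly_monom s_def sum.distrib sum_distrib_left algebra_simps)
  then have "poly p y = ?x * (- s)" using P(3) by (simp add: eq_neg_iff_add_eq_0)
  then have e: "\<phi> (poly p y) = hx i * \<phi> (- s)" by (simp only: \<phi>_mult \<phi>_\<xi>)
  have "\<phi> (- s) \<in> Fin" using O_mult[OF CF_O sO, of "- 1"] subring_uminus[OF subfield_subring[OF CF_subfield] CF1]
    by (simp add: \<phi>_uminus)
  then obtain h where h: "h \<in> CF (below i)" "hlt (\<phi> (- s)) h" unfolding Fin_def by blast
  have U: "\<phi> (poly p y) \<in> UU i" unfolding e by (rule UU_mult[OF hx_UU h(2,1)])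
  \<comment> \<open>\<open>p\<close> takes an infinitesimal value at \<open>y\<close> and its roots
    lie in the lower field; by primality \<open>y\<close> is infinitely close to one of
    them.\<close>
  obtain as where as: "p = smult (lead_coeff p) (\<Prod>a\<leftarrow>as. [:- a, 1:])"
    using alg_closed_factorization[OF ac p0] by blast
  have as_k: "a \<in> ?k" if "a \<in> set as" for a
  proof (rule rclosed_root[OF rclosed_acl p0 pk])
    have "poly (\<Prod>a\<leftarrow>as. [:- a, 1:]) a = 0" using that by (induction as) auto
    then show "poly p a = 0" by (subst as) simp
  qed
  have ev: "poly (\<Prod>a\<leftarrow>as. [:- a, 1:]) y = (\<Prod>a\<leftarrow>as. y - a)" for as by (induction as) (auto simp: algebra_simps)
  have "\<phi> (lead_coeff p) * \<phi> (\<Prod>a\<leftarrow>as. y - a) \<in> UU i"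
    using U by (subst (asm) as) (simp only: poly_smult ev \<phi>_mult)
  moreover have "\<phi> (lead_coeff p) \<notin> UU i"
  proof
    assume "\<phi> (lead_coeff p) \<in> UU i"
    moreover have "lead_coeff p \<in> ?k" using pk unfolding coeffs_in_def by blast
    ultimately have "\<phi> (lead_coeff p) = 0" by (intro UU_CF[OF kCF])
    then show False using p0 \<phi>_inj[of "lead_coeff p" 0] \<phi>_0 by simp
  qed
  ultimately have "\<phi> (\<Prod>a\<leftarrow>as. y - a) \<in> UU i" by (blast dest: UU_prime)
  then have "\<exists>a\<in>set as. \<phi> (y - a) \<in> UU i"
  proof (induction as)
    case Nil
    then show ?case using UU_CF[OF CF1] by (simp add: \<phi>_1)
  next
    case (Cons a as)
    then show ?case using UU_prime[of "\<phi> (y - a)" "\<phi> (\<Prod>a\<leftarrow>as. y - a)" i] by (auto simp: \<phi>_mult)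
  qed
  then show ?thesis using as_k by blast
qed

text \<open>A standard part averaged with its conjugate is fixed by \<open>\<sigma>\<close> and
  still close to the real \<open>y\<close>, since conjugation preserves smallness.\<close>

lemma real_standard_part:
  assumes yR: "y \<in> RR" and y: "y \<in> acl (\<xi> ` insert i (below i))" and bd: "hlt (\<phi> y) g" "g \<in> CF (below i)"
  shows "\<exists>c\<in>acl (\<xi> ` below i) \<inter> RR. \<phi> (y - c) \<in> UU i"
proof -
  obtain c where c: "c \<in> acl (\<xi> ` below i)" "\<phi> (y - c) \<in> UU i" using standard_part[OF y bd] by blast
  let ?c = "of_rat (1 / 2) * (c + \<sigma> c)"
  have "cj (\<phi> (y - c)) = \<phi> (y - \<sigma> c)" using yR unfolding RR_def by (simp flip: \<phi>_\<sigma> add: \<sigma>_diff)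
  then have "\<phi> (y - \<sigma> c) \<in> UU i" using UU_cj[OF c(2)] by simp
  then have "of_rat (1 / 2) * (\<phi> (y - c) + \<phi> (y - \<sigma> c)) \<in> UU i" using c(2) by (intro UU_scale UU_add CF_of_rat)
  moreover have "y - ?c = of_rat (1 / 2) * ((y - c) + (y - \<sigma> c))" by (simp add: field_simps of_rat_divide)
  ultimately have "\<phi> (y - ?c) \<in> UU i" by (simp only: \<phi>_mult \<phi>_add \<phi>_of_rat)
  moreover have "?c \<in> acl (\<xi> ` below i)" using c(1) \<sigma>_acl rclosed_of_rat[OF rclosed_acl]
    by (intro subring_mult[OF subring_acl] subring_add[OF subring_acl]) auto
  moreover have "?c \<in> RR" unfolding RR_def by (simp add: \<sigma>_mult \<sigma>_add \<sigma>_of_rat \<sigma>_\<sigma> add.commute)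
  ultimately show ?thesis by blast
qed

section \<open>Bases adapted to the levels\<close>

definition Rlt :: "'a \<Rightarrow> 'a set" where "Rlt i = acl (\<xi> ` below i) \<inter> RR"
definition Rle :: "'a \<Rightarrow> 'a set" where "Rle i = acl (\<xi> ` insert i (below i)) \<inter> RR"

lemma \<phi>_UU_subspace: "Q.subspace {y. \<phi> y \<in> UU i}"
  using UU_subspace[of i] unfolding Q.subspace_def by (simp add: \<phi>_0 \<phi>_add \<phi>_mult \<phi>_of_rat)

text \<open>\<open>B\<close> spans a complement of the earlier levels inside level \<open>i\<close>.
  It is chosen to contain a basis of the elements lying in \<open>UU i\<close>; so a combination
  that is small up to an element of an earlier level uses small basis elements only.\<close>

lemma level_basis:
  "\<exists>B. B \<subseteq> Rle i \<and> inverse (\<xi> i) \<in> B \<and> Q.independent B \<and>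
    (\<forall>y\<in>Rle i. \<exists>a\<in>Rlt i. \<exists>b\<in>Q.span B. y = a + b) \<and> Q.span B \<inter> Rlt i \<subseteq> {0} \<and>
    (\<forall>y\<in>Q.span B. \<forall>c\<in>Rlt i. \<phi> (y - c) \<in> UU i \<longrightarrow> y \<in> Q.span {b \<in> B. \<phi> b \<in> UU i})"
proof -
  let ?W = "{y \<in> Rle i. \<phi> y \<in> UU i}"
  have lt: "Q.subspace (Rlt i)" unfolding Rlt_def by (rule Q.subspace_inter[OF subspace_acl subspace_RR])
  have le: "Q.subspace (Rle i)" unfolding Rle_def by (rule Q.subspace_inter[OF subspace_acl subspace_RR])
  have W: "Q.subspace ?W" using Q.subspace_inter[OF le \<phi>_UU_subspace] by (simp add: Int_def)
  have lt_le: "Rlt i \<subseteq> Rle i" unfolding Rlt_def Rle_def using acl_mono[of "\<xi> ` below i" "\<xi> ` insert i (below i)"] by auto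
  obtain A where A: "A \<subseteq> Rlt i" "Q.independent A" "Rlt i \<subseteq> Q.span A" by (rule Q.maximal_independent_subset)
  obtain Wb where Wb: "Wb \<subseteq> ?W" "Q.independent Wb" "?W \<subseteq> Q.span Wb" by (rule Q.maximal_independent_subset)
  have sA: "Q.span A = Rlt i" using A(3) Q.span_minimal[OF A(1) lt] by blast
  have sW: "Q.span Wb = ?W" using Wb(3) Q.span_minimal[OF Wb(1) W] by blast
  have ltCF: "\<phi> y \<in> CF (below i)" if "y \<in> Rlt i" for y using that \<phi>_CF unfolding Rlt_def by blast
  have "Q.span A \<inter> Q.span Wb \<subseteq> {0}"
  proof
    fix y assume "y \<in> Q.span A \<inter> Q.span Wb"
    then have "y \<in> Rlt i" "\<phi> y \<in> UU i" unfolding sA sW by auto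
    then have "\<phi> y = 0" by (intro UU_CF[OF ltCF])
    then show "y \<in> {0}" using \<phi>_inj[of y 0] \<phi>_0 by simp
  qed
  then have AW: "Q.independent (A \<union> Wb)" by (rule independent_Un[OF A(2) Wb(2)])
  \<comment> \<open>Otherwise multiplication by the infinitesimal \<open>hx i\<close> would put 1
    into \<open>UU i\<close>.\<close>
  have inv: "inverse (\<xi> i) \<notin> Q.span (A \<union> Wb)"
  proof
    assume "inverse (\<xi> i) \<in> Q.span (A \<union> Wb)"
    then obtain a w where aw: "inverse (\<xi> i) = a + w" "a \<in> Rlt i" "\<phi> w \<in> UU i" unfolding Q.span_Un sA sW by blast
    have "hx i * \<phi> a \<in> UU i" using UU_scale[OF hx_UU ltCF[OF aw(2)]] by (simp add: mult.commute)
    moreover have "hlt (\<phi> w) 1" using aw(3) subring_1[OF subfield_subring[OF CF_subfield]] unfolding UU_def by force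
    then have "hx i * \<phi> w \<in> UU i" by (rule UU_mult[OF hx_UU]) (rule subring_1[OF subfield_subring[OF CF_subfield]])
    ultimately have "hx i * \<phi> (inverse (\<xi> i)) \<in> UU i" unfolding aw(1) \<phi>_add distrib_left by (rule UU_add)
    then have "1 \<in> UU i" using hx_nonzero[of i] by (simp add: \<phi>_inverse \<phi>_\<xi>)
    then show False using UU_CF[OF subring_1[OF subfield_subring[OF CF_subfield]], of i] by simp
  qed
  then have S: "Q.independent (insert (inverse (\<xi> i)) (A \<union> Wb))" using AW by (rule Q.independent_insertI)
  have "\<xi> i \<in> acl (\<xi> ` insert i (below i))" using acl_superset[of "\<xi> ` insert i (below i)"] by blast
  then have "inverse (\<xi> i) \<in> Rle i" unfolding Rle_def
    using subfield_inverse[OF subfield_acl] subfield_inverse[OF subfield_RR] \<sigma>_\<xi> by (simp add: RR_def[symmetric]) (simp add: RR_def)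
  then have "insert (inverse (\<xi> i)) (A \<union> Wb) \<subseteq> Rle i" using A(1) Wb(1) lt_le by auto
  then obtain T where T: "insert (inverse (\<xi> i)) (A \<union> Wb) \<subseteq> T" "T \<subseteq> Rle i" "Q.independent T" "Rle i \<subseteq> Q.span T"
    using Q.maximal_independent_subset_extend[OF _ S] by metis
  \<comment> \<open>Removing the basis \<open>A\<close> of the earlier levels from \<open>T\<close>
    leaves the complement, with \<open>Wb\<close> and \<open>inverse (\<xi> i)\<close> still in
    it.\<close>
  let ?B = "T - A"
  have AT: "A \<union> ?B = T" using T(1) by auto
  show ?thesis
  proof (intro exI[of _ ?B] conjI ballI impI)
    show "?B \<subseteq> Rle i" using T(2) by auto
    show "inverse (\<xi> i) \<in> ?B" using T(1) inv Q.span_base[of _ "A \<union> Wb"] by auto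
    show "Q.independent ?B" using T(3) by (rule Q.independent_mono) auto
    show "\<exists>a\<in>Rlt i. \<exists>b\<in>Q.span ?B. y = a + b" if "y \<in> Rle i" for y
      using subsetD[OF T(4) that] Q.span_Un[of A ?B] unfolding AT sA by auto
    show "Q.span ?B \<inter> Rlt i \<subseteq> {0}"
    proof
      fix y assume "y \<in> Q.span ?B \<inter> Rlt i"
      then have "y \<in> Q.span (?B \<inter> A)" using T(1) unfolding sA[symmetric] by (intro span_Int[OF T(3)]) auto
      moreover have "?B \<inter> A = {}" by blast
      ultimately show "y \<in> {0}" by (simp only: Q.span_empty)
    qed
    fix y c assume y: "y \<in> Q.span ?B" and c: "c \<in> Rlt i" and U: "\<phi> (y - c) \<in> UU i"
    have "?B \<subseteq> Rle i" using T(2) by auto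
    then have "y \<in> Rle i" using y Q.span_minimal[OF _ le] by blast
    then have "y - c \<in> ?W" using U c lt_le Q.subspace_diff[OF le] by blast
    then have "c + (y - c) \<in> Q.span (A \<union> Wb)" unfolding Q.span_Un sA sW using c by blast
    then have "y \<in> Q.span (?B \<inter> (A \<union> Wb))" using y T(1) by (intro span_Int[OF T(3)]) auto
    moreover have "?B \<inter> (A \<union> Wb) \<subseteq> {b \<in> ?B. \<phi> b \<in> UU i}" using Wb(1) by auto
    ultimately show "y \<in> Q.span {b \<in> ?B. \<phi> b \<in> UU i}" using Q.span_mono by blast
  qed
qed

lemma acl_level_cases:
  assumes "y \<in> acl (\<xi> ` A)"
  shows "y \<in> acl (\<xi> ` {}) \<or> (\<exists>j\<in>A. y \<in> acl (\<xi> ` insert j (below j)))"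
proof -
  obtain G where G: "finite G" "G \<subseteq> \<xi> ` A" "y \<in> acl G" using acl_finitary[OF assms] by blast
  then obtain F where F: "finite F" "F \<subseteq> A" "G = \<xi> ` F" by (meson finite_subset_image)
  show ?thesis
  proof (cases "F = {}")
    case True then show ?thesis using G(3) F(3) by simp
  next
    case False
    then obtain m where m: "m \<in> F" "F \<subseteq> insert m (below m)" using finite_max_idx[OF F(1)] by blast
    have "acl G \<subseteq> acl (\<xi> ` insert m (below m))" unfolding F(3) using m(2) by (intro acl_mono image_mono)
    then show ?thesis using G(3) m(1) F(2) by blast
  qed
qed

text \<open>Union of the bases of the complements, level by level. Expansions then respect
  smallness: small elements are combinations of small basis elements, so that a linear map can be
  controlled on the basis alone.\<close>

lemma orthogonal_basis:
  "\<exists>\<B>. \<B> \<subseteq> RR \<and> Q.independent \<B> \<and> Q.span \<B> = RR \<and> (\<forall>i. inverse (\<xi> i) \<in> \<B>) \<and>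
    (\<forall>y\<in>RR. \<forall>i. \<phi> y \<in> UU i \<longrightarrow> y \<in> Q.span {b \<in> \<B>. \<phi> b \<in> UU i})"
proof -
  have "\<forall>i. \<exists>B. B \<subseteq> Rle i \<and> inverse (\<xi> i) \<in> B \<and> Q.independent B \<and>
    (\<forall>y\<in>Rle i. \<exists>a\<in>Rlt i. \<exists>b\<in>Q.span B. y = a + b) \<and> Q.span B \<inter> Rlt i \<subseteq> {0} \<and>
    (\<forall>y\<in>Q.span B. \<forall>c\<in>Rlt i. \<phi> (y - c) \<in> UU i \<longrightarrow> y \<in> Q.span {b \<in> B. \<phi> b \<in> UU i})"
    using level_basis by blast
  then obtain B where "\<forall>i. B i \<subseteq> Rle i \<and> inverse (\<xi> i) \<in> B i \<and> Q.independent (B i) \<and>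
    (\<forall>y\<in>Rle i. \<exists>a\<in>Rlt i. \<exists>b\<in>Q.span (B i). y = a + b) \<and> Q.span (B i) \<inter> Rlt i \<subseteq> {0} \<and>
    (\<forall>y\<in>Q.span (B i). \<forall>c\<in>Rlt i. \<phi> (y - c) \<in> UU i \<longrightarrow> y \<in> Q.span {b \<in> B i. \<phi> b \<in> UU i})"
    by (rule choice[THEN exE])
  then have B: "\<And>i. B i \<subseteq> Rle i" "\<And>i. inverse (\<xi> i) \<in> B i" "\<And>i. Q.independent (B i)"
    "\<And>i y. y \<in> Rle i \<Longrightarrow> \<exists>a\<in>Rlt i. \<exists>b\<in>Q.span (B i). y = a + b" "\<And>i. Q.span (B i) \<inter> Rlt i \<subseteq> {0}"
    "\<And>i y c. y \<in> Q.span (B i) \<Longrightarrow> c \<in> Rlt i \<Longrightarrow> \<phi> (y - c) \<in> UU i \<Longrightarrow> y \<in> Q.span {b \<in> B i. \<phi> b \<in> UU i}"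
    by - ((drule spec, elim conjE, (assumption | erule (1) bspec | (drule (1) bspec, drule (1) bspec, erule (1) mp)))+)
  let ?R0 = "acl (\<xi> ` {}) \<inter> RR"
  obtain B0 where B0: "B0 \<subseteq> ?R0" "Q.independent B0" "?R0 \<subseteq> Q.span B0" by (rule Q.maximal_independent_subset)
  define \<B> where "\<B> = B0 \<union> (\<Union>i. B i)"
  have BR: "\<B> \<subseteq> RR" using B0(1) B(1) unfolding \<B>_def Rle_def by blast
  let ?U = "\<lambda>i. {b \<in> \<B>. \<phi> b \<in> UU i}"
  define good where "good y \<longleftrightarrow> y \<in> Q.span \<B> \<and> (\<forall>i. \<phi> y \<in> UU i \<longrightarrow> y \<in> Q.span (?U i))" for y
  have zero: "y = 0" if "\<phi> y \<in> CF (below i)" "\<phi> y \<in> UU i" for y i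
    using UU_CF[OF that] \<phi>_inj[of y 0] \<phi>_0 by simp
  have base: "good y" if y: "y \<in> ?R0" for y
  proof -
    have "y \<in> Q.span \<B>" using y B0(3) Q.span_mono[of B0 \<B>] unfolding \<B>_def by blast
    moreover have "y = 0" if "\<phi> y \<in> UU i" for i
      using zero[of y i] that y \<phi>_CF[of y "{}"] CF_mono[of "{}" "below i"] by blast
    ultimately show ?thesis unfolding good_def using Q.span_zero by blast
  qed
  have step: "good y" if "y \<in> Rle i" for y i
    using that
  proof (induction i arbitrary: y rule: wf_induct_rule[OF idx_wf])
    case (1 i)
    obtain a b where ab: "a \<in> Rlt i" "b \<in> Q.span (B i)" "y = a + b" using B(4)[OF 1(2)] by blast
    have ga: "good a"
    proof -
      have "a \<in> acl (\<xi> ` below i)" "a \<in> RR" using ab(1) unfolding Rlt_def by auto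
      then show ?thesis using acl_level_cases[of a "below i"] base[of a] 1(1)[of _ a] unfolding Rle_def
        by (auto simp: below_iff)
    qed
    have BB: "B i \<subseteq> \<B>" unfolding \<B>_def by blast
    have "b \<in> Q.span \<B>" using ab(2) Q.span_mono[OF BB] by blast
    then have ysp: "y \<in> Q.span \<B>" using ga ab(3) unfolding good_def by (auto intro: Q.span_add)
    have "y \<in> Q.span (?U j)" if U: "\<phi> y \<in> UU j" for j
    \<comment> \<open>For \<open>i\<close> below \<open>j\<close>, only 0 of this level lies in
      \<open>UU j\<close>. Otherwise \<open>UU i\<close> is contained in \<open>UU j\<close>, and
      the standard part of the bounded \<open>y\<close> shows that its component \<open>b\<close> is
      a combination of elements of \<open>UU i\<close>; the rest \<open>a\<close> belongs to earlier
      levels.\<close>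
    proof (cases "i \<in> below j")
      case True
      have "\<phi> y \<in> CF (insert i (below i))" using 1(2) \<phi>_CF unfolding Rle_def by blast
      then have "\<phi> y \<in> CF (below j)" using CF_mono[OF below_subset[OF True]] by blast
      then show ?thesis using zero U Q.span_zero by blast
    next
      case False
      then have "j = i \<or> j \<in> below i" using idx_linear[of i j] by blast
      then have "below j \<subseteq> below i" using below_subset[of j i] by auto
      then have Uji: "UU i \<subseteq> UU j" by (rule UU_mono)
      have CF1: "1 \<in> CF A" for A :: "'a set" by (rule subring_1[OF subfield_subring[OF CF_subfield]])
      have "hlt (\<phi> y) 1" using U CF1 unfolding UU_def by force
      then obtain c where c: "c \<in> Rlt i" "\<phi> (y - c) \<in> UU i"
        using real_standard_part[of y i 1] 1(2) CF1 unfolding Rle_def Rlt_def by blast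
      have "c - a \<in> Rlt i" using c(1) ab(1) unfolding Rlt_def
        by (auto intro: subring_diff[OF subring_acl] subring_diff[OF subring_RR])
      moreover have "b - (c - a) = y - c" using ab(3) by simp
      ultimately have bU: "b \<in> Q.span {b \<in> B i. \<phi> b \<in> UU i}" using B(6)[OF ab(2), of "c - a"] c(2) by metis
      have "{b \<in> B i. \<phi> b \<in> UU i} \<subseteq> ?U j" using BB Uji by blast
      then have bUj: "b \<in> Q.span (?U j)" using bU Q.span_mono by blast
      have "{b \<in> B i. \<phi> b \<in> UU i} \<subseteq> {y. \<phi> y \<in> UU i}" by blast
      then have "\<phi> b \<in> UU j" using bU Q.span_minimal[OF _ \<phi>_UU_subspace] Uji by blast
      then have "\<phi> y - \<phi> b \<in> UU j" using U by (intro UU_diff)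
      then have "\<phi> a \<in> UU j" using ab(3) by (simp add: \<phi>_add)
      then have "a \<in> Q.span (?U j)" using ga unfolding good_def by blast
      then show ?thesis using bUj ab(3) by (auto intro: Q.span_add)
    qed
    then show ?case using ysp unfolding good_def by blast
  qed
  have all: "good y" if y: "y \<in> RR" for y
    using acl_level_cases[OF \<phi>_UNIV[of y]] base step y unfolding Rle_def by blast
  have sp: "Q.span \<B> = RR" using all Q.span_minimal[OF BR subspace_RR] unfolding good_def by blast
  \<comment> \<open>In a dependence, the terms of the highest level sum to an element of earlier
    levels, hence to 0 because they span a complement of these.\<close>
  have ind: "Q.independent \<B>"
  proof
    assume "Q.dependent \<B>"
    then obtain t u where t: "finite t" "t \<subseteq> \<B>" "(\<Sum>v\<in>t. of_rat (u v) * v) = 0" "\<exists>v\<in>t. u v \<noteq> 0"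
      unfolding Q.dependent_explicit by blast
    define t' where "t' = {v \<in> t. u v \<noteq> 0}"
    have t': "finite t'" "t' \<subseteq> \<B>" "t' \<noteq> {}" using t unfolding t'_def by auto
    have sum': "(\<Sum>v\<in>t'. of_rat (u v) * v) = 0"
      using t(3) sum.mono_neutral_right[OF t(1), of t' "\<lambda>v. of_rat (u v) * v"] unfolding t'_def by simp
    have unz: "u v \<noteq> 0" if "v \<in> t'" for v using that unfolding t'_def by simp
    show False
    proof (cases "t' \<subseteq> B0")
      case True
      then have "Q.dependent B0" unfolding Q.dependent_explicit using t' sum' unz by blast
      then show False using B0(2) by blast
    next
      case False
      define lev where "lev v = (SOME i. v \<in> B i)" for v
      have lev: "v \<in> B (lev v)" if "v \<in> t' - B0" for v
        unfolding lev_def by (rule someI_ex) (use that t'(2) in \<open>auto simp: \<B>_def\<close>)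
      have "finite (lev ` (t' - B0))" "lev ` (t' - B0) \<noteq> {}" using t'(1) False by auto
      then obtain m where m: "m \<in> lev ` (t' - B0)" "lev ` (t' - B0) \<subseteq> insert m (below m)" using finite_max_idx by blast
      define t1 where "t1 = {v \<in> t' - B0. lev v = m}"
      have t1: "t1 \<subseteq> t'" "t1 \<noteq> {}" using m(1) unfolding t1_def by auto
      moreover have "t1 \<subseteq> B m" using lev unfolding t1_def by fast
      ultimately have t1: "t1 \<subseteq> t'" "t1 \<noteq> {}" "t1 \<subseteq> B m" by simp_all
      have "v \<in> Rlt m" if v: "v \<in> t' - t1" for v
      proof (cases "v \<in> B0")
        case True
        then show ?thesis using B0(1) acl_mono[of "\<xi> ` {}" "\<xi> ` below m"] unfolding Rlt_def by auto
      next
        case False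
        then have vt: "v \<in> t' - B0" using v by blast
        then have "lev v \<noteq> m" using v unfolding t1_def by blast
        then have b: "lev v \<in> below m" using m(2) vt by blast
        have "v \<in> Rle (lev v)" using lev[OF vt] B(1) by blast
        then show ?thesis using acl_mono[OF image_mono[OF below_subset[OF b]], of \<xi>] unfolding Rle_def Rlt_def by blast
      qed
      then have "(\<Sum>v\<in>t' - t1. of_rat (u v) * v) \<in> Rlt m"
      proof -
        assume h: "\<And>v. v \<in> t' - t1 \<Longrightarrow> v \<in> Rlt m"
        have "Q.subspace (Rlt m)" unfolding Rlt_def by (rule Q.subspace_inter[OF subspace_acl subspace_RR])
        then show ?thesis using h by (intro Q.subspace_sum Q.subspace_scale)
      qed
      moreover have "(\<Sum>v\<in>t'. of_rat (u v) * v) = (\<Sum>v\<in>t' - t1. of_rat (u v) * v) + (\<Sum>v\<in>t1. of_rat (u v) * v)"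
        by (rule sum.subset_diff[OF t1(1) t'(1)])
      then have e: "(\<Sum>v\<in>t1. of_rat (u v) * v) = - (\<Sum>v\<in>t' - t1. of_rat (u v) * v)" using sum' by (simp add: eq_neg_iff_add_eq_0 add.commute)
      ultimately have "(\<Sum>v\<in>t1. of_rat (u v) * v) \<in> Rlt m" unfolding e Rlt_def
        using subring_uminus[OF subring_acl] subring_uminus[OF subring_RR] by blast
      moreover have "(\<Sum>v\<in>t1. of_rat (u v) * v) \<in> Q.span (B m)" using t1(3) by (intro Q.span_sum Q.span_scale Q.span_base) blast
      ultimately have "(\<Sum>v\<in>t1. of_rat (u v) * v) = 0" using B(5) by blast
      moreover have "finite t1" using t1(1) t'(1) finite_subset by blast
      ultimately have "Q.dependent (B m)" unfolding Q.dependent_explicit using t1 unz by blast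
      then show False using B(3) by blast
    qed
  qed
  show ?thesis using BR ind sp B(2) all unfolding good_def \<B>_def by blast
qed

end

section \<open>Logarithms in the ultrapower\<close>

global_interpretation Qp: vector_space_pair "\<lambda>(q :: rat) (x :: 'a::field_char_0). of_rat q * x"
  "\<lambda>(q :: rat) (x :: 'b::field_char_0). of_rat q * x"
  by unfold_locales

lemma basis_bij_extend:
  fixes \<theta> :: "'a::field_char_0 \<Rightarrow> 'b::field_char_0"
  assumes B: "Q.independent B" and H: "Q.independent H" and \<theta>: "bij_betw \<theta> B H"
  shows "\<exists>A. (\<forall>x y. A (x + y) = A x + A y) \<and> (\<forall>q x. A (of_rat q * x) = of_rat q * A x) \<and>
    (\<forall>b\<in>B. A b = \<theta> b) \<and> bij_betw A (Q.span B) (Q.span H)"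
proof -
  obtain A where A: "Vector_Spaces.linear (\<lambda>q x :: 'a. of_rat q * x) (\<lambda>q x :: 'b. of_rat q * x) A" "\<forall>b\<in>B. A b = \<theta> b"
    using Qp.linear_independent_extend[OF B, of \<theta>] by blast
  interpret A: Vector_Spaces.linear "\<lambda>q x :: 'a. of_rat q * x" "\<lambda>q x :: 'b. of_rat q * x" A by (rule A(1))
  have AB: "A ` B = H" using \<theta> A(2) unfolding bij_betw_def by (simp cong: image_cong)
  have "inj_on A B" using \<theta> A(2) unfolding bij_betw_def inj_on_def by simp
  have inj: "inj_on A (Q.span B)" unfolding A.inj_on_iff_eq_0[OF Q.subspace_span]
  proof (intro ballI impI)
    fix x assume x: "x \<in> Q.span B" "A x = 0"
    let ?r = "Q.representation B x" let ?J = "{b. ?r b \<noteq> 0}"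
    have J: "finite ?J" "?J \<subseteq> B" using Q.finite_representation Q.representation_ne_zero by auto
    have e: "(\<Sum>b\<in>?J. of_rat (?r b) * b) = x" by (rule Q.sum_nonzero_representation_eq[OF B x(1)])
    have "A (\<Sum>b\<in>?J. of_rat (?r b) * b) = 0" unfolding e by (rule x(2))
    then have "(\<Sum>b\<in>?J. of_rat (?r b) * A b) = 0" unfolding A.sum A.scale .
    moreover have iJ: "inj_on A ?J" using \<open>inj_on A B\<close> J(2) inj_on_subset by blast
    ultimately have "(\<Sum>c\<in>A ` ?J. of_rat (?r (inv_into ?J A c)) * c) = 0"
      unfolding sum.reindex[OF iJ] comp_def by (subst sum.cong[OF refl]) (simp_all only: inv_into_f_f[OF iJ])
    moreover have "A ` ?J \<subseteq> H" using AB J(2) by blast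
    ultimately have "\<forall>c\<in>A ` ?J. ?r (inv_into ?J A c) = 0"
      using Q.independentD[OF H finite_imageI[OF J(1)], of A "\<lambda>c. ?r (inv_into ?J A c)"] by simp
    then have "?J = {}" using inv_into_f_f[OF iJ] by auto
    then show "x = 0" using e by simp
  qed
  have "bij_betw A (Q.span B) (Q.span H)" using inj A.span_image[of B] unfolding AB bij_betw_def by simp
  then show ?thesis using A(2) A.add A.scale by blast
qed

text \<open>The Cantor-Bernstein bijection with a record, for each argument, of which of the two
  injections it follows; every argument is thus of one of two good kinds.\<close>

lemma cantor_bernstein_choice:
  assumes u: "inj_on u A" "u ` A \<subseteq> B" and v: "inj_on v B" "v ` B \<subseteq> A"
  shows "\<exists>\<theta>. bij_betw \<theta> A B \<and> (\<forall>a\<in>A. \<theta> a = u a \<or> v (\<theta> a) = a)"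
proof -
  \<comment> \<open>On this least fixed point the bijection follows \<open>u\<close>; outside it,
    everything is a value of \<open>v\<close> and the bijection inverts \<open>v\<close>.\<close>
  define S where "S = lfp (\<lambda>S. A - v ` (B - u ` S))"
  have "mono (\<lambda>S. A - v ` (B - u ` S))" by (rule monoI) blast
  then have S: "S = A - v ` (B - u ` S)" unfolding S_def by (rule lfp_unfold)
  define \<theta> where "\<theta> a = (if a \<in> S then u a else inv_into B v a)" for a
  have out: "\<theta> a \<in> B - u ` S \<and> v (\<theta> a) = a" if a: "a \<in> A" "a \<notin> S" for a
  proof -
    have "a \<in> v ` (B - u ` S)" using a S by blast
    then obtain b where b: "b \<in> B" "b \<notin> u ` S" "a = v b" by blast
    then have "\<theta> a = b" using a(2) v(1) by (simp add: \<theta>_def)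
    then show ?thesis using b by simp
  qed
  have SA: "S \<subseteq> A" using S by blast
  have "bij_betw \<theta> A B" unfolding bij_betw_def
  proof
    show "inj_on \<theta> A"
    proof (rule inj_onI)
      fix a a' assume a: "a \<in> A" "a' \<in> A" "\<theta> a = \<theta> a'"
      have in_S: "\<theta> c \<in> u ` S" if "c \<in> S" for c using that by (simp add: \<theta>_def)
      consider "a \<in> S" "a' \<in> S" | "a \<notin> S" "a' \<notin> S" using a out in_S by (metis DiffD2)
      then show "a = a'"
      proof cases
        case 1 then show ?thesis using a u(1) by (simp add: \<theta>_def inj_on_eq_iff)
      next
        case 2 then show ?thesis using a out by metis
      qed
    qed
    show "\<theta> ` A = B"
    proof
      show "\<theta> ` A \<subseteq> B" using out u(2) SA by (auto simp: \<theta>_def)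
      show "B \<subseteq> \<theta> ` A"
      proof
        fix b assume b: "b \<in> B"
        show "b \<in> \<theta> ` A"
        proof (cases "b \<in> u ` S")
          case True then show ?thesis using SA by (auto simp: \<theta>_def)
        next
          case False
          then have "v b \<notin> S" using b S by blast
          moreover have "v b \<in> A" using b v(2) by blast
          ultimately show ?thesis using v(1) b by (intro image_eqI[of _ _ "v b"]) (simp_all add: \<theta>_def)
        qed
      qed
    qed
  qed
  moreover have "\<theta> a = u a \<or> v (\<theta> a) = a" if "a \<in> A" for a using out[OF that] by (cases "a \<in> S") (simp_all add: \<theta>_def)
  ultimately show ?thesis by blast
qed

section \<open>The exponential of the ultrapower and its kernel\<close>

abbreviation hexp :: "'i hc \<Rightarrow> 'i hc" where "hexp \<equiv> hmap exp"
abbreviation habs :: "'i hc \<Rightarrow> 'i hc" where "habs \<equiv> hmap (\<lambda>z. of_real (cmod z))"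
definition hi :: "'i hc" where "hi = hcof (\<lambda>_. \<i>)"
definition tpi :: "'i hc" where "tpi = hcof (\<lambda>_. of_real (2 * pi))"

lemma ax_E_hexp: "ax_E (hexp :: 'i hc \<Rightarrow> 'i hc)"
  unfolding ax_E_def
proof (intro conjI allI)
  fix a b :: "'i hc"
  obtain f where f: "a = hcof f" by (rule hcof_surj)
  obtain g where g: "b = hcof g" by (rule hcof_surj)
  show "hexp a \<noteq> 0" unfolding f hcof_ops hcof_nonzero by simp
  show "hexp (a + b) = hexp a * hexp b" unfolding f g hcof_ops exp_add ..
qed

lemma hexp_cj: "hexp (cj a) = cj (hexp a)"
proof -
  obtain f where f: "a = hcof f" by (rule hcof_surj)
  show ?thesis unfolding f hcof_ops exp_cnj ..
qed

lemma hi_hi: "hi * hi = - 1"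
  unfolding hi_def hcof_ops hcof_1[symmetric] by simp

lemma cj_hi: "cj hi = - hi"
  unfolding hi_def hcof_ops by simp

lemma cj_ops: "cj (a + b) = cj a + cj b" "cj (a - b) = cj a - cj b" "cj (a * b) = cj a * cj b"
  using emb_cj[where 'a='a] unfolding emb_def by auto

lemma cj_of_rat: "cj (of_rat q) = of_rat q"
  unfolding hcof_of_rat hcof_ops by (cases q) (simp add: of_rat_rat)

lemma cj_real: "cj (hcof f) = hcof f \<longleftrightarrow> eventually (\<lambda>x. f x = of_real (Re (f x))) hyper"
  unfolding hcof_ops hcof_eq by (rule arg_cong2[where f=eventually]) (auto simp: complex_eq_iff)

lemma hx_pos: "eventually (\<lambda>x. 0 < x i \<and> x i < 1) hyper"
proof -
  have "depends_on (below i) (\<lambda>_. 1)" by (simp add: depends_on_def)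
  from hyper_tiny[OF this] show ?thesis by eventually_elim simp
qed

lemma UU_le:
  assumes "b \<in> UU i" "a = hcof f" "b = hcof g" "eventually (\<lambda>x. cmod (f x) \<le> cmod (g x)) hyper"
  shows "a \<in> UU i"
  unfolding UU_def
proof (intro CollectI ballI impI)
  fix c assume c: "c \<in> CF (below i)" "c \<noteq> 0"
  obtain h where h: "c = hcof h" by (rule hcof_surj)
  have "hlt b c" using assms(1) c unfolding UU_def by blast
  then show "hlt a c" unfolding assms(2,3) h hlt_hcof using assms(4) by eventually_elim simp
qed

lemma UU_hlt:
  assumes "hlt a b" "b \<in> UU i" shows "a \<in> UU i"
  using assms hlt_trans unfolding UU_def by blast

text \<open>The logarithm of \<open>1 + hx i\<close>; functions of a real variable pass through
  \<open>Re\<close>, because \<open>hmap\<close> lifts functions on the complex numbers.\<close>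

definition lnx :: "'i \<Rightarrow> 'i hc" where "lnx i = hmap (\<lambda>z. of_real (ln (1 + Re z))) (hx i)"
text \<open>The factor 2 makes the exponential of \<open>hi * atx i\<close> rational in
  \<open>hx i\<close>, without a square root.\<close>

definition atx :: "'i \<Rightarrow> 'i hc" where "atx i = hmap (\<lambda>z. of_real (2 * arctan (Re z))) (hx i)"

lemma lnx_CF: "lnx i \<in> CF {i}" and atx_CF: "atx i \<in> CF {i}"
  unfolding lnx_def atx_def by (intro CF_hmap hx_CF; simp)+

lemma lnx_nonzero: "lnx i \<noteq> 0" and atx_nonzero: "atx i \<noteq> 0"
  using hx_pos[of i] unfolding lnx_def atx_def hx_def hcof_ops hcof_nonzero
  by (auto elim!: eventually_mono)

lemma lnx_UU: "lnx i \<in> UU i"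
proof -
  have "eventually (\<lambda>x. cmod (of_real (ln (1 + x i))) \<le> cmod (of_real (x i))) hyper"
    using hx_pos[of i] by eventually_elim (auto intro: ln_add_one_self_le_self)
  then show ?thesis by (intro UU_le[OF hx_UU[of i] _ hx_def]) (simp_all only: lnx_def hx_def hcof_ops Re_complex_of_real)
qed

lemma atx_UU: "atx i \<in> UU i"
proof -
  have "eventually (\<lambda>x. cmod (of_real (2 * arctan (x i))) \<le> cmod (of_real (x i) + of_real (x i))) hyper"
    using hx_pos[of i]
  proof eventually_elim
    case (elim x)
    then have "arctan (x i) \<le> x i" by (intro arctan_le_self) simp
    then show ?case using elim by (simp flip: of_real_add)
  qed
  then show ?thesis by (intro UU_le[OF UU_add[OF hx_UU[of i] hx_UU[of i]]]) (simp_all only: atx_def hx_def hcof_ops Re_complex_of_real)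
qed

lemma cj_lnx: "cj (lnx i) = lnx i" and cj_atx: "cj (atx i) = atx i"
  unfolding lnx_def atx_def hx_def hcof_ops by simp_all

lemma hexp_lnx: "hexp (lnx i) = 1 + hx i"
proof -
  have "eventually (\<lambda>x. exp (of_real (ln (1 + x i))) = 1 + complex_of_real (x i)) hyper"
    using hx_pos[of i] unfolding exp_of_real by eventually_elim simp
  then show ?thesis unfolding lnx_def hx_def hcof_1[symmetric] hcof_ops hcof_eq by simp
qed

text \<open>The point of argument \<open>arctan t\<close> on the unit circle is
  \<open>1 + \<i> t\<close> divided by its modulus. Squaring turns the squared modulus into the
  product of \<open>1 + \<i> t\<close> and its conjugate, and one factor cancels.\<close>

lemma exp_arctan: "exp (\<i> * of_real (2 * arctan t)) = (1 + \<i> * of_real t) / (1 - \<i> * of_real t)"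
proof -
  let ?s = "sqrt (1 + t\<^sup>2)"
  have s: "?s > 0" by (simp add: add_pos_nonneg)
  have c: "cis (arctan t) = (1 + \<i> * of_real t) / of_real ?s"
    using s by (simp add: complex_eq_iff cos_arctan sin_arctan Re_divide_of_real Im_divide_of_real)
  have ss: "complex_of_real ?s * of_real ?s = (1 + \<i> * of_real t) * (1 - \<i> * of_real t)"
    by (simp add: complex_eq_iff power2_eq_square flip: of_real_mult)
  have nz: "1 - \<i> * of_real t \<noteq> 0" "1 + \<i> * of_real t \<noteq> 0" by (simp_all add: complex_eq_iff)
  have "exp (\<i> * of_real (2 * arctan t)) = cis (arctan t) * cis (arctan t)"
    unfolding cis_mult unfolding mult_2 cis_conv_exp ..
  also have "\<dots> = (1 + \<i> * of_real t) * (1 + \<i> * of_real t) / ((1 + \<i> * of_real t) * (1 - \<i> * of_real t))"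
    unfolding c times_divide_times_eq ss ..
  also have "\<dots> = (1 + \<i> * of_real t) / (1 - \<i> * of_real t)" using nz(2) by simp
  finally show ?thesis .
qed

lemma hexp_atx: "hexp (hi * atx i) = (1 + hi * hx i) / (1 - hi * hx i)"
  unfolding atx_def hx_def hi_def hcof_1[symmetric] hcof_ops by (simp only: Re_complex_of_real exp_arctan)

text \<open>Finiteness in the standard sense. Imposed on arguments, it excludes infinite multiples
  of the period.\<close>

definition hfin :: "'i hc \<Rightarrow> bool" where "hfin h \<longleftrightarrow> (\<exists>n. hlt h (of_nat n))"

lemma hfin_hcof: "hfin (hcof f) \<longleftrightarrow> (\<exists>n. eventually (\<lambda>x. cmod (f x) < real n) hyper)"
  unfolding hfin_def hcof_of_nat hlt_hcof by simp

text \<open>Pointwise the argument is an integer multiple of \<open>2 * pi\<close>. Finiteness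
  bounds these integers by a standard number, so the ultrafilter selects a single standard
  one.\<close>

lemma hexp_kernel:
  assumes h: "cj h = h" "hfin h" "hexp (hi * h) = 1"
  shows "\<exists>k :: int. h = of_int k * tpi"
proof -
  obtain f where f: "h = hcof f" by (rule hcof_surj)
  obtain n where n: "eventually (\<lambda>x. cmod (f x) < real n) hyper" using h(2) unfolding f hfin_hcof by blast
  have e: "eventually (\<lambda>x. exp (\<i> * f x) = 1) hyper" using h(3) unfolding f hi_def hcof_ops hcof_1[symmetric] hcof_eq .
  have r: "eventually (\<lambda>x. f x = of_real (Re (f x))) hyper" using h(1) unfolding f cj_real .
  have "eventually (\<lambda>x. \<exists>k\<in>{- int n..int n}. f x = of_int k * of_real (2 * pi)) hyper"
    using n e r
  proof eventually_elim
    case (elim x)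
    then obtain k :: int where k: "Re (f x) = of_int (2 * k) * pi" unfolding exp_eq_1 by auto
    have fx: "f x = of_real (of_int k * (2 * pi))" by (subst elim(3)) (simp add: k)
    then have "\<bar>of_int k * (2 * pi)\<bar> < real n" using elim(1) by (simp only: norm_of_real)
    moreover have "\<bar>of_int k\<bar> * 1 \<le> \<bar>real_of_int k\<bar> * (2 * pi)" using pi_gt3 by (intro mult_left_mono) auto
    ultimately have "\<bar>real_of_int k\<bar> < real n" by (simp add: abs_mult)
    then have "k \<in> {- int n..int n}" by simp linarith
    then show ?case using fx by (intro bexI[of _ k]) simp_all
  qed
  then obtain k where "eventually (\<lambda>x. f x = of_int k * of_real (2 * pi)) hyper"
    using hyper_bex[of "{- int n..int n}" "\<lambda>k x. f x = of_int k * of_real (2 * pi)"] by auto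
  then have "h = of_int k * tpi" unfolding f tpi_def hcof_of_int hcof_ops hcof_eq .
  then show ?thesis ..
qed

lemma tpi_nonzero: "tpi \<noteq> 0"
  unfolding tpi_def hcof_nonzero by simp

lemma cj_tpi: "cj tpi = tpi"
  unfolding tpi_def hcof_ops by simp

lemma hfin_tpi: "hfin tpi"
proof -
  obtain n where "2 * pi < real n" using reals_Archimedean2 by blast
  then show ?thesis unfolding tpi_def hfin_hcof by (intro exI[of _ n] always_eventually allI) (simp add: norm_mult)
qed

lemma hexp_tpi: "hexp (hi * tpi) = 1"
  proof -
  have "exp (\<i> * of_real (2 * pi)) = 1" unfolding exp_eq_1 by (auto intro!: exI[of _ 1])
  then show ?thesis unfolding tpi_def hi_def hcof_ops hcof_1[symmetric] by simp
qed

lemma hexp_inj_real: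
  assumes "cj a = a" "cj b = b" "hexp a = hexp b" shows "a = b"
proof -
  obtain f where f: "a = hcof f" by (rule hcof_surj)
  obtain g where g: "b = hcof g" by (rule hcof_surj)
  show ?thesis using assms unfolding f g cj_real unfolding hcof_ops hcof_eq
  proof eventually_elim
    case (elim x)
    then have "exp (complex_of_real (Re (f x))) = exp (of_real (Re (g x)))" by metis
    then have "Re (f x) = Re (g x)" unfolding exp_of_real of_real_eq_iff by simp
    then show ?case using elim by metis
  qed
qed

lemma hexp_eq_1:
  assumes "cj a = a" "cj b = b" "hexp (a + hi * b) = 1" shows "a = 0" "hexp (hi * b) = 1"
proof -
  obtain f where f: "a = hcof f" by (rule hcof_surj)
  obtain g where g: "b = hcof g" by (rule hcof_surj)
  show a: "a = 0" using assms unfolding f g cj_real unfolding hi_def hcof_ops hcof_eq hcof_1[symmetric] hcof_0[symmetric]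
  proof eventually_elim
    case (elim x)
    then have "Re (f x) + Re (\<i> * g x) = 0" unfolding exp_eq_1 by simp
    moreover have "Im (g x) = 0" using elim(2) by (metis Im_complex_of_real)
    ultimately show ?case using elim(1) by simp
  qed
  show "hexp (hi * b) = 1" using assms(3) a by simp
qed

text \<open>Triangularity: a nonzero \<open>f i\<close> in \<open>UU i\<close> lies outside the
  field of the earlier levels, which contains all earlier values.\<close>

lemma infinitesimals_independent:
  fixes f :: "'i \<Rightarrow> 'i hc"
  assumes f: "\<And>i. f i \<in> CF {i}" "\<And>i. f i \<in> UU i" "\<And>i. f i \<noteq> 0"
  shows "inj f \<and> Q.independent (range f)"
proof -
  have "inj_on f (UNIV :: 'i set) \<and> acl_indep {} (f ` (UNIV :: 'i set))"
  proof (rule acl_indep_linear_order[OF idx_linear_order])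
    fix i :: 'i
    have "f j \<in> CF (below i)" if "j \<in> below i" for j
      using f(1)[of j] CF_mono[of "{j}" "below i"] that by auto
    then have "{} \<union> f ` (UNIV \<inter> below i) \<subseteq> CF (below i)" by auto
    then have "acl ({} \<union> f ` (UNIV \<inter> below i)) \<subseteq> CF (below i)" by (rule acl_least[OF rclosed_CF])
    moreover have "f i \<notin> CF (below i)" using UU_CF[of "f i" i] f(2,3) by blast
    ultimately show "f i \<notin> acl ({} \<union> f ` (UNIV \<inter> below i))" by (rule contra_subsetD)
  qed (simp add: idx_Field)
  then have inj: "inj f" and ind: "acl_indep {} (range f)" by auto
  have "Q.independent (range f)" unfolding Q.dependent_def
  proof
    assume "\<exists>a\<in>range f. a \<in> Q.span (range f - {a})"
    then obtain a where a: "a \<in> range f" "a \<in> Q.span (range f - {a})" by blast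
    have "Q.span (range f - {a}) \<subseteq> acl (range f - {a})" by (rule Q.span_minimal[OF acl_superset subspace_acl])
    then have "a \<in> acl ({} \<union> (range f - {a}))" using a(2) by auto
    then show False using ind a(1) unfolding acl_indep_def by blast
  qed
  then show ?thesis using inj by blast
qed

text \<open>All values of \<open>f\<close> are small at the least level \<open>m\<close>, below
  which there are no coordinates; the nonzero constant \<open>tpi\<close> is not.\<close>

lemma infinitesimals_tpi:
  fixes f :: "'i \<Rightarrow> 'i hc"
  assumes f: "\<And>i. f i \<in> UU i" shows "tpi \<notin> Q.span (range f)"
proof
  assume t: "tpi \<in> Q.span (range f)"
  obtain m :: 'i where m: "\<And>j. j \<notin> below m"
    using wfE_min[OF idx_wf, of undefined UNIV] unfolding below_iff by (metis UNIV_I)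
  have "range f \<subseteq> UU m"
  proof
    fix y assume "y \<in> range f"
    then obtain i where "y = f i" by blast
    moreover have "UU i \<subseteq> UU m" by (rule UU_mono) (use m in blast)
    ultimately show "y \<in> UU m" using f by blast
  qed
  then have "Q.span (range f) \<subseteq> UU m" by (rule Q.span_minimal[OF _ UU_subspace])
  then have "tpi \<in> UU m" using t by blast
  then have "tpi = (0 :: 'i hc)" by (intro UU_CF[of _ m]) (auto simp: tpi_def CF_const)
  then show False using tpi_nonzero by blast
qed

lemma hfin_add:
  assumes "hfin a" "hfin b" shows "hfin (a + b)"
proof -
  obtain f where f: "a = hcof f" by (rule hcof_surj)
  obtain g where g: "b = hcof g" by (rule hcof_surj)
  obtain n m where "eventually (\<lambda>x. cmod (f x) < real n) hyper" "eventually (\<lambda>x. cmod (g x) < real m) hyper"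
    using assms unfolding f g hfin_hcof by blast
  then have "eventually (\<lambda>x. cmod (f x + g x) < real (n + m)) hyper"
  proof eventually_elim
    case (elim x) then show ?case using norm_triangle_ineq[of "f x" "g x"] by simp
  qed
  then show ?thesis unfolding f g hcof_ops hfin_hcof by blast
qed

lemma hfin_scale:
  assumes "hfin a" shows "hfin (of_rat q * a)"
proof -
  obtain f where f: "a = hcof f" by (rule hcof_surj)
  obtain n where n: "eventually (\<lambda>x. cmod (f x) < real n) hyper" using assms unfolding f hfin_hcof by blast
  obtain m where m: "cmod (of_rat q) < real m" using reals_Archimedean2 by blast
  from n have "eventually (\<lambda>x. cmod (of_rat q * f x) < real (m * n)) hyper"
  proof eventually_elim
    case (elim x) then show ?case unfolding norm_mult of_nat_mult using m by (intro mult_strict_mono') auto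
  qed
  then show ?thesis unfolding f hcof_of_rat hcof_ops hfin_hcof by blast
qed

section \<open>The exponential\<close>

text \<open>\<open>A1\<close> turns real parts into logarithms of moduli and \<open>A2\<close> turns
  imaginary parts into finite arguments. The last argument of \<open>g\<close> separates the four
  sorts of levels: 0 and 2 for the modulus, 1 and 3 for the argument, the odd ones of each map never
  meeting the even ones.\<close>

locale hyper_logarithm = hyper_embedding \<xi> \<phi>
  for \<xi> :: "'a::field_char_0 \<Rightarrow> 'a" and \<phi> :: "'a \<Rightarrow> 'a hc" +
  fixes \<B> :: "'a set" and g :: "'a \<Rightarrow> nat \<Rightarrow> 'a" and A1 A2 :: "'a \<Rightarrow> 'a hc"
  assumes B: "\<B> \<subseteq> RR" "Q.independent \<B>" "Q.span \<B> = RR"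
    and orth: "\<And>y i. y \<in> RR \<Longrightarrow> \<phi> y \<in> UU i \<Longrightarrow> y \<in> Q.span {b \<in> \<B>. \<phi> b \<in> UU i}"
    and g_inj: "\<And>a b i j. g a i = g b j \<Longrightarrow> a = b \<and> i = j"
    and g_acl: "\<And>a i. a \<in> acl (\<xi> ` below (g a i))"
    and A1: "\<And>x y. A1 (x + y) = A1 x + A1 y" "\<And>q x. A1 (of_rat q * x) = of_rat q * A1 x"
    and A1_bij: "bij_betw A1 RR {h. cj h = h \<and> hexp h \<in> range \<phi>}"
    and A1_cases: "\<And>b. b \<in> \<B> \<Longrightarrow> A1 b = lnx (g b 0) \<or> b = inverse (\<xi> (g (inv \<phi> (hexp (A1 b))) 2))"
    and A2: "\<And>x y. A2 (x + y) = A2 x + A2 y" "\<And>q x. A2 (of_rat q * x) = of_rat q * A2 x"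
    and A2_bij: "bij_betw A2 RR {h. cj h = h \<and> hfin h \<and> hexp (hi * h) \<in> range \<phi>}"
    and A2_cases: "\<And>b. b \<in> \<B> \<Longrightarrow> A2 b = atx (g b 1) \<or> b = inverse (\<xi> (g (inv \<phi> (hexp (hi * A2 b))) 3))"

section \<open>Real and imaginary parts in \<open>K\<close>\<close>

context hyper_embedding
begin

lemmas range_mult = subring_mult[OF rclosed_subring[OF rclosed_range]]

lemma \<phi>_inv: "a \<in> range \<phi> \<Longrightarrow> \<phi> (inv \<phi> a) = a"
  by (rule f_inv_into_f)

lemma hi_range: "hi \<in> range \<phi>"
proof (rule rclosed_power_root[OF rclosed_range, of 2])
  show "hi ^ 2 \<in> range \<phi>" unfolding power2_eq_square hi_hi
    using \<phi>_uminus[of 1] \<phi>_1 by (metis rangeI)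
qed simp

definition iK :: 'a where "iK = inv \<phi> hi"

lemma \<phi>_iK: "\<phi> iK = hi"
  unfolding iK_def by (rule \<phi>_inv[OF hi_range])

lemma iK_iK: "iK * iK = - 1"
  unfolding \<phi>_inj[symmetric] \<phi>_mult \<phi>_iK hi_hi \<phi>_uminus \<phi>_1 ..

lemma \<sigma>_iK: "\<sigma> iK = - iK"
  unfolding \<phi>_inj[symmetric] \<phi>_\<sigma> \<phi>_iK cj_hi \<phi>_uminus ..

lemma iK_nonzero: "iK \<noteq> 0"
  using iK_iK by auto

lemma sqrt_minus_1_acl:
  assumes "s * s = (- 1 :: 'a)" shows "s \<in> acl A"
proof (rule rclosed_power_root[OF rclosed_acl, of 2])
  show "s ^ 2 \<in> acl A" unfolding power2_eq_square assms
    by (rule subring_uminus[OF subring_acl subring_1[OF subring_acl]])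
qed simp

text \<open>The coordinates with respect to any square root of -1, since the one chosen in the
  definition of the topology need not be the preimage of \<open>\<i>\<close>.\<close>

definition re :: "'a \<Rightarrow> 'a" where "re z = of_rat (1 / 2) * (z + \<sigma> z)"
definition im :: "'a \<Rightarrow> 'a \<Rightarrow> 'a" where "im s z = of_rat (1 / 2) * (- s) * (z - \<sigma> z)"

lemma half: "of_rat (1 / 2) * x + of_rat (1 / 2) * x = (x :: 'b::field_char_0)"
  by (simp add: of_rat_divide)

lemma \<sigma>_sqrt:
  assumes "s * s = - 1" shows "\<sigma> s = - s"
proof -
  have "(s - iK) * (s + iK) = 0" using assms iK_iK by (simp add: algebra_simps)
  then have "s = iK \<or> s = - iK" by (auto simp: eq_neg_iff_add_eq_0)
  moreover have "\<sigma> (- iK) = iK" using \<sigma>_diff[of 0 iK] \<sigma>_0 \<sigma>_iK by simp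
  ultimately show ?thesis using \<sigma>_iK by auto
qed

lemma \<sigma>_uminus: "\<sigma> (- x) = - \<sigma> x"
  using \<sigma>_diff[of 0 x] \<sigma>_0 by simp

lemma re_RR: "re z \<in> RR"
  unfolding RR_def re_def by (simp add: \<sigma>_mult \<sigma>_add \<sigma>_of_rat \<sigma>_\<sigma> add.commute)

lemma im_RR: "s * s = - 1 \<Longrightarrow> im s z \<in> RR"
  unfolding RR_def im_def by (simp add: \<sigma>_mult \<sigma>_diff \<sigma>_of_rat \<sigma>_\<sigma> \<sigma>_uminus \<sigma>_sqrt algebra_simps)

lemma re_im:
  assumes "s * s = - 1" shows "re z + s * im s z = z"
proof -
  have "s * im s z = of_rat (1 / 2) * (- (s * s)) * (z - \<sigma> z)" unfolding im_def by (simp only: ac_simps mult_minus_left mult_minus_right)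
  then have "re z + s * im s z = of_rat (1 / 2) * z + of_rat (1 / 2) * z" unfolding re_def assms by (simp add: algebra_simps)
  then show ?thesis unfolding half .
qed

lemma re_coord:
  assumes "s * s = - 1" "a \<in> RR" "b \<in> RR" shows "re (a + s * b) = a" "im s (a + s * b) = b"
proof -
  have *: "\<sigma> (a + s * b) = a - s * b" using assms(2,3) \<sigma>_sqrt[OF assms(1)] unfolding RR_def by (simp add: \<sigma>_add \<sigma>_mult)
  have "re (a + s * b) = of_rat (1 / 2) * a + of_rat (1 / 2) * a" unfolding re_def * by (simp add: algebra_simps)
  then show "re (a + s * b) = a" unfolding half .
  have "im s (a + s * b) = of_rat (1 / 2) * (- (s * s) * b) + of_rat (1 / 2) * (- (s * s) * b)" unfolding im_def * by (simp add: algebra_simps)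
  then show "im s (a + s * b) = b" unfolding half assms by simp
qed

lemma re_add: "re (x + y) = re x + re y" and re_diff: "re (x - y) = re x - re y"
  unfolding re_def by (simp_all add: \<sigma>_add \<sigma>_diff algebra_simps)

lemma im_add: "im s (x + y) = im s x + im s y" and im_diff: "im s (x - y) = im s x - im s y"
  unfolding im_def by (simp_all add: \<sigma>_add \<sigma>_diff algebra_simps)

lemma re_\<sigma>: "re (\<sigma> z) = re z" and im_\<sigma>: "im s (\<sigma> z) = - im s z"
  unfolding re_def im_def by (simp_all add: \<sigma>_\<sigma> algebra_simps)

lemma RR_cj: "x \<in> RR \<longleftrightarrow> cj (\<phi> x) = \<phi> x"
  unfolding RR_def \<phi>_\<sigma>[symmetric] \<phi>_inj by simp

lemma \<phi>_algebraic_CF: "x \<in> acl (\<xi> ` {}) \<Longrightarrow> \<phi> x \<in> CF A"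
  using \<phi>_CF[of x "{}"] CF_mono[of "{}" A] by blast

lemma re_UU: "\<phi> z \<in> UU i \<Longrightarrow> \<phi> (re z) \<in> UU i"
  unfolding re_def \<phi>_mult \<phi>_add \<phi>_of_rat \<phi>_\<sigma> by (intro UU_scale UU_add UU_cj CF_of_rat)

text \<open>A square root of -1 is algebraic over the empty set of levels, so its image lies in
  every level field and multiplication by it preserves smallness.\<close>

lemma im_UU:
  assumes s: "s * s = - 1" and z: "\<phi> z \<in> UU i" shows "\<phi> (im s z) \<in> UU i"
proof -
  have "- s \<in> acl (\<xi> ` {})" using s by (intro sqrt_minus_1_acl) simp
  then have "\<phi> (of_rat (1 / 2) * - s) \<in> CF (below i)"
    by (intro \<phi>_algebraic_CF subring_mult[OF subring_acl] rclosed_of_rat[OF rclosed_acl])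
  then show ?thesis unfolding im_def \<phi>_mult[of _ "z - \<sigma> z"] \<phi>_diff \<phi>_\<sigma>
    using z by (intro UU_scale UU_diff UU_cj)
qed

end

section \<open>Kernel, surjectivity and effect on small elements\<close>

context hyper_logarithm
begin

definition E :: "'a \<Rightarrow> 'a" where "E z = inv \<phi> (hexp (A1 (re z) + hi * A2 (im iK z)))"

lemma A1_RR: "a \<in> RR \<Longrightarrow> cj (A1 a) = A1 a \<and> hexp (A1 a) \<in> range \<phi>"
  and A2_RR: "a \<in> RR \<Longrightarrow> cj (A2 a) = A2 a \<and> hfin (A2 a) \<and> hexp (hi * A2 a) \<in> range \<phi>"
  using A1_bij A2_bij unfolding bij_betw_def by blast+

lemma A1_0: "A1 0 = 0" and A2_0: "A2 0 = 0"
  using A1(1)[of 0 0] A2(1)[of 0 0] by simp_all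

lemma \<phi>_E: "\<phi> (E z) = hexp (A1 (re z) + hi * A2 (im iK z))"
  unfolding E_def E_add[OF ax_E_hexp]
  by (intro \<phi>_inv range_mult) (use A1_RR[OF re_RR] A2_RR[OF im_RR[OF iK_iK]] in blast)+

lemma E_E: "ax_E E"
  unfolding ax_E_def
proof (intro conjI allI)
  fix x y
  show "E x \<noteq> 0" using E_nonzero[OF ax_E_hexp] \<phi>_inj[of "E x" 0] \<phi>_0 \<phi>_E[of x] by metis
  have "A1 (re (x + y)) + hi * A2 (im iK (x + y)) = (A1 (re x) + hi * A2 (im iK x)) + (A1 (re y) + hi * A2 (im iK y))"
    unfolding re_add im_add A1(1) A2(1) by (simp add: algebra_simps)
  then have "\<phi> (E (x + y)) = \<phi> (E x * E y)" unfolding \<phi>_mult \<phi>_E by (simp only: E_add[OF ax_E_hexp])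
  then show "E (x + y) = E x * E y" unfolding \<phi>_inj .
qed

lemma E_\<sigma>: "\<sigma> (E z) = E (\<sigma> z)"
proof -
  have neg: "A2 (- y) = - A2 y" for y using A2(1)[of y "- y"] A2_0 by (simp add: eq_neg_iff_add_eq_0 add.commute)
  have "cj (A1 (re z) + hi * A2 (im iK z)) = A1 (re (\<sigma> z)) + hi * A2 (im iK (\<sigma> z))"
    unfolding cj_ops cj_hi re_\<sigma> im_\<sigma> neg using A1_RR[OF re_RR] A2_RR[OF im_RR[OF iK_iK]] by simp
  then have "\<phi> (\<sigma> (E z)) = \<phi> (E (\<sigma> z))" unfolding \<phi>_\<sigma> \<phi>_E hexp_cj[symmetric] by simp
  then show ?thesis unfolding \<phi>_inj .
qed

lemma E_coord:
  assumes "a \<in> RR" "b \<in> RR" shows "\<phi> (E (a + iK * b)) = hexp (A1 a + hi * A2 b)"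
  unfolding \<phi>_E re_coord[OF iK_iK assms] ..

lemma E_real: "a \<in> RR \<Longrightarrow> \<phi> (E a) = hexp (A1 a)"
  using E_coord[of a 0] subring_0[OF subring_RR] by (simp add: A2_0)

lemma E_imag: "b \<in> RR \<Longrightarrow> \<phi> (E (iK * b)) = hexp (hi * A2 b)"
  using E_coord[of 0 b] subring_0[OF subring_RR] by (simp add: A1_0)

text \<open>Polar coordinates. The modulus is a square root of the product of \<open>w\<close> and
  its conjugate, hence lies in the image of \<open>\<phi>\<close>; so do the phase factor and thus
  both coordinates are in the ranges of \<open>A1\<close> and \<open>A2\<close>.\<close>

lemma E_LOG: "ax_LOG E"
  unfolding ax_LOG_def
proof (intro allI impI)
  fix w :: 'a assume w: "w \<noteq> 0"
  then have "\<phi> w \<noteq> 0" using \<phi>_inj[of w 0] \<phi>_0 by simp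
  obtain f where f: "\<phi> w = hcof f" by (rule hcof_surj)
  have f0: "eventually (\<lambda>x. f x \<noteq> 0) hyper" using \<open>\<phi> w \<noteq> 0\<close> unfolding f hcof_nonzero .
  let ?n = "hcof (\<lambda>x. of_real (cmod (f x)))"
  let ?h1 = "hcof (\<lambda>x. of_real (ln (cmod (f x))))" let ?h2 = "hcof (\<lambda>x. of_real (Arg (f x)))"
  have "?n ^ 2 = \<phi> w * cj (\<phi> w)" unfolding f hcof_ops by (simp add: complex_norm_square[symmetric])
  then have "?n ^ 2 \<in> range \<phi>" using range_mult[OF rangeI cj_range] by metis
  then have n: "?n \<in> range \<phi>" by (rule rclosed_power_root[OF rclosed_range zero_less_numeral])
  have e1: "hexp ?h1 = ?n" unfolding hcof_ops hcof_eq
    unfolding exp_of_real using f0 by eventually_elim simp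
  have e2: "?n * hexp (hi * ?h2) = \<phi> w" unfolding f hi_def hcof_ops hcof_eq
    by (rule always_eventually) (metis rcis_cmod_Arg rcis_def cis_conv_exp)
  have n0: "?n \<noteq> 0" unfolding hcof_nonzero using f0 by eventually_elim simp
  have "hexp (hi * ?h2) = \<phi> w * inverse ?n" unfolding e2[symmetric] using n0 by simp
  then have "hexp (hi * ?h2) \<in> range \<phi>"
    using range_mult[OF rangeI subfield_inverse[OF rclosed_subfield[OF rclosed_range] n]] by metis
  moreover have "hfin ?h2" unfolding hfin_hcof
  proof (intro exI always_eventually allI)
    fix x show "cmod (of_real (Arg (f x))) < real 4"
      using mpi_less_Arg[of "f x"] Arg_le_pi[of "f x"] pi_less_4 by simp
  qed
  moreover have "cj ?h2 = ?h2" "cj ?h1 = ?h1" unfolding hcof_ops by simp_all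
  ultimately have "?h1 \<in> A1 ` RR" "?h2 \<in> A2 ` RR"
    using A1_bij A2_bij n e1 unfolding bij_betw_def by simp_all
  then obtain a b where ab: "a \<in> RR" "A1 a = ?h1" "b \<in> RR" "A2 b = ?h2" by (elim imageE) simp
  have "\<phi> (E (a + iK * b)) = \<phi> w" unfolding E_coord[OF ab(1,3)] ab E_add[OF ax_E_hexp] e1 e2 ..
  then show "\<exists>z. E z = w" unfolding \<phi>_inj by blast
qed

lemma A2_of_int: "A2 (of_int k * x) = of_int k * A2 x"
  using A2(2)[of "of_int k" x] by simp

text \<open>The generator is \<open>iK\<close> times the preimage of \<open>tpi\<close> under
  \<open>A2\<close>: the kernel forces the logarithm of the modulus to vanish and the finite
  argument to be an integer multiple of \<open>tpi\<close>.\<close>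

lemma E_STD: "ax_STD E"
proof -
  have "tpi \<in> {h. cj h = h \<and> hfin h \<and> hexp (hi * h) \<in> range \<phi>}"
    using rangeI[of \<phi> 1] by (simp add: cj_tpi hfin_tpi hexp_tpi \<phi>_1)
  then obtain b0 where b0: "b0 \<in> RR" "A2 b0 = tpi" using A2_bij unfolding bij_betw_def by (metis imageE)
  have b0k: "of_int k * b0 \<in> RR" for k
    using subring_mult[OF subring_RR subring_of_int[OF subring_RR] b0(1)] .
  have "b0 \<noteq> 0" using b0(2) A2_0 tpi_nonzero by auto
  then have "iK * b0 \<noteq> 0" using iK_nonzero by simp
  moreover have "{z. E z = 1} = range (\<lambda>k :: int. iK * b0 * of_int k)"
  proof
    show "range (\<lambda>k :: int. iK * b0 * of_int k) \<subseteq> {z. E z = 1}"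
    proof
      fix z assume "z \<in> range (\<lambda>k :: int. iK * b0 * of_int k)"
      then obtain k :: int where z: "z = iK * (of_int k * b0)" by (auto simp: ac_simps)
      have "\<phi> (E z) = hexp (of_int k * (hi * tpi))" unfolding z E_imag[OF b0k] A2_of_int b0(2) by (simp add: ac_simps)
      also have "\<dots> = \<phi> 1" unfolding E_of_int[OF ax_E_hexp] hexp_tpi \<phi>_1 by simp
      finally show "z \<in> {z. E z = 1}" unfolding \<phi>_inj by simp
    qed
    show "{z. E z = 1} \<subseteq> range (\<lambda>k :: int. iK * b0 * of_int k)"
    proof
      fix z assume "z \<in> {z. E z = 1}"
      then have 1: "hexp (A1 (re z) + hi * A2 (im iK z)) = 1" unfolding \<phi>_E[symmetric] by (simp add: \<phi>_1)
      note r = A1_RR[OF re_RR[of z], THEN conjunct1] A2_RR[OF im_RR[OF iK_iK], of z]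
      have z1: "A1 (re z) = 0" "hexp (hi * A2 (im iK z)) = 1" using hexp_eq_1[OF r(1) conjunct1[OF r(2)] 1] .
      then obtain k where k: "A2 (im iK z) = of_int k * tpi"
        using hexp_kernel[OF conjunct1[OF r(2)] conjunct1[OF conjunct2[OF r(2)]] z1(2)] by (elim exE)
      have "A2 (im iK z) = A2 (of_int k * b0)" unfolding A2_of_int b0(2) by (rule k)
      then have "im iK z = of_int k * b0"
        using inj_onD[OF bij_betw_imp_inj_on[OF A2_bij] _ im_RR[OF iK_iK] b0k] by simp
      moreover have "re z = 0"
        using inj_onD[OF bij_betw_imp_inj_on[OF A1_bij] _ re_RR subring_0[OF subring_RR]] z1(1) A1_0 by simp
      ultimately have "z = iK * b0 * of_int k" using re_im[OF iK_iK, of z] by (simp add: ac_simps)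
      then show "z \<in> range (\<lambda>k :: int. iK * b0 * of_int k)" by blast
    qed
  qed
  ultimately show ?thesis unfolding ax_STD_def by blast
qed

text \<open>A nonzero element of the levels below \<open>j\<close> cannot belong to
  \<open>UU i\<close> unless \<open>i\<close> lies below \<open>j\<close>.\<close>

lemma below_of_acl:
  assumes "x \<in> acl (\<xi> ` below j)" "x \<noteq> 0" "\<phi> x \<in> UU i" shows "UU j \<subseteq> UU i"
proof (cases "i \<in> below j")
  case True
  then show ?thesis using below_subset[of i j] by (intro UU_mono) blast
next
  case False
  then have "below j \<subseteq> below i" using idx_linear[of i j] below_subset[of j i] by auto
  then have "\<phi> x \<in> CF (below i)" using \<phi>_CF[OF assms(1)] CF_mono by blast
  then have "\<phi> x = \<phi> 0" using UU_CF[OF _ assms(3)] \<phi>_0 by simp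
  then show ?thesis using assms(2) unfolding \<phi>_inj by blast
qed

lemma inverse_hx_UU: "inverse (hx j) \<notin> UU (i :: 'a)"
proof
  assume "inverse (hx j) \<in> UU i"
  then have "hlt (inverse (hx j)) 1" using subring_1[OF subfield_subring[OF CF_subfield]] unfolding UU_def by force
  then have "eventually (\<lambda>x. cmod (inverse (of_real (x j))) < 1) hyper" unfolding hx_def hcof_1[symmetric] hcof_ops hlt_hcof by simp
  then have "eventually (\<lambda>x :: 'a \<Rightarrow> real. False) hyper" using hx_pos[of j]
  proof eventually_elim
    case (elim x)
    then have "1 \<le> inverse (x j)" by (simp add: one_le_inverse)
    then show ?case using elim by (simp add: norm_inverse)
  qed
  then show False using hyper_False by blast
qed

lemma B_nonzero: "b \<in> \<B> \<Longrightarrow> b \<noteq> 0"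
  using B(2) Q.dependent_zero by blast

text \<open>By the adapted basis only basis elements in \<open>UU i\<close> matter. Being small,
  they are not inverses of infinitesimals, so their logarithms lie at a private level later than
  their own and are smaller still.\<close>

lemma log_UU:
  assumes add: "\<And>x y. A (x + y) = A x + A y" and scale: "\<And>q x. A (of_rat q * x) = of_rat q * A x"
    and cases: "\<And>b. b \<in> \<B> \<Longrightarrow> A b = l (g b k) \<or> (\<exists>j. b = inverse (\<xi> j))"
    and l: "\<And>j. l j \<in> UU j" and a: "a \<in> RR" "\<phi> a \<in> UU i"
  shows "A a \<in> UU i"
proof -
  have "a \<in> Q.span {b \<in> \<B>. \<phi> b \<in> UU i}" by (rule orth[OF a])
  moreover have "{b \<in> \<B>. \<phi> b \<in> UU i} \<subseteq> {x. A x \<in> UU i}"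
  proof
    fix b assume b: "b \<in> {b \<in> \<B>. \<phi> b \<in> UU i}"
    have "b \<noteq> inverse (\<xi> j)" for j using b inverse_hx_UU[of j i] \<phi>_inverse[of "\<xi> j"] \<phi>_\<xi>[of j] by auto
    then have "A b = l (g b k)" using cases[of b] b by blast
    moreover have "UU (g b k) \<subseteq> UU i" using below_of_acl[OF g_acl[of b k]] B_nonzero[of b] b by blast
    ultimately show "b \<in> {x. A x \<in> UU i}" using l by auto
  qed
  moreover have "Q.subspace {x. A x \<in> UU i}"
    using UU_subspace[of i] add[of 0 0] unfolding Q.subspace_def by (simp add: add scale)
  ultimately show ?thesis using Q.span_minimal by blast
qed

text \<open>The Taylor estimate of order 0; the constant 3 bounds \<open>exp 1\<close>.\<close>

lemma hexp_UU:
  assumes "h \<in> UU i" shows "hexp h - 1 \<in> UU i"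
proof -
  obtain f where f: "h = hcof f" by (rule hcof_surj)
  have "hlt h 1" using assms subring_1[OF subfield_subring[OF CF_subfield]] unfolding UU_def by force
  then have "eventually (\<lambda>x. cmod (f x) < 1) hyper" unfolding f hcof_1[symmetric] hlt_hcof by simp
  then have ev: "eventually (\<lambda>x. cmod (exp (f x) - 1) \<le> cmod (3 * f x)) hyper"
  proof eventually_elim
    case (elim x)
    have "cmod (exp (f x) - 1) \<le> exp \<bar>Re (f x)\<bar> * cmod (f x)" using Taylor_exp[of "f x" 0] by simp
    also have "\<dots> \<le> 3 * cmod (f x)"
    proof (rule mult_right_mono)
      have "exp \<bar>Re (f x)\<bar> \<le> exp 1" using elim abs_Re_le_cmod[of "f x"] by simp
      then show "exp \<bar>Re (f x)\<bar> \<le> 3" using exp_le by linarith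
    qed simp
    finally show ?case by (simp add: norm_mult)
  qed
  have u: "hcof (\<lambda>_. 3) * h \<in> UU i" by (intro UU_scale[OF assms] CF_const)
  have e: "hexp h - 1 = hcof (\<lambda>x. exp (f x) - 1)" "hcof (\<lambda>_. 3) * h = hcof (\<lambda>x. 3 * f x)"
    unfolding f hcof_1[symmetric] hcof_ops by (rule refl)+
  show ?thesis by (rule UU_le[OF u e ev])
qed

lemma E_UU:
  assumes "\<phi> z \<in> UU i" shows "\<phi> (E z - 1) \<in> UU i"
proof -
  have "A1 (re z) \<in> UU i"
  proof (rule log_UU[of A1 lnx 0, OF A1 _ lnx_UU re_RR re_UU[OF assms]])
    show "A1 b = lnx (g b 0) \<or> (\<exists>j. b = inverse (\<xi> j))" if "b \<in> \<B>" for b using A1_cases[OF that] by (rule disj_forward[OF _ _ exI])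
  qed
  moreover have "A2 (im iK z) \<in> UU i"
  proof (rule log_UU[of A2 atx 1, OF A2 _ atx_UU im_RR[OF iK_iK] im_UU[OF iK_iK assms]])
    show "A2 b = atx (g b 1) \<or> (\<exists>j. b = inverse (\<xi> j))" if "b \<in> \<B>" for b using A2_cases[OF that] by (rule disj_forward[OF _ _ exI])
  qed
  ultimately have "A1 (re z) + hi * A2 (im iK z) \<in> UU i" unfolding hi_def by (intro UU_add UU_scale CF_const)
  then show ?thesis unfolding \<phi>_diff \<phi>_E \<phi>_1 by (rule hexp_UU)
qed

text \<open>Reduced to continuity at 0 by the functional equation. The level \<open>k\<close> is
  also at or above one whose earlier levels carry \<open>E z0\<close>, so that multiplication by it
  preserves \<open>UU k\<close>.\<close>

lemma E_continuous_UU: "\<exists>k. \<forall>z. \<phi> (z - z0) \<in> UU k \<longrightarrow> \<phi> (E z - E z0) \<in> UU m"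
proof -
  obtain k where k: "{m, g (E z0) 0} \<subseteq> insert k (below k)" using finite_max_idx[of "{m, g (E z0) 0}"] by auto
  then have sub: "below m \<subseteq> below k" "below (g (E z0) 0) \<subseteq> below k"
    using below_subset[of m k] below_subset[of "g (E z0) 0" k] by auto
  have "\<phi> (E z - E z0) \<in> UU m" if z: "\<phi> (z - z0) \<in> UU k" for z
  proof -
    have "E z - E z0 = E z0 * (E (z - z0) - 1)" using E_add[OF E_E, of z0 "z - z0"] by (simp add: algebra_simps)
    then have "\<phi> (E z - E z0) = \<phi> (E z0) * \<phi> (E (z - z0) - 1)" by (simp only: \<phi>_mult)
    moreover have "\<phi> (E z0) \<in> CF (below k)" using \<phi>_CF[OF g_acl[of "E z0" 0]] CF_mono[OF sub(2)] by blast
    ultimately have "\<phi> (E z - E z0) \<in> UU k" using UU_scale[OF E_UU[OF z]] by simp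
    then show ?thesis using UU_mono[OF sub(1)] by blast
  qed
  then show ?thesis by blast
qed

end

section \<open>The exponential is free\<close>

context hyper_logarithm
begin

text \<open>The Cayley transform, sending real elements to elements of modulus 1; the counterpart in
  \<open>K\<close> of the exponential of \<open>hi * atx i\<close>.\<close>

definition cayley :: "'a \<Rightarrow> 'a" where "cayley x = (1 + iK * x) / (1 - iK * x)"

definition CC :: "'a set" where "CC = \<B> \<union> (\<lambda>b. iK * b) ` \<B>"

text \<open>The level of the transcendental that distinguishes \<open>c\<close> from
  \<open>E c\<close>: private to \<open>E c\<close> (tags 2 and 3) if \<open>c\<close> is built from
  the inverse of an infinitesimal, otherwise private to the real coordinate of \<open>c\<close>
  (tags 0 and 1).\<close>

definition ind :: "'a \<Rightarrow> 'a" where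
  "ind c = (if c \<in> \<B> then if c = inverse (\<xi> (g (E c) 2)) then g (E c) 2 else g c 0
    else if c = iK * inverse (\<xi> (g (E c) 3)) then g (E c) 3 else g (c / iK) 1)"

lemma E_basis:
  assumes "b \<in> \<B>"
  shows "E b = 1 + \<xi> (g b 0) \<or> b = inverse (\<xi> (g (E b) 2))"
    and "E (iK * b) = cayley (\<xi> (g b 1)) \<or> b = inverse (\<xi> (g (E (iK * b)) 3))"
proof -
  have R: "b \<in> RR" using assms B(1) by blast
  have inv: "inv \<phi> (\<phi> x) = x" for x by (rule inv_f_f) (rule injI, simp add: \<phi>_inj)
  have "\<phi> (E b) = \<phi> (1 + \<xi> (g b 0))" if "A1 b = lnx (g b 0)"
    unfolding E_real[OF R] that hexp_lnx \<phi>_add \<phi>_1 \<phi>_\<xi> ..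
  then show "E b = 1 + \<xi> (g b 0) \<or> b = inverse (\<xi> (g (E b) 2))"
    using A1_cases[OF assms] unfolding E_real[OF R, symmetric] inv \<phi>_inj by blast
  have "\<phi> (E (iK * b)) = \<phi> (cayley (\<xi> (g b 1)))" if "A2 b = atx (g b 1)"
    unfolding E_imag[OF R] that hexp_atx cayley_def \<phi>_divide \<phi>_add \<phi>_diff \<phi>_mult \<phi>_1 \<phi>_\<xi> \<phi>_iK ..
  then show "E (iK * b) = cayley (\<xi> (g b 1)) \<or> b = inverse (\<xi> (g (E (iK * b)) 3))"
    using A2_cases[OF assms] unfolding E_imag[OF R, symmetric] inv \<phi>_inj by blast
qed

lemma ind_cases:
  assumes "c \<in> CC"
  obtains "ind c = g c 0" "E c = 1 + \<xi> (ind c)"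
  | "ind c = g (c / iK) 1" "E c = cayley (\<xi> (ind c))"
  | "ind c = g (E c) 2" "c = inverse (\<xi> (ind c))"
  | "ind c = g (E c) 3" "c = iK * inverse (\<xi> (ind c))"
proof (cases "c \<in> \<B>")
  case True
  then show ?thesis using that(1,3) E_basis(1)[OF True] unfolding ind_def by (cases "c = inverse (\<xi> (g (E c) 2))") simp_all
next
  case False
  then obtain b where b: "b \<in> \<B>" "c = iK * b" using assms unfolding CC_def by blast
  then have "c / iK = b" using iK_nonzero by simp
  then show ?thesis using that(2,4) E_basis(2)[OF b(1)] False unfolding ind_def b(2)[symmetric]
    by (cases "c = iK * inverse (\<xi> (g (E c) 3))") (simp_all add: b(2))
qed

lemma iK_acl: "iK \<in> acl A"
  by (rule sqrt_minus_1_acl[OF iK_iK])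

lemma iK_\<xi>: "1 - iK * \<xi> i \<noteq> 0"
proof
  assume "1 - iK * \<xi> i = 0"
  then have 1: "iK * \<xi> i = 1" by simp
  have "\<xi> i = - (iK * iK) * \<xi> i" unfolding iK_iK by simp
  also have "\<dots> = - iK" using 1 by (simp add: mult.assoc)
  finally have "\<xi> i = - iK" .
  then have "\<xi> i \<in> acl (\<xi> ` {})" using subring_uminus[OF subring_acl iK_acl] by metis
  then show False using tbasis_notin[OF tb, of i "{}"] by simp
qed

text \<open>The Cayley transform is invertible over the field with \<open>iK\<close>, so it is as
  transcendental as \<open>\<xi> i\<close>.\<close>

lemma cayley_inverse: "\<xi> i * (iK * (cayley (\<xi> i) + 1)) = cayley (\<xi> i) - 1" "cayley (\<xi> i) + 1 \<noteq> 0"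
proof -
  have c: "cayley (\<xi> i) * (1 - iK * \<xi> i) = 1 + iK * \<xi> i" unfolding cayley_def using iK_\<xi> by simp
  then show "\<xi> i * (iK * (cayley (\<xi> i) + 1)) = cayley (\<xi> i) - 1" by (simp add: algebra_simps)
  show "cayley (\<xi> i) + 1 \<noteq> 0"
  proof
    assume "cayley (\<xi> i) + 1 = 0"
    then have "cayley (\<xi> i) = - 1" by (simp add: eq_neg_iff_add_eq_0)
    then show False using c by (simp add: algebra_simps)
  qed
qed

lemma im_\<B>: "Q.independent ((\<lambda>b. iK * b) ` \<B>)"
proof -
  interpret L: Vector_Spaces.linear "\<lambda>q x :: 'a. of_rat q * x" "\<lambda>q x :: 'a. of_rat q * x" "\<lambda>b. iK * b"
    by unfold_locales (simp_all add: algebra_simps)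
  have "inj_on (\<lambda>b. iK * b) (Q.span \<B>)" using iK_nonzero by (auto intro!: inj_onI)
  then show ?thesis using L.independent_injective_image[OF B(2)] by blast
qed

lemma CC_basis: "Q.independent CC" "Q.span CC = UNIV"
proof -
  interpret L: Vector_Spaces.linear "\<lambda>q x :: 'a. of_rat q * x" "\<lambda>q x :: 'a. of_rat q * x" "\<lambda>b. iK * b"
    by unfold_locales (simp_all add: algebra_simps)
  have sp: "Q.span ((\<lambda>b. iK * b) ` \<B>) = (\<lambda>b. iK * b) ` RR" unfolding L.span_image B(3) ..
  show "Q.independent CC" unfolding CC_def
  proof (rule independent_Un[OF B(2) im_\<B>])
    show "Q.span \<B> \<inter> Q.span ((\<lambda>b. iK * b) ` \<B>) \<subseteq> {0}" unfolding sp B(3)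
    proof
      fix x assume "x \<in> RR \<inter> (\<lambda>b. iK * b) ` RR"
      then obtain b where b: "x \<in> RR" "b \<in> RR" "x = iK * b" by blast
      have "re (0 + iK * b) = 0" "re (x + iK * 0) = x" using re_coord(1)[OF iK_iK] b(1,2) subring_0[OF subring_RR] by blast+
      then show "x \<in> {0}" using b(3) by simp
    qed
  qed
  have "z \<in> Q.span CC" for z
  proof -
    have "iK * im iK z \<in> Q.span ((\<lambda>b. iK * b) ` \<B>)" unfolding sp using im_RR[OF iK_iK] by blast
    then have "re z + iK * im iK z \<in> Q.span CC" unfolding CC_def Q.span_Un B(3) using re_RR[of z] by blast
    then show ?thesis unfolding re_im[OF iK_iK] .
  qed
  then show "Q.span CC = UNIV" by blast
qed

text \<open>The level determines the element and the tag given to \<open>g\<close>, and from these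
  together with the level \<open>c\<close> is recovered.\<close>

lemma ind_inj: "inj_on ind CC"
proof (rule inj_onI)
  fix c d assume cd: "c \<in> CC" "d \<in> CC" and e: "ind c = ind d"
  define dec where "dec k a i = (if k = 0 then a else if k = 1 then iK * a else if k = 2 then inverse (\<xi> i)
    else iK * inverse (\<xi> i))" for k :: nat and a i
  have dec: "\<exists>a k. ind x = g a k \<and> x = dec k a (ind x)" if "x \<in> CC" for x
    using that
  proof (cases rule: ind_cases)
    case 1 then show ?thesis by (intro exI[of _ x] exI[of _ 0]) (simp add: dec_def)
  next
    case 2 then show ?thesis by (intro exI[of _ "x / iK"] exI[of _ 1]) (simp add: dec_def iK_nonzero)
  next
    case 3 then show ?thesis by (intro exI[of _ "E x"] exI[of _ 2]) (simp add: dec_def)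
  next
    case 4 then show ?thesis by (intro exI[of _ "E x"] exI[of _ 3]) (simp add: dec_def)
  qed
  obtain a k where a: "ind c = g a k" "c = dec k a (ind c)" using dec[OF cd(1)] by (elim exE conjE)
  obtain b l where b: "ind d = g b l" "d = dec l b (ind d)" using dec[OF cd(2)] by (elim exE conjE)
  have "a = b \<and> k = l" using g_inj[of a k b l] a(1) b(1) e by simp
  then show "c = d" using a(2) b(2) e by simp
qed

text \<open>With tags 0 and 1 the value \<open>E c\<close> is new and \<open>c\<close> is old; with
  tags 2 and 3 the roles are exchanged. In each case \<open>\<xi> (ind c)\<close> is rational in the
  new element and \<open>iK\<close>.\<close>

lemma E_free: "free_exp E \<xi> CC ind"
proof (unfold_locales)
  fix c assume c: "c \<in> CC"
  let ?i = "ind c"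
  let ?L = "acl (\<xi> ` below ?i)" and ?L' = "acl (\<xi> ` insert ?i (below ?i))"
  have x: "\<xi> ?i \<in> ?L'" using acl_superset[of "\<xi> ` insert ?i (below ?i)"] by blast
  have nx: "\<xi> ?i \<notin> ?L" by (rule tbasis_notin[OF tb idx_irrefl])
  have gm: "a \<in> ?L" if "?i = g a k" for a k using g_acl[of a k] that by simp
  note add = subring_add[OF subring_acl] and mult = subring_mult[OF subring_acl] and diff = subring_diff[OF subring_acl]
    and one = subring_1[OF subring_acl] and inv = subfield_inverse[OF subfield_acl]
  show "\<exists>y y'. (y = c \<and> y' = E c \<or> y = E c \<and> y' = c) \<and> y \<in> ?L' \<and> y \<notin> ?L \<and> y' \<in> ?L"
    using c
  proof (cases rule: ind_cases)
    case 1
    have "E c \<in> ?L'" unfolding 1(2) by (intro add one x)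
    moreover have "E c \<notin> ?L"
    proof
      assume "E c \<in> ?L"
      then have "E c - 1 \<in> ?L" by (intro diff one)
      then show False using nx 1(2) by simp
    qed
    moreover have "c \<in> ?L" by (rule gm[OF 1(1)])
    ultimately show ?thesis by blast
  next
    case 2
    have "E c \<in> ?L'" unfolding 2(2) cayley_def divide_inverse by (intro add one x mult inv diff iK_acl)
    moreover have "E c \<notin> ?L"
    proof
      assume h: "E c \<in> ?L"
      have "iK * (E c + 1) \<noteq> 0" using cayley_inverse(2)[of ?i] iK_nonzero unfolding 2(2)[symmetric] by simp
      then have "\<xi> ?i = (E c - 1) * inverse (iK * (E c + 1))"
        using cayley_inverse(1)[of ?i] unfolding 2(2)[symmetric] by (metis divide_inverse nonzero_mult_div_cancel_right)
      moreover have "(E c - 1) * inverse (iK * (E c + 1)) \<in> ?L" by (intro add one mult inv diff iK_acl h)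
      ultimately show False using nx by simp
    qed
    moreover have "c \<in> ?L"
    proof -
      have "iK * (c / iK) \<in> ?L" by (intro mult iK_acl gm[OF 2(1)])
      then show ?thesis using iK_nonzero by simp
    qed
    ultimately show ?thesis by blast
  next
    case 3
    have "c \<in> ?L'" by (subst 3(2)) (intro inv x)
    moreover have "c \<notin> ?L"
    proof
      assume "c \<in> ?L"
      then have "inverse c \<in> ?L" by (rule inv)
      moreover have "inverse c = \<xi> ?i" by (subst 3(2)) simp
      ultimately show False using nx by simp
    qed
    moreover have "E c \<in> ?L" by (rule gm[OF 3(1)])
    ultimately show ?thesis by blast
  next
    case 4
    have "c \<in> ?L'" by (subst 4(2)) (intro mult iK_acl inv x)
    moreover have "c \<notin> ?L"
    proof
      assume "c \<in> ?L"
      then have "inverse c * iK \<in> ?L" by (intro mult iK_acl inv)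
      moreover have "inverse c * iK = \<xi> ?i" by (subst 4(2)) (simp add: iK_nonzero)
      ultimately show False using nx by simp
    qed
    moreover have "E c \<in> ?L" by (rule gm[OF 4(1)])
    ultimately show ?thesis by blast
  qed
qed (rule tb E_E CC_basis ind_inj)+

section \<open>Continuity\<close>

lemma fixed_field_\<sigma>: "fixed_field \<sigma> = RR"
  unfolding fixed_field_def RR_def ..

text \<open>Positivity read in the ultrapower as being equal to the modulus. Conversely, the square
  root of the modulus lies in the image, which is relatively algebraically closed, and it is
  real.\<close>

lemma rc_less_iff:
  assumes "x \<in> RR" "y \<in> RR"
  shows "rc_less \<sigma> x y \<longleftrightarrow> x \<noteq> y \<and> habs (\<phi> (y - x)) = \<phi> (y - x)"
proof
  assume "rc_less \<sigma> x y"
  then obtain r where r: "x \<noteq> y" "r \<in> RR" "y - x = r * r" unfolding rc_less_def fixed_field_\<sigma> by blast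
  obtain f where f: "\<phi> r = hcof f" by (rule hcof_surj)
  have "eventually (\<lambda>x. f x = of_real (Re (f x))) hyper" using r(2) unfolding RR_cj f cj_real .
  then have "habs (\<phi> (y - x)) = \<phi> (y - x)" unfolding r(3) \<phi>_mult f hcof_ops hcof_eq
  proof eventually_elim
    case (elim x)
    then obtain t where t: "f x = of_real t" by blast
    show ?case unfolding t of_real_mult[symmetric] norm_of_real by (simp add: abs_mult_self_eq)
  qed
  then show "x \<noteq> y \<and> habs (\<phi> (y - x)) = \<phi> (y - x)" using r(1) by blast
next
  assume h: "x \<noteq> y \<and> habs (\<phi> (y - x)) = \<phi> (y - x)"
  obtain f where f: "\<phi> (y - x) = hcof f" by (rule hcof_surj)
  let ?s = "hcof (\<lambda>x. of_real (sqrt (cmod (f x))))"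
  have "?s ^ 2 = habs (\<phi> (y - x))" unfolding f hcof_ops by (simp flip: of_real_power)
  then have s: "?s ^ 2 = \<phi> (y - x)" using h by simp
  then have "?s ^ 2 \<in> range \<phi>" by (metis rangeI)
  then have "?s \<in> range \<phi>" by (rule rclosed_power_root[OF rclosed_range zero_less_numeral])
  then obtain r where r: "?s = \<phi> r" by blast
  have "cj ?s = ?s" unfolding hcof_ops by simp
  then have "r \<in> RR" unfolding r RR_cj .
  moreover have "y - x = r * r" using s unfolding r power2_eq_square \<phi>_mult[symmetric] \<phi>_inj by simp
  ultimately show "rc_less \<sigma> x y" using h unfolding rc_less_def fixed_field_\<sigma> by blast
qed

lemma habs_pos:
  assumes d: "habs d = d" and e: "cj e = e" "hlt e d" shows "habs (d + e) = d + e \<and> d + e \<noteq> 0"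
proof -
  obtain f where f: "d = hcof f" by (rule hcof_surj)
  obtain h where h: "e = hcof h" by (rule hcof_surj)
  have "eventually (\<lambda>x. of_real (cmod (f x)) = f x) hyper" using d unfolding f hcof_ops hcof_eq .
  moreover have "eventually (\<lambda>x. h x = of_real (Re (h x))) hyper" using e(1) unfolding h cj_real .
  moreover have "eventually (\<lambda>x. cmod (h x) < cmod (f x)) hyper" using e(2) unfolding h f hlt_hcof .
  ultimately have "eventually (\<lambda>x. of_real (cmod (f x + h x)) = f x + h x \<and> f x + h x \<noteq> 0) hyper"
  proof eventually_elim
    case (elim x)
    obtain s t where st: "f x = of_real s" "h x = of_real t" "s = cmod (f x)" using elim by metis
    then have "\<bar>t\<bar> < s" using elim(3) by simp
    then have "s + t > 0" by linarith
    then show ?case unfolding st(1,2) of_real_add[symmetric] norm_of_real by (simp del: of_real_add)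
  qed
  then show ?thesis unfolding f h hcof_ops hcof_eq hcof_nonzero by (simp add: eventually_conj_iff)
qed

text \<open>Turns the two order inequalities that place \<open>e\<close> between \<open>- d\<close>
  and \<open>d\<close> into a comparison of moduli.\<close>

lemma habs_squeeze:
  assumes "habs (d + e) = d + e" "habs (d - e) = d - e" "d - e \<noteq> 0" "d + e \<noteq> 0" shows "hlt e d"
proof -
  obtain f where f: "d = hcof f" by (rule hcof_surj)
  obtain h where h: "e = hcof h" by (rule hcof_surj)
  have "eventually (\<lambda>x. of_real (cmod (f x + h x)) = f x + h x) hyper" "eventually (\<lambda>x. of_real (cmod (f x - h x)) = f x - h x) hyper"
    using assms(1,2) unfolding f h hcof_ops hcof_eq by blast+
  moreover have "eventually (\<lambda>x. f x - h x \<noteq> 0) hyper" "eventually (\<lambda>x. f x + h x \<noteq> 0) hyper"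
    using assms(3,4) unfolding f h hcof_ops hcof_nonzero .
  ultimately have "eventually (\<lambda>x. cmod (h x) < cmod (f x)) hyper"
  proof eventually_elim
    case (elim x)
    define s t where "s = cmod (f x + h x)" and "t = cmod (f x - h x)"
    have st: "s > 0" "t > 0" using elim(3,4) unfolding s_def t_def by simp_all
    have "2 * f x = (f x + h x) + (f x - h x)" "2 * h x = (f x + h x) - (f x - h x)" by simp_all
    then have "2 * f x = of_real (s + t)" "2 * h x = of_real (s - t)" using elim(1,2) unfolding s_def t_def by simp_all
    then have "cmod (2 * f x) = \<bar>s + t\<bar>" "cmod (2 * h x) = \<bar>s - t\<bar>" by (simp_all only: norm_of_real)
    then show ?case using st by (simp add: norm_mult)
  qed
  then show ?thesis unfolding f h hlt_hcof .
qed

lemma imag_unit: "(imag_unit :: 'a) * imag_unit = - 1"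
  unfolding imag_unit_def by (rule someI[of _ iK]) (rule iK_iK)

text \<open>\<open>m\<close> is taken at or above levels private to the four distances from the
  point to the edges, so that elements of \<open>UU m\<close> are smaller than all of these
  distances.\<close>

lemma box_neighbourhood:
  assumes "U \<in> sigma_boxes \<sigma>" "z0 \<in> U"
  shows "\<exists>m. \<forall>z. \<phi> (z - z0) \<in> UU m \<longrightarrow> z \<in> U"
proof -
  let ?s = "imag_unit :: 'a"
  obtain a1 a2 b1 b2 where U: "U = {a + ?s * b | a b. a \<in> RR \<and> b \<in> RR \<and>
        rc_less \<sigma> a1 a \<and> rc_less \<sigma> a a2 \<and> rc_less \<sigma> b1 b \<and> rc_less \<sigma> b b2}"
    and R: "a1 \<in> RR" "a2 \<in> RR" "b1 \<in> RR" "b2 \<in> RR"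
    using assms(1) unfolding sigma_boxes_def fixed_field_\<sigma> by blast
  obtain a b where ab: "z0 = a + ?s * b" "a \<in> RR" "b \<in> RR"
    and l: "rc_less \<sigma> a1 a" "rc_less \<sigma> a a2" "rc_less \<sigma> b1 b" "rc_less \<sigma> b b2"
    using assms(2) unfolding U by blast
  let ?D = "{a - a1, a2 - a, b - b1, b2 - b}"
  obtain m where m: "(\<lambda>d. g d 0) ` ?D \<subseteq> insert m (below m)" using finite_max_idx[of "(\<lambda>d. g d 0) ` ?D"] by auto
  have small: "hlt (\<phi> e) (\<phi> d)" if d: "d \<in> ?D" "d \<noteq> 0" and e: "\<phi> e \<in> UU m" for d e
  proof -
    have "g d 0 \<in> insert m (below m)" using m d(1) by blast
    then have "below (g d 0) \<subseteq> below m" using below_subset[of "g d 0" m] by auto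
    then have "\<phi> d \<in> CF (below m)" using \<phi>_CF[OF g_acl[of d 0]] CF_mono by blast
    moreover have "\<phi> d \<noteq> 0" using d(2) \<phi>_inj[of d 0] \<phi>_0 by simp
    ultimately show ?thesis using e unfolding UU_def by blast
  qed
  have upper: "rc_less \<sigma> x (y + e)" if x: "x \<in> RR" "y \<in> RR" "e \<in> RR" and xy: "rc_less \<sigma> x y" "y - x \<in> ?D" and e: "\<phi> e \<in> UU m"
    for x y e
  proof -
    have p: "x \<noteq> y" "habs (\<phi> (y - x)) = \<phi> (y - x)" using xy(1) rc_less_iff[OF x(1,2)] by blast+
    have "y - x \<noteq> 0" using p(1) by simp
    then have "hlt (\<phi> e) (\<phi> (y - x))" by (rule small[OF xy(2) _ e])
    then have "habs (\<phi> (y - x) + \<phi> e) = \<phi> (y - x) + \<phi> e \<and> \<phi> (y - x) + \<phi> e \<noteq> 0"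
      using habs_pos[OF p(2)] x(3) unfolding RR_cj by blast
    moreover have eq: "\<phi> (y - x) + \<phi> e = \<phi> (y + e - x)" unfolding \<phi>_add[symmetric] by (simp add: algebra_simps)
    ultimately have h: "habs (\<phi> (y + e - x)) = \<phi> (y + e - x)" "\<phi> (y + e - x) \<noteq> 0" by simp_all
    have "x \<noteq> y + e" using h(2) \<phi>_0 by auto
    then show ?thesis using h(1) rc_less_iff[OF x(1) subring_add[OF subring_RR x(2,3)]] by blast
  qed
  have lower: "rc_less \<sigma> (x + e) y" if x: "x \<in> RR" "y \<in> RR" "e \<in> RR" and xy: "rc_less \<sigma> x y" "y - x \<in> ?D" and e: "\<phi> e \<in> UU m"
    for x y e
  proof -
    have n: "- e \<in> RR" "\<phi> (- e) \<in> UU m" using subring_uminus[OF subring_RR x(3)] UU_diff[OF UU_0 e] by (simp_all add: \<phi>_uminus)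
    have "rc_less \<sigma> x (y + - e)" by (rule upper[OF x(1,2) n(1) xy n(2)])
    moreover have "y + - e - x = y - (x + e)" "x \<noteq> y + - e \<longleftrightarrow> x + e \<noteq> y" by (auto simp: algebra_simps)
    ultimately show ?thesis unfolding rc_less_def by metis
  qed
  have "z \<in> U" if z: "\<phi> (z - z0) \<in> UU m" for z
  proof -
    let ?a = "re (z - z0)" and ?b = "im ?s (z - z0)"
    have u: "\<phi> ?a \<in> UU m" "\<phi> ?b \<in> UU m" using re_UU[OF z] im_UU[OF imag_unit z] .
    have RR: "?a \<in> RR" "?b \<in> RR" by (rule re_RR, rule im_RR[OF imag_unit])
    have "z = (a + ?a) + ?s * (b + ?b)" using re_im[OF imag_unit, of "z - z0"] unfolding ab(1) by (simp add: algebra_simps)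
    moreover have "a + ?a \<in> RR" "b + ?b \<in> RR" using ab(2,3) RR by (auto intro: subring_add[OF subring_RR])
    moreover have "rc_less \<sigma> a1 (a + ?a)" "rc_less \<sigma> b1 (b + ?b)"
      using upper[OF R(1) ab(2) RR(1) l(1) _ u(1)] upper[OF R(3) ab(3) RR(2) l(3) _ u(2)] by simp_all
    moreover have "rc_less \<sigma> (a + ?a) a2" "rc_less \<sigma> (b + ?b) b2"
      using lower[OF ab(2) R(2) RR(1) l(2) _ u(1)] lower[OF ab(3) R(4) RR(2) l(4) _ u(2)] by simp_all
    ultimately show ?thesis unfolding U by blast
  qed
  then show ?thesis by blast
qed

text \<open>The box centred at \<open>z0\<close> that extends by \<open>\<xi> m\<close> in each
  direction works: anything bounded by \<open>hx m\<close> lies in \<open>UU m\<close>.\<close>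

lemma neighbourhood_box: "\<exists>U\<in>sigma_boxes \<sigma>. z0 \<in> U \<and> (\<forall>z\<in>U. \<phi> (z - z0) \<in> UU m)"
proof -
  let ?s = "imag_unit :: 'a" and ?a = "re z0" and ?b = "im imag_unit z0" and ?x = "\<xi> m"
  let ?U = "{a + ?s * b | a b. a \<in> RR \<and> b \<in> RR \<and> rc_less \<sigma> (?a - ?x) a \<and> rc_less \<sigma> a (?a + ?x) \<and>
    rc_less \<sigma> (?b - ?x) b \<and> rc_less \<sigma> b (?b + ?x)}"
  have RR: "?a \<in> RR" "?b \<in> RR" "?x \<in> RR" using re_RR im_RR[OF imag_unit] \<sigma>_\<xi> by (auto simp: RR_def)
  have hx: "habs (hx m) = hx m" unfolding hx_def hcof_ops hcof_eq using hx_pos[of m] by eventually_elim simp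
  have x: "rc_less \<sigma> (c - ?x) c" "rc_less \<sigma> c (c + ?x)" if "c \<in> RR" for c
    using that RR(3) hx hx_nonzero[of m] \<phi>_0
    by (auto simp: rc_less_iff subring_add[OF subring_RR] subring_diff[OF subring_RR] \<phi>_\<xi> simp flip: \<phi>_\<xi>)
  have "?U \<in> sigma_boxes \<sigma>" unfolding sigma_boxes_def fixed_field_\<sigma>
    using RR by (blast intro: subring_add[OF subring_RR] subring_diff[OF subring_RR])
  moreover have "z0 \<in> ?U"
  proof -
    have "z0 = ?a + ?s * ?b" by (rule re_im[OF imag_unit, symmetric])
    then show ?thesis using RR x[OF RR(1)] x[OF RR(2)] by blast
  qed
  moreover have "\<forall>z\<in>?U. \<phi> (z - z0) \<in> UU m"
  proof
    fix z assume z: "z \<in> ?U"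
    obtain a b where ab: "z = a + ?s * b" "a \<in> RR" "b \<in> RR" "rc_less \<sigma> (?a - ?x) a" "rc_less \<sigma> a (?a + ?x)"
      "rc_less \<sigma> (?b - ?x) b" "rc_less \<sigma> b (?b + ?x)" using z by blast
    have squeeze: "\<phi> (d - c) \<in> UU m" if c: "c \<in> RR" "d \<in> RR" "rc_less \<sigma> (c - ?x) d" "rc_less \<sigma> d (c + ?x)" for c d
    proof -
      have i: "rc_less \<sigma> (c - ?x) d \<longleftrightarrow> c - ?x \<noteq> d \<and> habs (\<phi> (d - (c - ?x))) = \<phi> (d - (c - ?x))"
        "rc_less \<sigma> d (c + ?x) \<longleftrightarrow> d \<noteq> c + ?x \<and> habs (\<phi> (c + ?x - d)) = \<phi> (c + ?x - d)"
        using c(1,2) RR(3) by (intro rc_less_iff; auto intro: subring_add[OF subring_RR] subring_diff[OF subring_RR])+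
      have e: "\<phi> (d - (c - ?x)) = hx m + \<phi> (d - c)" "\<phi> (c + ?x - d) = hx m - \<phi> (d - c)"
        by (simp_all add: \<phi>_add \<phi>_diff \<phi>_\<xi>)
      have "hx m + \<phi> (d - c) \<noteq> 0" "hx m - \<phi> (d - c) \<noteq> 0"
        unfolding e[symmetric] using c(3,4) i \<phi>_inj[of _ 0] \<phi>_0 by auto
      then have "hlt (\<phi> (d - c)) (hx m)" using c(3,4) unfolding i e by (intro habs_squeeze) auto
      then show ?thesis by (rule UU_hlt[OF _ hx_UU])
    qed
    have "?s \<in> acl (\<xi> ` {})" by (rule sqrt_minus_1_acl[OF imag_unit])
    then have "\<phi> ?s \<in> CF (below m)" by (rule \<phi>_algebraic_CF)
    then have "\<phi> (a - ?a) + \<phi> ?s * \<phi> (b - ?b) \<in> UU m"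
      using squeeze[OF RR(1) ab(2,4,5)] squeeze[OF RR(2) ab(3,6,7)] by (intro UU_add UU_scale)
    moreover have "z - z0 = (a - ?a) + ?s * (b - ?b)"
      using re_im[OF imag_unit, of z0] unfolding ab(1) by (simp add: algebra_simps)
    ultimately show "\<phi> (z - z0) \<in> UU m" by (simp only: \<phi>_add \<phi>_mult)
  qed
  ultimately show ?thesis by (intro bexI[of _ ?U] conjI)
qed

text \<open>Boxes and the subgroups \<open>UU\<close> refine each other, so continuity can be
  checked on the latter.\<close>

lemma E_continuous: "continuous_map (sigma_topology \<sigma>) (subtopology (sigma_topology \<sigma>) (- {0})) E"
proof -
  let ?T = "topology_generated_by (sigma_boxes \<sigma>)"
  have "openin ?T (E -` U \<inter> topspace ?T)" if U: "U \<in> sigma_boxes \<sigma>" for U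
  proof (subst openin_subopen, intro ballI)
    fix z0 assume "z0 \<in> E -` U \<inter> topspace ?T"
    then have "E z0 \<in> U" by simp
    obtain m where m: "\<forall>w. \<phi> (w - E z0) \<in> UU m \<longrightarrow> w \<in> U" using box_neighbourhood[OF U \<open>E z0 \<in> U\<close>] by (elim exE)
    obtain k where k: "\<forall>z. \<phi> (z - z0) \<in> UU k \<longrightarrow> \<phi> (E z - E z0) \<in> UU m" using E_continuous_UU[of z0 m] by (elim exE)
    obtain V where V: "V \<in> sigma_boxes \<sigma>" "z0 \<in> V" "\<forall>z\<in>V. \<phi> (z - z0) \<in> UU k" using neighbourhood_box[of z0 k] by blast
    have "openin ?T V" by (rule topology_generated_by_Basis[OF V(1)])
    moreover have "V \<subseteq> E -` U \<inter> topspace ?T"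
    proof
      fix z assume z: "z \<in> V"
      have "E z \<in> U" using m k V(3) z by simp
      moreover have "z \<in> topspace ?T" using V(1) z unfolding topology_generated_by_topspace by blast
      ultimately show "z \<in> E -` U \<inter> topspace ?T" by simp
    qed
    ultimately show "\<exists>T. openin ?T T \<and> z0 \<in> T \<and> T \<subseteq> E -` U \<inter> topspace ?T" using V(2) by blast
  qed
  moreover have "w \<in> \<Union> (sigma_boxes \<sigma>)" for w using neighbourhood_box[of w undefined] by blast
  ultimately have "continuous_map ?T ?T E" unfolding continuous_on_generated_topo_iff by blast
  moreover have "E z \<noteq> 0" for z by (rule E_nonzero[OF E_E])
  ultimately show ?thesis unfolding sigma_topology_def continuous_map_in_subtopology by blast
qed

end

section \<open>Existence\<close>

context hyper_embedding
begin

lemma hexp_range_subspace: "Q.subspace {h. cj h = h \<and> hexp h \<in> range \<phi>}"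
proof (rule Q.subspaceI)
  show "0 \<in> {h. cj h = h \<and> hexp h \<in> range \<phi>}"
    using subring_1[OF rclosed_subring[OF rclosed_range]] cj_ops(2)[of 0 0] by (simp add: E_zero[OF ax_E_hexp])
  fix x y q assume x: "x \<in> {h. cj h = h \<and> hexp h \<in> range \<phi>}"
  show "of_rat q * x \<in> {h. cj h = h \<and> hexp h \<in> range \<phi>}"
    using x E_of_rat_mem[OF ax_E_hexp rclosed_range, of x q] by (simp add: cj_ops cj_of_rat)
  assume "y \<in> {h. cj h = h \<and> hexp h \<in> range \<phi>}"
  then show "x + y \<in> {h. cj h = h \<and> hexp h \<in> range \<phi>}"
    using x by (simp add: cj_ops E_add[OF ax_E_hexp] range_mult)
qed

lemma hexp_hi_range_subspace: "Q.subspace {h. cj h = h \<and> hfin h \<and> hexp (hi * h) \<in> range \<phi>}"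
proof (rule Q.subspaceI)
  have "hfin (0 :: 'a hc)" using hfin_scale[OF hfin_tpi, of 0] by simp
  then show "0 \<in> {h. cj h = h \<and> hfin h \<and> hexp (hi * h) \<in> range \<phi>}"
    using subring_1[OF rclosed_subring[OF rclosed_range]] cj_ops(2)[of 0 0] by (simp add: E_zero[OF ax_E_hexp])
  fix x y q assume x: "x \<in> {h. cj h = h \<and> hfin h \<and> hexp (hi * h) \<in> range \<phi>}"
  have "hexp (of_rat q * (hi * x)) \<in> range \<phi>" using x E_of_rat_mem[OF ax_E_hexp rclosed_range, of "hi * x" q] by simp
  then show "of_rat q * x \<in> {h. cj h = h \<and> hfin h \<and> hexp (hi * h) \<in> range \<phi>}"
    using x by (simp add: cj_ops cj_of_rat hfin_scale mult.left_commute)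
  assume "y \<in> {h. cj h = h \<and> hfin h \<and> hexp (hi * h) \<in> range \<phi>}"
  then show "x + y \<in> {h. cj h = h \<and> hfin h \<and> hexp (hi * h) \<in> range \<phi>}"
    using x by (simp add: cj_ops E_add[OF ax_E_hexp] range_mult hfin_add distrib_left)
qed

text \<open>Only a basis containing all \<open>lnx i\<close> can serve as target for the injection
  that sends basis elements to logarithms at prescribed levels.\<close>

lemma real_logarithm_basis:
  "\<exists>H. range lnx \<subseteq> H \<and> Q.independent H \<and> Q.span H = {h. cj h = h \<and> hexp h \<in> range \<phi>}"
proof -
  let ?L = "{h. cj h = h \<and> hexp h \<in> range \<phi>}"
  have "lnx i \<in> ?L" for i
    using cj_lnx[of i] rangeI[of \<phi> "1 + \<xi> i"] by (simp add: hexp_lnx \<phi>_add \<phi>_1 \<phi>_\<xi>)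
  then have s: "range lnx \<subseteq> ?L" by blast
  have "Q.independent (range (lnx :: 'a \<Rightarrow> 'a hc))"
    by (rule conjunct2[OF infinitesimals_independent[OF lnx_CF lnx_UU lnx_nonzero]])
  then obtain H where H: "range lnx \<subseteq> H" "H \<subseteq> ?L" "Q.independent H" "?L \<subseteq> Q.span H"
    by (rule Q.maximal_independent_subset_extend[OF s])
  moreover have "Q.span H \<subseteq> ?L" by (rule Q.span_minimal[OF H(2) hexp_range_subspace])
  ultimately show ?thesis by blast
qed

text \<open>Besides the \<open>atx i\<close>, the period \<open>tpi\<close> is made a basis element,
  so that distinct basis elements have distinct exponentials.\<close>

lemma imaginary_logarithm_basis:
  "\<exists>H. range atx \<subseteq> H \<and> tpi \<in> H \<and> Q.independent H \<and> Q.span H = {h. cj h = h \<and> hfin h \<and> hexp (hi * h) \<in> range \<phi>}"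
proof -
  let ?L = "{h. cj h = h \<and> hfin h \<and> hexp (hi * h) \<in> range \<phi>}"
  have "atx i \<in> ?L" for i
  proof -
    have "hfin (atx i)" unfolding hfin_def using atx_UU[of i] subring_1[OF subfield_subring[OF CF_subfield]]
      unfolding UU_def by (intro exI[of _ 1]) force
    moreover have "hexp (hi * atx i) = \<phi> ((1 + iK * \<xi> i) / (1 - iK * \<xi> i))"
      unfolding hexp_atx \<phi>_divide \<phi>_add \<phi>_diff \<phi>_mult \<phi>_1 \<phi>_\<xi> \<phi>_iK ..
    ultimately show ?thesis using cj_atx by simp
  qed
  moreover have "tpi \<in> ?L" using rangeI[of \<phi> 1] by (simp add: cj_tpi hfin_tpi hexp_tpi \<phi>_1)
  ultimately have s: "insert tpi (range atx) \<subseteq> ?L" by blast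
  have "Q.independent (range (atx :: 'a \<Rightarrow> 'a hc))"
    by (rule conjunct2[OF infinitesimals_independent[OF atx_CF atx_UU atx_nonzero]])
  then have "Q.independent (insert tpi (range (atx :: 'a \<Rightarrow> 'a hc)))"
    by (rule Q.independent_insertI[OF infinitesimals_tpi[OF atx_UU]])
  then obtain H where H: "insert tpi (range atx) \<subseteq> H" "H \<subseteq> ?L" "Q.independent H" "?L \<subseteq> Q.span H"
    by (rule Q.maximal_independent_subset_extend[OF s])
  moreover have "Q.span H \<subseteq> ?L" by (rule Q.span_minimal[OF H(2) hexp_hi_range_subspace])
  ultimately show ?thesis by blast
qed

text \<open>Two arguments with the same exponential differ by an integer multiple of
  \<open>tpi\<close>, which would be a linear relation among at most three members of the
  basis.\<close>

lemma hexp_hi_inj: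
  assumes H: "tpi \<in> (H :: 'a hc set)" "Q.independent H" "\<And>h. h \<in> H \<Longrightarrow> cj h = h \<and> hfin h"
    and a: "a \<in> H" and b: "b \<in> H" and eq: "hexp (hi * a) = hexp (hi * b)"
  shows "a = b"
proof (rule ccontr)
  assume ne: "a \<noteq> b"
  have neg: "of_rat (- 1) * b = - b" by simp
  have "cj (a - b) = a - b" using H(3) a b by (simp add: cj_ops)
  moreover have "hfin (a + of_rat (- 1) * b)" using H(3) a b by (intro hfin_add hfin_scale) auto
  then have "hfin (a - b)" unfolding neg by simp
  moreover have "hexp (hi * (a - b)) = hexp (hi * a) * inverse (hexp (hi * b))"
    unfolding E_uminus[OF ax_E_hexp, symmetric] E_add[OF ax_E_hexp, symmetric] by (simp add: algebra_simps)
  then have "hexp (hi * (a - b)) = 1" unfolding eq right_inverse[OF E_nonzero[OF ax_E_hexp]] .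
  ultimately obtain k :: int where k: "a - b = of_int k * tpi" using hexp_kernel by blast
  have sp: "of_int j * tpi \<in> Q.span S" if "tpi \<in> S" for j :: int and S :: "'a hc set"
    using Q.span_scale[OF Q.span_base[OF that], of "of_int j"] by simp
  have dep: False if "x \<in> H" "x \<in> Q.span (H - {x})" for x using that H(2) unfolding Q.dependent_def by blast
  show False
  proof (cases "a = tpi")
    case True
    have "b = of_int (1 - k) * tpi" using k unfolding True by (simp add: algebra_simps)
    moreover have "of_int (1 - k) * tpi \<in> Q.span (H - {b})" using H(1) ne True by (intro sp) simp
    ultimately show False using dep[OF b] by simp
  next
    case False
    have "a = b + of_int k * tpi" using k by (simp add: algebra_simps)
    moreover have "b + of_int k * tpi \<in> Q.span (H - {a})"
      using H(1) b ne False by (intro Q.span_add sp Q.span_base) auto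
    ultimately show False using dep[OF a] by simp
  qed
qed

text \<open>Two applications of the Cantor-Bernstein choice, between the adapted basis of
  \<open>R\<close> and the bases of the logarithms and of the arguments; linear extension then gives
  \<open>A1\<close> and \<open>A2\<close>.\<close>

lemma hyper_logarithm_exists: "\<exists>\<B> g A1 A2. hyper_logarithm \<xi> \<phi> \<B> g A1 A2"
proof -
  obtain \<B> where B: "\<B> \<subseteq> RR" "Q.independent \<B>" "Q.span \<B> = RR" "\<forall>i. inverse (\<xi> i) \<in> \<B>"
    "\<forall>y\<in>RR. \<forall>i. \<phi> y \<in> UU i \<longrightarrow> y \<in> Q.span {b \<in> \<B>. \<phi> b \<in> UU i}"
    using orthogonal_basis by (elim exE conjE)
  obtain g :: "'a \<Rightarrow> nat \<Rightarrow> 'a" where g: "\<forall>a i b j. g a i = g b j \<longrightarrow> a = b \<and> i = j" "\<forall>a i. a \<in> acl (\<xi> ` below (g a i))"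
    using tbasis_index_function[OF tb] by (elim exE conjE)
  have gi: "g a i = g b i \<longleftrightarrow> a = b" for a b i using g(1) by blast
  have \<xi>i: "inverse (\<xi> i) = inverse (\<xi> j) \<longleftrightarrow> i = j" for i j using tb unfolding tbasis_def by (auto dest: injD)
  have invi: "inv \<phi> a = inv \<phi> b \<Longrightarrow> a = b" if ab: "a \<in> range \<phi>" "b \<in> range \<phi>" for a b using \<phi>_inv[OF ab(1)] \<phi>_inv[OF ab(2)] by metis
  obtain H1 where H1: "range lnx \<subseteq> H1" "Q.independent H1" "Q.span H1 = {h. cj h = h \<and> hexp h \<in> range \<phi>}"
    using real_logarithm_basis by (elim exE conjE)
  have H1': "cj h = h \<and> hexp h \<in> range \<phi>" if "h \<in> H1" for h using Q.span_base[OF that] unfolding H1(3) by simp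
  obtain H2 where H2: "range atx \<subseteq> H2" "tpi \<in> H2" "Q.independent H2"
    "Q.span H2 = {h. cj h = h \<and> hfin h \<and> hexp (hi * h) \<in> range \<phi>}"
    using imaginary_logarithm_basis by (elim exE conjE)
  have H2': "cj h = h \<and> hfin h \<and> hexp (hi * h) \<in> range \<phi>" if "h \<in> H2" for h using Q.span_base[OF that] unfolding H2(4) by simp
  have lnx_inj: "inj (lnx :: 'a \<Rightarrow> 'a hc)"
    by (rule conjunct1[OF infinitesimals_independent[OF lnx_CF lnx_UU lnx_nonzero]])
  have atx_inj: "inj (atx :: 'a \<Rightarrow> 'a hc)"
    by (rule conjunct1[OF infinitesimals_independent[OF atx_CF atx_UU atx_nonzero]])
  \<comment> \<open>One injection sends \<open>b\<close> to the logarithm at a level private to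
    \<open>b\<close>; the other sends a logarithm to the inverse infinitesimal at a level private to
    its exponential. The latter is injective because the exponential is injective on real
    elements.\<close>
  have "\<exists>\<theta>. bij_betw \<theta> \<B> H1 \<and> (\<forall>b\<in>\<B>. \<theta> b = lnx (g b 0) \<or> inverse (\<xi> (g (inv \<phi> (hexp (\<theta> b))) 2)) = b)"
  proof (rule cantor_bernstein_choice)
    show "inj_on (\<lambda>b. lnx (g b 0)) \<B>" using lnx_inj gi by (auto intro!: inj_onI dest: injD)
    show "(\<lambda>b. lnx (g b 0)) ` \<B> \<subseteq> H1" using H1(1) by blast
    show "inj_on (\<lambda>h. inverse (\<xi> (g (inv \<phi> (hexp h)) 2))) H1"
    proof (rule inj_onI)
      fix h h' assume h: "h \<in> H1" "h' \<in> H1" "inverse (\<xi> (g (inv \<phi> (hexp h)) 2)) = inverse (\<xi> (g (inv \<phi> (hexp h')) 2))"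
      then have "hexp h = hexp h'" using invi[of "hexp h" "hexp h'"] H1' unfolding \<xi>i gi by blast
      then show "h = h'" using hexp_inj_real[of h h'] H1'[OF h(1)] H1'[OF h(2)] by blast
    qed
    show "(\<lambda>h. inverse (\<xi> (g (inv \<phi> (hexp h)) 2))) ` H1 \<subseteq> \<B>" using B(4) by blast
  qed
  then obtain \<theta>1 where \<theta>1: "bij_betw \<theta>1 \<B> H1"
    "\<forall>b\<in>\<B>. \<theta>1 b = lnx (g b 0) \<or> inverse (\<xi> (g (inv \<phi> (hexp (\<theta>1 b))) 2)) = b" by (elim exE conjE)
  \<comment> \<open>The same for arguments, with the tags 1 and 3. The exponential is periodic here,
    and only the presence of \<open>tpi\<close> in the basis makes the second map injective.\<close>
  have "\<exists>\<theta>. bij_betw \<theta> \<B> H2 \<and> (\<forall>b\<in>\<B>. \<theta> b = atx (g b 1) \<or> inverse (\<xi> (g (inv \<phi> (hexp (hi * \<theta> b))) 3)) = b)"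
  proof (rule cantor_bernstein_choice)
    show "inj_on (\<lambda>b. atx (g b 1)) \<B>" using atx_inj gi by (auto intro!: inj_onI dest: injD)
    show "(\<lambda>b. atx (g b 1)) ` \<B> \<subseteq> H2" using H2(1) by blast
    show "inj_on (\<lambda>h. inverse (\<xi> (g (inv \<phi> (hexp (hi * h))) 3))) H2"
    proof (rule inj_onI)
      fix h h' assume h: "h \<in> H2" "h' \<in> H2"
        "inverse (\<xi> (g (inv \<phi> (hexp (hi * h))) 3)) = inverse (\<xi> (g (inv \<phi> (hexp (hi * h'))) 3))"
      then have e: "hexp (hi * h) = hexp (hi * h')" using invi[of "hexp (hi * h)" "hexp (hi * h')"] H2' unfolding \<xi>i gi by blast
      show "h = h'" by (rule hexp_hi_inj[OF H2(2,3) _ h(1,2) e]) (use H2' in blast)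
    qed
    show "(\<lambda>h. inverse (\<xi> (g (inv \<phi> (hexp (hi * h))) 3))) ` H2 \<subseteq> \<B>" using B(4) by blast
  qed
  then obtain \<theta>2 where \<theta>2: "bij_betw \<theta>2 \<B> H2"
    "\<forall>b\<in>\<B>. \<theta>2 b = atx (g b 1) \<or> inverse (\<xi> (g (inv \<phi> (hexp (hi * \<theta>2 b))) 3)) = b" by (elim exE conjE)
  obtain A1 where A1: "\<forall>x y. A1 (x + y) = A1 x + A1 y" "\<forall>q x. A1 (of_rat q * x) = of_rat q * A1 x"
    "\<forall>b\<in>\<B>. A1 b = \<theta>1 b" "bij_betw A1 (Q.span \<B>) (Q.span H1)"
    using basis_bij_extend[OF B(2) H1(2) \<theta>1(1)] by (elim exE conjE)
  obtain A2 where A2: "\<forall>x y. A2 (x + y) = A2 x + A2 y" "\<forall>q x. A2 (of_rat q * x) = of_rat q * A2 x"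
    "\<forall>b\<in>\<B>. A2 b = \<theta>2 b" "bij_betw A2 (Q.span \<B>) (Q.span H2)"
    using basis_bij_extend[OF B(2) H2(3) \<theta>2(1)] by (elim exE conjE)
  have "hyper_logarithm \<xi> \<phi> \<B> g A1 A2"
  proof unfold_locales
    show "\<B> \<subseteq> RR" "Q.independent \<B>" "Q.span \<B> = RR" by (rule B)+
    show "y \<in> Q.span {b \<in> \<B>. \<phi> b \<in> UU i}" if "y \<in> RR" "\<phi> y \<in> UU i" for y i using B(5) that by simp
    show "a = b \<and> i = j" if "g a i = g b j" for a b i j using g(1) that by simp
    show "a \<in> acl (\<xi> ` below (g a i))" for a i using g(2) by simp
    show "A1 (x + y) = A1 x + A1 y" "A1 (of_rat q * x) = of_rat q * A1 x" for x y q using A1(1,2) by simp_all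
    show "bij_betw A1 RR {h. cj h = h \<and> hexp h \<in> range \<phi>}" using A1(4) unfolding B(3) H1(3) .
    show "A1 b = lnx (g b 0) \<or> b = inverse (\<xi> (g (inv \<phi> (hexp (A1 b))) 2))" if "b \<in> \<B>" for b
      using bspec[OF \<theta>1(2) that] bspec[OF A1(3) that] by (elim disjE) simp_all
    show "A2 (x + y) = A2 x + A2 y" "A2 (of_rat q * x) = of_rat q * A2 x" for x y q using A2(1,2) by simp_all
    show "bij_betw A2 RR {h. cj h = h \<and> hfin h \<and> hexp (hi * h) \<in> range \<phi>}" using A2(4) unfolding B(3) H2(4) .
    show "A2 b = atx (g b 1) \<or> b = inverse (\<xi> (g (inv \<phi> (hexp (hi * A2 b))) 3))" if "b \<in> \<B>" for b
      using bspec[OF \<theta>2(2) that] bspec[OF A2(3) that] by (elim disjE) simp_all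
  qed
  then show ?thesis by blast
qed

end

theorem theorem12p7:
  assumes "alg_closed_field TYPE('a::field_char_0)"
    and "saturated TYPE('a)"
  shows "\<exists>(E::'a \<Rightarrow> 'a) \<sigma>. (\<forall>x. E x \<noteq> 0) \<and> field_aut \<sigma> \<and> \<sigma> \<circ> \<sigma> = id \<and> \<sigma> \<noteq> id
    \<and> \<sigma> \<circ> E = E \<circ> \<sigma>
    \<and> ax_E E \<and> ax_LOG E \<and> ax_STD E \<and> ax_SP E \<and> ax_CCP E
    \<and> continuous_map (sigma_topology \<sigma>) (subtopology (sigma_topology \<sigma>) (- {0})) E"
proof -
  obtain \<xi> :: "'a \<Rightarrow> 'a" where tb: "tbasis \<xi>" using tbasis_exists[OF assms(2)] by (elim exE)
  obtain \<phi> where "hyper_embedding \<xi> \<phi>" using hyper_embedding_exists[OF assms(1) tb] by (elim exE)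
  then interpret hyper_embedding \<xi> \<phi> .
  obtain \<B> g A1 A2 where "hyper_logarithm \<xi> \<phi> \<B> g A1 A2" using hyper_logarithm_exists by (elim exE)
  then interpret hyper_logarithm \<xi> \<phi> \<B> g A1 A2 .
  interpret free_exp E \<xi> CC ind by (rule E_free)
  have ss: "\<sigma> \<circ> \<sigma> = id" by (rule ext) (simp add: \<sigma>_\<sigma>)
  then have "field_aut \<sigma>" unfolding field_aut_def using \<sigma>_add \<sigma>_mult \<sigma>_1 o_bij[OF ss ss] by simp
  moreover have "\<sigma> \<noteq> id"
  proof
    assume "\<sigma> = id"
    then have "iK + iK = 0" using \<sigma>_iK add.right_inverse[of iK] by simp
    moreover have "of_rat (1 / 2) * (iK + iK) = iK" unfolding distrib_left by (rule half)
    ultimately show False using iK_nonzero by simp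
  qed
  moreover have "\<sigma> \<circ> E = E \<circ> \<sigma>" by (rule ext) (simp add: E_\<sigma>)
  moreover have "\<forall>x. E x \<noteq> 0" using E_nonzero[OF E_E] by blast
  ultimately show ?thesis using ss E_E E_LOG E_STD free_SP free_CCP[OF assms(1) E_STD] E_continuous
    by (intro exI[of _ E] exI[of _ \<sigma>] conjI)
qed

end
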